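(* Let $\nu>0$, let $D$ be the unit disk in the plane and let $C=D\times(0,1)$. Let $u_0\in H(C)$ be a helical vector field with step equal to $1$. Let $u\in C^0([0,\infty);H_w(C))\cap L^2((0,\infty);V(C))$ be the unique weak solution of the helical incompressible Navier--Stokes equations with viscosity $\nu$, zero forcing and initial data $u_0$. Let $v_0\in H(C)$ and let $v\in C^0([0,\infty);H_w(C))\cap L^2((0,\infty);V(C))$ be a Leray--Hopf weak solution of the three-dimensional incompressible Navier--Stokes equations in $C$ with viscosity $\nu$, zero forcing and initial data $v_0$. Then $$\|v-u\|_{L^2(C)}^2(t)\le\|v_0-u_0\|_{L^2(C)}^2\,\exp\left(\frac{27}{64\nu^4}\|u_0\|_{L^2(C)}^4\right)\quad\text{for all } t\ge0.$$
   Context: The Navier--Stokes equations with viscosity $\nu>0$ and zero forcing are $\partial_t u+(u\cdot\nabla)u=-\nabla p+\nu\Delta u$, $\operatorname{div}u=0$. Spaces on the periodic cylinder $C=D\times(0,1)$: let $\mathcal{D}(C)$ be the space of $C^\infty$ $\mathbb{R}^3$-valued fields that are $1$-periodic in the vertical variable $x_3$ and compactly supported in $D$ in the horizontal variables $(x_1,x_2)$. $H(C)$ and $V(C)$ are the closures of the divergence-free fields in $\mathcal{D}(C)$ in the $L^2(C)$ and $H^1(C)$ norms, respectively. $H_w(C)$ is $H(C)$ endowed with the weak $L^2$ topology. Helical fields: for $\theta\in\mathbb{R}$ let $R_\theta=\begin{pmatrix}\cos\theta&\sin\theta&0\\-\sin\theta&\cos\theta&0\\0&0&1\end{pmatrix}$.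 A vector field $U$ is helical with step $\sigma\in\mathbb{R}\setminus\{0\}$ if $U\left(R_\theta x+(0,0,\tfrac{\sigma}{2\pi}\theta)^{T}\right)=R_\theta U(x)$ for all $\theta\in\mathbb{R}$ and all $x$ (fields on $C$ being extended periodically in $x_3$ with period $1$). Leray--Hopf weak solution on $\Omega=C$ with initial data $v_0\in H(\Omega)$ and zero forcing: a field $v\in C^0([0,\infty);H_w(\Omega))\cap L^\infty((0,\infty);H(\Omega))\cap L^2_{\mathrm{loc}}([0,\infty);V(\Omega))$ such that (1) for every $\phi\in C_c^\infty([0,\infty);\mathcal{D}(\Omega))$ with $\operatorname{div}\phi=0$, $$\int_0^\infty\!\!\int_\Omega\{-\partial_t\phi\cdot v-[(v\cdot\nabla)\phi]\cdot v+\nu\nabla v:\nabla\phi\}\,dx\,dt-\int_\Omega v_0\cdot\phi(0,x)\,dx=0,$$ where $A:B=\sum_{i,j}a_{ij}b_{ij}$; (2) for every $t>0$, $\|v(t,\cdot)\|_{L^2(\Omega)}^2+2\nu\int_0^t\|\nabla v(s,\cdot)\|_{L^2(\Omega)}^2\,ds\le\|v_0\|_{L^2(\Omega)}^2$. The weak solution of the helical Navier--Stokes equations with helical data $u_0$ is the field $u$, with $u(t,\cdot)$ helical of step $1$ for every $t$, that satisfies (1) and (2) with initial data $u_0$; its existence and its uniqueness among such helical solutions are known. *)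

theory Defs
  imports "HOL-Analysis.Analysis"
begin

text \<open>
  Conventions.  A vector field on the cylinder is a function on the whole of \<open>real^3\<close>; only its
  values on \<open>cyl\<close> matter, and elements of the Lebesgue and Sobolev spaces are represented by
  functions (identified when equal almost everywhere) rather than by equivalence classes.
\<close>

definition disk :: "(real \<times> real) set" where
  "disk = ball 0 1"

definition hor :: "real^3 \<Rightarrow> real \<times> real" where
  "hor x = (x $ 1, x $ 2)"

definition cyl :: "(real^3) set" where
  "cyl = {x. hor x \<in> disk \<and> 0 < x $ 3 \<and> x $ 3 < 1}"

text \<open>Derivatives are taken within \<open>S\<close>.  The sets used below are open or are the half space
  \<open>{0..} \<times> UNIV\<close>, so that the derivative within \<open>S\<close> is unique; in the latter case this is
  smoothness up to the boundary \<open>t = 0\<close>.\<close>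

primrec Ck_on :: "nat \<Rightarrow> 'a::euclidean_space set \<Rightarrow> ('a \<Rightarrow> 'b::euclidean_space) \<Rightarrow> bool" where
  "Ck_on 0 S f \<longleftrightarrow> continuous_on S f"
| "Ck_on (Suc k) S f \<longleftrightarrow>
     (\<forall>x\<in>S. f differentiable (at x within S)) \<and>
     (\<forall>h. Ck_on k S (\<lambda>x. frechet_derivative f (at x within S) h))"

definition smooth_on :: "'a::euclidean_space set \<Rightarrow> ('a \<Rightarrow> 'b::euclidean_space) \<Rightarrow> bool" where
  "smooth_on S f \<longleftrightarrow> (\<forall>k. Ck_on k S f)"

definition partial :: "3 \<Rightarrow> (real^3 \<Rightarrow> real) \<Rightarrow> real^3 \<Rightarrow> real" where
  "partial j f x = frechet_derivative f (at x) (axis j 1)"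

text \<open>The entry \<open>jac f x $ i $ j\<close> is the \<open>j\<close>-th partial derivative of the \<open>i\<close>-th component, so
  \<open>(v \<cdot> \<nabla>) f = jac f x *v v\<close>.\<close>

definition jac :: "(real^3 \<Rightarrow> real^3) \<Rightarrow> real^3 \<Rightarrow> real^3^3" where
  "jac f x = matrix (frechet_derivative f (at x))"

definition divergence :: "(real^3 \<Rightarrow> real^3) \<Rightarrow> real^3 \<Rightarrow> real" where
  "divergence f x = trace (jac f x)"

text \<open>The norm of \<open>real^3^3\<close> is the Frobenius norm.\<close>

definition L2 :: "(real^3 \<Rightarrow> 'b::euclidean_space) set" where
  "L2 = {f. f \<in> borel_measurable (lebesgue_on cyl) \<and>
            integrable (lebesgue_on cyl) (\<lambda>x. (norm (f x))\<^sup>2)}"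

definition L2_norm :: "(real^3 \<Rightarrow> 'b::euclidean_space) \<Rightarrow> real" where
  "L2_norm f = sqrt (LINT x|lebesgue_on cyl. (norm (f x))\<^sup>2)"

definition scalar_test :: "(real^3 \<Rightarrow> real) set" where
  "scalar_test = {\<psi>. smooth_on UNIV \<psi> \<and>
     (\<exists>K. compact K \<and> K \<subseteq> cyl \<and> (\<forall>x. x \<notin> K \<longrightarrow> \<psi> x = 0))}"

definition weak_gradient :: "(real^3 \<Rightarrow> real^3) \<Rightarrow> (real^3 \<Rightarrow> real^3^3) \<Rightarrow> bool" where
  "weak_gradient v G \<longleftrightarrow> (\<forall>\<psi>\<in>scalar_test. \<forall>i j.
     (LINT x|lebesgue_on cyl. v x $ i * partial j \<psi> x) =
     - (LINT x|lebesgue_on cyl. G x $ i $ j * \<psi> x))"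

definition H1 :: "(real^3 \<Rightarrow> real^3) set" where
  "H1 = {v \<in> L2. \<exists>G\<in>L2. weak_gradient v G}"

text \<open>A representative of the weak gradient of \<open>v\<close>, determined up to null sets if \<open>v \<in> H1\<close>.\<close>

definition wgrad :: "(real^3 \<Rightarrow> real^3) \<Rightarrow> real^3 \<Rightarrow> real^3^3" where
  "wgrad v = (SOME G. G \<in> L2 \<and> weak_gradient v G)"

definition H1_norm :: "(real^3 \<Rightarrow> real^3) \<Rightarrow> real" where
  "H1_norm v = sqrt ((L2_norm v)\<^sup>2 + (L2_norm (wgrad v))\<^sup>2)"

definition z_periodic :: "(real^3 \<Rightarrow> 'b) \<Rightarrow> bool" where
  "z_periodic f \<longleftrightarrow> (\<forall>x. f (x + axis 3 1) = f x)"

definition D_space :: "(real^3 \<Rightarrow> real^3) set" where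
  "D_space = {f. smooth_on UNIV f \<and> z_periodic f \<and>
     (\<exists>K. compact K \<and> K \<subseteq> disk \<and> (\<forall>x. hor x \<notin> K \<longrightarrow> f x = 0))}"

definition D_sol :: "(real^3 \<Rightarrow> real^3) set" where
  "D_sol = {f \<in> D_space. \<forall>x. divergence f x = 0}"

definition H_space :: "(real^3 \<Rightarrow> real^3) set" where
  "H_space = {v \<in> L2. \<exists>f. (\<forall>n. f n \<in> D_sol) \<and>
     (\<lambda>n::nat. L2_norm (\<lambda>x. f n x - v x)) \<longlonglongrightarrow> 0}"

definition V_space :: "(real^3 \<Rightarrow> real^3) set" where
  "V_space = {v \<in> H1. \<exists>f. (\<forall>n. f n \<in> D_sol) \<and>
     (\<lambda>n::nat. H1_norm (\<lambda>x. f n x - v x)) \<longlonglongrightarrow> 0}"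

text \<open>\<open>H_space\<close> with the weak topology of \<open>L2\<close>: the initial topology for the pairings with all
  elements of \<open>L2\<close>.\<close>

definition Hw :: "(real^3 \<Rightarrow> real^3) topology" where
  "Hw = pullback_topology H_space
     (\<lambda>v. \<lambda>w\<in>L2. LINT x|lebesgue_on cyl. v x \<bullet> w x)
     (product_topology (\<lambda>w. euclideanreal) L2)"

text \<open>Bochner spaces of functions on a set \<open>I\<close> of times with values in \<open>X\<close>, with (semi)norm \<open>N\<close>.
  Strong measurability is approximation almost everywhere by simple functions.\<close>

definition strongly_measurable_on ::
  "real set \<Rightarrow> (real^3 \<Rightarrow> real^3) set \<Rightarrow> ((real^3 \<Rightarrow> real^3) \<Rightarrow> real) \<Rightarrow>
   (real \<Rightarrow> real^3 \<Rightarrow> real^3) \<Rightarrow> bool" where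
  "strongly_measurable_on I X N v \<longleftrightarrow>
     (\<exists>s. (\<forall>n. simple_function (lebesgue_on I) (s n) \<and> s n ` I \<subseteq> X) \<and>
          (AE t in lebesgue_on I. v t \<in> X \<and>
             (\<lambda>n::nat. N (\<lambda>x. s n t x - v t x)) \<longlonglongrightarrow> 0))"

definition C0_Hw :: "(real \<Rightarrow> real^3 \<Rightarrow> real^3) set" where
  "C0_Hw = {v. continuous_map (top_of_set {0..}) Hw v}"

definition Linf_H :: "real set \<Rightarrow> (real \<Rightarrow> real^3 \<Rightarrow> real^3) set" where
  "Linf_H I = {v. strongly_measurable_on I H_space L2_norm v \<and>
     (\<exists>M. AE t in lebesgue_on I. L2_norm (v t) \<le> M)}"

definition L2_V :: "real set \<Rightarrow> (real \<Rightarrow> real^3 \<Rightarrow> real^3) set" where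
  "L2_V I = {v. strongly_measurable_on I V_space H1_norm v \<and>
     integrable (lebesgue_on I) (\<lambda>t. (H1_norm (v t))\<^sup>2)}"

definition L2loc_V :: "(real \<Rightarrow> real^3 \<Rightarrow> real^3) set" where
  "L2loc_V = {v. \<forall>T>0. v \<in> L2_V {0<..<T}}"

text \<open>Smooth divergence-free test fields with compact support in \<open>[0,\<infinity>)\<close> and, horizontally, in the
  disk; they need not vanish at \<open>t = 0\<close>.\<close>

definition test_fields :: "(real \<Rightarrow> real^3 \<Rightarrow> real^3) set" where
  "test_fields = {\<phi>. smooth_on ({0..} \<times> UNIV) (\<lambda>(t, x). \<phi> t x) \<and>
     (\<forall>t\<ge>0. z_periodic (\<phi> t) \<and> (\<forall>x. divergence (\<phi> t) x = 0)) \<and>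
     (\<exists>T K. compact K \<and> K \<subseteq> disk \<and>
        (\<forall>t\<ge>0. \<forall>x. t > T \<or> hor x \<notin> K \<longrightarrow> \<phi> t x = 0))}"

definition time_deriv :: "(real \<Rightarrow> real^3 \<Rightarrow> real^3) \<Rightarrow> real \<Rightarrow> real^3 \<Rightarrow> real^3" where
  "time_deriv \<phi> t x = vector_derivative (\<lambda>s. \<phi> s x) (at t within {0..})"

text \<open>The inner product of \<open>real^3^3\<close> is the double contraction \<open>A : B\<close>.\<close>

definition weak_form ::
  "real \<Rightarrow> (real^3 \<Rightarrow> real^3) \<Rightarrow> (real \<Rightarrow> real^3 \<Rightarrow> real^3) \<Rightarrow> bool" where
  "weak_form \<nu> v\<^sub>0 v \<longleftrightarrow> (\<forall>\<phi>\<in>test_fields.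
     (LINT t|lebesgue_on {0..}. LINT x|lebesgue_on cyl.
        - (time_deriv \<phi> t x \<bullet> v t x)
        - (jac (\<phi> t) x *v v t x) \<bullet> v t x
        + \<nu> * (wgrad (v t) x \<bullet> jac (\<phi> t) x))
     - (LINT x|lebesgue_on cyl. v\<^sub>0 x \<bullet> \<phi> 0 x) = 0)"

definition energy_inequality ::
  "real \<Rightarrow> (real^3 \<Rightarrow> real^3) \<Rightarrow> (real \<Rightarrow> real^3 \<Rightarrow> real^3) \<Rightarrow> bool" where
  "energy_inequality \<nu> v\<^sub>0 v \<longleftrightarrow> (\<forall>t>0.
     (L2_norm (v t))\<^sup>2 + 2 * \<nu> * (LINT s|lebesgue_on {0..t}. (L2_norm (wgrad (v s)))\<^sup>2)
       \<le> (L2_norm v\<^sub>0)\<^sup>2)"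

definition leray_hopf ::
  "real \<Rightarrow> (real^3 \<Rightarrow> real^3) \<Rightarrow> (real \<Rightarrow> real^3 \<Rightarrow> real^3) \<Rightarrow> bool" where
  "leray_hopf \<nu> v\<^sub>0 v \<longleftrightarrow>
     v \<in> C0_Hw \<and> v \<in> Linf_H {0<..} \<and> v \<in> L2loc_V \<and>
     weak_form \<nu> v\<^sub>0 v \<and> energy_inequality \<nu> v\<^sub>0 v"

definition rot :: "real \<Rightarrow> real^3^3" where
  "rot \<theta> = vector [vector [cos \<theta>, sin \<theta>, 0],
                   vector [- sin \<theta>, cos \<theta>, 0],
                   vector [0, 0, 1]]"

definition z_extend :: "(real^3 \<Rightarrow> 'b) \<Rightarrow> real^3 \<Rightarrow> 'b" where
  "z_extend U x = U (vector [x $ 1, x $ 2, frac (x $ 3)])"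

text \<open>For elements of \<open>L2\<close> the identity is, as usual, understood for almost every \<open>x\<close> in the
  infinite cylinder, for each \<open>\<theta>\<close>.\<close>

definition helical :: "real \<Rightarrow> (real^3 \<Rightarrow> real^3) \<Rightarrow> bool" where
  "helical \<sigma> U \<longleftrightarrow> (\<forall>\<theta>. AE x in lebesgue. hor x \<in> disk \<longrightarrow>
     z_extend U (rot \<theta> *v x + vector [0, 0, \<sigma> / (2 * pi) * \<theta>]) = rot \<theta> *v z_extend U x)"

definition helical_weak_solution ::
  "real \<Rightarrow> real \<Rightarrow> (real^3 \<Rightarrow> real^3) \<Rightarrow> (real \<Rightarrow> real^3 \<Rightarrow> real^3) \<Rightarrow> bool" where
  "helical_weak_solution \<nu> \<sigma> u\<^sub>0 u \<longleftrightarrow>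
     u \<in> C0_Hw \<and> u \<in> L2_V {0<..} \<and> (\<forall>t\<ge>0. helical \<sigma> (u t)) \<and>
     weak_form \<nu> u\<^sub>0 u \<and> energy_inequality \<nu> u\<^sub>0 u"

end

theory Submission
  imports Defs
begin

text \<open>
  Subtracting twice the identity for the inner product of \<open>u\<close> and \<open>v\<close> from the sum of the
  two energy inequalities gives, for \<open>w = v - u\<close>, the bound
  \<open>|w(t)|^2 \<le> |w(0)|^2 - 2 \<integral> (\<nu> |grad w|^2 + b(w, u, w))\<close> with \<open>b(w, u, w) = - b(w, w, u)\<close>.
  On different horizontal slices the modulus of a helical field differs only by a rotation, so
  the \<open>L^4\<close> norm of \<open>u\<close> is the same on every slice.  Holder's inequality and the
  two-dimensional Ladyzhenskaya inequality \<open>|f|_4^4 \<le> 2 |f|^2 |grad f|^2\<close> on the slices yield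
  \<open>|b(w, u, w)| \<le> \<nu> |grad w|^2 + 27 / (64 \<nu>^3) |u|^2 |grad u|^2 |w|^2\<close>, and Gronwall's lemma
  concludes, since \<open>2 \<nu> \<integral> |grad u|^2 \<le> |u(0)|^2\<close>.

  Neither solution is an admissible test field for the equation of the other.  Instead of
  mollifying in time, one tests the equation of \<open>v\<close> on \<open>[t, t + h]\<close> with the fixed field
  \<open>u(t + h)\<close> and that of \<open>u\<close> with \<open>v(t)\<close>.  The error is \<open>o(h)\<close> in mean over \<open>t\<close>, because off a
  set of small measure \<open>u\<close> and \<open>v\<close> are uniformly continuous into \<open>V\<close>.  Summing over \<open>n\<close> steps of
  length \<open>\<tau> / n\<close> shows that the defect of the identity takes the same value at \<open>t\<close> and \<open>t + \<tau>\<close>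
  for almost every \<open>t\<close>.  One then lets \<open>t\<close> tend to \<open>0\<close>, where the energy inequality gives
  strong continuity, and uses weak lower semicontinuity of the norm at \<open>\<tau>\<close>.
\<close>

section \<open>Smooth functions\<close>

text \<open>In three dimensions, interpolation bounds b(v, u, v) by a multiple of |v|^(1/2) |grad
  v|^(3/2) |grad u|, which two square integrable gradients do not make integrable in time. With the
  derivative moved off u, the slice estimate yields |grad v|^(3/2) |v|^(1/2) times the L^4 norm of
  u, hence the factor |u|^(1/2) |grad u|^(1/2) and just enough integrability. So helicity is needed
  already to define the quantity that is to be conserved. Increments of u in time are again helical,
  and this brings the time-stepping error under the same estimate. Smooth approximants need not be
  helical: symmetry is used on u itself, smoothness only on approximants.

  The constant: Young's inequality with exponents 4/3 and 4 contributes 27/256, the Ladyzhenskaya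
  inequality a factor 2 for w and a factor 2 for u, together 27/64. The energy balance doubles this,
  and the dissipation budget |u(0)|^2 / (2 \<nu>) of u halves it again and raises \<nu>^3 to
  \<nu>^4.\<close>

text \<open>Derivatives within such sets are unique.\<close>

definition solid :: "'a::euclidean_space set \<Rightarrow> bool" where
  "solid S \<longleftrightarrow> (\<forall>x\<in>S. \<forall>i\<in>Basis. \<forall>e>0. \<exists>d. 0 < \<bar>d\<bar> \<and> \<bar>d\<bar> < e \<and> x + d *\<^sub>R i \<in> S)"

lemma solid_UNIV [simp]: "solid (UNIV :: 'a::euclidean_space set)"
  unfolding solid_def by (metis UNIV_I abs_of_pos dense)

lemma solid_atLeast_0 [simp]: "solid {0::real..}"
  unfolding solid_def
proof (intro ballI allI impI)
  fix x i e :: real assume "x \<in> {0..}" "i \<in> Basis" "e > 0"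
  then show "\<exists>d. 0 < \<bar>d\<bar> \<and> \<bar>d\<bar> < e \<and> x + d *\<^sub>R i \<in> {0..}"
    by (intro exI[of _ "e/2"]) auto
qed

lemma solid_Times:
  fixes S :: "'a::euclidean_space set" and T :: "'b::euclidean_space set"
  assumes "solid S" "solid T"
  shows "solid (S \<times> T)"
  unfolding solid_def
proof (intro ballI allI impI)
  fix x :: "'a \<times> 'b" and i :: "'a \<times> 'b" and e :: real
  assume x: "x \<in> S \<times> T" and i: "i \<in> Basis" and e: "e > 0"
  from i consider j where "i = (j, 0)" "j \<in> Basis" | j where "i = (0, j)" "j \<in> Basis"
    unfolding Basis_prod_def by blast
  then show "\<exists>d. 0 < \<bar>d\<bar> \<and> \<bar>d\<bar> < e \<and> x + d *\<^sub>R i \<in> S \<times> T"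
  proof cases
    case 1
    with assms(1) x e obtain d where "0 < \<bar>d\<bar>" "\<bar>d\<bar> < e" "fst x + d *\<^sub>R j \<in> S"
      unfolding solid_def by (metis mem_Times_iff)
    then show ?thesis using x 1 by (intro exI[of _ d]) (auto simp: mem_Times_iff)
  next
    case 2
    with assms(2) x e obtain d where "0 < \<bar>d\<bar>" "\<bar>d\<bar> < e" "snd x + d *\<^sub>R j \<in> T"
      unfolding solid_def by (metis mem_Times_iff)
    then show ?thesis using x 2 by (intro exI[of _ d]) (auto simp: mem_Times_iff)
  qed
qed

lemma frechet_derivative_eq_solid:
  assumes "solid S" "x \<in> S" "(f has_derivative f') (at x within S)"
  shows "frechet_derivative f (at x within S) = f'"
proof -
  have "(f has_derivative frechet_derivative f (at x within S)) (at x within S)"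
    using assms(3) frechet_derivative_works differentiable_def by blast
  from frechet_derivative_unique_within[OF this assms(3)] assms(1,2)
  show ?thesis unfolding solid_def by blast
qed

lemma Ck_on_cong:
  assumes "\<And>x. x \<in> S \<Longrightarrow> f x = g x"
  shows "Ck_on k S f \<longleftrightarrow> Ck_on k S g"
  using assms
proof (induction k arbitrary: f g)
  case 0 then show ?case by (simp cong: continuous_on_cong)
next
  case (Suc m)
  have d: "(f has_derivative D) (at x within S) \<longleftrightarrow> (g has_derivative D) (at x within S)"
    if "x \<in> S" for x D
    using Suc.prems that has_derivative_transform by metis
  have e: "frechet_derivative f (at x within S) = frechet_derivative g (at x within S)" if "x \<in> S" for x
    unfolding frechet_derivative_def using d[OF that] by simp
  have "f differentiable (at x within S) \<longleftrightarrow> g differentiable (at x within S)" if "x \<in> S" for x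
    unfolding differentiable_def using d[OF that] by simp
  then show ?case
    using Suc.IH[of "\<lambda>x. frechet_derivative f (at x within S) h" "\<lambda>x. frechet_derivative g (at x within S) h" for h] e
    by (auto)
qed

text \<open>\<open>Ck_on\<close> refers to the derivative chosen by
  \<open>frechet_derivative\<close>. Uniqueness on solid sets lets any explicitly computed
  derivative stand in for it, which turns the closure properties below into inductions on the
  order.\<close>

lemma Ck_on_SucI:
  assumes "solid S" "\<And>x. x \<in> S \<Longrightarrow> (f has_derivative f' x) (at x within S)"
    "\<And>h. Ck_on k S (\<lambda>x. f' x h)"
  shows "Ck_on (Suc k) S f"
proof -
  have "frechet_derivative f (at x within S) = f' x" if "x \<in> S" for x
    by (rule frechet_derivative_eq_solid[OF assms(1) that assms(2)[OF that]])
  then have "Ck_on k S (\<lambda>x. frechet_derivative f (at x within S) h)" for h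
    using assms(3)[of h] Ck_on_cong[of S "\<lambda>x. frechet_derivative f (at x within S) h" "\<lambda>x. f' x h" k] by simp
  then show ?thesis using assms(2) by (auto simp: differentiable_def)
qed

lemma Ck_on_SucD:
  assumes "Ck_on (Suc k) S f"
  shows "Ck_on k S f"
  using assms
proof (induction k arbitrary: f)
  case 0
  then show ?case
    by (simp add: continuous_on_eq_continuous_within differentiable_imp_continuous_within)
qed auto

lemma Ck_on_hd:
  assumes "Ck_on (Suc k) S f" "x \<in> S"
  shows "(f has_derivative frechet_derivative f (at x within S)) (at x within S)"
  using assms frechet_derivative_works by auto

lemma Ck_on_add:
  assumes "solid S" "Ck_on k S f" "Ck_on k S g"
  shows "Ck_on k S (\<lambda>x. f x + g x)"
  using assms(2,3)
proof (induction k arbitrary: f g)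
  case 0 then show ?case by (auto intro: continuous_intros)
next
  case (Suc k)
  show ?case
    by (rule Ck_on_SucI[OF assms(1) has_derivative_add[OF Ck_on_hd[OF Suc.prems(1)] Ck_on_hd[OF Suc.prems(2)]]])
      (use Suc in auto)
qed

lemma Ck_on_const:
  assumes "solid S" shows "Ck_on k S (\<lambda>x. c)"
proof (induction k arbitrary: c)
  case (Suc k)
  show ?case by (rule Ck_on_SucI[OF assms has_derivative_const]) (use Suc in auto)
qed auto

text \<open>The product rule leaves one of the two factors undifferentiated in each term, so the
  induction also needs the factors themselves at the lower order; \<open>Ck_on_SucD\<close> supplies
  this.\<close>

lemma Ck_on_scaleR:
  assumes "solid S" "Ck_on k S f" "Ck_on k S g"
  shows "Ck_on k S (\<lambda>x. f x *\<^sub>R g x)"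
  using assms(2,3)
proof (induction k arbitrary: f g)
  case 0 then show ?case by (auto intro: continuous_intros)
next
  case (Suc k)
  show ?case
    by (rule Ck_on_SucI[OF assms(1) has_derivative_scaleR[OF Ck_on_hd[OF Suc.prems(1)] Ck_on_hd[OF Suc.prems(2)]]])
     (use Suc.prems Ck_on_SucD[OF Suc.prems(1)] Ck_on_SucD[OF Suc.prems(2)] in
       \<open>auto intro!: Ck_on_add[OF assms(1)] Suc.IH simp del: Ck_on.simps(1)\<close>)
qed

text \<open>For an affine inner map the chain rule only replaces the direction \<open>h\<close> by
  \<open>L h\<close> and creates no further factor, so the induction hypothesis applies directly to
  the directional derivatives of \<open>f\<close>.\<close>

lemma Ck_on_compose_affine:
  assumes "solid S" "bounded_linear L" "\<And>x. x \<in> S \<Longrightarrow> L x + c \<in> T" "Ck_on k T f"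
  shows "Ck_on k S (\<lambda>x. f (L x + c))"
  using assms(4)
proof (induction k arbitrary: f)
  case 0
  interpret bounded_linear L by fact
  have "continuous_on S (\<lambda>x. L x + c)"
    by (intro continuous_intros linear_continuous_on assms)
  then show ?case using 0 assms(3)
    by (auto intro!: continuous_on_compose2[of T f S "\<lambda>x. L x + c"])
next
  case (Suc k)
  interpret bounded_linear L by fact
  show ?case
  proof (rule Ck_on_SucI[OF assms(1)])
    fix x assume x: "x \<in> S"
    have 1: "((\<lambda>x. L x + c) has_derivative L) (at x within S)"
      by (auto intro!: derivative_eq_intros bounded_linear_imp_has_derivative assms(2))
    have "(f has_derivative frechet_derivative f (at (L x + c) within T)) (at (L x + c) within (\<lambda>x. L x + c) ` S)"
      by (rule has_derivative_subset[OF Ck_on_hd[OF Suc.prems]]) (use x assms(3) in auto)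
    from diff_chain_within[OF 1 this]
    show "((\<lambda>x. f (L x + c)) has_derivative (\<lambda>h. frechet_derivative f (at (L x + c) within T) (L h))) (at x within S)"
      by (simp add: o_def)
  next
    fix h show "Ck_on k S (\<lambda>x. frechet_derivative f (at (L x + c) within T) (L h))"
      using Suc.IH[of "\<lambda>y. frechet_derivative f (at y within T) (L h)"] Suc.prems by auto
  qed
qed

lemma Ck_on_prod:
  fixes f :: "'i \<Rightarrow> 'a::euclidean_space \<Rightarrow> real"
  assumes "solid S" "finite I" "\<And>i. i \<in> I \<Longrightarrow> Ck_on k S (f i)"
  shows "Ck_on k S (\<lambda>x. \<Prod>i\<in>I. f i x)"
  using assms(2,3)
proof (induction I rule: finite_induct)
  case empty then show ?case by (simp add: Ck_on_const[OF assms(1)])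
next
  case (insert i I)
  then show ?case using Ck_on_scaleR[OF assms(1), of k "f i" "\<lambda>x. \<Prod>i\<in>I. f i x"] by simp
qed

text \<open>This family is closed under differentiation, see \<open>flat_DERIV\<close>; this makes the smoothness of
  \<open>flat 0\<close> a plain induction.\<close>

definition flat :: "nat \<Rightarrow> real \<Rightarrow> real" where
  "flat m x = (if x > 0 then (1 / x) ^ m * exp (- (1 / x)) else 0)"

lemma flat_nonneg [simp]: "0 \<le> flat m x"
  by (simp add: flat_def)

lemma flat_0_le_1 [simp]: "flat 0 x \<le> 1"
  by (simp add: flat_def)

lemma flat_nonpos [simp]: "x \<le> 0 \<Longrightarrow> flat m x = 0"
  by (simp add: flat_def)

lemma flat_tendsto_0: "(flat m \<longlongrightarrow> 0) (at 0)"
proof -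
  have "((\<lambda>x::real. inverse x ^ m / exp (inverse x)) \<longlongrightarrow> 0) (at_right 0)"
    by (rule filterlim_compose[OF tendsto_power_div_exp_0 filterlim_inverse_at_top_right])
  then have "(flat m \<longlongrightarrow> 0) (at_right 0)"
    by (rule Lim_transform_eventually)
      (auto simp: eventually_at_filter flat_def exp_minus field_simps)
  moreover have "(flat m \<longlongrightarrow> 0) (at_left 0)"
    by (rule Lim_transform_eventually[of "\<lambda>x. 0"]) (auto simp: eventually_at_filter)
  ultimately show ?thesis by (simp add: filterlim_at_split)
qed

lemma flat_DERIV: "(flat m has_real_derivative (flat (m + 2) x - real m * flat (m + 1) x)) (at x)"
proof -
  consider "x > 0" | "x < 0" | "x = 0" by linarith
  then show ?thesis
  proof cases
    case 1
    define y where "y = 1 / x"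
    have "((\<lambda>x. (1 / x) ^ m * exp (- (1 / x))) has_real_derivative
        real m * y ^ (m - 1) * (- (y * y)) * exp (- y) + y ^ m * (exp (- y) * (y * y))) (at x)"
      using 1 by (auto intro!: derivative_eq_intros simp: y_def)
    also have "real m * y ^ (m - 1) * (- (y * y)) * exp (- y) + y ^ m * (exp (- y) * (y * y)) =
        flat (m + 2) x - real m * flat (m + 1) x"
      using 1 by (cases m) (auto simp: flat_def y_def[symmetric] algebra_simps)
    finally have "((\<lambda>x. (1 / x) ^ m * exp (- (1 / x))) has_real_derivative
        (flat (m + 2) x - real m * flat (m + 1) x)) (at x)" .
    then show ?thesis
      by (rule has_field_derivative_transform_within_open[of _ _ _ "{0<..}"]) (use 1 in \<open>auto simp: flat_def\<close>)
  next
    case 2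
    have "((\<lambda>x. 0) has_real_derivative 0) (at x)" by simp
    then have "(flat m has_real_derivative 0) (at x)"
      by (rule has_field_derivative_transform_within_open[of _ _ _ "{..<0}"]) (use 2 in \<open>auto simp: flat_def\<close>)
    then show ?thesis using 2 by simp
  next
    case 3
    \<comment> \<open>At the origin the difference quotient of \<open>flat m\<close> is
      \<open>flat (Suc m)\<close>, which tends to \<open>0\<close> like every member of the
      family.\<close>
    have "((\<lambda>h. (flat m (0 + h) - flat m 0) / h) \<longlongrightarrow> 0) (at 0)"
      by (rule Lim_transform_eventually[OF flat_tendsto_0[of "Suc m"]])
        (auto simp: eventually_at_filter flat_def)
    then show ?thesis using 3 by (simp add: DERIV_def)
  qed
qed

lemma Ck_on_flat: "Ck_on k UNIV (flat m)"
proof (induction k arbitrary: m)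
  case 0
  have "\<forall>x\<in>UNIV. isCont (flat m) x" using flat_DERIV DERIV_isCont by blast
  then show ?case by (simp add: continuous_at_imp_continuous_on)
next
  case (Suc k)
  show ?case
  proof (rule Ck_on_SucI)
    fix x :: real
    show "(flat m has_derivative (\<lambda>h. (flat (m + 2) x + (- real m) *\<^sub>R flat (m + 1) x) *\<^sub>R h)) (at x)"
      using flat_DERIV[of m x] by (auto simp: has_field_derivative_def o_def elim!: has_derivative_eq_rhs)
  next
    fix h :: real
    show "Ck_on k UNIV (\<lambda>x. (flat (m + 2) x + (- real m) *\<^sub>R flat (m + 1) x) *\<^sub>R h)"
      by (intro Ck_on_scaleR Ck_on_add Ck_on_const Suc) auto
  qed simp
qed

section \<open>Smooth approximations of indicator functions\<close>

lemma flat_scaled_tendsto_1: "(\<lambda>n. flat 0 (real n * x - 1)) \<longlonglongrightarrow> (if x > 0 then 1 else 0)"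
proof (cases "x > 0")
  case True
  have 1: "filterlim (\<lambda>n. -1 + x * real n) at_top sequentially"
    by (intro filterlim_tendsto_add_at_top[OF tendsto_const]
        filterlim_tendsto_pos_mult_at_top[OF tendsto_const True filterlim_real_sequentially])
  have "(\<lambda>n. exp (- inverse (-1 + x * real n))) \<longlonglongrightarrow> exp (- 0)"
    by (intro tendsto_intros tendsto_inverse_0_at_top[OF 1])
  moreover have "\<forall>\<^sub>F n in sequentially. -1 + x * real n > 0"
    using 1 unfolding filterlim_at_top_dense by blast
  then have "\<forall>\<^sub>F n in sequentially. exp (- inverse (-1 + x * real n)) = flat 0 (real n * x - 1)"
    by eventually_elim (auto simp: flat_def inverse_eq_divide algebra_simps)
  ultimately show ?thesis using True by (auto intro: Lim_transform_eventually)
next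
  case False
  then have "real n * x \<le> 0" for n by (simp add: mult_nonneg_nonpos)
  then have "flat 0 (real n * x - 1) = 0" for n by (smt (verit) flat_nonpos)
  then show ?thesis using False by simp
qed

lemma flat_scaled_tendsto: "(\<lambda>n. flat 0 (real n * x)) \<longlonglongrightarrow> (if x > 0 then 1 else 0)"
proof (cases "x > 0")
  case True
  have "(\<lambda>n. exp (- (1 / x * (1 / real n)))) \<longlonglongrightarrow> exp (- (1 / x * 0))"
    by (intro tendsto_intros lim_1_over_n)
  moreover have "\<forall>\<^sub>F n in sequentially. exp (- (1 / x * (1 / real n))) = flat 0 (real n * x)"
    using eventually_gt_at_top[of 0] by eventually_elim (use True in \<open>auto simp: flat_def\<close>)
  ultimately show ?thesis using True by (auto intro: Lim_transform_eventually)
next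
  case False
  then have "flat 0 (real n * x) = 0" for n by (simp add: mult_nonneg_nonpos)
  then show ?thesis using False by simp
qed

text \<open>The shift by \<open>1\<close> makes the \<open>n\<close>-th function vanish wherever a
  coordinate is within \<open>1 / n\<close> of a face, so its support is a compact subset of the
  open box, as \<open>scalar_test\<close> demands.\<close>

definition bump :: "real^3 \<Rightarrow> real^3 \<Rightarrow> nat \<Rightarrow> real^3 \<Rightarrow> real" where
  "bump a b n x = (\<Prod>i\<in>UNIV. flat 0 (real n * (x $ i - a $ i) - 1) * flat 0 (real n * (b $ i - x $ i) - 1))"

lemma bump_scalar_test:
  assumes "box a b \<subseteq> cyl"
  shows "bump a b n \<in> scalar_test"
proof -
  have 1: "Ck_on k UNIV (\<lambda>x::real^3. flat 0 (c * (x $ i - d) - 1))" for k i c d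
    using Ck_on_compose_affine[of UNIV "\<lambda>x::real^3. c * (x $ i)" "- c * d - 1" UNIV k "flat 0"]
    by (simp add: Ck_on_flat algebra_simps bounded_linear_mult_right[THEN bounded_linear_compose] bounded_linear_vec_nth)
  have 2: "Ck_on k UNIV (\<lambda>x::real^3. flat 0 (c * (d - x $ i) - 1))" for k i c d
    using Ck_on_compose_affine[of UNIV "\<lambda>x::real^3. (- c) * (x $ i)" "c * d - 1" UNIV k "flat 0"]
    by (simp add: Ck_on_flat algebra_simps bounded_linear_mult_right[THEN bounded_linear_compose] bounded_linear_vec_nth bounded_linear_minus)
  have "Ck_on k UNIV (bump a b n)" for k
    unfolding bump_def
    using Ck_on_prod[of UNIV UNIV k "\<lambda>i x. flat 0 (real n * (x $ i - a $ i) - 1) * flat 0 (real n * (b $ i - x $ i) - 1)"]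
      Ck_on_scaleR[OF solid_UNIV 1 2] by simp
  \<comment> \<open>For \<open>n = 0\<close> every factor is \<open>flat 0 (- 1) = 0\<close>, so the
    empty support is correct and no division by \<open>n\<close> arises.\<close>
  moreover define K where "K = (if n = 0 then {} else cbox (\<chi> i. a $ i + 1 / real n) (\<chi> i. b $ i - 1 / real n))"
  have "bump a b n x = 0" if x: "x \<notin> K" for x
  proof -
    obtain i where "real n * (x $ i - a $ i) - 1 \<le> 0 \<or> real n * (b $ i - x $ i) - 1 \<le> 0"
      using x by (auto simp: K_def mem_box_cart not_le field_simps split: if_splits) (metis less_eq_real_def)+
    then have "flat 0 (real n * (x $ i - a $ i) - 1) * flat 0 (real n * (b $ i - x $ i) - 1) = 0"
      by auto
    then show ?thesis unfolding bump_def by (auto intro!: prod_zero bexI[of _ i])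
  qed
  moreover have "compact K" by (simp add: K_def)
  moreover have "K \<subseteq> box a b"
  proof
    fix x assume x: "x \<in> K"
    then have n: "1 / real n > 0" by (auto simp: K_def split: if_splits)
    have "a $ i + 1 / real n \<le> x $ i \<and> x $ i \<le> b $ i - 1 / real n" for i
      using x by (auto simp: K_def mem_box_cart split: if_splits)
    then have "a $ i < x $ i \<and> x $ i < b $ i" for i using n by (smt (verit))
    then show "x \<in> box a b" by (simp add: mem_box_cart)
  qed
  ultimately show ?thesis
    unfolding scalar_test_def smooth_on_def using assms by (auto intro!: exI[of _ K])
qed

lemma bump_bounds: "0 \<le> bump a b n x" "bump a b n x \<le> 1"
  unfolding bump_def by (auto intro!: prod_nonneg prod_le_1 mult_le_one)

lemma bump_tendsto: "(\<lambda>n. bump a b n x) \<longlonglongrightarrow> indicator (box a b) x"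
proof -
  have "(\<lambda>n. bump a b n x) \<longlonglongrightarrow>
    (\<Prod>i\<in>UNIV. (if x $ i - a $ i > 0 then 1 else 0) * (if b $ i - x $ i > 0 then 1 else 0))"
    unfolding bump_def by (intro tendsto_prod tendsto_mult flat_scaled_tendsto_1)
  also have "(\<Prod>i\<in>UNIV. (if x $ i - a $ i > 0 then 1 else 0) * (if b $ i - x $ i > 0 then 1 else 0)) =
      (indicator (box a b) x :: real)"
  proof (cases "x \<in> box a b")
    case True then show ?thesis by (auto simp: mem_box_cart)
  next
    case False
    then obtain i where "\<not> (a $ i < x $ i \<and> x $ i < b $ i)" by (auto simp: mem_box_cart)
    then show ?thesis using False by (auto intro!: prod_zero bexI[of _ i])
  qed
  finally show ?thesis .
qed

section \<open>Jacobians, and test fields that are products of a time cutoff and a fixed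
  field\<close>

lemma smooth_on_UNIV_has_derivative:
  "smooth_on UNIV f \<Longrightarrow> (f has_derivative frechet_derivative f (at x)) (at x)"
  using Ck_on_hd[of 0 UNIV f x] unfolding smooth_on_def by auto

lemma smooth_on_UNIV_continuous_derivative:
  "smooth_on UNIV f \<Longrightarrow> continuous_on UNIV (\<lambda>x. frechet_derivative f (at x) h)"
  unfolding smooth_on_def by (drule spec[of _ 1]) auto

lemma jac_has_derivative:
  assumes "(f has_derivative f') (at x)"
  shows "jac f x = matrix f'" "(f has_derivative (\<lambda>h. jac f x *v h)) (at x)"
proof -
  show 1: "jac f x = matrix f'"
    unfolding jac_def using frechet_derivative_at[OF assms] by simp
  have "linear f'" using assms has_derivative_linear by blast
  then show "(f has_derivative (\<lambda>h. jac f x *v h)) (at x)"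
    using assms 1 by (simp add: matrix_works)
qed

lemma jac_scaleR:
  assumes "f differentiable (at x)"
  shows "jac (\<lambda>x. c *\<^sub>R f x) x = c *\<^sub>R jac f x"
proof -
  have f: "(f has_derivative frechet_derivative f (at x)) (at x)"
    using assms frechet_derivative_works by blast
  have "jac (\<lambda>x. c *\<^sub>R f x) x = matrix (\<lambda>h. c *\<^sub>R frechet_derivative f (at x) h)"
    by (rule jac_has_derivative) (auto intro!: derivative_eq_intros f)
  then show ?thesis by (simp add: jac_def matrix_def vec_eq_iff)
qed

text \<open>It vanishes from \<open>\<tau>\<close> on and tends to \<open>1\<close> before
  \<open>\<tau>\<close> as \<open>n\<close> grows, while minus its derivative concentrates at
  \<open>\<tau>\<close>. Testing with its product with a fixed field therefore evaluates the pairing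
  of the solution with that field at the time \<open>\<tau>\<close>.\<close>

definition cutoff :: "real \<Rightarrow> nat \<Rightarrow> real \<Rightarrow> real" where
  "cutoff \<tau> n t = flat 0 (real n * (\<tau> - t))"

lemma cutoff_DERIV: "(cutoff \<tau> n has_real_derivative - real n * flat 2 (real n * (\<tau> - t))) (at t)"
proof -
  have "((\<lambda>t. flat 0 (real n * (\<tau> - t))) has_real_derivative (flat 2 (real n * (\<tau> - t))) * (- real n)) (at t)"
    by (rule DERIV_chain2[of "flat 0"]) (use flat_DERIV[of 0] in \<open>auto intro!: derivative_eq_intros simp: numeral_2_eq_2\<close>)
  then show ?thesis by (simp add: cutoff_def[abs_def] mult.commute)
qed

lemma Ck_on_cutoff: "Ck_on k UNIV (cutoff \<tau> n)"
  using Ck_on_compose_affine[of UNIV "\<lambda>x::real. - real n * x" "real n * \<tau>" UNIV k "flat 0"]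
  by (simp add: Ck_on_flat cutoff_def[abs_def] algebra_simps bounded_linear_mult_left bounded_linear_minus)

lemma D_spaceD:
  assumes "f \<in> D_space"
  shows "smooth_on UNIV f" "z_periodic f"
    "f differentiable (at x)"
  using assms smooth_on_UNIV_has_derivative[of f x] by (auto simp: D_space_def differentiable_def)

lemma cutoff_test_field:
  assumes f: "f \<in> D_sol"
  shows "(\<lambda>t x. cutoff \<tau> n t *\<^sub>R f x) \<in> test_fields"
proof -
  have fD: "f \<in> D_space" and dv: "\<And>x. divergence f x = 0" using f by (auto simp: D_sol_def)
  have sol: "solid ({0::real..} \<times> (UNIV :: (real^3) set))" by (intro solid_Times) auto
  have "Ck_on k ({0..} \<times> UNIV) (\<lambda>p. cutoff \<tau> n (fst p + 0) *\<^sub>R f (snd p + 0))" for k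
    using D_spaceD(1)[OF fD] Ck_on_cutoff
    by (intro Ck_on_scaleR[OF sol] Ck_on_compose_affine[OF sol, where T = UNIV])
       (auto simp: bounded_linear_fst bounded_linear_snd smooth_on_def)
  then have "smooth_on ({0..} \<times> UNIV) (\<lambda>(t, x). cutoff \<tau> n t *\<^sub>R f x)"
    by (simp add: smooth_on_def case_prod_unfold)
  moreover have "z_periodic (\<lambda>x. cutoff \<tau> n t *\<^sub>R f x)" for t
    using D_spaceD(2)[OF fD] by (simp add: z_periodic_def)
  moreover have "divergence (\<lambda>x. cutoff \<tau> n t *\<^sub>R f x) x = 0" for t x
    using dv[of x] D_spaceD(3)[OF fD, of x]
    by (simp add: divergence_def jac_scaleR trace_def sum_distrib_left[symmetric])
  moreover from fD obtain K where "compact K" "K \<subseteq> disk" "\<forall>x. hor x \<notin> K \<longrightarrow> f x = 0"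
    by (auto simp: D_space_def)
  moreover have "cutoff \<tau> n t = 0" if "t > \<tau>" for t
    using that by (simp add: cutoff_def mult_nonneg_nonpos)
  ultimately show ?thesis
    unfolding test_fields_def by (auto intro!: exI[of _ \<tau>] exI[of _ K])
qed

lemma time_deriv_cutoff:
  assumes "t \<ge> 0"
  shows "time_deriv (\<lambda>t x. cutoff \<tau> n t *\<^sub>R f x) t x = (- real n * flat 2 (real n * (\<tau> - t))) *\<^sub>R f x"
  unfolding time_deriv_def
proof (rule vector_derivative_within)
  show "at t within {0..} \<noteq> bot"
    unfolding trivial_limit_within not_not islimpt_approachable
  proof (intro allI impI)
    fix e :: real assume "e > 0"
    then show "\<exists>x'\<in>{0..}. x' \<noteq> t \<and> dist x' t < e"
      using assms by (intro bexI[of _ "t + e / 2"]) (auto simp: dist_real_def)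
  qed
  have "(cutoff \<tau> n has_field_derivative (- real n * flat 2 (real n * (\<tau> - t)))) (at t within {0..})"
    using cutoff_DERIV[of \<tau> n t] by (rule has_field_derivative_at_within)
  from has_vector_derivative_scaleR[OF this has_vector_derivative_const]
  show "((\<lambda>s. cutoff \<tau> n s *\<^sub>R f x) has_vector_derivative (- real n * flat 2 (real n * (\<tau> - t))) *\<^sub>R f x) (at t within {0..})"
    by simp
qed

section \<open>Square integrable fields on the cylinder\<close>

lemma open_cyl: "open cyl"
proof -
  have 1: "open ((\<lambda>x::real^3. (x $ 1, x $ 2)) -` ball 0 1)"
    by (intro open_vimage continuous_intros) auto
  have 2: "open {x::real^3. 0 < x $ 3}" "open {x::real^3. x $ 3 < 1}"
    by (intro open_Collect_less continuous_intros)+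
  have "open ((\<lambda>x::real^3. (x $ 1, x $ 2)) -` ball 0 1 \<inter> ({x::real^3. 0 < x $ 3} \<inter> {x::real^3. x $ 3 < 1}))"
    by (intro open_Int 1 2)
  also have "(\<lambda>x::real^3. (x $ 1, x $ 2)) -` ball 0 1 \<inter> ({x::real^3. 0 < x $ 3} \<inter> {x::real^3. x $ 3 < 1}) = cyl"
    by (auto simp: cyl_def hor_def disk_def)
  finally show ?thesis .
qed

lemma cyl_lebesgue [simp, measurable]: "cyl \<in> sets lebesgue"
  using open_cyl by (simp add: borel_open)

lemma disk_iff: "hor x \<in> disk \<longleftrightarrow> (x $ 1)\<^sup>2 + (x $ 2)\<^sup>2 < 1"
  by (simp add: hor_def disk_def norm_Pair)

lemma cyl_subset_cbox: "cyl \<subseteq> cbox (-1) 1"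
proof
  fix x assume "x \<in> cyl"
  then have d: "(x $ 1)\<^sup>2 + (x $ 2)\<^sup>2 < 1" "0 < x $ 3" "x $ 3 < 1" by (auto simp: cyl_def disk_iff)
  then have "(x $ 1)\<^sup>2 \<le> 1" "(x $ 2)\<^sup>2 \<le> 1"
    using zero_le_power2[of "x $ 1"] zero_le_power2[of "x $ 2"] by linarith+
  then have "\<bar>x $ 1\<bar> \<le> 1" "\<bar>x $ 2\<bar> \<le> 1" by (simp_all add: abs_square_le_1)
  with d show "x \<in> cbox (-1) 1"
    by (simp add: mem_box_cart forall_3 abs_le_iff)
qed

lemma bounded_cyl: "bounded cyl"
  using cyl_subset_cbox bounded_cbox bounded_subset by blast

lemma finite_measure_cyl: "finite_measure (lebesgue_on cyl)"
proof
  have "cyl \<in> lmeasurable"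
    using bounded_cyl cyl_lebesgue bounded_set_imp_lmeasurable by blast
  then show "emeasure (lebesgue_on cyl) (space (lebesgue_on cyl)) \<noteq> \<infinity>"
    by (simp add: emeasure_restrict_space fmeasurable_def)
qed

interpretation cyl: finite_measure "lebesgue_on cyl" by (rule finite_measure_cyl)

lemma continuous_measurable_cyl [intro]:
  "continuous_on UNIV f \<Longrightarrow> f \<in> borel_measurable (lebesgue_on cyl)"
  using continuous_imp_measurable_on_sets_lebesgue continuous_on_subset cyl_lebesgue by blast

definition ip :: "(real^3 \<Rightarrow> 'b::euclidean_space) \<Rightarrow> (real^3 \<Rightarrow> 'b) \<Rightarrow> real" where
  "ip f g = (LINT x|lebesgue_on cyl. f x \<bullet> g x)"

lemma L2_measurable: "f \<in> L2 \<Longrightarrow> f \<in> borel_measurable (lebesgue_on cyl)"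
  by (simp add: L2_def)

lemma L2_integrable_sq: "f \<in> L2 \<Longrightarrow> integrable (lebesgue_on cyl) (\<lambda>x. (norm (f x))\<^sup>2)"
  by (simp add: L2_def)

lemma L2_integrable_norm_mult:
  assumes "f \<in> L2" "g \<in> L2"
  shows "integrable (lebesgue_on cyl) (\<lambda>x. norm (f x) * norm (g x))"
proof (rule Bochner_Integration.integrable_bound)
  show "integrable (lebesgue_on cyl) (\<lambda>x. (norm (f x))\<^sup>2 + (norm (g x))\<^sup>2)"
    by (intro Bochner_Integration.integrable_add L2_integrable_sq assms)
  show "(\<lambda>x. norm (f x) * norm (g x)) \<in> borel_measurable (lebesgue_on cyl)"
    using assms[THEN L2_measurable] by measurable
  have "a * b \<le> a\<^sup>2 + b\<^sup>2" if "a \<ge> 0" "b \<ge> 0" for a b :: real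
    using sum_squares_bound[of a b] mult_nonneg_nonneg[OF that] by (simp only: mult.assoc)
  then show "AE x in lebesgue_on cyl. norm (norm (f x) * norm (g x)) \<le> norm ((norm (f x))\<^sup>2 + (norm (g x))\<^sup>2)"
    by auto
qed

lemma L2_boundI:
  assumes "f \<in> borel_measurable (lebesgue_on cyl)" "g \<in> L2" "AE x in lebesgue_on cyl. norm (f x) \<le> norm (g x)"
  shows "f \<in> L2"
proof -
  have "integrable (lebesgue_on cyl) (\<lambda>x. (norm (f x))\<^sup>2)"
    by (rule Bochner_Integration.integrable_bound[OF L2_integrable_sq[OF assms(2)]])
      (use assms in \<open>auto elim!: eventually_mono intro!: power_mono\<close>)
  then show ?thesis using assms by (simp add: L2_def)
qed

lemma L2_norm_fun: "f \<in> L2 \<Longrightarrow> (\<lambda>x. norm (f x)) \<in> L2"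
  by (auto intro!: L2_boundI[of _ f] dest: L2_measurable)

lemma L2_const: "(\<lambda>x. c) \<in> L2"
  by (auto simp: L2_def)

lemma L2_bounded:
  assumes "f \<in> borel_measurable (lebesgue_on cyl)" "\<And>x. x \<in> cyl \<Longrightarrow> norm (f x) \<le> B"
  shows "f \<in> L2"
  by (rule L2_boundI[OF assms(1) L2_const[of B]]) (use assms(2) in \<open>auto intro!: AE_I2 order.trans[OF _ abs_ge_self] simp: space_restrict_space\<close>)

lemma continuous_bounded_cyl:
  assumes "continuous_on UNIV f"
  shows "\<exists>B. \<forall>x\<in>cyl. norm (f x) \<le> B"
proof -
  have "compact (f ` cbox (-1) 1)"
    by (intro compact_continuous_image continuous_on_subset[OF assms]) auto
  then obtain B where "\<forall>y\<in>f ` cbox (-1) 1. norm y \<le> B"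
    using compact_imp_bounded bounded_iff by metis
  then show ?thesis using cyl_subset_cbox by blast
qed

lemma L2_continuous: "continuous_on UNIV f \<Longrightarrow> f \<in> L2"
  using continuous_bounded_cyl[of f] L2_bounded[of f] by blast

lemma L2_scaleR: "f \<in> L2 \<Longrightarrow> (\<lambda>x. c *\<^sub>R f x) \<in> L2"
  by (auto simp: L2_def power_mult_distrib)

lemma L2_add:
  assumes "f \<in> L2" "g \<in> L2"
  shows "(\<lambda>x. f x + g x) \<in> L2"
proof -
  have "integrable (lebesgue_on cyl) (\<lambda>x. (norm (f x + g x))\<^sup>2)"
  proof (rule Bochner_Integration.integrable_bound)
    show "integrable (lebesgue_on cyl) (\<lambda>x. (norm (f x))\<^sup>2 + 2 * (norm (f x) * norm (g x)) + (norm (g x))\<^sup>2)"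
      by (intro Bochner_Integration.integrable_add integrable_mult_right L2_integrable_sq L2_integrable_norm_mult assms)
    show "(\<lambda>x. (norm (f x + g x))\<^sup>2) \<in> borel_measurable (lebesgue_on cyl)"
      using assms[THEN L2_measurable] by measurable
    have "(norm (f x + g x))\<^sup>2 \<le> (norm (f x))\<^sup>2 + 2 * (norm (f x) * norm (g x)) + (norm (g x))\<^sup>2" for x
      using power_mono[OF norm_triangle_ineq[of "f x" "g x"], of 2] by (simp add: power2_sum algebra_simps)
    then show "AE x in lebesgue_on cyl. norm ((norm (f x + g x))\<^sup>2) \<le>
        norm ((norm (f x))\<^sup>2 + 2 * (norm (f x) * norm (g x)) + (norm (g x))\<^sup>2)"
      by (auto intro!: AE_I2 order.trans[OF _ abs_ge_self])
  qed
  then show ?thesis using assms[THEN L2_measurable] by (simp add: L2_def)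
qed

lemma L2_diff: "f \<in> L2 \<Longrightarrow> g \<in> L2 \<Longrightarrow> (\<lambda>x. f x - g x) \<in> L2"
  using L2_add[of f "\<lambda>x. (-1) *\<^sub>R g x"] L2_scaleR[of g "-1"] by simp

lemma L2_integrable_inner:
  assumes "f \<in> L2" "g \<in> L2"
  shows "integrable (lebesgue_on cyl) (\<lambda>x. f x \<bullet> g x)"
  by (rule Bochner_Integration.integrable_bound[OF L2_integrable_norm_mult[OF assms]])
    (use assms[THEN L2_measurable] Cauchy_Schwarz_ineq2 in auto)

lemma L2_integrable:
  assumes "f \<in> L2" shows "integrable (lebesgue_on cyl) f"
  by (rule Bochner_Integration.integrable_bound[OF L2_integrable_norm_mult[OF assms L2_const[of "1::real"]]])
    (use assms[THEN L2_measurable] in auto)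

lemma L2_norm_nonneg [simp]: "0 \<le> L2_norm f"
  by (simp add: L2_norm_def)

lemma L2_norm_sq: "(L2_norm f)\<^sup>2 = (LINT x|lebesgue_on cyl. (norm (f x))\<^sup>2)"
  by (simp add: L2_norm_def)

lemma L2_norm_sq_ip: "(L2_norm f)\<^sup>2 = ip f f"
  by (simp add: L2_norm_sq ip_def dot_square_norm)

lemma ip_commute: "ip f g = ip g f"
  by (simp add: ip_def inner_commute)

lemma ip_add_left: "f \<in> L2 \<Longrightarrow> g \<in> L2 \<Longrightarrow> h \<in> L2 \<Longrightarrow> ip (\<lambda>x. f x + g x) h = ip f h + ip g h"
  by (simp add: ip_def inner_add_left L2_integrable_inner)

lemma ip_diff_left: "f \<in> L2 \<Longrightarrow> g \<in> L2 \<Longrightarrow> h \<in> L2 \<Longrightarrow> ip (\<lambda>x. f x - g x) h = ip f h - ip g h"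
  by (simp add: ip_def inner_diff_left L2_integrable_inner)

lemma ip_diff_right: "f \<in> L2 \<Longrightarrow> g \<in> L2 \<Longrightarrow> h \<in> L2 \<Longrightarrow> ip h (\<lambda>x. f x - g x) = ip h f - ip h g"
  by (simp add: ip_def inner_diff_right L2_integrable_inner)

lemma ip_add_right: "f \<in> L2 \<Longrightarrow> g \<in> L2 \<Longrightarrow> h \<in> L2 \<Longrightarrow> ip h (\<lambda>x. f x + g x) = ip h f + ip h g"
  by (simp add: ip_def inner_add_right L2_integrable_inner)

lemma ip_scaleR_right: "ip h (\<lambda>x. c *\<^sub>R f x) = c * ip h f"
  by (simp add: ip_def)

lemma ip_scaleR_left: "ip (\<lambda>x. c *\<^sub>R f x) h = c * ip f h"
  by (simp add: ip_def)

lemma L2_norm_sq_diff: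
  assumes "f \<in> L2" "g \<in> L2"
  shows "(L2_norm (\<lambda>x. f x - g x))\<^sup>2 = (L2_norm f)\<^sup>2 - 2 * ip f g + (L2_norm g)\<^sup>2"
  unfolding L2_norm_sq_ip
  using assms by (simp add: ip_diff_left ip_diff_right L2_diff ip_commute[of g f])

lemma L2_norm_sq_add:
  assumes "f \<in> L2" "g \<in> L2"
  shows "(L2_norm (\<lambda>x. f x + g x))\<^sup>2 = (L2_norm f)\<^sup>2 + 2 * ip f g + (L2_norm g)\<^sup>2"
  unfolding L2_norm_sq_ip
  using assms by (simp add: ip_add_left ip_add_right L2_add ip_commute[of g f])

lemma discriminant_le:
  fixes a b c :: real
  assumes "\<And>t. 0 \<le> a - 2 * t * b + t\<^sup>2 * c" "0 \<le> c"
  shows "b\<^sup>2 \<le> a * c"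
proof (cases "c = 0")
  case True
  have "b = 0"
  proof (rule ccontr)
    assume "b \<noteq> 0"
    \<comment> \<open>With \<open>c = 0\<close> the expression is affine in \<open>t\<close>, and
      this \<open>t\<close> gives it the value \<open>- 1\<close>.\<close>
    then show False using assms(1)[of "(a + 1) / (2 * b)"] True by (simp add: field_simps)
  qed
  then show ?thesis using True by simp
next
  case False
  have "0 \<le> a - 2 * (b / c) * b + (b / c)\<^sup>2 * c" by (rule assms(1))
  also have "\<dots> = a - b\<^sup>2 / c" using False by (simp add: field_simps power2_eq_square)
  finally show ?thesis using False assms(2) by (simp add: field_simps)
qed

lemma ip_Cauchy_Schwarz:
  assumes "f \<in> L2" "g \<in> L2"
  shows "\<bar>ip f g\<bar> \<le> L2_norm f * L2_norm g"
proof -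
  have "0 \<le> (L2_norm f)\<^sup>2 - 2 * t * ip f g + t\<^sup>2 * (L2_norm g)\<^sup>2" for t
  proof -
    have "0 \<le> (L2_norm (\<lambda>x. f x - t *\<^sub>R g x))\<^sup>2" by simp
    also have "\<dots> = (L2_norm f)\<^sup>2 - 2 * t * ip f g + t\<^sup>2 * (L2_norm g)\<^sup>2"
      using L2_norm_sq_diff[OF assms(1) L2_scaleR[OF assms(2), of t]]
      by (simp only: L2_norm_sq_ip ip_scaleR_left ip_scaleR_right) (simp add: power2_eq_square)
    finally show ?thesis .
  qed
  then have "(ip f g)\<^sup>2 \<le> (L2_norm f)\<^sup>2 * (L2_norm g)\<^sup>2"
    by (intro discriminant_le) auto
  then have "\<bar>ip f g\<bar>\<^sup>2 \<le> (L2_norm f * L2_norm g)\<^sup>2" by (simp add: power_mult_distrib)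
  then show ?thesis by (rule power2_le_imp_le) simp
qed

lemma L2_norm_norm: "L2_norm (\<lambda>x. norm (f x)) = L2_norm f"
  by (simp add: L2_norm_def)

lemma integral_norm_mult_le:
  assumes "f \<in> L2" "g \<in> L2"
  shows "(LINT x|lebesgue_on cyl. norm (f x) * norm (g x)) \<le> L2_norm f * L2_norm g"
  using ip_Cauchy_Schwarz[OF assms[THEN L2_norm_fun]] by (simp add: ip_def L2_norm_norm)

lemma L2_norm_triangle:
  assumes "f \<in> L2" "g \<in> L2"
  shows "L2_norm (\<lambda>x. f x + g x) \<le> L2_norm f + L2_norm g"
proof (rule power2_le_imp_le)
  show "(L2_norm (\<lambda>x. f x + g x))\<^sup>2 \<le> (L2_norm f + L2_norm g)\<^sup>2"
    using ip_Cauchy_Schwarz[OF assms] by (simp add: L2_norm_sq_add[OF assms] power2_sum)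
qed simp

lemma L2_norm_diff_triangle:
  assumes "f \<in> L2" "g \<in> L2" "h \<in> L2"
  shows "L2_norm (\<lambda>x. f x - h x) \<le> L2_norm (\<lambda>x. f x - g x) + L2_norm (\<lambda>x. g x - h x)"
  using L2_norm_triangle[OF L2_diff[OF assms(1,2)] L2_diff[OF assms(2,3)]] by simp

lemma L2_norm_minus_commute: "L2_norm (\<lambda>x. f x - g x) = L2_norm (\<lambda>x. g x - f x)"
  by (simp add: L2_norm_def norm_minus_commute)

lemma L2_norm_cong_AE:
  assumes "f \<in> L2" "g \<in> borel_measurable (lebesgue_on cyl)" "AE x in lebesgue_on cyl. f x = g x"
  shows "L2_norm f = L2_norm g"
  unfolding L2_norm_def
  by (subst integral_cong_AE[of _ _ "\<lambda>x. (norm (g x))\<^sup>2"])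
    (use assms L2_measurable[OF assms(1)] in auto)

lemma ip_cong_AE:
  assumes "f \<in> L2" "g \<in> L2" "h \<in> L2" "AE x in lebesgue_on cyl. f x = g x"
  shows "ip f h = ip g h"
  unfolding ip_def
  by (rule integral_cong_AE) (use assms in \<open>auto dest!: L2_measurable\<close>)

lemma L2_norm_AE_subseq:
  assumes "\<And>n. f n \<in> L2" "g \<in> L2" "(\<lambda>n. L2_norm (\<lambda>x. f n x - g x)) \<longlonglongrightarrow> 0"
  shows "\<exists>r::nat\<Rightarrow>nat. strict_mono r \<and> (AE x in lebesgue_on cyl. (\<lambda>n. f (r n) x) \<longlonglongrightarrow> g x)"
proof -
  have "(\<lambda>n. (L2_norm (\<lambda>x. f n x - g x))\<^sup>2) \<longlonglongrightarrow> 0"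
    using tendsto_power[OF assms(3), of 2] by simp
  then have "(\<lambda>n. LINT x|lebesgue_on cyl. norm ((norm (f n x - g x))\<^sup>2)) \<longlonglongrightarrow> 0"
    by (simp add: L2_norm_sq)
  from tendsto_L1_AE_subseq[OF _ this] obtain r :: "nat \<Rightarrow> nat" where
    r: "strict_mono r" "AE x in lebesgue_on cyl. (\<lambda>n. (norm (f (r n) x - g x))\<^sup>2) \<longlonglongrightarrow> 0"
    using L2_integrable_sq[OF L2_diff[OF assms(1,2)]] by blast
  have "(\<lambda>n. f (r n) x) \<longlonglongrightarrow> g x" if "(\<lambda>n. (norm (f (r n) x - g x))\<^sup>2) \<longlonglongrightarrow> 0" for x
    using tendsto_real_sqrt[OF that] by (simp add: tendsto_norm_zero_iff LIM_zero_iff)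
  then show ?thesis using r by (intro exI[of _ r]) auto
qed

section \<open>Coordinates, integration by parts and weak gradients\<close>

text \<open>The \<open>i\<close>-th coordinate of \<open>coords i j (s, b, c)\<close> is \<open>s\<close>, the \<open>j\<close>-th is \<open>b\<close> and the remaining
  one is \<open>c\<close>.\<close>

definition coords :: "3 \<Rightarrow> 3 \<Rightarrow> real \<times> real \<times> real \<Rightarrow> real^3" where
  "coords i j p = (\<chi> m. if m = i then fst p else if m = j then fst (snd p) else snd (snd p))"

lemma coords_nth: "coords i j (s, b, c) $ m = (if m = i then s else if m = j then b else c)"
  by (simp add: coords_def)

lemma continuous_coords: "continuous_on UNIV (coords i j)"
  unfolding coords_def
proof (rule continuous_on_vec_lambda)
  fix m
  show "continuous_on UNIV (\<lambda>p::real\<times>real\<times>real. if m = i then fst p else if m = j then fst (snd p) else snd (snd p))"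
    by (cases "m = i"; cases "m = j") (auto intro!: continuous_intros)
qed

lemma coords_measurable [measurable]: "coords i j \<in> borel_measurable borel"
  using continuous_coords by (rule borel_measurable_continuous_onI)

lemma third_index:
  fixes i j :: 3 assumes "i \<noteq> j"
  obtains k where "UNIV = {i, j, k}" "k \<noteq> i" "k \<noteq> j"
proof -
  have "card (UNIV - {i, j}) = 1"
    using assms by (subst card_Diff_subset) auto
  then obtain k where k: "UNIV - {i, j} = {k}" by (auto simp: card_1_singleton_iff)
  then have "UNIV = {i, j, k}" "k \<noteq> i" "k \<noteq> j" by auto
  then show ?thesis using that by blast
qed

text \<open>\<open>coords i j\<close> only reorders coordinates: the preimage of a box is a product
  of three intervals with the same lengths, and Lebesgue measure is determined by boxes. Through
  this lemma Fubini's theorem for iterated products is available with any coordinate singled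
  out.\<close>

lemma distr_coords:
  assumes "i \<noteq> j"
  shows "distr lborel borel (coords i j) = lborel"
proof (rule sym, rule lborel_eqI)
  fix l u :: "real^3" assume le: "\<And>b. b \<in> Basis \<Longrightarrow> l \<bullet> b \<le> u \<bullet> b"
  obtain k where k: "UNIV = {i, j, k}" "k \<noteq> i" "k \<noteq> j" using third_index[OF assms] .
  have le': "l $ m \<le> u $ m" for m using le[of "axis m 1"] by (simp add: inner_axis axis_in_Basis_iff)
  have "coords i j -` box l u = {l $ i<..<u $ i} \<times> ({l $ j<..<u $ j} \<times> {l $ k<..<u $ k})"
  proof -
    have all3: "(\<forall>m. P m) \<longleftrightarrow> P i \<and> P j \<and> P k" for P
    proof -
      have "(\<forall>m. P m) \<longleftrightarrow> (\<forall>m\<in>{i, j, k}. P m)" unfolding k(1)[symmetric] by simp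
      then show ?thesis by simp
    qed
    show ?thesis
      unfolding set_eq_iff vimage_eq mem_box_cart all3 using k(2,3) assms by (auto simp: coords_def)
  qed
  then have "emeasure (distr lborel borel (coords i j)) (box l u) =
      emeasure (lborel \<Otimes>\<^sub>M lborel) ({l $ i<..<u $ i} \<times> ({l $ j<..<u $ j} \<times> {l $ k<..<u $ k}))"
    by (simp add: emeasure_distr lborel_prod)
  also have "\<dots> = emeasure lborel {l $ i<..<u $ i} * emeasure lborel ({l $ j<..<u $ j} \<times> {l $ k<..<u $ k})"
    by (intro lborel.emeasure_pair_measure_Times) (auto intro!: borel_open open_Times)
  also have "emeasure lborel ({l $ j<..<u $ j} \<times> {l $ k<..<u $ k}) =
      emeasure (lborel \<Otimes>\<^sub>M lborel) ({l $ j<..<u $ j} \<times> {l $ k<..<u $ k})"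
    by (simp add: lborel_prod)
  also have "\<dots> = emeasure lborel {l $ j<..<u $ j} * emeasure lborel {l $ k<..<u $ k}"
    by (intro lborel.emeasure_pair_measure_Times) auto
  finally have "emeasure (distr lborel borel (coords i j)) (box l u) =
      ennreal (u $ i - l $ i) * (ennreal (u $ j - l $ j) * ennreal (u $ k - l $ k))"
    using le' by simp
  also have "\<dots> = ennreal (\<Prod>m\<in>UNIV. u $ m - l $ m)"
  proof -
    have "(\<Prod>m\<in>UNIV. u $ m - l $ m) = (u $ i - l $ i) * ((u $ j - l $ j) * (u $ k - l $ k))"
      unfolding k(1) using k(2,3) assms by simp
    then show ?thesis using le' by (simp add: ennreal_mult'[symmetric] ennreal_mult[symmetric])
  qed
  also have "(\<Prod>m\<in>UNIV. u $ m - l $ m) = (\<Prod>b\<in>Basis. (u - l) \<bullet> b)"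
  proof -
    have B: "(Basis :: (real^3) set) = (\<lambda>m. axis m 1) ` UNIV"
      by (auto simp: Basis_vec_def)
    have "inj (\<lambda>m::3. axis m (1::real))" by (auto simp: inj_on_def axis_eq_axis)
    then show ?thesis unfolding B by (subst prod.reindex) (auto simp: inner_axis)
  qed
  finally show "emeasure (distr lborel borel (coords i j)) (box l u) = ennreal (\<Prod>b\<in>Basis. (u - l) \<bullet> b)" .
qed simp

lemma nn_integral_coords:
  assumes "i \<noteq> j" and [measurable]: "F \<in> borel_measurable borel"
  shows "(\<integral>\<^sup>+x. F x \<partial>lborel) = (\<integral>\<^sup>+p. F (coords i j p) \<partial>lborel)"
  by (subst distr_coords[OF assms(1), symmetric], subst nn_integral_distr) auto

lemma nn_integral_lborel_pair:
  fixes F :: "'a::euclidean_space \<times> 'b::euclidean_space \<Rightarrow> ennreal"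
  assumes [measurable]: "F \<in> borel_measurable borel"
  shows "(\<integral>\<^sup>+p. F p \<partial>lborel) = (\<integral>\<^sup>+y. \<integral>\<^sup>+x. F (x, y) \<partial>lborel \<partial>lborel)"
    "(\<integral>\<^sup>+p. F p \<partial>lborel) = (\<integral>\<^sup>+x. \<integral>\<^sup>+y. F (x, y) \<partial>lborel \<partial>lborel)"
proof -
  have [measurable]: "F \<in> borel_measurable (lborel \<Otimes>\<^sub>M lborel)" by (simp add: lborel_prod)
  show "(\<integral>\<^sup>+p. F p \<partial>lborel) = (\<integral>\<^sup>+y. \<integral>\<^sup>+x. F (x, y) \<partial>lborel \<partial>lborel)"
    by (subst lborel_prod[symmetric], subst lborel_pair.nn_integral_snd) auto
  show "(\<integral>\<^sup>+p. F p \<partial>lborel) = (\<integral>\<^sup>+x. \<integral>\<^sup>+y. F (x, y) \<partial>lborel \<partial>lborel)"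
    by (subst lborel_prod[symmetric], subst lborel.nn_integral_fst[symmetric]) auto
qed

lemma integral_coords:
  fixes F :: "real^3 \<Rightarrow> real"
  assumes "i \<noteq> j" and int: "integrable lborel F"
  shows "(\<integral>x. F x \<partial>lborel) = (\<integral>p. (\<integral>s. F (coords i j (s, p)) \<partial>lborel) \<partial>lborel)"
proof -
  have [measurable]: "F \<in> borel_measurable borel" using int by auto
  have "integrable (distr lborel borel (coords i j)) F" using int distr_coords[OF assms(1)] by simp
  then have "integrable lborel (\<lambda>p. F (coords i j p))"
    by (subst (asm) integrable_distr_eq) auto
  then have i: "integrable (lborel \<Otimes>\<^sub>M lborel) (case_prod (\<lambda>s p. F (coords i j (s, p))))"
    by (simp add: lborel_prod case_prod_unfold)
  have "(\<integral>x. F x \<partial>lborel) = (\<integral>p. F (coords i j p) \<partial>lborel)"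
    by (subst distr_coords[OF assms(1), symmetric], subst integral_distr) auto
  also have "\<dots> = (\<integral>p. (\<integral>s. F (coords i j (s, p)) \<partial>lborel) \<partial>lborel)"
    using lborel_pair.integral_snd[OF i] by (simp add: lborel_prod case_prod_unfold)
  finally show ?thesis .
qed

lemma cyl_borel [measurable]: "cyl \<in> sets borel"
  using open_cyl by simp

lemma integral_cyl_lborel:
  fixes g :: "real^3 \<Rightarrow> real"
  assumes "g \<in> borel_measurable borel"
  shows "(LINT x|lebesgue_on cyl. g x) = (\<integral>x. indicator cyl x * g x \<partial>lborel)"
  using assms by (simp add: integral_restrict_space integral_completion)

lemma integrable_cyl_lborel:
  fixes g :: "real^3 \<Rightarrow> real"
  assumes "g \<in> borel_measurable borel"
  shows "integrable (lebesgue_on cyl) g \<longleftrightarrow> integrable lborel (\<lambda>x. indicator cyl x * g x)"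
  using assms by (simp add: integrable_restrict_space integrable_completion)

lemma has_derivative_zero_outside:
  assumes "(f has_derivative D) (at x)" "open U" "x \<in> U" "\<And>y. y \<in> U \<Longrightarrow> f y = 0"
  shows "D = (\<lambda>h. 0)"
proof -
  have "((\<lambda>y. 0) has_derivative D) (at x)"
    using has_derivative_transform_within_open[OF assms(1-3)] assms(4) by simp
  then show ?thesis using has_derivative_unique has_derivative_const by blast
qed

lemma has_bochner_FTC_indicator:
  assumes "a \<le> b" "\<And>x. DERIV F x :> f x" "continuous_on UNIV f"
  shows "(\<integral>x. f x * indicator {a..b} x \<partial>lborel) = F b - (F a :: real)"
  by (rule integral_FTC_Icc_real) (use assms in \<open>auto simp: continuous_on_eq_continuous_at\<close>)

text \<open>Integration by parts without boundary terms. On each line parallel to the axis the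
  fundamental theorem leaves two boundary values: in a horizontal direction both are zero because
  \<open>h\<close> vanishes off the disk, in the vertical direction they cancel. As
  \<open>per\<close> relates only the heights \<open>0\<close> and \<open>1\<close>, it holds both
  for periodic fields and for products with a test function that vanishes at top and bottom.\<close>

lemma cyl_integral_deriv_0:
  fixes h :: "real^3 \<Rightarrow> real"
  assumes der: "\<And>x. (h has_derivative D x) (at x)"
    and cont: "continuous_on UNIV (\<lambda>x. D x (axis i 1))"
    and van: "\<And>x. hor x \<notin> disk \<Longrightarrow> h x = 0" "\<And>x. hor x \<notin> disk \<Longrightarrow> D x (axis i 1) = 0"
    and per: "\<And>x y. x $ 1 = y $ 1 \<Longrightarrow> x $ 2 = y $ 2 \<Longrightarrow> x $ 3 = 0 \<Longrightarrow> y $ 3 = 1 \<Longrightarrow> h x = h y"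
  shows "(LINT x|lebesgue_on cyl. D x (axis i 1)) = 0"
proof -
  define g where "g = (\<lambda>x. D x (axis i 1))"
  \<comment> \<open>With this choice the pair \<open>p\<close> starts with the height if the line is
    horizontal, and consists of the two horizontal coordinates if it is vertical.\<close>
  define j :: 3 where "j = (if i = 3 then 1 else 3)"
  have ij: "i \<noteq> j" by (simp add: j_def)
  have gm [measurable]: "g \<in> borel_measurable borel"
    using cont unfolding g_def by (rule borel_measurable_continuous_onI)
  have "integrable (lebesgue_on cyl) g"
    using cont unfolding g_def by (intro L2_integrable L2_continuous)
  then have int: "integrable lborel (\<lambda>x. indicator cyl x * g x)"
    by (simp add: integrable_cyl_lborel)
  have line: "DERIV (\<lambda>s. h (coords i j (s, p))) s :> g (coords i j (s, p))" for s p
  proof -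
    have eq: "coords i j (s, p) = coords i j (0, p) + s *\<^sub>R axis i 1" for s
      by (simp add: vec_eq_iff coords_def axis_def)
    have "((\<lambda>s. coords i j (0, p) + s *\<^sub>R axis i 1) has_derivative (\<lambda>s. s *\<^sub>R axis i 1)) (at s)"
      by (auto intro!: derivative_eq_intros)
    from has_derivative_compose[OF this der]
    have "((\<lambda>s. h (coords i j (0, p) + s *\<^sub>R axis i 1)) has_derivative (\<lambda>r. D (coords i j (0, p) + s *\<^sub>R axis i 1) (r *\<^sub>R axis i 1))) (at s)" .
    moreover have "D x (r *\<^sub>R axis i 1) = g x * r" for r x
      using linear_cmul[OF has_derivative_linear[OF der]] by (simp add: g_def)
    moreover have "(\<lambda>s. h (coords i j (s, p))) = (\<lambda>s. h (coords i j (0, p) + s *\<^sub>R axis i 1))"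
      by (rule ext, rule arg_cong[OF eq])
    moreover have "g (coords i j (s, p)) = g (coords i j (0, p) + s *\<^sub>R axis i 1)"
      by (rule arg_cong[OF eq])
    ultimately show ?thesis
      unfolding has_field_derivative_def by simp
  qed
  have contline: "continuous_on UNIV (\<lambda>s. g (coords i j (s, p)))" for p
    by (rule continuous_on_compose2[OF cont[folded g_def]])
      (auto intro!: continuous_on_compose2[OF continuous_coords] continuous_intros)
  have "(\<integral>s. indicator cyl (coords i j (s, p)) * g (coords i j (s, p)) \<partial>lborel) = 0" for p
  proof -
    obtain b c where p: "p = (b, c)" by (cases p)
    show ?thesis
    proof (cases "i = 3")
      case False
      then have j: "j = 3" by (simp add: j_def)
      have hd: "hor (coords i j (s, p)) \<in> disk \<longleftrightarrow> s\<^sup>2 + c\<^sup>2 < 1" for s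
        using exhaust_3[of i] False j by (auto simp: disk_iff p coords_nth add.commute)
      have hd1: "hor (coords i j (s, p)) \<notin> disk" if "1 \<le> \<bar>s\<bar>" for s
        using one_le_power[OF that, of 2] zero_le_power2[of c] unfolding hd power2_abs by linarith
      have z: "coords i j (s, p) $ 3 = b" for s using ij j by (simp add: p coords_nth)
      show ?thesis
      proof (cases "0 < b \<and> b < 1")
        case True
        \<comment> \<open>The chord of the disk may be replaced by the whole interval from
          \<open>- 1\<close> to \<open>1\<close>, because the derivative vanishes off the disk; the
          end points of that interval do not depend on the line and lie outside the open
          disk.\<close>
        have "indicator cyl (coords i j (s, p)) * g (coords i j (s, p)) = g (coords i j (s, p)) * indicator {-1..1} s" for s
        proof (cases "hor (coords i j (s, p)) \<in> disk")
          case T: True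
          then have "\<bar>s\<bar> \<le> 1" using hd1 by (meson linear)
          then show ?thesis using T True z by (auto simp: cyl_def abs_le_iff)
        next
          case False
          then show ?thesis using van by (simp add: cyl_def g_def)
        qed
        then have "(\<integral>s. indicator cyl (coords i j (s, p)) * g (coords i j (s, p)) \<partial>lborel) =
            (\<integral>s. g (coords i j (s, p)) * indicator {-1..1} s \<partial>lborel)"
          by (simp only:)
        then show ?thesis
          using has_bochner_FTC_indicator[OF _ line contline, of "-1" 1 p] van(1)[OF hd1, of 1] van(1)[OF hd1, of "-1"]
          by simp
      next
        case False
        then have "coords i j (s, p) \<notin> cyl" for s using z by (auto simp: cyl_def)
        then show ?thesis by simp
      qed
    next
      case True
      then have j: "j = 1" by (simp add: j_def)
      have z: "coords i j (s, p) $ 3 = s" "coords i j (s, p) $ 1 = b" "coords i j (s, p) $ 2 = c" for s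
        using True j by (simp_all add: p coords_nth)
      show ?thesis
      proof (cases "b\<^sup>2 + c\<^sup>2 < 1")
        case T: True
        have cy: "coords i j (s, p) \<in> cyl \<longleftrightarrow> 0 < s \<and> s < 1" for s
          using T z by (auto simp: cyl_def disk_iff)
        have "(\<integral>s. indicator cyl (coords i j (s, p)) * g (coords i j (s, p)) \<partial>lborel) =
            (\<integral>s. g (coords i j (s, p)) * indicator {0..1} s \<partial>lborel)"
        proof (rule integral_cong_AE)
          have [measurable]: "(\<lambda>s. g (coords i j (s, p))) \<in> borel_measurable borel"
            using contline by (rule borel_measurable_continuous_onI)
          have "indicator cyl (coords i j (s, p)) = (indicator {0<..<1} s :: real)" for s
            using cy by (auto simp: indicator_def)
          then show "(\<lambda>s. indicator cyl (coords i j (s, p)) * g (coords i j (s, p))) \<in> borel_measurable lborel" by simp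
          show "(\<lambda>s. g (coords i j (s, p)) * indicator {0..1} s) \<in> borel_measurable lborel" by simp
          have "AE s in lborel. s \<noteq> (0::real)" "AE s in lborel. s \<noteq> (1::real)"
            by (rule AE_lborel_singleton)+
          then show "AE s in lborel. indicator cyl (coords i j (s, p)) * g (coords i j (s, p)) = g (coords i j (s, p)) * indicator {0..1} s"
            by eventually_elim (auto simp: indicator_def cy)
        qed
        then show ?thesis
          using has_bochner_FTC_indicator[OF _ line contline, of 0 1 p] per[of "coords i j (0, p)" "coords i j (1, p)"] z
          by simp
      next
        case False
        then have "coords i j (s, p) \<notin> cyl" for s using z by (auto simp: cyl_def disk_iff)
        then show ?thesis by simp
      qed
    qed
  qed
  then have "(\<integral>x. indicator cyl x * g x \<partial>lborel) = 0"
    using integral_coords[OF ij int] by simp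
  then show ?thesis using integral_cyl_lborel[OF gm] by (simp add: g_def)
qed

text \<open>The support is compact in the open disk, so the field vanishes in a neighbourhood of
  every point off the disk, boundary points included; hence so does its derivative.\<close>

lemma D_space_zero_outside:
  assumes "f \<in> D_space" "hor x \<notin> disk"
  shows "f x = 0" "frechet_derivative f (at x) = (\<lambda>h. 0)" "jac f x = 0"
proof -
  obtain K where K: "compact K" "K \<subseteq> disk" "\<forall>x. hor x \<notin> K \<longrightarrow> f x = 0"
    using assms(1) by (auto simp: D_space_def)
  then show "f x = 0" using assms(2) by auto
  have "open (hor -` (- K))"
    unfolding hor_def[abs_def] by (intro open_vimage continuous_intros) (use K compact_imp_closed in auto)
  then show "frechet_derivative f (at x) = (\<lambda>h. 0)"
    using has_derivative_zero_outside[OF smooth_on_UNIV_has_derivative[OF D_spaceD(1)[OF assms(1)]], of "hor -` (- K)" x]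
      K assms(2) by auto
  then show "jac f x = 0" by (simp add: jac_def matrix_def vec_eq_iff)
qed

lemma jac_nth: "jac f x $ i $ j = frechet_derivative f (at x) (axis j 1) $ i"
  by (simp add: jac_def matrix_def)

lemma D_space_has_derivative:
  assumes "f \<in> D_space"
  shows "(f has_derivative frechet_derivative f (at x)) (at x)"
  by (rule smooth_on_UNIV_has_derivative[OF D_spaceD(1)[OF assms]])

lemma D_space_continuous:
  assumes "f \<in> D_space"
  shows "continuous_on UNIV f" "continuous_on UNIV (\<lambda>x. frechet_derivative f (at x) h)" "continuous_on UNIV (jac f)"
proof -
  show "continuous_on UNIV f"
    using D_spaceD(3)[OF assms] differentiable_imp_continuous_on differentiable_on_def
    by (metis differentiable_at_withinI)
  show 2: "continuous_on UNIV (\<lambda>x. frechet_derivative f (at x) h)" for h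
    by (rule smooth_on_UNIV_continuous_derivative[OF D_spaceD(1)[OF assms]])
  have "continuous_on UNIV (\<lambda>x. \<chi> i j. frechet_derivative f (at x) (axis j 1) $ i)"
    by (intro continuous_on_vec_lambda continuous_intros 2)
  then show "continuous_on UNIV (jac f)" by (simp add: jac_def[abs_def] matrix_def)
qed

lemma D_space_L2: "f \<in> D_space \<Longrightarrow> f \<in> L2" "f \<in> D_space \<Longrightarrow> jac f \<in> L2"
  by (auto intro!: L2_continuous D_space_continuous)

lemma scalar_testD:
  assumes "\<psi> \<in> scalar_test"
  shows "(\<psi> has_derivative frechet_derivative \<psi> (at x)) (at x)"
    "continuous_on UNIV \<psi>" "continuous_on UNIV (\<lambda>x. frechet_derivative \<psi> (at x) h)"
    "x \<notin> cyl \<Longrightarrow> \<psi> x = 0" "x \<notin> cyl \<Longrightarrow> frechet_derivative \<psi> (at x) = (\<lambda>h. 0)"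
proof -
  have s: "smooth_on UNIV \<psi>" using assms by (simp add: scalar_test_def)
  show d: "(\<psi> has_derivative frechet_derivative \<psi> (at x)) (at x)" for x
    by (rule smooth_on_UNIV_has_derivative[OF s])
  show "continuous_on UNIV \<psi>"
    by (rule has_derivative_continuous_on) (rule has_derivative_at_withinI[OF d])
  show "continuous_on UNIV (\<lambda>x. frechet_derivative \<psi> (at x) h)"
    by (rule smooth_on_UNIV_continuous_derivative[OF s])
  obtain K where K: "compact K" "K \<subseteq> cyl" "\<forall>x. x \<notin> K \<longrightarrow> \<psi> x = 0"
    using assms by (auto simp: scalar_test_def)
  then show "x \<notin> cyl \<Longrightarrow> \<psi> x = 0" by auto
  have "open (- K)" using K compact_imp_closed by auto
  then show "x \<notin> cyl \<Longrightarrow> frechet_derivative \<psi> (at x) = (\<lambda>h. 0)"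
    using has_derivative_zero_outside[OF d, of "- K" x] K by auto
qed

lemma L2_nth:
  assumes "(f :: real^3 \<Rightarrow> 'b::euclidean_space^'n) \<in> L2"
  shows "(\<lambda>x. f x $ i) \<in> L2"
proof (rule L2_boundI[OF _ assms])
  show "(\<lambda>x. f x $ i) \<in> borel_measurable (lebesgue_on cyl)"
    by (rule borel_measurable_continuous_on[OF _ L2_measurable[OF assms]]) (intro continuous_intros)
qed (use Finite_Cartesian_Product.norm_nth_le in auto)

section \<open>Weak gradients and their uniqueness\<close>

lemma jac_weak_gradient:
  assumes f: "f \<in> D_space"
  shows "weak_gradient f (jac f)"
  unfolding weak_gradient_def
proof (intro ballI allI)
  fix \<psi> i j assume \<psi>: "\<psi> \<in> scalar_test"
  define D where "D = (\<lambda>x h. f x $ i * frechet_derivative \<psi> (at x) h + frechet_derivative f (at x) h $ i * \<psi> x)"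
  have [simp]: "hor x \<notin> disk \<Longrightarrow> x \<notin> cyl" "x $ 3 = 0 \<Longrightarrow> x \<notin> cyl" "x $ 3 = 1 \<Longrightarrow> x \<notin> cyl" for x
    by (auto simp: cyl_def)
  have "(LINT x|lebesgue_on cyl. D x (axis j 1)) = 0"
  proof (rule cyl_integral_deriv_0[of "\<lambda>x. f x $ i * \<psi> x"])
    show "((\<lambda>x. f x $ i * \<psi> x) has_derivative D x) (at x)" for x
      unfolding D_def
      by (auto intro!: derivative_eq_intros D_space_has_derivative[OF f] scalar_testD(1)[OF \<psi>] bounded_linear.has_derivative[OF bounded_linear_vec_nth])
    show "continuous_on UNIV (\<lambda>x. D x (axis j 1))"
      unfolding D_def by (intro continuous_intros D_space_continuous[OF f] scalar_testD[OF \<psi>])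
  qed (auto simp: D_def scalar_testD(4,5)[OF \<psi>])
  moreover have "(LINT x|lebesgue_on cyl. D x (axis j 1)) =
      (LINT x|lebesgue_on cyl. f x $ i * partial j \<psi> x) + (LINT x|lebesgue_on cyl. jac f x $ i $ j * \<psi> x)"
    unfolding D_def partial_def jac_nth
    by (intro Bochner_Integration.integral_add L2_integrable L2_continuous continuous_intros D_space_continuous[OF f] scalar_testD[OF \<psi>])
  ultimately show "(LINT x|lebesgue_on cyl. f x $ i * partial j \<psi> x) = - (LINT x|lebesgue_on cyl. jac f x $ i $ j * \<psi> x)"
    by simp
qed

lemma D_space_H1: "f \<in> D_space \<Longrightarrow> f \<in> H1"
  using D_space_L2 jac_weak_gradient by (auto simp: H1_def)

lemma wgrad_props:
  assumes "f \<in> H1" shows "wgrad f \<in> L2" "weak_gradient f (wgrad f)"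
proof -
  have "\<exists>G. G \<in> L2 \<and> weak_gradient f G" using assms by (auto simp: H1_def)
  from someI_ex[OF this] show "wgrad f \<in> L2" "weak_gradient f (wgrad f)" by (simp_all add: wgrad_def)
qed

text \<open>Boxes are stable under intersection and generate the Borel sets, so the vanishing of the
  integrals spreads to all Borel subsets of a box by a Dynkin system argument, in particular to the
  sets where \<open>g\<close> is positive or negative. One box is treated at a time because the
  argument needs the integral over the whole space to vanish, which is given for boxes in
  \<open>S\<close> and not for \<open>S\<close>; countably many boxes then cover
  \<open>S\<close>.\<close>

lemma AE_zero_of_box_integrals:
  fixes g :: "'a::euclidean_space \<Rightarrow> real"
  assumes int: "integrable lborel g" and S: "open S"
    and box: "\<And>a b. box a b \<subseteq> S \<Longrightarrow> (\<integral>x. indicator (box a b) x * g x \<partial>lborel) = 0"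
  shows "AE x in lborel. x \<in> S \<longrightarrow> g x = 0"
proof -
  have [measurable]: "g \<in> borel_measurable borel" using int by auto
  have inti: "integrable lborel (\<lambda>x. indicator A x * g x)" if "A \<in> sets borel" for A
    using integrable_mult_indicator[OF _ int, of A] that by simp
  have B: "AE x in lborel. x \<in> box l u \<longrightarrow> g x = 0" if lu: "box l u \<subseteq> S" for l u
  proof -
    define G where "G = {box a b | a b :: 'a. box a b \<subseteq> box l u}"
    have key: "A \<in> sets borel \<and> (\<integral>x. indicator A x * g x \<partial>lborel) = 0"
      if "A \<in> sigma_sets (box l u) G" for A
    proof (rule sigma_sets_induct_disjoint[of G "box l u" A])
      show "Int_stable G"
        unfolding Int_stable_def
      proof (intro ballI)
        fix X Y assume "X \<in> G" "Y \<in> G"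
        then obtain a b c d where XY: "X = box a b" "Y = box c d" "X \<subseteq> box l u" by (auto simp: G_def)
        have "\<exists>p q. X \<inter> Y = box p q" unfolding XY box_Int_box by blast
        then show "X \<inter> Y \<in> G" using XY(3) by (auto simp: G_def)
      qed
      show "G \<subseteq> Pow (box l u)" by (auto simp: G_def)
      show "A \<in> sigma_sets (box l u) G" by fact
      show "A \<in> sets borel \<and> (\<integral>x. indicator A x * g x \<partial>lborel) = 0" if "A \<in> G" for A
        using that box lu by (auto simp: G_def)
      show "{} \<in> sets borel \<and> (\<integral>x. indicator {} x * g x \<partial>lborel) = 0" by simp
    next
      fix A assume A: "A \<in> sigma_sets (box l u) G" "A \<in> sets borel \<and> (\<integral>x. indicator A x * g x \<partial>lborel) = 0"
      then have sub: "A \<subseteq> box l u"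
        using sigma_sets_into_sp[of G "box l u" A] by (auto simp: G_def)
      have "(\<integral>x. indicator (box l u - A) x * g x \<partial>lborel) =
          (\<integral>x. indicator (box l u) x * g x - indicator A x * g x \<partial>lborel)"
        by (intro Bochner_Integration.integral_cong) (use sub in \<open>auto simp: indicator_def\<close>)
      also have "\<dots> = 0"
        using A inti box[OF lu] by (subst Bochner_Integration.integral_diff) auto
      finally show "box l u - A \<in> sets borel \<and> (\<integral>x. indicator (box l u - A) x * g x \<partial>lborel) = 0"
        using A by auto
    next
      fix A :: "nat \<Rightarrow> 'a set" assume A: "disjoint_family A" "range A \<subseteq> sigma_sets (box l u) G"
        "\<And>i. A i \<in> sets borel \<and> (\<integral>x. indicator (A i) x * g x \<partial>lborel) = 0"
      have "(\<integral>x. indicator (\<Union>i. A i) x * g x \<partial>lborel) = (LINT x:(\<Union>i. A i)|lborel. g x)"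
        by (simp add: set_lebesgue_integral_def)
      also have "\<dots> = (\<Sum>i. (LINT x:A i|lborel. g x))"
        by (rule lebesgue_integral_countable_add)
          (use A inti[of "\<Union>i. A i"] sets.countable_UN''[of UNIV A borel] in
            \<open>auto simp: disjoint_family_on_def set_integrable_def\<close>)
      also have "\<dots> = 0" using A(3) by (simp add: set_lebesgue_integral_def)
      finally show "(\<Union>i. A i) \<in> sets borel \<and> (\<integral>x. indicator (\<Union>i. A i) x * g x \<partial>lborel) = 0"
        using A(3) by auto
    qed
    have sig: "A \<in> sigma_sets (box l u) G" if "A \<in> sets borel" "A \<subseteq> box l u" for A
    proof -
      have "A \<in> (\<inter>) (box l u) ` sigma_sets UNIV {U. open U}"
        using that by (intro image_eqI[of _ _ A]) (auto simp: sets_borel)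
      also have "\<dots> = sigma_sets (box l u) ((\<inter>) (box l u) ` {U. open U})"
        by (rule sigma_sets_Int) (auto simp: sets_borel[symmetric])
      also have "\<dots> \<subseteq> sigma_sets (box l u) G"
      proof (rule sigma_sets_mono, rule subsetI)
        fix V assume "V \<in> (\<inter>) (box l u) ` {U. open U}"
        then have V: "open V" "V \<subseteq> box l u" by auto
        obtain \<D> where D: "countable \<D>" "\<D> \<subseteq> Pow V" "\<And>X. X \<in> \<D> \<Longrightarrow> \<exists>a b. X = box a b" "\<Union>\<D> = V"
          using open_countable_Union_open_box[OF V(1)] by metis
        have "\<Union>\<D> \<in> sigma_sets (box l u) G"
        proof (rule sigma_sets_UNION[OF D(1)])
          fix X assume "X \<in> \<D>"
          then obtain a b where "X = box a b" "X \<subseteq> V" using D by blast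
          then show "X \<in> sigma_sets (box l u) G" using V by (auto simp: G_def intro!: sigma_sets.Basic)
        qed
        then show "V \<in> sigma_sets (box l u) G" using D by simp
      qed
      finally show ?thesis .
    qed
    have z: "(\<integral>x. indicator A x * g x \<partial>lborel) = 0" if "A \<in> sets borel" "A \<subseteq> box l u" for A
      using key[OF sig[OF that]] by simp
    define P where "P = {x \<in> box l u. g x > 0}"
    define N where "N = {x \<in> box l u. g x < 0}"
    have [measurable]: "P \<in> sets borel" "N \<in> sets borel" unfolding P_def N_def by measurable
    have "AE x in lborel. indicator P x * g x = 0"
      using integral_nonneg_eq_0_iff_AE[OF inti[of P]] z[of P] by (auto simp: P_def indicator_def)
    moreover have "AE x in lborel. - (indicator N x * g x) = 0"
      using integral_nonneg_eq_0_iff_AE[OF integrable_minus[OF inti[of N]]] z[of N] by (auto simp: N_def indicator_def)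
    ultimately show ?thesis
      by eventually_elim (auto simp: P_def N_def indicator_def split: if_splits)
  qed
  obtain \<D> where D: "countable \<D>" "\<D> \<subseteq> Pow S" "\<And>X. X \<in> \<D> \<Longrightarrow> \<exists>a b. X = box a b" "\<Union>\<D> = S"
    using open_countable_Union_open_box[OF S] by metis
  have "AE x in lborel. \<forall>X\<in>\<D>. x \<in> X \<longrightarrow> g x = 0"
    using D B by (intro AE_ball_countable'[OF _ D(1)]) (metis Pow_iff subsetD)
  then show ?thesis by eventually_elim (use D(4) in auto)
qed

lemma AE_cyl_iff: "(AE x in lebesgue_on cyl. P x) \<longleftrightarrow> (AE x in lebesgue. x \<in> cyl \<longrightarrow> P x)"
  by (simp add: AE_restrict_space_iff)

text \<open>The bump functions of a box are bounded by \<open>1\<close> and converge to its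
  indicator, so dominated convergence reduces the claim to integrals over boxes. The passage to a
  Borel version \<open>g'\<close> is needed because \<open>g\<close> is only Lebesgue
  measurable.\<close>

lemma fundamental_lemma:
  fixes g :: "real^3 \<Rightarrow> real"
  assumes g: "g \<in> L2" and z: "\<And>\<psi>. \<psi> \<in> scalar_test \<Longrightarrow> (LINT x|lebesgue_on cyl. g x * \<psi> x) = 0"
  shows "AE x in lebesgue_on cyl. g x = 0"
proof -
  have gi: "integrable lebesgue (\<lambda>x. indicator cyl x * g x)"
    using L2_integrable[OF g] by (simp add: integrable_restrict_space)
  then obtain g' where g'[measurable]: "g' \<in> borel_measurable borel"
    and ae: "AE x in lborel. indicator cyl x * g x = g' x"
    using completion_ex_borel_measurable_real[of "\<lambda>x. indicator cyl x * g x" lborel] by auto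
  have ae': "AE x in lebesgue. indicator cyl x * g x = g' x" using ae by (rule AE_completion)
  have "integrable lebesgue g'"
    by (rule integrable_cong_AE_imp[OF gi]) (use ae' in \<open>auto intro: measurable_completion\<close>)
  then have int: "integrable lborel g'" by (simp add: integrable_completion)
  have "AE x in lborel. x \<in> cyl \<longrightarrow> g' x = 0"
  proof (rule AE_zero_of_box_integrals[OF int open_cyl])
    fix a b :: "real^3" assume ab: "box a b \<subseteq> cyl"
    have bm [measurable]: "bump a b n \<in> borel_measurable borel" for n
      using scalar_testD(2)[OF bump_scalar_test[OF ab]] by (rule borel_measurable_continuous_onI)
    have "(\<lambda>n. \<integral>x. bump a b n x * g' x \<partial>lborel) \<longlonglongrightarrow> (\<integral>x. indicator (box a b) x * g' x \<partial>lborel)"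
    proof (rule integral_dominated_convergence)
      show "integrable lborel (\<lambda>x. norm (g' x))" using int by simp
      show "AE x in lborel. (\<lambda>n. bump a b n x * g' x) \<longlonglongrightarrow> indicator (box a b) x * g' x"
        by (intro AE_I2 tendsto_mult bump_tendsto tendsto_const)
      show "AE x in lborel. norm (bump a b n x * g' x) \<le> norm (g' x)" for n
        by (intro AE_I2) (simp add: abs_mult mult_left_le_one_le bump_bounds)
    qed auto
    moreover have "(\<integral>x. bump a b n x * g' x \<partial>lborel) = 0" for n
    proof -
      have bl: "bump a b n \<in> borel_measurable lebesgue" by (rule measurable_completion) simp
      have "(\<integral>x. bump a b n x * g' x \<partial>lborel) = (\<integral>x. bump a b n x * g' x \<partial>lebesgue)"
        by (simp add: integral_completion)
      also have "\<dots> = (\<integral>x. indicator cyl x * (g x * bump a b n x) \<partial>lebesgue)"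
      proof (rule integral_cong_AE)
        show "(\<lambda>x. bump a b n x * g' x) \<in> borel_measurable lebesgue" by (rule measurable_completion) simp
        have "(\<lambda>x. (indicator cyl x * g x) * bump a b n x) \<in> borel_measurable lebesgue"
          by (rule borel_measurable_times[OF borel_measurable_integrable[OF gi] bl])
        then show "(\<lambda>x. indicator cyl x * (g x * bump a b n x)) \<in> borel_measurable lebesgue"
          by (simp add: mult.assoc)
        show "AE x in lebesgue. bump a b n x * g' x = indicator cyl x * (g x * bump a b n x)"
          using ae' by eventually_elim (auto simp: mult_ac)
      qed
      also have "\<dots> = (LINT x|lebesgue_on cyl. g x * bump a b n x)"
        by (simp add: integral_restrict_space)
      also have "\<dots> = 0" by (rule z[OF bump_scalar_test[OF ab]])
      finally show ?thesis .
    qed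
    ultimately show "(\<integral>x. indicator (box a b) x * g' x \<partial>lborel) = 0"
      by (simp add: LIMSEQ_const_iff)
  qed
  with ae have "AE x in lborel. x \<in> cyl \<longrightarrow> g x = 0" by eventually_elim auto
  then show ?thesis unfolding AE_cyl_iff by (rule AE_completion)
qed

lemma scalar_test_L2:
  assumes "\<psi> \<in> scalar_test" shows "\<psi> \<in> L2" "partial j \<psi> \<in> L2"
  unfolding partial_def[abs_def] by (intro L2_continuous scalar_testD[OF assms])+

lemma L2_integrable_times:
  fixes f g :: "real^3 \<Rightarrow> real"
  assumes "f \<in> L2" "g \<in> L2"
  shows "integrable (lebesgue_on cyl) (\<lambda>x. f x * g x)"
  using L2_integrable_inner[OF assms] by simp

text \<open>\<open>wgrad\<close> is an arbitrary choice among weak gradients; uniqueness is what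
  makes it linear on differences and equal to the Jacobian on smooth fields, up to null
  sets.\<close>

lemma weak_gradient_unique:
  assumes "G \<in> L2" "G' \<in> L2" "weak_gradient f G" "weak_gradient f G'"
  shows "AE x in lebesgue_on cyl. G x = G' x"
proof -
  have L: "(\<lambda>x. F x $ i $ j) \<in> L2" if "F \<in> L2" for F :: "real^3 \<Rightarrow> real^3^3" and i j
    using L2_nth[OF L2_nth[OF that, of i], of j] .
  have "AE x in lebesgue_on cyl. G x $ i $ j - G' x $ i $ j = 0" for i j
  proof (rule fundamental_lemma)
    show "(\<lambda>x. G x $ i $ j - G' x $ i $ j) \<in> L2" by (intro L2_diff L assms)
    fix \<psi> assume "\<psi> \<in> scalar_test"
    moreover from this have "integrable (lebesgue_on cyl) (\<lambda>x. F x $ i $ j * \<psi> x)" if "F \<in> L2" for F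
      by (intro L2_integrable_times L scalar_test_L2 that)
    ultimately show "(LINT x|lebesgue_on cyl. (G x $ i $ j - G' x $ i $ j) * \<psi> x) = 0"
      using assms unfolding weak_gradient_def by (simp add: left_diff_distrib)
  qed
  then have "AE x in lebesgue_on cyl. \<forall>i\<in>UNIV. \<forall>j\<in>UNIV. G x $ i $ j - G' x $ i $ j = 0"
    by (intro AE_ball_countable') auto
  then show ?thesis by eventually_elim (simp add: vec_eq_iff)
qed

lemma weak_gradient_diff:
  assumes "f \<in> L2" "g \<in> L2" "F \<in> L2" "G \<in> L2" "weak_gradient f F" "weak_gradient g G"
  shows "weak_gradient (\<lambda>x. f x - g x) (\<lambda>x. F x - G x)"
  unfolding weak_gradient_def
proof (intro ballI allI)
  fix \<psi> i j assume \<psi>: "\<psi> \<in> scalar_test"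
  have L: "(\<lambda>x. F x $ i $ j) \<in> L2" if "F \<in> L2" for F :: "real^3 \<Rightarrow> real^3^3" and i j
    using L2_nth[OF L2_nth[OF that, of i], of j] .
  show "(LINT x|lebesgue_on cyl. (f x - g x) $ i * partial j \<psi> x) =
      - (LINT x|lebesgue_on cyl. (F x - G x) $ i $ j * \<psi> x)"
    using assms \<psi> scalar_test_L2[OF \<psi>] unfolding weak_gradient_def
    by (simp add: left_diff_distrib L2_integrable_times L2_nth L)
qed

lemma H1_L2: "f \<in> H1 \<Longrightarrow> f \<in> L2"
  by (simp add: H1_def)

lemma H1_diff: "f \<in> H1 \<Longrightarrow> g \<in> H1 \<Longrightarrow> (\<lambda>x. f x - g x) \<in> H1"
  using weak_gradient_diff[of f g "wgrad f" "wgrad g"] wgrad_props[of f] wgrad_props[of g]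
    L2_diff[of f g] L2_diff[of "wgrad f" "wgrad g"]
  by (auto simp: H1_def)

lemma wgrad_diff:
  assumes "f \<in> H1" "g \<in> H1"
  shows "AE x in lebesgue_on cyl. wgrad (\<lambda>x. f x - g x) x = wgrad f x - wgrad g x"
  by (rule weak_gradient_unique[OF wgrad_props(1)[OF H1_diff[OF assms]] _ wgrad_props(2)[OF H1_diff[OF assms]]])
    (intro L2_diff weak_gradient_diff wgrad_props assms H1_L2)+

lemma wgrad_D_space:
  assumes "f \<in> D_space"
  shows "AE x in lebesgue_on cyl. wgrad f x = jac f x"
  by (rule weak_gradient_unique[OF wgrad_props(1) D_space_L2(2) wgrad_props(2) jac_weak_gradient])
    (use assms D_space_H1 in auto)

section \<open>The Ladyzhenskaya inequality on horizontal slices\<close>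

text \<open>For these functions the integral over a horizontal slice exists at every height and not
  merely at almost every one, so slicewise inequalities can be stated pointwise in
  \<open>c\<close>.\<close>

definition cts_disk :: "(real^3 \<Rightarrow> real) \<Rightarrow> bool" where
  "cts_disk F \<longleftrightarrow> continuous_on UNIV F \<and> (\<forall>x. hor x \<notin> disk \<longrightarrow> F x = 0)"

abbreviation sl :: "real \<Rightarrow> real \<times> real \<Rightarrow> real^3" where
  "sl c p \<equiv> coords 3 1 (c, p)"

definition slice :: "(real^3 \<Rightarrow> real) \<Rightarrow> real \<Rightarrow> real" where
  "slice F c = (\<integral>p. F (sl c p) \<partial>lborel)"

lemma sl_nth [simp]: "sl c (a, b) $ 1 = a" "sl c (a, b) $ 2 = b" "sl c p $ 3 = c"
  by (simp_all add: coords_def)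

lemma sl_eq: "coords 1 2 (a, b, c) = sl c (a, b)" "coords 2 1 (b, a, c) = sl c (a, b)"
  by (simp_all add: vec_eq_iff forall_3 coords_nth)

lemma hor_sl: "hor (sl c p) = p"
  by (cases p) (simp add: hor_def)

lemma sl_in_cyl: "sl c p \<in> cyl \<longleftrightarrow> p \<in> disk \<and> 0 < c \<and> c < 1"
  by (simp add: cyl_def hor_sl)

lemma continuous_sl: "continuous_on UNIV (\<lambda>p. sl c p)"
  by (intro continuous_on_compose2[OF continuous_coords] continuous_intros) auto

lemma continuous_on_sl: "continuous_on UNIV F \<Longrightarrow> continuous_on UNIV (\<lambda>p. F (sl c p))"
  by (rule continuous_on_compose2[OF _ continuous_sl]) auto

lemma cts_disk_continuous: "cts_disk F \<Longrightarrow> continuous_on UNIV F"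
  by (simp add: cts_disk_def)

lemma cts_disk_measurable: "cts_disk F \<Longrightarrow> F \<in> borel_measurable borel"
  by (simp add: cts_disk_def borel_measurable_continuous_onI)

lemma cts_disk_mult: "cts_disk F \<Longrightarrow> continuous_on UNIV G \<Longrightarrow> cts_disk (\<lambda>x. F x * G x)"
  by (auto simp: cts_disk_def intro!: continuous_intros)

lemma disk_subset: "disk \<subseteq> cbox (-1, -1) (1, 1)"
proof
  fix p :: "real \<times> real" assume "p \<in> disk"
  then have "norm p < 1" by (simp add: disk_def)
  moreover have "\<bar>fst p\<bar> \<le> norm p" "\<bar>snd p\<bar> \<le> norm p"
    using norm_fst_le[of "fst p" "snd p"] norm_snd_le[of "snd p" "fst p"] by simp_all
  ultimately have "\<bar>fst p\<bar> \<le> 1" "\<bar>snd p\<bar> \<le> 1" by linarith+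
  then show "p \<in> cbox (-1, -1) (1, 1)"
    by (cases p) (auto simp: abs_le_iff)
qed

lemma slice_integrable:
  assumes "cts_disk F"
  shows "integrable lborel (\<lambda>p. F (sl c p))"
proof -
  have "continuous_on UNIV (\<lambda>p. F (sl c p))"
    using assms by (intro continuous_on_compose2[OF _ continuous_sl]) (auto simp: cts_disk_def)
  then have "integrable lborel (\<lambda>p. indicator (cbox (-1, -1) (1, 1)) p *\<^sub>R F (sl c p))"
    by (intro borel_integrable_compact) (auto intro: continuous_on_subset)
  moreover have "indicator (cbox (-1, -1) (1, 1)) p *\<^sub>R F (sl c p) = F (sl c p)" for p
    using disk_subset assms by (auto simp: cts_disk_def hor_sl indicator_def)
  ultimately show ?thesis by (simp only:)
qed

lemma slice_nonneg: "(\<And>x. 0 \<le> F x) \<Longrightarrow> 0 \<le> slice F c"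
  by (simp add: slice_def)

lemma slice_mono: "cts_disk F \<Longrightarrow> cts_disk G \<Longrightarrow> (\<And>x. F x \<le> G x) \<Longrightarrow> slice F c \<le> slice G c"
  unfolding slice_def by (intro integral_mono slice_integrable)

lemma slice_add: "cts_disk F \<Longrightarrow> cts_disk G \<Longrightarrow> slice (\<lambda>x. F x + G x) c = slice F c + slice G c"
  by (simp add: slice_def slice_integrable)

lemma slice_mult: "slice (\<lambda>x. k * F x) c = k * slice F c"
  by (simp add: slice_def)

lemma nn_integral_slice:
  assumes "cts_disk F" "\<And>x. 0 \<le> F x"
  shows "(\<integral>\<^sup>+p. ennreal (F (sl c p)) \<partial>lborel) = ennreal (slice F c)"
  unfolding slice_def by (rule nn_integral_eq_integral[OF slice_integrable[OF assms(1)]]) (simp add: assms)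

lemma slice_measurable:
  assumes "cts_disk F"
  shows "slice F \<in> borel_measurable borel"
proof -
  note [measurable] = cts_disk_measurable[OF assms]
  have "(\<lambda>q. F (coords 3 1 q)) \<in> borel_measurable (borel :: (real \<times> real \<times> real) measure)" by measurable
  moreover have "sets ((borel :: real measure) \<Otimes>\<^sub>M (lborel :: (real \<times> real) measure)) = sets borel"
    by (metis borel_prod sets_lborel sets_pair_measure_cong)
  ultimately have "(\<lambda>q. F (coords 3 1 q)) \<in> borel_measurable (borel \<Otimes>\<^sub>M lborel :: (real \<times> real \<times> real) measure)"
    using measurable_cong_sets by blast
  then show ?thesis unfolding slice_def[abs_def] by measurable
qed

lemma slice_Cauchy_Schwarz:
  assumes "cts_disk F" "cts_disk G"
  shows "(slice (\<lambda>x. F x * G x) c)\<^sup>2 \<le> slice (\<lambda>x. (F x)\<^sup>2) c * slice (\<lambda>x. (G x)\<^sup>2) c"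
proof (rule discriminant_le)
  have c: "continuous_on UNIV F" "continuous_on UNIV G" using assms by (auto simp: cts_disk_def)
  note i = slice_integrable[OF cts_disk_mult[OF assms(1) c(2)], of c]
    slice_integrable[OF cts_disk_mult[OF assms(1) c(1)], of c] slice_integrable[OF cts_disk_mult[OF assms(2) c(2)], of c]
  fix t
  have "0 \<le> (\<integral>p. (F (sl c p) - t * G (sl c p))\<^sup>2 \<partial>lborel)" by simp
  also have "\<dots> = (\<integral>p. F (sl c p) * F (sl c p) - (2 * t) * (F (sl c p) * G (sl c p)) + t\<^sup>2 * (G (sl c p) * G (sl c p)) \<partial>lborel)"
    by (intro Bochner_Integration.integral_cong) (auto simp: power2_eq_square algebra_simps)
  also have "\<dots> = slice (\<lambda>x. (F x)\<^sup>2) c - 2 * t * slice (\<lambda>x. F x * G x) c + t\<^sup>2 * slice (\<lambda>x. (G x)\<^sup>2) c"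
    using i by (simp add: slice_def power2_eq_square)
  finally show "0 \<le> slice (\<lambda>x. (F x)\<^sup>2) c - 2 * t * slice (\<lambda>x. F x * G x) c + t\<^sup>2 * slice (\<lambda>x. (G x)\<^sup>2) c" .
qed (simp add: slice_nonneg)

lemma integral_slices:
  assumes "cts_disk F"
  shows "(LINT x|lebesgue_on cyl. F x) = (\<integral>c. indicator {0<..<1} c * slice F c \<partial>lborel)"
    and "integrable lborel (\<lambda>c. indicator {0<..<1} c * slice F c)"
proof -
  note [measurable] = cts_disk_measurable[OF assms]
  have "integrable (lebesgue_on cyl) F"
    using assms by (intro L2_integrable L2_continuous) (simp add: cts_disk_def)
  then have "integrable lborel (\<lambda>x. indicator cyl x * F x)" by (simp add: integrable_cyl_lborel)
  then have "integrable (distr lborel borel (coords 3 1)) (\<lambda>x. indicator cyl x * F x)" using distr_coords[of 3 1] by simp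
  then have "integrable lborel (\<lambda>q. indicator cyl (coords 3 1 q) * F (coords 3 1 q))"
    by (subst (asm) integrable_distr_eq) auto
  then have i: "integrable (lborel \<Otimes>\<^sub>M lborel) (case_prod (\<lambda>c p. indicator cyl (sl c p) * F (sl c p)))"
    by (simp add: lborel_prod case_prod_unfold)
  have eq: "(\<integral>p. indicator cyl (sl c p) * F (sl c p) \<partial>lborel) = indicator {0<..<1} c * slice F c" for c
  proof -
    have "indicator cyl (sl c p) * F (sl c p) = indicator {0<..<1} c * F (sl c p)" for p
      using assms by (auto simp: indicator_def sl_in_cyl cts_disk_def hor_sl)
    then have "(\<integral>p. indicator cyl (sl c p) * F (sl c p) \<partial>lborel) = (\<integral>p. indicator {0<..<1} c * F (sl c p) \<partial>lborel)"
      by (simp only:)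
    then show ?thesis by (simp add: slice_def)
  qed
  have "(LINT x|lebesgue_on cyl. F x) = (\<integral>x. indicator cyl x * F x \<partial>lborel)"
    by (rule integral_cyl_lborel) simp
  also have "\<dots> = (\<integral>q. indicator cyl (coords 3 1 q) * F (coords 3 1 q) \<partial>lborel)"
    by (subst distr_coords[of 3 1, symmetric], simp, subst integral_distr) auto
  also have "\<dots> = (\<integral>c. indicator {0<..<1} c * slice F c \<partial>lborel)"
    using lborel_pair.integral_fst[OF i] by (simp add: lborel_prod case_prod_unfold eq)
  finally show "(LINT x|lebesgue_on cyl. F x) = (\<integral>c. indicator {0<..<1} c * slice F c \<partial>lborel)" .
  show "integrable lborel (\<lambda>c. indicator {0<..<1} c * slice F c)"
    using lborel_pair.integrable_fst[OF i] by (simp add: eq)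
qed

section \<open>Inequalities for smooth fields on lines and slices\<close>

definition pd :: "3 \<Rightarrow> (real^3 \<Rightarrow> real^3) \<Rightarrow> real^3 \<Rightarrow> real^3" where
  "pd i f x = frechet_derivative f (at x) (axis i 1)"

lemma jac_pd: "jac f x $ k $ i = pd i f x $ k"
  by (simp add: jac_nth pd_def)

lemma norm_jac_sq: "(norm (jac f x))\<^sup>2 = (norm (pd 1 f x))\<^sup>2 + (norm (pd 2 f x))\<^sup>2 + (norm (pd 3 f x))\<^sup>2"
proof -
  have "(norm v)\<^sup>2 = (v $ 1)\<^sup>2 + (v $ 2)\<^sup>2 + (v $ 3)\<^sup>2" for v :: "real^3"
    by (simp add: norm_vec_def L2_set_def sum_3 real_sqrt_pow2)
  moreover have "(norm M)\<^sup>2 = (norm (M $ 1))\<^sup>2 + (norm (M $ 2))\<^sup>2 + (norm (M $ 3))\<^sup>2" for M :: "real^3^3"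
    by (simp add: norm_vec_def[of M] L2_set_def sum_3)
  ultimately show ?thesis by (simp add: jac_pd)
qed

lemma norm_pd_le: "norm (pd i f x) \<le> norm (jac f x)"
proof (rule power2_le_imp_le)
  show "(norm (pd i f x))\<^sup>2 \<le> (norm (jac f x))\<^sup>2"
    unfolding norm_jac_sq using exhaust_3[of i] by auto
qed simp

lemma pd_D_space:
  assumes "f \<in> D_space"
  shows "continuous_on UNIV (pd i f)" "hor x \<notin> disk \<Longrightarrow> pd i f x = 0"
  unfolding pd_def[abs_def] using D_space_continuous(2)[OF assms] D_space_zero_outside[OF assms] by auto

lemma cts_disk_D_space:
  assumes "f \<in> D_space"
  shows "cts_disk (\<lambda>x. norm (f x) * norm (pd i f x))" "n > 0 \<Longrightarrow> cts_disk (\<lambda>x. norm (f x) ^ n)"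
    "n > 0 \<Longrightarrow> cts_disk (\<lambda>x. norm (pd i f x) ^ n)" "n > 0 \<Longrightarrow> cts_disk (\<lambda>x. norm (jac f x) ^ n)"
    "cts_disk (\<lambda>x. norm (f x))" "cts_disk (\<lambda>x. norm (pd i f x))" "cts_disk (\<lambda>x. norm (jac f x))"
  unfolding cts_disk_def using D_space_zero_outside[OF assms] pd_D_space[OF assms]
  by (auto intro!: continuous_intros D_space_continuous[OF assms] pd_D_space[OF assms])

lemma line_derivative:
  assumes "f \<in> D_space"
  shows "DERIV (\<lambda>s. (norm (f (coords i j (s, p))))\<^sup>2) s :> 2 * (f (coords i j (s, p)) \<bullet> pd i f (coords i j (s, p)))"
proof -
  have eq: "coords i j (s, p) = coords i j (0, p) + s *\<^sub>R axis i 1" for s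
    by (simp add: vec_eq_iff coords_def axis_def)
  have e2: "f (coords i j (s, p)) = f (coords i j (0, p) + s *\<^sub>R axis i 1)"
    "pd i f (coords i j (s, p)) = pd i f (coords i j (0, p) + s *\<^sub>R axis i 1)" for s
    by (rule arg_cong[OF eq])+
  have "((\<lambda>s. coords i j (0, p) + s *\<^sub>R axis i 1) has_derivative (\<lambda>s. s *\<^sub>R axis i 1)) (at s)"
    by (auto intro!: derivative_eq_intros)
  from has_derivative_compose[OF this D_space_has_derivative[OF assms]]
  have d: "((\<lambda>s. f (coords i j (0, p) + s *\<^sub>R axis i 1)) has_derivative
      (\<lambda>r. frechet_derivative f (at (coords i j (0, p) + s *\<^sub>R axis i 1)) (r *\<^sub>R axis i 1))) (at s)" .
  have l: "frechet_derivative f (at x) (r *\<^sub>R axis i 1) = r *\<^sub>R pd i f x" for r x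
    using linear_cmul[OF has_derivative_linear[OF D_space_has_derivative[OF assms]]] by (simp add: pd_def)
  have "((\<lambda>s. f (coords i j (0, p) + s *\<^sub>R axis i 1) \<bullet> f (coords i j (0, p) + s *\<^sub>R axis i 1)) has_derivative
      (\<lambda>r. 2 * (f (coords i j (0, p) + s *\<^sub>R axis i 1) \<bullet> pd i f (coords i j (0, p) + s *\<^sub>R axis i 1)) * r)) (at s)"
    by (rule has_derivative_eq_rhs[OF has_derivative_inner[OF d d]]) (auto simp: l inner_commute fun_eq_iff)
  then show ?thesis
    unfolding has_field_derivative_def e2 power2_norm_eq_inner .
qed

text \<open>Working with the square of the norm avoids its lack of differentiability at zeros of
  \<open>f\<close>. Both orders of the end points are recorded because \<open>slice_sq_bound\<close>
  compares two heights of which either may be the larger.\<close>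

lemma line_FTC:
  assumes f: "f \<in> D_space" and "a \<le> b"
  shows "ennreal ((norm (f (coords i j (b, p))))\<^sup>2) \<le> ennreal ((norm (f (coords i j (a, p))))\<^sup>2) +
    (\<integral>\<^sup>+r. ennreal (2 * (norm (f (coords i j (r, p))) * norm (pd i f (coords i j (r, p))))) * indicator {a..b} r \<partial>lborel)"
    and "ennreal ((norm (f (coords i j (a, p))))\<^sup>2) \<le> ennreal ((norm (f (coords i j (b, p))))\<^sup>2) +
    (\<integral>\<^sup>+r. ennreal (2 * (norm (f (coords i j (r, p))) * norm (pd i f (coords i j (r, p))))) * indicator {a..b} r \<partial>lborel)"
proof -
  let ?g = "\<lambda>r. 2 * (f (coords i j (r, p)) \<bullet> pd i f (coords i j (r, p)))"
  let ?h = "\<lambda>r. 2 * (norm (f (coords i j (r, p))) * norm (pd i f (coords i j (r, p))))"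
  have cc: "continuous_on UNIV (\<lambda>r. F (coords i j (r, p)))" if "continuous_on UNIV F" for F :: "real^3 \<Rightarrow> real^3"
    by (rule continuous_on_compose2[OF that]) (auto intro!: continuous_on_compose2[OF continuous_coords] continuous_intros)
  have cg: "continuous_on UNIV ?g"
    by (intro continuous_intros cc D_space_continuous[OF f] pd_D_space[OF f])
  have hb: "has_bochner_integral lborel (\<lambda>r. ?g r * indicator {a..b} r) ((norm (f (coords i j (b, p))))\<^sup>2 - (norm (f (coords i j (a, p))))\<^sup>2)"
    by (rule has_bochner_integral_FTC_Icc_real[OF assms(2)])
      (use line_derivative[OF f] cg in \<open>auto simp: continuous_on_eq_continuous_at\<close>)
  have "ennreal \<bar>(norm (f (coords i j (b, p))))\<^sup>2 - (norm (f (coords i j (a, p))))\<^sup>2\<bar> \<le> (\<integral>\<^sup>+r. norm (?g r * indicator {a..b} r) \<partial>lborel)"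
    using integral_norm_bound_ennreal[of lborel "\<lambda>r. ?g r * indicator {a..b} r"] hb
    by (simp add: has_bochner_integral_iff)
  also have "\<dots> \<le> (\<integral>\<^sup>+r. ennreal (?h r) * indicator {a..b} r \<partial>lborel)"
    by (intro nn_integral_mono)
      (auto simp: indicator_def abs_mult intro!: ennreal_leI Cauchy_Schwarz_ineq2)
  finally have *: "ennreal \<bar>(norm (f (coords i j (b, p))))\<^sup>2 - (norm (f (coords i j (a, p))))\<^sup>2\<bar> \<le> (\<integral>\<^sup>+r. ennreal (?h r) * indicator {a..b} r \<partial>lborel)" .
  have X: "ennreal x \<le> ennreal y + I" if "ennreal \<bar>x - y\<bar> \<le> I" "0 \<le> x" "0 \<le> y" for x y I
  proof -
    have "ennreal x \<le> ennreal (y + \<bar>x - y\<bar>)" by (rule ennreal_leI) simp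
    also have "\<dots> = ennreal y + ennreal \<bar>x - y\<bar>" using that by (subst ennreal_plus) auto
    also have "\<dots> \<le> ennreal y + I" using that by (intro add_left_mono) auto
    finally show ?thesis .
  qed
  show "ennreal ((norm (f (coords i j (b, p))))\<^sup>2) \<le> ennreal ((norm (f (coords i j (a, p))))\<^sup>2) + (\<integral>\<^sup>+r. ennreal (?h r) * indicator {a..b} r \<partial>lborel)"
    by (rule X[OF *]) auto
  show "ennreal ((norm (f (coords i j (a, p))))\<^sup>2) \<le> ennreal ((norm (f (coords i j (b, p))))\<^sup>2) + (\<integral>\<^sup>+r. ennreal (?h r) * indicator {a..b} r \<partial>lborel)"
    by (rule X) (use * in \<open>auto simp: abs_minus_commute\<close>)
qed

lemma not_in_disk:
  assumes "i \<noteq> 3" "1 \<le> (x $ i)\<^sup>2" shows "hor x \<notin> disk"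
proof -
  have "i = 1 \<or> i = 2" using exhaust_3[of i] assms(1) by auto
  then have "1 \<le> (x $ 1)\<^sup>2 \<or> 1 \<le> (x $ 2)\<^sup>2" using assms(2) by auto
  then show ?thesis
    unfolding disk_iff using zero_le_power2[of "x $ 1"] zero_le_power2[of "x $ 2"] by linarith
qed

text \<open>Integration starts at the coordinate \<open>- 1\<close>, where the field vanishes. This
  one-sided bound, used in two directions, is the origin of the constant \<open>2\<close> in
  \<open>slice_Ladyzhenskaya\<close>.\<close>

lemma line_bound:
  assumes f: "f \<in> D_space" and i: "i \<noteq> 3"
  shows "ennreal ((norm (f (coords i j (s, p))))\<^sup>2) \<le>
    (\<integral>\<^sup>+r. ennreal (2 * (norm (f (coords i j (r, p))) * norm (pd i f (coords i j (r, p))))) \<partial>lborel)"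
proof (cases "\<bar>s\<bar> < 1")
  case False
  have "(coords i j (s, p) $ i)\<^sup>2 \<ge> 1" using False one_le_power[of "\<bar>s\<bar>" 2] by (simp add: coords_def not_less)
  then have "hor (coords i j (s, p)) \<notin> disk" by (rule not_in_disk[OF i])
  then show ?thesis using D_space_zero_outside[OF f] by simp
next
  case True
  have "(coords i j (-1, p) $ i)\<^sup>2 \<ge> 1" by (simp add: coords_def)
  then have "hor (coords i j (-1, p)) \<notin> disk" by (rule not_in_disk[OF i])
  then have "ennreal ((norm (f (coords i j (s, p))))\<^sup>2) \<le>
    (\<integral>\<^sup>+r. ennreal (2 * (norm (f (coords i j (r, p))) * norm (pd i f (coords i j (r, p))))) * indicator {-1..s} r \<partial>lborel)"
  proof -
    have "-1 \<le> s" using True by (simp add: abs_less_iff)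
    moreover have "f (coords i j (-1, p)) = 0" by (rule D_space_zero_outside[OF f]) fact
    ultimately show ?thesis using line_FTC(1)[OF f, of "-1" s i j p] by (simp only: norm_zero zero_power2 ennreal_0 add_0)
  qed
  also have "\<dots> \<le> (\<integral>\<^sup>+r. ennreal (2 * (norm (f (coords i j (r, p))) * norm (pd i f (coords i j (r, p))))) \<partial>lborel)"
    by (intro nn_integral_mono) (auto simp: indicator_def)
  finally show ?thesis .
qed

text \<open>At the point with coordinates a and b, |f|^2 is bounded by an integral along the line
  through it in the first direction, which depends only on b, and by one in the second direction,
  which depends only on a. The product of the two bounds separates under Fubini's theorem.\<close>

lemma slice_product_bound:
  assumes f: "f \<in> D_space"
  shows "slice (\<lambda>x. norm (f x) ^ 4) c \<le>
    (2 * slice (\<lambda>x. norm (f x) * norm (pd 1 f x)) c) * (2 * slice (\<lambda>x. norm (f x) * norm (pd 2 f x)) c)"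
proof -
  define \<phi> where "\<phi> i x = 2 * (norm (f x) * norm (pd i f x))" for i x
  have c\<phi>: "cts_disk (\<phi> i)" for i
    using cts_disk_mult[OF cts_disk_D_space(1)[OF f, of i], of "\<lambda>x. 2"] by (simp add: \<phi>_def[abs_def] mult.commute)
  have [measurable]: "\<phi> i \<in> borel_measurable borel" for i by (rule cts_disk_measurable[OF c\<phi>])
  have [measurable]: "(\<lambda>p. \<phi> i (sl c p)) \<in> borel_measurable borel" for i
    by (intro borel_measurable_continuous_onI continuous_on_sl cts_disk_continuous c\<phi>)
  define A where "A b = (\<integral>\<^sup>+r. ennreal (\<phi> 1 (sl c (r, b))) \<partial>lborel)" for b
  define B where "B a = (\<integral>\<^sup>+r. ennreal (\<phi> 2 (sl c (a, r))) \<partial>lborel)" for a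
  have Bm[measurable]: "B \<in> borel_measurable borel"
  proof -
    have "(\<lambda>p. ennreal (\<phi> 2 (sl c p))) \<in> borel_measurable (lborel \<Otimes>\<^sub>M lborel)" by (simp add: lborel_prod)
    from lborel.borel_measurable_nn_integral_fst[OF this] show ?thesis unfolding B_def by simp
  qed
  have Am[measurable]: "A \<in> borel_measurable borel"
  proof -
    have "continuous_on UNIV (\<lambda>p::real \<times> real. \<phi> 1 (sl c (snd p, fst p)))"
      by (rule continuous_on_compose2[OF continuous_on_sl[OF cts_disk_continuous[OF c\<phi>]]]) (auto intro!: continuous_intros)
    then have "(\<lambda>p. \<phi> 1 (sl c (snd p, fst p))) \<in> borel_measurable (borel :: (real \<times> real) measure)"
      by (rule borel_measurable_continuous_onI)
    then have "(\<lambda>p. ennreal (\<phi> 1 (sl c (snd p, fst p)))) \<in> borel_measurable (lborel \<Otimes>\<^sub>M lborel)"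
      by (simp add: lborel_prod)
    from lborel.borel_measurable_nn_integral_fst[OF this] show ?thesis unfolding A_def by simp
  qed
  have pt: "ennreal (norm (f (sl c (a, b))) ^ 4) \<le> A b * B a" for a b
  proof -
    have "ennreal ((norm (f (sl c (a, b))))\<^sup>2) \<le> A b"
      using line_bound[OF f, of 1 2 a "(b, c)"] by (simp add: sl_eq A_def \<phi>_def)
    moreover have "ennreal ((norm (f (sl c (a, b))))\<^sup>2) \<le> B a"
      using line_bound[OF f, of 2 1 b "(a, c)"] by (simp add: sl_eq B_def \<phi>_def)
    ultimately have "ennreal ((norm (f (sl c (a, b))))\<^sup>2) * ennreal ((norm (f (sl c (a, b))))\<^sup>2) \<le> A b * B a"
      by (rule mult_mono) auto
    then show ?thesis by (simp add: ennreal_mult[symmetric] power4_eq_xxxx power2_eq_square mult.assoc)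
  qed
  have "ennreal (slice (\<lambda>x. norm (f x) ^ 4) c) = (\<integral>\<^sup>+p. ennreal (norm (f (sl c p)) ^ 4) \<partial>lborel)"
    by (rule nn_integral_slice[symmetric]) (use cts_disk_D_space(2)[OF f] in auto)
  also have "\<dots> \<le> (\<integral>\<^sup>+p. A (snd p) * B (fst p) \<partial>lborel)"
    by (intro nn_integral_mono) (use pt in force)
  also have "\<dots> = (\<integral>\<^sup>+b. A b \<partial>lborel) * (\<integral>\<^sup>+a. B a \<partial>lborel)"
  proof -
    have "(\<lambda>p. A (snd p) * B (fst p)) \<in> borel_measurable (lborel \<Otimes>\<^sub>M lborel)" by measurable
    then have "(\<lambda>p. A (snd p) * B (fst p)) \<in> borel_measurable borel" by (simp add: lborel_prod)
    from nn_integral_lborel_pair(1)[OF this] show ?thesis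
      by (simp add: nn_integral_cmult nn_integral_multc)
  qed
  also have "(\<integral>\<^sup>+b. A b \<partial>lborel) = (\<integral>\<^sup>+p. ennreal (\<phi> 1 (sl c p)) \<partial>lborel)"
    unfolding A_def by (subst nn_integral_lborel_pair(1)) auto
  also have "(\<integral>\<^sup>+a. B a \<partial>lborel) = (\<integral>\<^sup>+p. ennreal (\<phi> 2 (sl c p)) \<partial>lborel)"
    unfolding B_def by (subst nn_integral_lborel_pair(2)) auto
  finally have "ennreal (slice (\<lambda>x. norm (f x) ^ 4) c) \<le> ennreal (slice (\<phi> 1) c) * ennreal (slice (\<phi> 2) c)"
    using nn_integral_slice[OF c\<phi>] by (simp add: \<phi>_def)
  also have "\<dots> = ennreal (slice (\<phi> 1) c * slice (\<phi> 2) c)"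
    by (rule ennreal_mult[symmetric]) (auto simp: \<phi>_def intro!: slice_nonneg)
  finally have "slice (\<lambda>x. norm (f x) ^ 4) c \<le> slice (\<phi> 1) c * slice (\<phi> 2) c"
    by (subst (asm) ennreal_le_iff) (auto simp: \<phi>_def intro!: mult_nonneg_nonneg slice_nonneg)
  then show ?thesis by (simp add: \<phi>_def[abs_def] slice_mult)
qed

text \<open>Each factor of the product bound is estimated by the Cauchy-Schwarz inequality, and the
  product of the two derivative norms by half their sum. Only horizontal derivatives occur; the full
  Jacobian merely dominates them.\<close>

lemma slice_Ladyzhenskaya:
  assumes f: "f \<in> D_space"
  shows "slice (\<lambda>x. norm (f x) ^ 4) c \<le> 2 * slice (\<lambda>x. (norm (f x))\<^sup>2) c * slice (\<lambda>x. (norm (jac f x))\<^sup>2) c"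
proof -
  define m where "m = slice (\<lambda>x. (norm (f x))\<^sup>2) c"
  define n where "n i = slice (\<lambda>x. (norm (pd i f x))\<^sup>2) c" for i
  define \<alpha> where "\<alpha> i = slice (\<lambda>x. norm (f x) * norm (pd i f x)) c" for i
  have nn: "0 \<le> m" "0 \<le> n i" "0 \<le> \<alpha> i" for i by (auto simp: m_def n_def \<alpha>_def intro!: slice_nonneg)
  have cs: "(\<alpha> i)\<^sup>2 \<le> m * n i" for i
    unfolding m_def n_def \<alpha>_def by (rule slice_Cauchy_Schwarz) (intro cts_disk_D_space[OF f])+
  have "n 1 + n 2 = slice (\<lambda>x. (norm (pd 1 f x))\<^sup>2 + (norm (pd 2 f x))\<^sup>2) c"
    unfolding n_def by (rule slice_add[symmetric]) (intro cts_disk_D_space[OF f] zero_less_numeral)+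
  also have "\<dots> \<le> slice (\<lambda>x. (norm (jac f x))\<^sup>2) c"
  proof (rule slice_mono)
    show "cts_disk (\<lambda>x. (norm (pd 1 f x))\<^sup>2 + (norm (pd 2 f x))\<^sup>2)"
      using pd_D_space[OF f] by (auto simp: cts_disk_def intro!: continuous_intros)
  qed (use cts_disk_D_space(4)[OF f, of 2] in \<open>auto simp: norm_jac_sq\<close>)
  finally have n: "n 1 + n 2 \<le> slice (\<lambda>x. (norm (jac f x))\<^sup>2) c" .
  have "\<alpha> 1 * \<alpha> 2 \<le> m * (n 1 + n 2) / 2"
  proof (rule power2_le_imp_le)
    have "(\<alpha> 1 * \<alpha> 2)\<^sup>2 \<le> (m * n 1) * (m * n 2)"
      unfolding power_mult_distrib by (intro mult_mono cs) (auto simp: nn)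
    also have "\<dots> = m\<^sup>2 * (n 1 * n 2)" by (simp add: power2_eq_square)
    also have "\<dots> \<le> m\<^sup>2 * ((n 1 + n 2) / 2)\<^sup>2"
    proof (rule mult_left_mono)
      have "4 * (n 1 * n 2) \<le> (n 1 + n 2)\<^sup>2"
        using zero_le_power2[of "n 1 - n 2"] by (simp add: power2_eq_square algebra_simps)
      then show "n 1 * n 2 \<le> ((n 1 + n 2) / 2)\<^sup>2" by (simp add: power_divide)
    qed simp
    finally show "(\<alpha> 1 * \<alpha> 2)\<^sup>2 \<le> (m * (n 1 + n 2) / 2)\<^sup>2" by (simp add: power_mult_distrib power_divide)
  qed (use nn in auto)
  then have "(2 * \<alpha> 1) * (2 * \<alpha> 2) \<le> 2 * m * (n 1 + n 2)" by simp
  also have "\<dots> \<le> 2 * m * slice (\<lambda>x. (norm (jac f x))\<^sup>2) c"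
    using n nn by (intro mult_left_mono) auto
  finally show ?thesis using slice_product_bound[OF f, of c] by (simp add: \<alpha>_def m_def)
qed

text \<open>A trace estimate: the fundamental theorem in the vertical direction compares the slice
  at \<open>c\<close> with the slice at any \<open>c'\<close>, and averaging over \<open>c'\<close>
  in the unit interval replaces the latter by the norm over the cylinder.\<close>

lemma slice_sq_bound:
  assumes f: "f \<in> D_space" and c: "0 < c" "c < 1"
  shows "slice (\<lambda>x. (norm (f x))\<^sup>2) c \<le> (L2_norm f)\<^sup>2 + 2 * L2_norm f * L2_norm (jac f)"
proof -
  define \<psi> where "\<psi> x = 2 * (norm (f x) * norm (pd 3 f x))" for x
  have c\<psi>: "cts_disk \<psi>"
    using cts_disk_mult[OF cts_disk_D_space(1)[OF f, of 3], of "\<lambda>x. 2"] by (simp add: \<psi>_def[abs_def] mult.commute)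
  have [measurable]: "\<psi> \<in> borel_measurable borel" by (rule cts_disk_measurable[OF c\<psi>])
  define X where "X = (LINT x|lebesgue_on cyl. \<psi> x)"
  have X0: "0 \<le> X" by (simp add: X_def \<psi>_def)
  have cf: "cts_disk (\<lambda>x. (norm (f x))\<^sup>2)" using cts_disk_D_space(2)[OF f] by simp
  have m: "slice (\<lambda>x. (norm (f x))\<^sup>2) c \<le> slice (\<lambda>x. (norm (f x))\<^sup>2) c' + X" if c': "0 < c'" "c' < 1" for c'
  proof -
    have pt: "ennreal ((norm (f (sl c p)))\<^sup>2) \<le> ennreal ((norm (f (sl c' p)))\<^sup>2) +
      (\<integral>\<^sup>+r. ennreal (\<psi> (sl r p)) * indicator {0<..<1} r \<partial>lborel)" for p
    proof -
      have "ennreal ((norm (f (sl c p)))\<^sup>2) \<le> ennreal ((norm (f (sl c' p)))\<^sup>2) +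
        (\<integral>\<^sup>+r. ennreal (\<psi> (sl r p)) * indicator {min c c'..max c c'} r \<partial>lborel)"
        using line_FTC(1)[OF f, of c' c 3 1 p] line_FTC(2)[OF f, of c c' 3 1 p]
        by (cases "c \<le> c'") (auto simp: \<psi>_def min_def max_def)
      also have "\<dots> \<le> ennreal ((norm (f (sl c' p)))\<^sup>2) + (\<integral>\<^sup>+r. ennreal (\<psi> (sl r p)) * indicator {0<..<1} r \<partial>lborel)"
        by (intro add_left_mono nn_integral_mono) (use c c' in \<open>auto simp: indicator_def\<close>)
      finally show ?thesis .
    qed
    have "ennreal (slice (\<lambda>x. (norm (f x))\<^sup>2) c) = (\<integral>\<^sup>+p. ennreal ((norm (f (sl c p)))\<^sup>2) \<partial>lborel)"
      by (rule nn_integral_slice[symmetric, OF cf]) simp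
    also have "\<dots> \<le> (\<integral>\<^sup>+p. ennreal ((norm (f (sl c' p)))\<^sup>2) + (\<integral>\<^sup>+r. ennreal (\<psi> (sl r p)) * indicator {0<..<1} r \<partial>lborel) \<partial>lborel)"
      by (intro nn_integral_mono pt)
    also have "\<dots> = (\<integral>\<^sup>+p. ennreal ((norm (f (sl c' p)))\<^sup>2) \<partial>lborel) +
        (\<integral>\<^sup>+p. \<integral>\<^sup>+r. ennreal (\<psi> (sl r p)) * indicator {0<..<1} r \<partial>lborel \<partial>lborel)"
    proof (rule nn_integral_add)
      have "(\<lambda>p. F (sl c' p)) \<in> borel_measurable borel" if "continuous_on UNIV F" for F :: "real^3 \<Rightarrow> real"
        by (intro borel_measurable_continuous_onI continuous_on_sl that)
      then show "(\<lambda>p. ennreal ((norm (f (sl c' p)))\<^sup>2)) \<in> borel_measurable lborel"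
        using cf by (auto simp: cts_disk_def)
      have "(\<lambda>q. ennreal (\<psi> (coords 3 1 (snd q, fst q))) * indicator {0<..<1} (snd q)) \<in> borel_measurable (borel :: ((real \<times> real) \<times> real) measure)"
      proof -
        have [measurable]: "(\<lambda>q. (snd q, fst q)) \<in> (borel :: ((real \<times> real) \<times> real) measure) \<rightarrow>\<^sub>M borel"
          by (intro borel_measurable_continuous_onI continuous_intros)
        have [measurable]: "snd \<in> (borel :: ((real \<times> real) \<times> real) measure) \<rightarrow>\<^sub>M borel"
          by (intro borel_measurable_continuous_onI continuous_intros)
        show ?thesis by measurable
      qed
      then have "(\<lambda>q. ennreal (\<psi> (coords 3 1 (snd q, fst q))) * indicator {0<..<1} (snd q)) \<in> borel_measurable ((lborel :: (real \<times> real) measure) \<Otimes>\<^sub>M (lborel :: real measure))"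
        by (simp add: lborel_prod)
      from lborel.borel_measurable_nn_integral_fst[OF this]
      show "(\<lambda>p. \<integral>\<^sup>+r. ennreal (\<psi> (sl r p)) * indicator {0<..<1} r \<partial>lborel) \<in> borel_measurable lborel" by simp
    qed
    also have "(\<integral>\<^sup>+p. ennreal ((norm (f (sl c' p)))\<^sup>2) \<partial>lborel) = ennreal (slice (\<lambda>x. (norm (f x))\<^sup>2) c')"
      by (rule nn_integral_slice[OF cf]) simp
    also have "(\<integral>\<^sup>+p. \<integral>\<^sup>+r. ennreal (\<psi> (sl r p)) * indicator {0<..<1} r \<partial>lborel \<partial>lborel) =
        (\<integral>\<^sup>+p. \<integral>\<^sup>+r. ennreal (indicator cyl (sl r p) * \<psi> (sl r p)) \<partial>lborel \<partial>lborel)"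
      using c\<psi> by (intro nn_integral_cong) (auto simp: indicator_def sl_in_cyl cts_disk_def hor_sl)
    also have "\<dots> = (\<integral>\<^sup>+x. ennreal (indicator cyl x * \<psi> x) \<partial>lborel)"
      by (subst nn_integral_coords[of 3 1]) (auto simp: nn_integral_lborel_pair(1))
    also have "\<dots> = ennreal (\<integral>x. indicator cyl x * \<psi> x \<partial>lborel)"
    proof (rule nn_integral_eq_integral)
      have "integrable (lebesgue_on cyl) \<psi>"
        using c\<psi> by (intro L2_integrable L2_continuous) (simp add: cts_disk_def)
      then show "integrable lborel (\<lambda>x. indicator cyl x * \<psi> x)" by (simp add: integrable_cyl_lborel)
    qed (auto simp: \<psi>_def)
    also have "\<dots> = ennreal X" unfolding X_def by (subst integral_cyl_lborel) auto
    finally have "ennreal (slice (\<lambda>x. (norm (f x))\<^sup>2) c) \<le> ennreal (slice (\<lambda>x. (norm (f x))\<^sup>2) c' + X)"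
      using X0 by (subst ennreal_plus) (auto intro!: slice_nonneg)
    then show ?thesis using X0 by (subst (asm) ennreal_le_iff) (auto intro!: slice_nonneg add_nonneg_nonneg)
  qed
  have X: "X \<le> 2 * L2_norm f * L2_norm (jac f)"
  proof -
    have pdL: "pd 3 f \<in> L2" by (intro L2_continuous pd_D_space[OF f])
    have "X = 2 * (LINT x|lebesgue_on cyl. norm (f x) * norm (pd 3 f x))" by (simp add: X_def \<psi>_def)
    also have "\<dots> \<le> 2 * (L2_norm f * L2_norm (pd 3 f))"
      using integral_norm_mult_le[OF D_space_L2(1)[OF f] pdL] by simp
    also have "L2_norm (pd 3 f) \<le> L2_norm (jac f)"
      unfolding L2_norm_def
      by (intro real_sqrt_le_mono integral_mono L2_integrable_sq pdL D_space_L2[OF f] power_mono norm_pd_le) auto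
    then have "2 * (L2_norm f * L2_norm (pd 3 f)) \<le> 2 * L2_norm f * L2_norm (jac f)"
      by (simp add: mult_left_mono)
    finally show ?thesis .
  qed
  have unit: "(\<integral>c'. indicator {0<..<1::real} c' * k \<partial>lborel) = k" for k :: real
    by (simp add: measure_def)
  have ii: "integrable lborel (\<lambda>c'. indicator {0<..<1::real} c' * k)" for k :: real
    by simp
  have "slice (\<lambda>x. (norm (f x))\<^sup>2) c = (\<integral>c'. indicator {0<..<1::real} c' * slice (\<lambda>x. (norm (f x))\<^sup>2) c \<partial>lborel)"
    by (rule unit[symmetric])
  also have "\<dots> \<le> (\<integral>c'. indicator {0<..<1::real} c' * slice (\<lambda>x. (norm (f x))\<^sup>2) c' + indicator {0<..<1} c' * X \<partial>lborel)"
    by (intro integral_mono Bochner_Integration.integrable_add integral_slices(2)[OF cf] ii)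
      (use m in \<open>auto simp: indicator_def\<close>)
  also have "\<dots> = (\<integral>c'. indicator {0<..<1::real} c' * slice (\<lambda>x. (norm (f x))\<^sup>2) c' \<partial>lborel) + X"
    by (subst Bochner_Integration.integral_add[OF integral_slices(2)[OF cf]]) (auto simp: unit)
  also have "\<dots> = (L2_norm f)\<^sup>2 + X"
    by (simp add: integral_slices(1)[OF cf, symmetric] L2_norm_sq)
  finally show ?thesis using X by simp
qed

lemma H1_norm_nonneg [simp]: "0 \<le> H1_norm f"
  by (simp add: H1_norm_def)

lemma H1_norm_sq: "(H1_norm f)\<^sup>2 = (L2_norm f)\<^sup>2 + (L2_norm (wgrad f))\<^sup>2"
  by (simp add: H1_norm_def)

lemma L2_norm_wgrad_D_space:
  assumes "f \<in> D_space" shows "L2_norm (wgrad f) = L2_norm (jac f)"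
  by (rule L2_norm_cong_AE[OF wgrad_props(1)[OF D_space_H1[OF assms]] _ wgrad_D_space[OF assms]])
    (rule L2_measurable[OF D_space_L2(2)[OF assms]])

text \<open>A crude bound without symmetry. It provides integrability and continuity of the
  trilinear form on \<open>V_space\<close>; the constant that matters comes from the helical
  estimates.\<close>

lemma D_space_L4:
  assumes f: "f \<in> D_space"
  shows "(LINT x|lebesgue_on cyl. norm (f x) ^ 4) \<le> 4 * H1_norm f ^ 4"
proof -
  have c4: "cts_disk (\<lambda>x. norm (f x) ^ 4)" and cj: "cts_disk (\<lambda>x. (norm (jac f x))\<^sup>2)"
    using cts_disk_D_space[OF f] by auto
  define M where "M = 2 * (H1_norm f)\<^sup>2"
  have M: "slice (\<lambda>x. (norm (f x))\<^sup>2) c \<le> M" if "0 < c" "c < 1" for c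
  proof -
    have "2 * L2_norm f * L2_norm (jac f) \<le> (L2_norm f)\<^sup>2 + (L2_norm (jac f))\<^sup>2" by (rule sum_squares_bound)
    then have "(L2_norm f)\<^sup>2 + 2 * L2_norm f * L2_norm (jac f) \<le> M"
      using zero_le_power2[of "L2_norm (jac f)"]
      unfolding M_def H1_norm_sq L2_norm_wgrad_D_space[OF f] distrib_left by linarith
    then show ?thesis using slice_sq_bound[OF f that] by simp
  qed
  have "(LINT x|lebesgue_on cyl. norm (f x) ^ 4) = (\<integral>c. indicator {0<..<1} c * slice (\<lambda>x. norm (f x) ^ 4) c \<partial>lborel)"
    by (rule integral_slices(1)[OF c4])
  also have "\<dots> \<le> (\<integral>c. (2 * M) * (indicator {0<..<1} c * slice (\<lambda>x. (norm (jac f x))\<^sup>2) c) \<partial>lborel)"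
  proof (rule integral_mono)
    fix c
    have "slice (\<lambda>x. norm (f x) ^ 4) c \<le> 2 * M * slice (\<lambda>x. (norm (jac f x))\<^sup>2) c" if "0 < c" "c < 1"
    proof -
      have "2 * slice (\<lambda>x. (norm (f x))\<^sup>2) c * slice (\<lambda>x. (norm (jac f x))\<^sup>2) c \<le> 2 * M * slice (\<lambda>x. (norm (jac f x))\<^sup>2) c"
        using M[OF that] by (intro mult_right_mono) (auto intro!: slice_nonneg)
      then show ?thesis using slice_Ladyzhenskaya[OF f, of c] by linarith
    qed
    then show "indicator {0<..<1} c * slice (\<lambda>x. norm (f x) ^ 4) c \<le> (2 * M) * (indicator {0<..<1} c * slice (\<lambda>x. (norm (jac f x))\<^sup>2) c)"
      by (auto simp: indicator_def)
  qed (intro integral_slices(2)[OF c4] integrable_mult_right integral_slices(2)[OF cj])+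
  also have "\<dots> = 2 * M * (L2_norm (jac f))\<^sup>2"
    by (simp add: integral_slices(1)[OF cj, symmetric] L2_norm_sq)
  also have "\<dots> \<le> 2 * M * (H1_norm f)\<^sup>2"
    by (intro mult_left_mono) (auto simp: M_def H1_norm_sq L2_norm_wgrad_D_space[OF f])
  also have "\<dots> = 4 * H1_norm f ^ 4" by (simp add: M_def power4_eq_xxxx power2_eq_square)
  finally show ?thesis .
qed

section \<open>The space V and the trilinear form\<close>

lemma jac_diff:
  assumes "f differentiable (at x)" "g differentiable (at x)"
  shows "jac (\<lambda>x. f x - g x) x = jac f x - jac g x"
proof -
  have "(f has_derivative frechet_derivative f (at x)) (at x)" "(g has_derivative frechet_derivative g (at x)) (at x)"
    using assms frechet_derivative_works by blast+
  from jac_has_derivative(1)[OF has_derivative_diff[OF this]]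
  show ?thesis by (simp add: jac_def matrix_def vec_eq_iff)
qed

lemma D_space_diff:
  assumes "f \<in> D_space" "g \<in> D_space"
  shows "(\<lambda>x. f x - g x) \<in> D_space"
proof -
  have "smooth_on UNIV (\<lambda>x. f x - g x)"
    unfolding smooth_on_def
  proof
    fix k
    have "Ck_on k UNIV (\<lambda>x. f x + (-1) *\<^sub>R g x)"
      using D_spaceD(1)[OF assms(1)] D_spaceD(1)[OF assms(2)]
      by (intro Ck_on_add Ck_on_scaleR Ck_on_const) (auto simp: smooth_on_def)
    then show "Ck_on k UNIV (\<lambda>x. f x - g x)" by simp
  qed
  moreover have "z_periodic (\<lambda>x. f x - g x)"
    using D_spaceD(2)[OF assms(1)] D_spaceD(2)[OF assms(2)] by (simp add: z_periodic_def)
  moreover obtain K L where "compact K" "K \<subseteq> disk" "\<forall>x. hor x \<notin> K \<longrightarrow> f x = 0"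
     "compact L" "L \<subseteq> disk" "\<forall>x. hor x \<notin> L \<longrightarrow> g x = 0"
    using assms by (auto simp: D_space_def)
  then have "compact (K \<union> L) \<and> K \<union> L \<subseteq> disk \<and> (\<forall>x. hor x \<notin> K \<union> L \<longrightarrow> f x - g x = 0)" by auto
  ultimately show ?thesis unfolding D_space_def by blast
qed

lemma D_sol_D_space: "f \<in> D_sol \<Longrightarrow> f \<in> D_space"
  by (simp add: D_sol_def)

lemma D_sol_diff:
  assumes "f \<in> D_sol" "g \<in> D_sol"
  shows "(\<lambda>x. f x - g x) \<in> D_sol"
proof -
  have "divergence (\<lambda>x. f x - g x) x = divergence f x - divergence g x" for x
    using assms by (simp add: divergence_def jac_diff D_spaceD(3) D_sol_D_space trace_def sum_subtractf)
  then show ?thesis using assms D_space_diff by (simp add: D_sol_def)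
qed

lemma zero_H1: "(\<lambda>x. 0) \<in> H1" and H1_norm_zero: "H1_norm (\<lambda>x. 0) = 0"
proof -
  have w: "weak_gradient (\<lambda>x. 0) (\<lambda>x. 0)" by (simp add: weak_gradient_def)
  then show H: "(\<lambda>x. 0) \<in> H1" using L2_const[of "0::real^3"] L2_const[of "0::real^3^3"]
    unfolding H1_def by blast
  have "L2_norm (wgrad (\<lambda>x. 0)) = L2_norm (\<lambda>x. 0 :: real^3^3)"
    by (rule L2_norm_cong_AE[OF wgrad_props(1)[OF H] _ weak_gradient_unique[OF wgrad_props(1)[OF H] L2_const wgrad_props(2)[OF H] w]]) simp
  then show "H1_norm (\<lambda>x. 0) = 0" by (simp add: H1_norm_def L2_norm_def)
qed

lemma L2_norm_wgrad_diff:
  assumes "f \<in> H1" "g \<in> H1"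
  shows "L2_norm (wgrad (\<lambda>x. f x - g x)) = L2_norm (\<lambda>x. wgrad f x - wgrad g x)"
  by (rule L2_norm_cong_AE[OF wgrad_props(1)[OF H1_diff[OF assms]] _ wgrad_diff[OF assms]])
    (intro L2_measurable L2_diff wgrad_props assms)

lemma L2_norm_le_H1: "L2_norm f \<le> H1_norm f" "L2_norm (wgrad f) \<le> H1_norm f"
  unfolding H1_norm_def by (auto intro!: real_le_rsqrt)

lemma L2_norm_wgrad_diff_le: "f \<in> H1 \<Longrightarrow> g \<in> H1 \<Longrightarrow> L2_norm (\<lambda>x. wgrad f x - wgrad g x) \<le> H1_norm (\<lambda>x. f x - g x)"
  using L2_norm_wgrad_diff[of f g] L2_norm_le_H1(2)[of "\<lambda>x. f x - g x"] by simp

lemma H1_norm_minus_commute: "f \<in> H1 \<Longrightarrow> g \<in> H1 \<Longrightarrow> H1_norm (\<lambda>x. f x - g x) = H1_norm (\<lambda>x. g x - f x)"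
  by (simp add: H1_norm_def L2_norm_wgrad_diff L2_norm_minus_commute[of f] L2_norm_minus_commute[of "wgrad f"])

lemma sqrt_sum_squares_triangle_le:
  assumes "a \<le> a1 + a2" "b \<le> b1 + b2" "0 \<le> a" "0 \<le> b"
  shows "sqrt (a\<^sup>2 + b\<^sup>2) \<le> sqrt (a1\<^sup>2 + b1\<^sup>2) + sqrt (a2\<^sup>2 + b2\<^sup>2)"
proof -
  have "sqrt (a\<^sup>2 + b\<^sup>2) \<le> sqrt ((a1 + a2)\<^sup>2 + (b1 + b2)\<^sup>2)"
    by (intro real_sqrt_le_mono add_mono power_mono assms)
  also have "\<dots> \<le> sqrt (a1\<^sup>2 + b1\<^sup>2) + sqrt (a2\<^sup>2 + b2\<^sup>2)"
    by (rule real_sqrt_sum_squares_triangle_ineq)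
  finally show ?thesis .
qed

lemma H1_triangle:
  assumes "f \<in> H1" "g \<in> H1" "h \<in> H1"
  shows "H1_norm (\<lambda>x. f x - h x) \<le> H1_norm (\<lambda>x. f x - g x) + H1_norm (\<lambda>x. g x - h x)"
  unfolding H1_norm_def using assms
  by (intro sqrt_sum_squares_triangle_le) (auto simp: L2_norm_wgrad_diff intro!: L2_norm_diff_triangle H1_L2 wgrad_props)

lemma L2_norm_triangle_diff:
  assumes "f \<in> L2" "g \<in> L2" shows "L2_norm f \<le> L2_norm (\<lambda>x. f x - g x) + L2_norm g"
  using L2_norm_triangle[OF L2_diff[OF assms] assms(2)] by simp

lemma H1_norm_triangle_diff:
  assumes "f \<in> H1" "g \<in> H1" shows "H1_norm f \<le> H1_norm (\<lambda>x. f x - g x) + H1_norm g"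
  unfolding H1_norm_def using assms
  by (intro sqrt_sum_squares_triangle_le) (auto simp: L2_norm_wgrad_diff intro!: L2_norm_triangle_diff H1_L2 wgrad_props)

lemma H1_norm_diff_abs:
  assumes "f \<in> H1" "g \<in> H1" shows "\<bar>H1_norm f - H1_norm g\<bar> \<le> H1_norm (\<lambda>x. f x - g x)"
  using H1_norm_triangle_diff[OF assms] H1_norm_triangle_diff[OF assms(2,1)] H1_norm_minus_commute[OF assms]
  by linarith

lemma L2_norm_diff_abs:
  assumes "f \<in> L2" "g \<in> L2" shows "\<bar>L2_norm f - L2_norm g\<bar> \<le> L2_norm (\<lambda>x. f x - g x)"
  using L2_norm_triangle_diff[OF assms] L2_norm_triangle_diff[OF assms(2,1)] L2_norm_minus_commute[of f g]
  by linarith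

lemma tendsto_of_abs_diff_le:
  fixes a :: "nat \<Rightarrow> real"
  assumes "\<And>n. \<bar>a n - l\<bar> \<le> e n" "e \<longlonglongrightarrow> 0" shows "a \<longlonglongrightarrow> l"
proof -
  have "(\<lambda>n. \<bar>a n - l\<bar>) \<longlonglongrightarrow> 0"
    by (rule tendsto_sandwich[OF _ _ tendsto_const assms(2)]) (use assms(1) in auto)
  then show ?thesis by (simp add: tendsto_rabs_zero_iff LIM_zero_iff)
qed

lemma H1_norm_tendsto:
  assumes "\<And>n. f n \<in> H1" "g \<in> H1" "(\<lambda>n. H1_norm (\<lambda>x. f n x - g x)) \<longlonglongrightarrow> 0"
  shows "(\<lambda>n. H1_norm (f n)) \<longlonglongrightarrow> H1_norm g" "(\<lambda>n. L2_norm (f n)) \<longlonglongrightarrow> L2_norm g"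
    "(\<lambda>n. L2_norm (\<lambda>x. f n x - g x)) \<longlonglongrightarrow> 0"
    "(\<lambda>n. L2_norm (\<lambda>x. wgrad (f n) x - wgrad g x)) \<longlonglongrightarrow> 0"
    "(\<lambda>n. L2_norm (wgrad (f n))) \<longlonglongrightarrow> L2_norm (wgrad g)"
proof -
  show "(\<lambda>n. H1_norm (f n)) \<longlonglongrightarrow> H1_norm g"
    by (rule tendsto_of_abs_diff_le[OF H1_norm_diff_abs assms(3)]) (use assms in auto)
  show "(\<lambda>n. L2_norm (f n)) \<longlonglongrightarrow> L2_norm g"
    by (rule tendsto_of_abs_diff_le[OF order.trans[OF L2_norm_diff_abs L2_norm_le_H1(1)] assms(3)]) (use assms H1_L2 in auto)
  show "(\<lambda>n. L2_norm (\<lambda>x. f n x - g x)) \<longlonglongrightarrow> 0"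
    by (rule tendsto_of_abs_diff_le[OF _ assms(3)]) (simp add: L2_norm_le_H1)
  show "(\<lambda>n. L2_norm (\<lambda>x. wgrad (f n) x - wgrad g x)) \<longlonglongrightarrow> 0"
    by (rule tendsto_of_abs_diff_le[OF _ assms(3)]) (simp add: L2_norm_wgrad_diff_le assms)
  show "(\<lambda>n. L2_norm (wgrad (f n))) \<longlonglongrightarrow> L2_norm (wgrad g)"
    by (rule tendsto_of_abs_diff_le[OF order.trans[OF L2_norm_diff_abs L2_norm_wgrad_diff_le] assms(3)])
      (use assms wgrad_props in auto)
qed

lemma V_H1: "v \<in> V_space \<Longrightarrow> v \<in> H1"
  by (simp add: V_space_def)

lemma V_L2: "v \<in> V_space \<Longrightarrow> v \<in> L2"
  by (simp add: V_H1 H1_L2)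

lemma V_wgrad_L2: "v \<in> V_space \<Longrightarrow> wgrad v \<in> L2"
  by (simp add: V_H1 wgrad_props)

lemma V_approx:
  assumes "v \<in> V_space"
  shows "\<exists>f. (\<forall>n::nat. f n \<in> D_sol) \<and> (\<lambda>n. H1_norm (\<lambda>x. f n x - v x)) \<longlonglongrightarrow> 0"
  using assms by (auto simp: V_space_def)

lemma D_sol_V: "f \<in> D_sol \<Longrightarrow> f \<in> V_space"
  unfolding V_space_def using H1_norm_zero D_space_H1[OF D_sol_D_space, of f] by (auto intro!: exI[of _ "\<lambda>n. f"])

lemma V_diff:
  assumes "v \<in> V_space" "w \<in> V_space"
  shows "(\<lambda>x. v x - w x) \<in> V_space"
proof -
  obtain f where f: "\<And>n::nat. f n \<in> D_sol" "(\<lambda>n. H1_norm (\<lambda>x. f n x - v x)) \<longlonglongrightarrow> 0" using V_approx[OF assms(1)] by auto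
  obtain g where g: "\<And>n::nat. g n \<in> D_sol" "(\<lambda>n. H1_norm (\<lambda>x. g n x - w x)) \<longlonglongrightarrow> 0" using V_approx[OF assms(2)] by auto
  have fH: "f n \<in> H1" "g n \<in> H1" for n using f g by (auto intro: D_space_H1 D_sol_D_space)
  note vH = V_H1[OF assms(1)] V_H1[OF assms(2)]
  have "(\<lambda>n. H1_norm (\<lambda>x. (f n x - g n x) - (v x - w x))) \<longlonglongrightarrow> 0"
  proof (rule tendsto_of_abs_diff_le)
    show "(\<lambda>n. H1_norm (\<lambda>x. f n x - v x) + H1_norm (\<lambda>x. g n x - w x)) \<longlonglongrightarrow> 0"
      using tendsto_add[OF f(2) g(2)] by simp
    fix n
    have "H1_norm (\<lambda>x. (f n x - v x) - (g n x - w x)) \<le> H1_norm (\<lambda>x. (f n x - v x) - 0) + H1_norm (\<lambda>x. 0 - (g n x - w x))"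
      by (rule H1_triangle[of "\<lambda>x. f n x - v x" "\<lambda>x. 0" "\<lambda>x. g n x - w x"]) (intro H1_diff fH vH zero_H1)+
    also have "H1_norm (\<lambda>x. 0 - (g n x - w x)) = H1_norm (\<lambda>x. (g n x - w x) - 0)"
      by (rule H1_norm_minus_commute) (intro H1_diff fH vH zero_H1)+
    finally show "\<bar>H1_norm (\<lambda>x. (f n x - g n x) - (v x - w x)) - 0\<bar> \<le> H1_norm (\<lambda>x. f n x - v x) + H1_norm (\<lambda>x. g n x - w x)"
      by (simp add: algebra_simps)
  qed
  then show ?thesis
    unfolding V_space_def using H1_diff[OF vH] D_sol_diff[OF f(1) g(1)] by (auto intro!: exI[of _ "\<lambda>n x. f n x - g n x"])
qed

text \<open>Fatou's lemma in the form needed to pass from smooth fields to \<open>V_space\<close>: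
  integrability of the limit is obtained together with the bound.\<close>

lemma Fatou_bound:
  fixes u :: "nat \<Rightarrow> 'a \<Rightarrow> real"
  assumes "\<And>n. integrable M (u n)" "\<And>n x. 0 \<le> u n x" "\<And>x. 0 \<le> g x" and g: "g \<in> borel_measurable M"
    and ae: "AE x in M. (\<lambda>n. u n x) \<longlonglongrightarrow> g x"
    and B: "\<And>n. (\<integral>x. u n x \<partial>M) \<le> B n" "B \<longlonglongrightarrow> b"
  shows "integrable M g" "(\<integral>x. g x \<partial>M) \<le> b"
proof -
  have "0 \<le> (\<integral>x. u n x \<partial>M)" for n by (simp add: assms(2))
  then have "0 \<le> B n" for n using B(1)[of n] by (rule order.trans)
  then have b: "0 \<le> b" using LIMSEQ_le_const[OF B(2)] by auto
  have "(\<integral>\<^sup>+x. ennreal (g x) \<partial>M) = (\<integral>\<^sup>+x. liminf (\<lambda>n. ennreal (u n x)) \<partial>M)"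
    using ae by (intro nn_integral_cong_AE) (auto elim!: eventually_mono intro!: lim_imp_Liminf[symmetric] tendsto_ennrealI)
  also have "\<dots> \<le> liminf (\<lambda>n. \<integral>\<^sup>+x. ennreal (u n x) \<partial>M)"
    by (rule nn_integral_liminf) (use assms(1) in auto)
  also have "\<dots> \<le> liminf (\<lambda>n. ennreal (B n))"
    by (intro Liminf_mono always_eventually allI)
      (use assms(1,2) B(1) in \<open>auto simp: nn_integral_eq_integral intro!: ennreal_leI\<close>)
  also have "\<dots> = ennreal b"
    by (rule lim_imp_Liminf) (auto intro!: tendsto_ennrealI B)
  finally have *: "(\<integral>\<^sup>+x. ennreal (g x) \<partial>M) \<le> ennreal b" .
  show i: "integrable M g"
    by (rule integrableI_nonneg[OF g]) (use * assms(3) in \<open>auto simp: le_less_trans[OF *]\<close>)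
  show "(\<integral>x. g x \<partial>M) \<le> b"
    using * assms(3) b by (simp add: nn_integral_eq_integral[OF i])
qed

lemma V_L4:
  assumes "p \<in> V_space"
  shows "integrable (lebesgue_on cyl) (\<lambda>x. norm (p x) ^ 4)"
    "(LINT x|lebesgue_on cyl. norm (p x) ^ 4) \<le> 4 * H1_norm p ^ 4"
proof -
  obtain f where f: "\<And>n::nat. f n \<in> D_sol" "(\<lambda>n. H1_norm (\<lambda>x. f n x - p x)) \<longlonglongrightarrow> 0" using V_approx[OF assms] by auto
  have fD: "f n \<in> D_space" and fH: "f n \<in> H1" for n using f by (auto intro: D_space_H1 D_sol_D_space)
  note t = H1_norm_tendsto[OF fH V_H1[OF assms] f(2)]
  obtain r where r: "strict_mono r" "AE x in lebesgue_on cyl. (\<lambda>n. f (r n) x) \<longlonglongrightarrow> p x"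
    using L2_norm_AE_subseq[OF H1_L2[OF fH] V_L2[OF assms] t(3)] by auto
  have 1: "integrable (lebesgue_on cyl) (\<lambda>x. norm (f (r n) x) ^ 4)" for n
    by (intro L2_integrable L2_continuous continuous_intros D_space_continuous fD)
  have 2: "(\<lambda>x. norm (p x) ^ 4) \<in> borel_measurable (lebesgue_on cyl)"
    using L2_measurable[OF V_L2[OF assms]] by measurable
  have 3: "AE x in lebesgue_on cyl. (\<lambda>n. norm (f (r n) x) ^ 4) \<longlonglongrightarrow> norm (p x) ^ 4"
    using r(2) by eventually_elim (intro tendsto_intros)
  have 4: "(\<lambda>n. 4 * H1_norm (f (r n)) ^ 4) \<longlonglongrightarrow> 4 * H1_norm p ^ 4"
    by (intro tendsto_intros LIMSEQ_subseq_LIMSEQ[OF t(1) r(1), unfolded o_def])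
  show "integrable (lebesgue_on cyl) (\<lambda>x. norm (p x) ^ 4)"
    "(LINT x|lebesgue_on cyl. norm (p x) ^ 4) \<le> 4 * H1_norm p ^ 4"
    using Fatou_bound[OF 1 _ _ 2 3 D_space_L4[OF fD] 4] by auto
qed

lemma V_sq_L2:
  assumes "p \<in> V_space"
  shows "(\<lambda>x. (norm (p x))\<^sup>2) \<in> L2" "L2_norm (\<lambda>x. (norm (p x))\<^sup>2) \<le> 2 * (H1_norm p)\<^sup>2"
proof -
  have e: "(norm ((norm (p x))\<^sup>2))\<^sup>2 = norm (p x) ^ 4" for x by (simp flip: power_mult)
  show "(\<lambda>x. (norm (p x))\<^sup>2) \<in> L2"
    unfolding L2_def mem_Collect_eq e using V_L4[OF assms] L2_measurable[OF V_L2[OF assms]] by simp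
  show "L2_norm (\<lambda>x. (norm (p x))\<^sup>2) \<le> 2 * (H1_norm p)\<^sup>2"
  proof (rule power2_le_imp_le)
    show "(L2_norm (\<lambda>x. (norm (p x))\<^sup>2))\<^sup>2 \<le> (2 * (H1_norm p)\<^sup>2)\<^sup>2"
      unfolding L2_norm_sq e using V_L4(2)[OF assms] by (simp add: power_mult_distrib flip: power_mult)
  qed simp
qed

lemma V_prod_L2:
  assumes "p \<in> V_space" "q \<in> V_space"
  shows "(\<lambda>x. norm (p x) * norm (q x)) \<in> L2"
    "(L2_norm (\<lambda>x. norm (p x) * norm (q x)))\<^sup>2 \<le> L2_norm (\<lambda>x. (norm (p x))\<^sup>2) * L2_norm (\<lambda>x. (norm (q x))\<^sup>2)"
    "L2_norm (\<lambda>x. norm (p x) * norm (q x)) \<le> 2 * H1_norm p * H1_norm q"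
proof -
  note pq = V_sq_L2[OF assms(1)] V_sq_L2[OF assms(2)]
  have e: "(norm (norm (p x) * norm (q x)))\<^sup>2 = (norm (p x))\<^sup>2 * (norm (q x))\<^sup>2" for x
    by (simp add: power_mult_distrib)
  show "(\<lambda>x. norm (p x) * norm (q x)) \<in> L2"
    unfolding L2_def mem_Collect_eq e
    using L2_integrable_times[OF pq(1,3)] L2_measurable[OF V_L2[OF assms(1)]] L2_measurable[OF V_L2[OF assms(2)]]
    by simp
  have "(L2_norm (\<lambda>x. norm (p x) * norm (q x)))\<^sup>2 = ip (\<lambda>x. (norm (p x))\<^sup>2) (\<lambda>x. (norm (q x))\<^sup>2)"
    unfolding L2_norm_sq e by (simp add: ip_def)
  also have "\<dots> \<le> L2_norm (\<lambda>x. (norm (p x))\<^sup>2) * L2_norm (\<lambda>x. (norm (q x))\<^sup>2)"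
    using ip_Cauchy_Schwarz[OF pq(1,3)] by linarith
  finally show 1: "(L2_norm (\<lambda>x. norm (p x) * norm (q x)))\<^sup>2 \<le> L2_norm (\<lambda>x. (norm (p x))\<^sup>2) * L2_norm (\<lambda>x. (norm (q x))\<^sup>2)" .
  show "L2_norm (\<lambda>x. norm (p x) * norm (q x)) \<le> 2 * H1_norm p * H1_norm q"
  proof (rule power2_le_imp_le)
    have "L2_norm (\<lambda>x. (norm (p x))\<^sup>2) * L2_norm (\<lambda>x. (norm (q x))\<^sup>2) \<le> (2 * (H1_norm p)\<^sup>2) * (2 * (H1_norm q)\<^sup>2)"
      by (intro mult_mono pq) auto
    then show "(L2_norm (\<lambda>x. norm (p x) * norm (q x)))\<^sup>2 \<le> (2 * H1_norm p * H1_norm q)\<^sup>2"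
      using 1 by (simp add: power_mult_distrib)
  qed simp
qed

text \<open>\<open>tri (wgrad f) p q\<close> is the form \<open>b(p, f, q)\<close>, the integral of \<open>((p \<cdot> \<nabla>) f) \<cdot> q\<close>.\<close>

definition tri :: "(real^3 \<Rightarrow> real^3^3) \<Rightarrow> (real^3 \<Rightarrow> real^3) \<Rightarrow> (real^3 \<Rightarrow> real^3) \<Rightarrow> real" where
  "tri G p q = (LINT x|lebesgue_on cyl. (G x *v p x) \<bullet> q x)"

section \<open>Bounds, continuity and antisymmetry of the trilinear form\<close>

lemma norm_matrix_vector_le:
  fixes A :: "real^'n^'m" shows "norm (A *v x) \<le> norm A * norm x"
proof (rule power2_le_imp_le)
  have sq: "(norm v)\<^sup>2 = (\<Sum>i\<in>UNIV. (norm (v $ i))\<^sup>2)" for v :: "('c::real_normed_vector)^'k"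
    by (simp add: norm_vec_def L2_set_def sum_nonneg)
  have "(norm (A *v x))\<^sup>2 = (\<Sum>i\<in>UNIV. (A $ i \<bullet> x)\<^sup>2)"
    unfolding sq by (simp add: matrix_mult_dot)
  also have "\<dots> \<le> (\<Sum>i\<in>UNIV. (norm (A $ i))\<^sup>2 * (norm x)\<^sup>2)"
    by (intro sum_mono) (metis Cauchy_Schwarz_ineq power2_norm_eq_inner)
  also have "\<dots> = (norm A * norm x)\<^sup>2"
    by (simp add: power_mult_distrib sq[of A] sum_distrib_right)
  finally show "(norm (A *v x))\<^sup>2 \<le> (norm A * norm x)\<^sup>2" .
qed simp

lemma tri_integrand_le: "\<bar>(G *v p) \<bullet> q\<bar> \<le> norm (G :: real^3^3) * (norm p * norm q)"
  using order.trans[OF Cauchy_Schwarz_ineq2[of "G *v p" q] mult_right_mono[OF norm_matrix_vector_le[of G p] norm_ge_zero[of q]]]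
  by (simp add: mult.assoc)

lemma matrix_vector_measurable:
  assumes "G \<in> borel_measurable M" "p \<in> borel_measurable M"
  shows "(\<lambda>x. (G x :: real^3^3) *v p x) \<in> borel_measurable M"
proof -
  have "continuous_on UNIV (\<lambda>z::(real^3^3) \<times> (real^3). fst z *v snd z)"
    unfolding matrix_vector_mult_def by (intro continuous_on_vec_lambda continuous_intros)
  from borel_measurable_continuous_Pair[OF assms this] show ?thesis by simp
qed

lemma tri_integrable:
  assumes "G \<in> L2" "p \<in> V_space" "q \<in> V_space"
  shows "integrable (lebesgue_on cyl) (\<lambda>x. norm (G x) * (norm (p x) * norm (q x)))"
    "integrable (lebesgue_on cyl) (\<lambda>x. (G x *v p x) \<bullet> q x)"
proof -
  show 1: "integrable (lebesgue_on cyl) (\<lambda>x. norm (G x) * (norm (p x) * norm (q x)))"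
    by (rule L2_integrable_times[OF L2_norm_fun[OF assms(1)] V_prod_L2(1)[OF assms(2,3)]])
  show "integrable (lebesgue_on cyl) (\<lambda>x. (G x *v p x) \<bullet> q x)"
    by (rule Bochner_Integration.integrable_bound[OF 1])
      (use V_L2[OF assms(2), THEN L2_measurable] V_L2[OF assms(3), THEN L2_measurable]
        L2_measurable[OF assms(1)] in \<open>auto intro!: borel_measurable_inner matrix_vector_measurable AE_I2 tri_integrand_le simp: abs_mult\<close>)
qed

lemma tri_abs_le:
  assumes "G \<in> L2" "p \<in> V_space" "q \<in> V_space"
  shows "\<bar>tri G p q\<bar> \<le> (LINT x|lebesgue_on cyl. norm (G x) * (norm (p x) * norm (q x)))"
    and "\<bar>tri G p q\<bar> \<le> L2_norm G * L2_norm (\<lambda>x. norm (p x) * norm (q x))"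
    and "\<bar>tri G p q\<bar> \<le> 2 * L2_norm G * H1_norm p * H1_norm q"
proof -
  have "\<bar>tri G p q\<bar> \<le> (LINT x|lebesgue_on cyl. \<bar>(G x *v p x) \<bullet> q x\<bar>)"
    unfolding tri_def by (rule integral_abs_bound)
  also have "\<dots> \<le> (LINT x|lebesgue_on cyl. norm (G x) * (norm (p x) * norm (q x)))"
    by (intro integral_mono integrable_abs tri_integrable assms tri_integrand_le)
  finally show 1: "\<bar>tri G p q\<bar> \<le> (LINT x|lebesgue_on cyl. norm (G x) * (norm (p x) * norm (q x)))" .
  also have "\<dots> \<le> L2_norm G * L2_norm (\<lambda>x. norm (p x) * norm (q x))"
    using integral_norm_mult_le[OF assms(1) V_prod_L2(1)[OF assms(2,3)]] by simp
  finally show 2: "\<bar>tri G p q\<bar> \<le> L2_norm G * L2_norm (\<lambda>x. norm (p x) * norm (q x))" .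
  also have "\<dots> \<le> L2_norm G * (2 * H1_norm p * H1_norm q)"
    by (intro mult_left_mono V_prod_L2(3) assms) simp
  finally show "\<bar>tri G p q\<bar> \<le> 2 * L2_norm G * H1_norm p * H1_norm q" by (simp add: mult_ac)
qed

lemma tri_diff:
  assumes "G \<in> L2" "G' \<in> L2" "p \<in> V_space" "p' \<in> V_space" "q \<in> V_space" "q' \<in> V_space"
  shows "tri (\<lambda>x. G x - G' x) p q = tri G p q - tri G' p q"
    "tri G (\<lambda>x. p x - p' x) q = tri G p q - tri G p' q"
    "tri G p (\<lambda>x. q x - q' x) = tri G p q - tri G p q'"
proof -
  have "A *v (x - y) = A *v x - A *v y" "(A - B) *v x = A *v x - B *v x" for A B :: "real^3^3" and x y
    by (simp_all add: matrix_vector_mult_diff_distrib matrix_vector_mult_diff_rdistrib)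
  note * = this
  show "tri (\<lambda>x. G x - G' x) p q = tri G p q - tri G' p q"
    "tri G (\<lambda>x. p x - p' x) q = tri G p q - tri G p' q"
    "tri G p (\<lambda>x. q x - q' x) = tri G p q - tri G p q'"
    unfolding tri_def * inner_diff_left inner_diff_right
    by (intro Bochner_Integration.integral_diff tri_integrable assms)+
qed

lemma tri_cong_AE:
  assumes "G \<in> L2" "G' \<in> L2" "p \<in> V_space" "q \<in> V_space" "AE x in lebesgue_on cyl. G x = G' x"
  shows "tri G p q = tri G' p q"
  unfolding tri_def
  by (rule integral_cong_AE)
    (use assms borel_measurable_integrable[OF tri_integrable(2)] in auto)

lemma tri_wgrad_diff:
  assumes "f \<in> V_space" "g \<in> V_space" "p \<in> V_space" "q \<in> V_space"
  shows "tri (wgrad (\<lambda>x. f x - g x)) p q = tri (wgrad f) p q - tri (wgrad g) p q"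
proof -
  have "tri (wgrad (\<lambda>x. f x - g x)) p q = tri (\<lambda>x. wgrad f x - wgrad g x) p q"
    by (rule tri_cong_AE) (intro V_wgrad_L2 V_diff L2_diff wgrad_diff V_H1 assms)+
  also have "\<dots> = tri (wgrad f) p q - tri (wgrad g) p q"
    by (rule tri_diff(1)[OF _ _ assms(3) assms(3) assms(4) assms(4)]) (intro V_wgrad_L2 assms)+
  finally show ?thesis .
qed

text \<open>The three arguments are exchanged one at a time; in each difference one norm tends to
  zero while the other two converge.\<close>

lemma tri_tendsto:
  assumes f: "\<And>n. f n \<in> V_space" "f' \<in> V_space" "(\<lambda>n. H1_norm (\<lambda>x. f n x - f' x)) \<longlonglongrightarrow> 0"
    and p: "\<And>n. p n \<in> V_space" "p' \<in> V_space" "(\<lambda>n. H1_norm (\<lambda>x. p n x - p' x)) \<longlonglongrightarrow> 0"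
    and q: "\<And>n. q n \<in> V_space" "q' \<in> V_space" "(\<lambda>n. H1_norm (\<lambda>x. q n x - q' x)) \<longlonglongrightarrow> 0"
  shows "(\<lambda>n. tri (wgrad (f n)) (p n) (q n)) \<longlonglongrightarrow> tri (wgrad f') p' q'"
proof (rule tendsto_of_abs_diff_le)
  let ?e = "\<lambda>n. 2 * H1_norm (\<lambda>x. f n x - f' x) * H1_norm (p n) * H1_norm (q n) +
     2 * L2_norm (wgrad f') * H1_norm (\<lambda>x. p n x - p' x) * H1_norm (q n) +
     2 * L2_norm (wgrad f') * H1_norm p' * H1_norm (\<lambda>x. q n x - q' x)"
  have "?e \<longlonglongrightarrow> 2 * 0 * H1_norm p' * H1_norm q' + 2 * L2_norm (wgrad f') * 0 * H1_norm q' + 2 * L2_norm (wgrad f') * H1_norm p' * 0"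
    by (intro tendsto_intros f p q H1_norm_tendsto(1) V_H1)
  then show "?e \<longlonglongrightarrow> 0" by simp
  fix n
  have "tri (wgrad (f n)) (p n) (q n) - tri (wgrad f') p' q' =
      tri (wgrad (\<lambda>x. f n x - f' x)) (p n) (q n) + tri (wgrad f') (\<lambda>x. p n x - p' x) (q n) + tri (wgrad f') p' (\<lambda>x. q n x - q' x)"
    using tri_wgrad_diff[OF f(1)[of n] f(2) p(1)[of n] q(1)[of n]]
      tri_diff(2)[OF V_wgrad_L2[OF f(2)] V_wgrad_L2[OF f(2)] p(1)[of n] p(2) q(1)[of n] q(2)]
      tri_diff(3)[OF V_wgrad_L2[OF f(2)] V_wgrad_L2[OF f(2)] p(2) p(2) q(1)[of n] q(2)] by simp
  moreover have "\<bar>tri (wgrad (\<lambda>x. f n x - f' x)) (p n) (q n)\<bar> \<le> 2 * H1_norm (\<lambda>x. f n x - f' x) * H1_norm (p n) * H1_norm (q n)"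
  proof -
    have "\<bar>tri (wgrad (\<lambda>x. f n x - f' x)) (p n) (q n)\<bar> \<le> 2 * L2_norm (wgrad (\<lambda>x. f n x - f' x)) * H1_norm (p n) * H1_norm (q n)"
      by (intro tri_abs_le V_wgrad_L2 V_diff f p q)
    also have "\<dots> \<le> 2 * H1_norm (\<lambda>x. f n x - f' x) * H1_norm (p n) * H1_norm (q n)"
      by (intro mult_right_mono mult_left_mono L2_norm_le_H1) auto
    finally show ?thesis .
  qed
  moreover have "\<bar>tri (wgrad f') (\<lambda>x. p n x - p' x) (q n)\<bar> \<le> 2 * L2_norm (wgrad f') * H1_norm (\<lambda>x. p n x - p' x) * H1_norm (q n)"
    by (intro tri_abs_le V_wgrad_L2 V_diff f p q)
  moreover have "\<bar>tri (wgrad f') p' (\<lambda>x. q n x - q' x)\<bar> \<le> 2 * L2_norm (wgrad f') * H1_norm p' * H1_norm (\<lambda>x. q n x - q' x)"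
    by (intro tri_abs_le V_wgrad_L2 V_diff f p q)
  ultimately show "\<bar>tri (wgrad (f n)) (p n) (q n) - tri (wgrad f') p' q'\<bar> \<le> ?e n" by linarith
qed

lemma V_const_tendsto: "v \<in> V_space \<Longrightarrow> (\<lambda>n::nat. H1_norm (\<lambda>x. v x - v x)) \<longlonglongrightarrow> 0"
  by (simp add: H1_norm_zero)

lemma jac_mult: "jac f x *v p = (\<Sum>j\<in>UNIV. p $ j *\<^sub>R pd j f x)"
  by (simp add: vec_eq_iff matrix_vector_mult_def jac_pd mult.commute)

text \<open>The sum of the two integrands is the divergence of \<open>(f \<bullet> g) p\<close>,
  because \<open>p\<close> is divergence-free, and each \<open>E j\<close> is one partial derivative
  in that divergence, with zero integral over the cylinder.\<close>

lemma tri_antisym_smooth: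
  assumes p: "p \<in> D_sol" and f: "f \<in> D_space" and g: "g \<in> D_space"
  shows "(LINT x|lebesgue_on cyl. (jac f x *v p x) \<bullet> g x) = - (LINT x|lebesgue_on cyl. (jac g x *v p x) \<bullet> f x)"
proof -
  note pD = D_sol_D_space[OF p]
  note cont = D_space_continuous(1)[OF pD] D_space_continuous(1)[OF f] D_space_continuous(1)[OF g]
    pd_D_space(1)[OF pD] pd_D_space(1)[OF f] pd_D_space(1)[OF g]
  define E where "E j x = pd j p x $ j * (f x \<bullet> g x) + p x $ j * (pd j f x \<bullet> g x + f x \<bullet> pd j g x)" for j x
  have E0: "(LINT x|lebesgue_on cyl. E j x) = 0" for j
  proof -
    define D where "D x h = frechet_derivative p (at x) h $ j * (f x \<bullet> g x) +
       p x $ j * (frechet_derivative f (at x) h \<bullet> g x + f x \<bullet> frechet_derivative g (at x) h)" for x h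
    have ED: "E j = (\<lambda>x. D x (axis j 1))" by (simp add: E_def D_def pd_def fun_eq_iff)
    have "(LINT x|lebesgue_on cyl. D x (axis j 1)) = 0"
    proof (rule cyl_integral_deriv_0[of "\<lambda>x. p x $ j * (f x \<bullet> g x)"])
      show "((\<lambda>x. p x $ j * (f x \<bullet> g x)) has_derivative D x) (at x)" for x
        unfolding D_def
        by (rule has_derivative_eq_rhs, rule has_derivative_mult, rule bounded_linear.has_derivative[OF bounded_linear_vec_nth],
            rule D_space_has_derivative[OF pD], rule has_derivative_inner, rule D_space_has_derivative[OF f], rule D_space_has_derivative[OF g])
          (auto simp: fun_eq_iff algebra_simps)
      show "continuous_on UNIV (\<lambda>x. D x (axis j 1))"
        unfolding ED[symmetric] E_def by (intro continuous_intros cont)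
      show "hor x \<notin> disk \<Longrightarrow> p x $ j * (f x \<bullet> g x) = 0" for x
        using D_space_zero_outside[OF pD] by simp
      show "hor x \<notin> disk \<Longrightarrow> D x (axis j 1) = 0" for x
        using D_space_zero_outside[OF pD] D_space_zero_outside[OF f] D_space_zero_outside[OF g] by (simp add: D_def)
      fix x y :: "real^3" assume "x $ 1 = y $ 1" "x $ 2 = y $ 2" "x $ 3 = 0" "y $ 3 = 1"
      then have y: "y = x + axis 3 1" by (auto simp: vec_eq_iff forall_3 axis_def)
      show "p x $ j * (f x \<bullet> g x) = p y $ j * (f y \<bullet> g y)"
        using D_spaceD(2)[OF pD] D_spaceD(2)[OF f] D_spaceD(2)[OF g] unfolding y z_periodic_def by simp
    qed
    then show ?thesis by (simp add: ED)
  qed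
  have Ei: "integrable (lebesgue_on cyl) (E j)" for j
    unfolding E_def[abs_def] by (intro L2_integrable L2_continuous continuous_intros cont)
  have S: "(\<Sum>j\<in>UNIV. E j x) = (jac f x *v p x) \<bullet> g x + (jac g x *v p x) \<bullet> f x" for x
  proof -
    have "(\<Sum>j\<in>UNIV. pd j p x $ j) = 0"
      using p unfolding D_sol_def divergence_def trace_def by (simp add: jac_pd)
    then have "(\<Sum>j\<in>UNIV. E j x) = (\<Sum>j\<in>UNIV. p x $ j * (pd j f x \<bullet> g x)) + (\<Sum>j\<in>UNIV. p x $ j * (pd j g x \<bullet> f x))"
      by (simp add: E_def sum.distrib algebra_simps inner_commute flip: sum_distrib_right sum_distrib_left)
    also have "\<dots> = (jac f x *v p x) \<bullet> g x + (jac g x *v p x) \<bullet> f x"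
      by (simp add: jac_mult inner_sum_left)
    finally show ?thesis .
  qed
  have "0 = (\<Sum>j\<in>UNIV. (LINT x|lebesgue_on cyl. E j x))" by (simp add: E0)
  also have "\<dots> = (LINT x|lebesgue_on cyl. (\<Sum>j\<in>UNIV. E j x))"
    by (rule Bochner_Integration.integral_sum[symmetric]) (rule Ei)
  also have "\<dots> = (LINT x|lebesgue_on cyl. (jac f x *v p x) \<bullet> g x) + (LINT x|lebesgue_on cyl. (jac g x *v p x) \<bullet> f x)"
    unfolding S by (intro Bochner_Integration.integral_add L2_integrable L2_continuous)
      (auto simp: jac_mult intro!: continuous_intros cont)
  finally show ?thesis by simp
qed

lemma tri_jac:
  assumes "f \<in> D_space" "p \<in> V_space" "q \<in> V_space"
  shows "tri (wgrad f) p q = tri (jac f) p q"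
  by (rule tri_cong_AE) (intro wgrad_props D_space_H1 D_space_L2 wgrad_D_space assms)+

lemma tri_antisym:
  assumes "p \<in> V_space" "f \<in> V_space" "g \<in> V_space"
  shows "tri (wgrad f) p g = - tri (wgrad g) p f"
proof -
  obtain pn where pn: "\<And>n::nat. pn n \<in> D_sol" "(\<lambda>n. H1_norm (\<lambda>x. pn n x - p x)) \<longlonglongrightarrow> 0" using V_approx[OF assms(1)] by auto
  obtain fn where fn: "\<And>n::nat. fn n \<in> D_sol" "(\<lambda>n. H1_norm (\<lambda>x. fn n x - f x)) \<longlonglongrightarrow> 0" using V_approx[OF assms(2)] by auto
  obtain gn where gn: "\<And>n::nat. gn n \<in> D_sol" "(\<lambda>n. H1_norm (\<lambda>x. gn n x - g x)) \<longlonglongrightarrow> 0" using V_approx[OF assms(3)] by auto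
  note t = tri_tendsto[OF D_sol_V[OF fn(1)] assms(2) fn(2) D_sol_V[OF pn(1)] assms(1) pn(2) D_sol_V[OF gn(1)] assms(3) gn(2)]
    tri_tendsto[OF D_sol_V[OF gn(1)] assms(3) gn(2) D_sol_V[OF pn(1)] assms(1) pn(2) D_sol_V[OF fn(1)] assms(2) fn(2)]
  have "tri (wgrad (fn n)) (pn n) (gn n) = - tri (wgrad (gn n)) (pn n) (fn n)" for n
    using tri_antisym_smooth[OF pn(1) D_sol_D_space[OF fn(1)] D_sol_D_space[OF gn(1)], of n n n]
    by (simp add: tri_jac D_sol_D_space fn gn pn D_sol_V) (simp add: tri_def)
  then have "(\<lambda>n. tri (wgrad (fn n)) (pn n) (gn n)) \<longlonglongrightarrow> - tri (wgrad g) p f"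
    using tendsto_minus[OF t(2)] by simp
  then show ?thesis using t(1) LIMSEQ_unique by blast
qed

lemma tri_self: "p \<in> V_space \<Longrightarrow> f \<in> V_space \<Longrightarrow> tri (wgrad f) p f = 0"
  using tri_antisym[of p f f] by simp

section \<open>Helical fields\<close>

lemma rot_nth:
  "(rot \<theta> *v x) $ 1 = cos \<theta> * x $ 1 + sin \<theta> * x $ 2"
  "(rot \<theta> *v x) $ 2 = - sin \<theta> * x $ 1 + cos \<theta> * x $ 2"
  "(rot \<theta> *v x) $ 3 = x $ 3"
  by (simp_all add: rot_def matrix_vector_mult_def sum_3)

lemma norm_sq_3: "(norm (x :: real^3))\<^sup>2 = (x $ 1)\<^sup>2 + (x $ 2)\<^sup>2 + (x $ 3)\<^sup>2"
  by (simp add: norm_vec_def L2_set_def sum_3)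

lemma rot_sq: "(cos \<theta> * a + sin \<theta> * b)\<^sup>2 + (- sin \<theta> * a + cos \<theta> * b)\<^sup>2 = a\<^sup>2 + (b :: real)\<^sup>2"
proof -
  have "(cos \<theta> * a + sin \<theta> * b)\<^sup>2 + (- sin \<theta> * a + cos \<theta> * b)\<^sup>2 = ((sin \<theta>)\<^sup>2 + (cos \<theta>)\<^sup>2) * (a\<^sup>2 + b\<^sup>2)"
    by algebra
  then show ?thesis by simp
qed

lemma norm_rot: "norm (rot \<theta> *v x) = norm x"
proof -
  have "(norm (rot \<theta> *v x))\<^sup>2 = (norm x)\<^sup>2"
    unfolding norm_sq_3 rot_nth rot_sq ..
  then show ?thesis by simp
qed

lemma rot_inverse: "rot (- \<theta>) *v (rot \<theta> *v x) = x"
proof -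
  have c: "cos \<theta> * cos \<theta> + sin \<theta> * sin \<theta> = 1"
    using sin_cos_squared_add[of \<theta>] by (simp add: power2_eq_square)
  have e: "cos \<theta> * (cos \<theta> * y) + sin \<theta> * (sin \<theta> * y) = y" for y
    by (metis c distrib_right mult.assoc mult_1)
  have "(rot (- \<theta>) *v (rot \<theta> *v x)) $ 1 = x $ 1" "(rot (- \<theta>) *v (rot \<theta> *v x)) $ 2 = x $ 2"
    using e[of "x $ 1"] e[of "x $ 2"] by (simp_all add: rot_nth algebra_simps)
  then show ?thesis by (simp add: vec_eq_iff forall_3 rot_nth(3))
qed

lemma rot_measurable [measurable]: "(\<lambda>x. rot \<theta> *v x) \<in> borel_measurable borel"
  by (intro borel_measurable_continuous_onI linear_continuous_on linear_conv_bounded_linear[THEN iffD1] matrix_vector_mul_linear)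

lemma distr_rot: "distr lborel borel (\<lambda>x. rot \<theta> *v x) = lborel"
proof (rule sym, rule lborel_eqI)
  fix l u :: "real^3" assume le: "\<And>b. b \<in> Basis \<Longrightarrow> l \<bullet> b \<le> u \<bullet> b"
  have o: "orthogonal_transformation (\<lambda>x. rot (- \<theta>) *v x)"
    by (simp add: orthogonal_transformation norm_rot matrix_vector_mul_linear)
  have im: "(\<lambda>x. rot \<theta> *v x) -` box l u = (\<lambda>x. rot (- \<theta>) *v x) ` box l u"
  proof (intro set_eqI iffI)
    fix x assume "x \<in> (\<lambda>x. rot \<theta> *v x) -` box l u"
    then show "x \<in> (\<lambda>x. rot (- \<theta>) *v x) ` box l u"
      by (intro image_eqI[of _ _ "rot \<theta> *v x"]) (auto simp: rot_inverse)
  next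
    fix x assume "x \<in> (\<lambda>x. rot (- \<theta>) *v x) ` box l u"
    then show "x \<in> (\<lambda>x. rot \<theta> *v x) -` box l u"
      using rot_inverse[of "- \<theta>"] by auto
  qed
  have lm: "box l u \<in> lmeasurable" by simp
  have "emeasure (distr lborel borel (\<lambda>x. rot \<theta> *v x)) (box l u) = emeasure lborel ((\<lambda>x. rot \<theta> *v x) -` box l u)"
    by (subst emeasure_distr) auto
  also have "\<dots> = emeasure lebesgue ((\<lambda>x. rot \<theta> *v x) -` box l u)"
    using measurable_sets[OF rot_measurable, of "box l u"] by (subst emeasure_completion) auto
  also have "\<dots> = emeasure lebesgue (box l u)"
    unfolding im using measurable_orthogonal_image[OF o lm] measure_orthogonal_image[OF o lm] lm
    by (simp add: emeasure_eq_measure2)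
  also have "\<dots> = emeasure lborel (box l u)" by simp
  also have "\<dots> = (\<Prod>b\<in>Basis. (u - l) \<bullet> b)"
    using le by (simp add: emeasure_lborel_box_eq)
  finally show "emeasure (distr lborel borel (\<lambda>x. rot \<theta> *v x)) (box l u) = (\<Prod>b\<in>Basis. (u - l) \<bullet> b)" .
qed simp

lemma AE_lborel_shift:
  assumes "AE x in lborel. P (x :: 'a::euclidean_space)"
  shows "AE x in lborel. P (x + t)"
proof -
  have "AE x in distr lborel borel ((+) t). P x" using assms by (simp only: lborel_distr_plus)
  from AE_distrD[OF _ this] show ?thesis by (simp add: add.commute)
qed

lemma AE_lborel_rot:
  assumes "AE x in lborel. P x"
  shows "AE x in lborel. P (rot \<theta> *v x + t)"
proof -
  have "AE x in distr lborel borel (\<lambda>x. rot \<theta> *v x). P (x + t)"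
    unfolding distr_rot by (rule AE_lborel_shift[OF assms])
  from AE_distrD[OF _ this] show ?thesis by simp
qed

lemma AE_slices:
  assumes "AE x in lborel. P (x :: real^3)"
  shows "AE c in lborel. AE p in lborel. P (sl c p)"
proof -
  have "AE q in lborel. P (coords 3 1 q)"
  proof -
    have "AE x in distr lborel borel (coords 3 1). P x" using assms by (simp only: distr_coords[of 3 1, simplified])
    from AE_distrD[OF _ this] show ?thesis by simp
  qed
  then have "AE q in lborel \<Otimes>\<^sub>M lborel. P (coords 3 1 q)" unfolding lborel_prod .
  from lborel_pair.AE_pair[OF this] show ?thesis .
qed

definition prot :: "real \<Rightarrow> real \<times> real \<Rightarrow> real \<times> real" where
  "prot \<theta> p = (cos \<theta> * fst p + sin \<theta> * snd p, - sin \<theta> * fst p + cos \<theta> * snd p)"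

lemma rot_sl: "rot \<theta> *v sl c p = sl c (prot \<theta> p)"
  by (cases p) (simp add: vec_eq_iff forall_3 rot_nth prot_def)

lemma prot_disk: "prot \<theta> p \<in> disk \<longleftrightarrow> p \<in> disk"
  by (cases p) (simp add: disk_def norm_Pair prot_def rot_sq[simplified])

lemma nn_integral_sl:
  assumes [measurable]: "F \<in> borel_measurable borel"
  shows "(\<integral>\<^sup>+x. F x \<partial>lborel) = (\<integral>\<^sup>+c. \<integral>\<^sup>+p. F (sl c p) \<partial>lborel \<partial>lborel)"
  by (subst nn_integral_coords[of 3 1]) (auto simp: nn_integral_lborel_pair(2))

text \<open>Invariance under rotations of the plane follows from that in space by extending
  \<open>F\<close> to a function that is constant in the height over an interval of length
  one.\<close>

lemma nn_integral_prot:
  assumes F: "F \<in> borel_measurable borel"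
  shows "(\<integral>\<^sup>+p. F (prot \<theta> p) \<partial>lborel) = (\<integral>\<^sup>+p. F p \<partial>lborel)"
proof -
  define G where "G x = F (hor x) * indicator {0<..<1} (x $ 3)" for x :: "real^3"
  have [measurable]: "hor \<in> borel_measurable borel" "(\<lambda>x::real^3. x $ 3) \<in> borel_measurable borel"
    unfolding hor_def by (intro borel_measurable_continuous_onI continuous_intros)+
  note [measurable] = F
  have G[measurable]: "G \<in> borel_measurable borel" unfolding G_def by measurable
  have unit: "(\<integral>\<^sup>+c. k * indicator {0<..<1::real} c \<partial>lborel) = k" for k
    by (simp add: nn_integral_cmult)
  have prot_m: "prot \<theta> \<in> borel_measurable borel"
    unfolding prot_def by (intro borel_measurable_continuous_onI continuous_intros)
  have 1: "(\<integral>\<^sup>+x. G x \<partial>lborel) = (\<integral>\<^sup>+p. F p \<partial>lborel)"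
    unfolding nn_integral_sl[OF G] by (simp add: G_def hor_sl nn_integral_multc unit)
  have "(\<integral>\<^sup>+x. G (rot \<theta> *v x) \<partial>lborel) = (\<integral>\<^sup>+c. \<integral>\<^sup>+p. G (rot \<theta> *v sl c p) \<partial>lborel \<partial>lborel)"
    by (rule nn_integral_sl) measurable
  also have "\<dots> = (\<integral>\<^sup>+p. F (prot \<theta> p) \<partial>lborel)"
    using measurable_compose[OF prot_m F] by (simp add: rot_sl G_def hor_sl nn_integral_multc unit)
  finally have 2: "(\<integral>\<^sup>+x. G (rot \<theta> *v x) \<partial>lborel) = (\<integral>\<^sup>+p. F (prot \<theta> p) \<partial>lborel)" .
  have "(\<integral>\<^sup>+x. G x \<partial>lborel) = (\<integral>\<^sup>+x. G (rot \<theta> *v x) \<partial>lborel)"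
    by (subst distr_rot[of \<theta>, symmetric], subst nn_integral_distr) auto
  then show ?thesis using 1 2 by simp
qed

text \<open>Addition modulo one for two numbers in the open unit interval. The value
  \<open>0\<close> at \<open>c + s = 1\<close> leaves the interval, but for fixed \<open>s\<close>
  this concerns a single \<open>c\<close>.\<close>

definition wrap :: "real \<Rightarrow> real \<Rightarrow> real" where
  "wrap c s = (if c + s < 1 then c + s else c + s - 1)"

text \<open>For step one, the rotation by the angle \<open>2 * pi * s\<close> is coupled with the
  vertical shift by \<open>s\<close>, and the rotation acting on the values of \<open>z\<close>
  preserves their norm. As helicity holds only almost everywhere for each angle, the result is
  phrased for a Borel version \<open>\<rho>\<close> of the norm and for almost every slice.\<close>

lemma helical_norm_AE:
  assumes h: "helical 1 z" and s: "0 < s" "s < 1"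
    and \<rho>: "AE x in lborel. x \<in> cyl \<longrightarrow> norm (z x) = \<rho> x"
  shows "AE c in lborel. AE p in lborel. p \<in> disk \<longrightarrow> 0 < c \<longrightarrow> c < 1 \<longrightarrow>
    \<rho> (sl (wrap c s) (prot (2 * pi * s) p)) = \<rho> (sl c p)"
proof -
  define \<theta> where "\<theta> = 2 * pi * s"
  define t :: "real^3" where "t = vector [0, 0, s]"
  have "AE x in lborel. hor x \<in> disk \<longrightarrow> z_extend z (rot \<theta> *v x + t) = rot \<theta> *v z_extend z x"
    using h[unfolded helical_def, rule_format, of \<theta>] by (simp add: AE_completion_iff \<theta>_def t_def)
  \<comment> \<open>The representation by \<open>\<rho>\<close> is needed at \<open>x\<close> and at
    its image, which lies at height \<open>x $ 3 + s\<close> or, after subtracting a period, at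
    \<open>x $ 3 + s - 1\<close>; hence the two translates.\<close>
  moreover note \<rho> AE_lborel_rot[OF \<rho>, of \<theta> t] AE_lborel_rot[OF \<rho>, of \<theta> "t - axis 3 1"]
  ultimately have "AE x in lborel. hor x \<in> disk \<longrightarrow> 0 < x $ 3 \<longrightarrow> x $ 3 < 1 \<longrightarrow> x $ 3 + s \<noteq> 1 \<longrightarrow>
     \<rho> (sl (wrap (x $ 3) s) (prot \<theta> (hor x))) = \<rho> x"
  proof eventually_elim
    case (elim x)
    show ?case
    proof (intro impI)
      assume x: "hor x \<in> disk" "0 < x $ 3" "x $ 3 < 1" "x $ 3 + s \<noteq> 1"
      have xs: "x = sl (x $ 3) (hor x)" by (simp add: vec_eq_iff forall_3 hor_def)
      have zx: "z_extend z x = z x"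
      proof -
        have "frac (x $ 3) = x $ 3" using x by (simp add: frac_eq)
        then have "vector [x $ 1, x $ 2, frac (x $ 3)] = x" by (simp add: vec_eq_iff forall_3)
        then show ?thesis by (simp add: z_extend_def)
      qed
      have r: "rot \<theta> *v x = sl (x $ 3) (prot \<theta> (hor x))" by (subst xs) (rule rot_sl)
      define y where "y = rot \<theta> *v x + (if x $ 3 + s < 1 then t else t - axis 3 1)"
      have y: "y = sl (wrap (x $ 3) s) (prot \<theta> (hor x))"
        unfolding y_def r wrap_def t_def
        by (cases "prot \<theta> (hor x)") (simp add: vec_eq_iff forall_3 axis_def)
      have ycyl: "y \<in> cyl" using x s unfolding y by (auto simp: sl_in_cyl prot_disk wrap_def)
      have fr: "frac (x $ 3 + s) = wrap (x $ 3) s"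
      proof (cases "x $ 3 + s < 1")
        case True then show ?thesis using x s by (simp add: wrap_def frac_eq)
      next
        case False
        then have "frac (x $ 3 + s) = frac ((x $ 3 + s - 1) + 1)" by simp
        also have "\<dots> = frac (x $ 3 + s - 1)" by (simp only: frac_1_eq)
        also have "\<dots> = x $ 3 + s - 1" using False x s by (simp add: frac_eq)
        finally show ?thesis using False by (simp add: wrap_def)
      qed
      have "z_extend z (rot \<theta> *v x + t) = z y"
      proof -
        have "(rot \<theta> *v x + t) $ 3 = x $ 3 + s" by (simp add: rot_nth t_def)
        then have "vector [(rot \<theta> *v x + t) $ 1, (rot \<theta> *v x + t) $ 2, frac ((rot \<theta> *v x + t) $ 3)] = y"
          using fr unfolding y r by (cases "prot \<theta> (hor x)") (simp add: vec_eq_iff forall_3 t_def)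
        then show ?thesis by (simp add: z_extend_def)
      qed
      then have "norm (z y) = norm (z x)" using elim(1) x zx norm_rot[of \<theta> "z x"] by auto
      moreover have "norm (z x) = \<rho> x" using elim(2) x by (simp add: cyl_def)
      moreover have "norm (z y) = \<rho> y" using elim(3,4) ycyl by (auto simp: y_def split: if_splits simp: algebra_simps)
      ultimately show "\<rho> (sl (wrap (x $ 3) s) (prot \<theta> (hor x))) = \<rho> x" using y by simp
    qed
  qed
  from AE_slices[OF this] have "AE c in lborel. AE p in lborel. p \<in> disk \<longrightarrow> 0 < c \<longrightarrow> c < 1 \<longrightarrow> c + s \<noteq> 1 \<longrightarrow>
    \<rho> (sl (wrap c s) (prot \<theta> p)) = \<rho> (sl c p)" by (simp add: hor_sl)
  moreover have "AE c in lborel. c \<noteq> 1 - s" by (rule AE_lborel_singleton)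
  ultimately show ?thesis
    unfolding \<theta>_def[symmetric]
    by eventually_elim (auto elim!: eventually_mono)
qed

text \<open>By Fubini's theorem some \<open>c\<close> satisfies \<open>Q (wrap c s) = Q c\<close> for almost every shift \<open>s\<close>.\<close>

lemma translation_invariant_const:
  fixes Q :: "real \<Rightarrow> ennreal"
  assumes Q[measurable]: "Q \<in> borel_measurable borel"
    and inv: "\<And>s. 0 < s \<Longrightarrow> s < 1 \<Longrightarrow> AE c in lborel. 0 < c \<longrightarrow> c < 1 \<longrightarrow> Q (wrap c s) = Q c"
  shows "\<exists>k. AE c in lborel. 0 < c \<longrightarrow> c < 1 \<longrightarrow> Q c = k"
proof -
  let ?P = "\<lambda>s c. 0 < s \<longrightarrow> s < 1 \<longrightarrow> 0 < c \<longrightarrow> c < 1 \<longrightarrow> Q (wrap c s) = Q c"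
  have "AE s in lborel. AE c in lborel. ?P s c"
  proof (rule AE_I2)
    fix s show "AE c in lborel. ?P s c"
      by (cases "0 < s \<and> s < 1") (use inv[of s] in auto)
  qed
  moreover have "{x \<in> space (lborel \<Otimes>\<^sub>M lborel). ?P (fst x) (snd x)} \<in> sets (lborel \<Otimes>\<^sub>M lborel)"
    unfolding wrap_def by measurable
  ultimately have AE: "AE c in lborel. AE s in lborel. ?P s c"
    using lborel_pair.AE_commute[of ?P] by blast
  have "\<exists>c. 0 < c \<and> c < 1 \<and> (AE s in lborel. ?P s c)"
  proof (rule ccontr)
    assume "\<not> ?thesis"
    with AE have "AE c in lborel. c \<notin> {0<..<1::real}" by (auto elim!: eventually_mono)
    then have "emeasure lborel {x::real. \<not> x \<notin> {0<..<1}} = 0" by (subst (asm) AE_iff_measurable[OF _ refl]) auto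
    moreover have "{x::real. \<not> x \<notin> {0<..<1}} = {0<..<1}" by auto
    ultimately show False by simp
  qed
  then obtain c where c: "0 < c" "c < 1" and P: "AE s in lborel. ?P s c" by blast
  have "AE d in lborel. 0 < d \<longrightarrow> d < 1 \<longrightarrow> Q d = Q c"
    \<comment> \<open>The height \<open>d\<close> is reached from \<open>c\<close> by the shift
      \<open>d - c\<close>, or by \<open>d - c + 1\<close> if \<open>d < c\<close>. The shift
      \<open>0\<close>, to which \<open>inv\<close> does not apply, is avoided by
      \<open>d \<noteq> c\<close>.\<close>
    using AE_lborel_shift[OF P, of "- c"] AE_lborel_shift[OF P, of "1 - c"] AE_lborel_singleton[of c]
  proof eventually_elim
    case (elim d)
    show ?case
    proof (intro impI)
      assume d: "0 < d" "d < 1"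
      show "Q d = Q c"
      proof (cases "d < c")
        case True then show ?thesis using elim(2) c d by (simp add: wrap_def algebra_simps)
      next
        case False then show ?thesis using elim(1,3) c d by (simp add: wrap_def)
      qed
    qed
  qed
  then show ?thesis by blast
qed

lemma sl_measurable_comp:
  assumes [measurable]: "F \<in> borel_measurable borel"
  shows "(\<lambda>p. F (sl c p)) \<in> borel_measurable borel"
  by (rule measurable_compose[OF borel_measurable_continuous_onI[OF continuous_sl] assms])

lemma slice_nn_measurable:
  assumes [measurable]: "F \<in> borel_measurable borel"
  shows "(\<lambda>c. \<integral>\<^sup>+p. F (sl c p) \<partial>lborel) \<in> borel_measurable borel"
proof -
  have "(\<lambda>q. F (coords 3 1 q)) \<in> borel_measurable (lborel \<Otimes>\<^sub>M lborel)" by (simp add: lborel_prod)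
  from lborel.borel_measurable_nn_integral_fst[OF this] show ?thesis by simp
qed

lemma nn_integral_cyl_lborel:
  assumes "F \<in> borel_measurable borel"
  shows "(\<integral>\<^sup>+x. F x \<partial>lebesgue_on cyl) = (\<integral>\<^sup>+x. F x * indicator cyl x \<partial>lborel)"
  using assms by (simp add: nn_integral_restrict_space nn_integral_completion)

text \<open>A slice of a Lebesgue measurable function need not be measurable, whereas every slice of
  a Borel function is.\<close>

lemma borel_norm_version:
  assumes "z \<in> L2"
  shows "\<exists>\<rho>. \<rho> \<in> borel_measurable borel \<and> (\<forall>x. 0 \<le> \<rho> x) \<and> (\<forall>x. x \<notin> cyl \<longrightarrow> \<rho> x = 0) \<and>
    (AE x in lborel. x \<in> cyl \<longrightarrow> norm (z x) = \<rho> x)"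
proof -
  have "(\<lambda>x. indicator cyl x * norm (z x)) \<in> borel_measurable lebesgue"
    using L2_integrable[OF L2_norm_fun[OF assms]] by (auto simp: integrable_restrict_space)
  then obtain g where [measurable]: "g \<in> borel_measurable borel" and ae: "AE x in lborel. indicator cyl x * norm (z x) = g x"
    using completion_ex_borel_measurable_real[of "\<lambda>x. indicator cyl x * norm (z x)" lborel] by auto
  have "AE x in lborel. x \<in> cyl \<longrightarrow> norm (z x) = indicator cyl x * \<bar>g x\<bar>"
    using ae
  proof eventually_elim
    case (elim x) then show ?case by (cases "x \<in> cyl") (simp_all, metis abs_norm_cancel)
  qed
  then show ?thesis by (intro exI[of _ "\<lambda>x. indicator cyl x * \<bar>g x\<bar>"]) auto
qed

text \<open>Passing from one height to another rotates the slice of \<open>\<rho>\<close>, and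
  planar integrals do not notice rotations; so the slice integral is invariant under almost every
  shift and hence constant. The heights fill an interval of length one, so the constant equals the
  integral over the cylinder.\<close>

lemma helical_slice_const:
  assumes z: "z \<in> V_space" and h: "helical 1 z"
    and \<rho>[measurable]: "\<rho> \<in> borel_measurable borel" and nonneg: "\<forall>x. 0 \<le> \<rho> x" and outside: "\<forall>x. x \<notin> cyl \<longrightarrow> \<rho> x = 0"
    and ae: "AE x in lborel. x \<in> cyl \<longrightarrow> norm (z x) = \<rho> x"
  shows "AE c in lborel. 0 < c \<longrightarrow> c < 1 \<longrightarrow>
    (\<integral>\<^sup>+p. ennreal (\<rho> (sl c p) ^ 4) \<partial>lborel) = ennreal (LINT x|lebesgue_on cyl. norm (z x) ^ 4)"
proof -
  have \<rho>0: "0 \<le> \<rho> x" "x \<notin> cyl \<Longrightarrow> \<rho> x = 0" for x using nonneg outside by auto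
  define Q where "Q c = (\<integral>\<^sup>+p. ennreal (\<rho> (sl c p) ^ 4) \<partial>lborel)" for c
  have Qm: "Q \<in> borel_measurable borel" unfolding Q_def by (rule slice_nn_measurable) measurable
  have "\<exists>k. AE c in lborel. 0 < c \<longrightarrow> c < 1 \<longrightarrow> Q c = k"
  proof (rule translation_invariant_const[OF Qm])
    fix s :: real assume s: "0 < s" "s < 1"
    show "AE c in lborel. 0 < c \<longrightarrow> c < 1 \<longrightarrow> Q (wrap c s) = Q c"
      using helical_norm_AE[OF h s ae]
    proof eventually_elim
      case (elim c)
      show ?case
      proof (intro impI)
        assume c: "0 < c" "c < 1"
        have "Q c = (\<integral>\<^sup>+p. ennreal (\<rho> (sl (wrap c s) (prot (2 * pi * s) p)) ^ 4) \<partial>lborel)"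
          unfolding Q_def
        proof (rule nn_integral_cong_AE)
          show "AE p in lborel. ennreal (\<rho> (sl c p) ^ 4) = ennreal (\<rho> (sl (wrap c s) (prot (2 * pi * s) p)) ^ 4)"
            using elim
          proof eventually_elim
            case (elim p)
            show ?case
            proof (cases "p \<in> disk")
              case False
              then have "sl c p \<notin> cyl" "sl (wrap c s) (prot (2 * pi * s) p) \<notin> cyl" by (auto simp: sl_in_cyl prot_disk)
              then show ?thesis by (simp add: \<rho>0)
            qed (use elim c in auto)
          qed
        qed
        also have "\<dots> = Q (wrap c s)"
          unfolding Q_def
          by (rule nn_integral_prot[of "\<lambda>p. ennreal (\<rho> (sl (wrap c s) p) ^ 4)"]) (rule sl_measurable_comp, measurable)
        finally show "Q (wrap c s) = Q c" by simp
      qed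
    qed
  qed
  then obtain k where k: "AE c in lborel. 0 < c \<longrightarrow> c < 1 \<longrightarrow> Q c = k" by blast
  have i4: "integrable (lebesgue_on cyl) (\<lambda>x. norm (z x) ^ 4)" by (rule V_L4[OF z])
  have "ennreal (LINT x|lebesgue_on cyl. norm (z x) ^ 4) = (\<integral>\<^sup>+x. ennreal (norm (z x) ^ 4) \<partial>lebesgue_on cyl)"
    by (rule nn_integral_eq_integral[OF i4, symmetric]) simp
  also have "\<dots> = (\<integral>\<^sup>+x. ennreal (\<rho> x ^ 4) \<partial>lebesgue_on cyl)"
    using AE_completion[OF ae] by (intro nn_integral_cong_AE) (auto simp: AE_cyl_iff elim!: eventually_mono)
  also have "\<dots> = (\<integral>\<^sup>+x. ennreal (\<rho> x ^ 4) * indicator cyl x \<partial>lborel)"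
    by (rule nn_integral_cyl_lborel) measurable
  also have "\<dots> = (\<integral>\<^sup>+c. \<integral>\<^sup>+p. ennreal (\<rho> (sl c p) ^ 4) * indicator cyl (sl c p) \<partial>lborel \<partial>lborel)"
    by (rule nn_integral_sl) measurable
  also have "\<dots> = (\<integral>\<^sup>+c. k * indicator {0<..<1::real} c \<partial>lborel)"
  proof (rule nn_integral_cong_AE)
    have e: "(\<integral>\<^sup>+p. ennreal (\<rho> (sl c p) ^ 4) * indicator cyl (sl c p) \<partial>lborel) = Q c * indicator {0<..<1} c" for c
    proof -
      have "ennreal (\<rho> (sl c p) ^ 4) * indicator cyl (sl c p) = ennreal (\<rho> (sl c p) ^ 4) * indicator {0<..<1} c" for p
        using \<rho>0(2)[of "sl c p"] by (cases "sl c p \<in> cyl") (auto simp: sl_in_cyl)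
      then have "(\<integral>\<^sup>+p. ennreal (\<rho> (sl c p) ^ 4) * indicator cyl (sl c p) \<partial>lborel) =
          (\<integral>\<^sup>+p. ennreal (\<rho> (sl c p) ^ 4) * indicator {0<..<1} c \<partial>lborel)" by (simp only:)
      also have "\<dots> = Q c * indicator {0<..<1} c"
      proof -
        have "(\<lambda>p. ennreal (\<rho> (sl c p) ^ 4)) \<in> borel_measurable borel"
          by (rule sl_measurable_comp) measurable
        then show ?thesis unfolding Q_def by (intro nn_integral_multc) simp
      qed
      finally show ?thesis .
    qed
    show "AE c in lborel. (\<integral>\<^sup>+p. ennreal (\<rho> (sl c p) ^ 4) * indicator cyl (sl c p) \<partial>lborel) = k * indicator {0<..<1} c"
      using k unfolding e by eventually_elim (auto simp: indicator_def)
  qed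
  also have "\<dots> = k" by (simp add: nn_integral_cmult)
  finally show ?thesis using k unfolding Q_def by simp
qed


text \<open>Optimising over \<open>t\<close> with no case distinction on whether \<open>A\<close> or
  \<open>C\<close> vanishes, when no best \<open>t\<close> exists: the hypothesis says that a
  quadratic polynomial in \<open>t\<close> is nonnegative, for \<open>t \<le> 0\<close> trivially,
  and so its discriminant is not positive.\<close>

lemma real_AM_GM_discriminant:
  fixes x A C :: real
  assumes "\<And>t. 0 < t \<Longrightarrow> x \<le> t * A + C / t" "0 \<le> A" "0 \<le> C" "0 \<le> x"
  shows "x\<^sup>2 \<le> 4 * A * C"
proof -
  have "0 \<le> C - 2 * t * (x / 2) + t\<^sup>2 * A" for t
  proof (cases "t > 0")
    case True
    then have "t * x \<le> t * (t * A + C / t)" by (intro mult_left_mono assms) auto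
    also have "\<dots> = t\<^sup>2 * A + C" using True by (simp add: power2_eq_square field_simps)
    finally show ?thesis by simp
  next
    case False
    then have "t * x \<le> 0" using assms by (simp add: mult_nonpos_nonneg)
    moreover have "0 \<le> t\<^sup>2 * A" using assms by simp
    ultimately show ?thesis using assms by simp
  qed
  from discriminant_le[OF this] assms have "(x / 2)\<^sup>2 \<le> C * A" by simp
  then show ?thesis by (simp add: power_divide mult_ac)
qed

text \<open>The square root of the slicewise inequality is integrated over the slices.  As the left-hand
  side does not depend on the slice, the Cauchy-Schwarz inequality gives the product of the norms
  over the whole cylinder, without a supremum over slices.  The parameter \<open>t\<close> in the proof replaces
  the Cauchy-Schwarz inequality by the arithmetic-geometric mean inequality.\<close>

lemma helical_L4:
  assumes z: "z \<in> V_space" and h: "helical 1 z"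
  shows "(LINT x|lebesgue_on cyl. norm (z x) ^ 4) \<le> 2 * (L2_norm z)\<^sup>2 * (L2_norm (wgrad z))\<^sup>2"
proof -
  define Z where "Z = (LINT x|lebesgue_on cyl. norm (z x) ^ 4)"
  have Z0: "0 \<le> Z" by (simp add: Z_def)
  obtain \<rho> where \<rho>[measurable]: "\<rho> \<in> borel_measurable borel" and \<rho>': "\<forall>x. 0 \<le> \<rho> x" "\<forall>x. x \<notin> cyl \<longrightarrow> \<rho> x = 0"
    and ae: "AE x in lborel. x \<in> cyl \<longrightarrow> norm (z x) = \<rho> x"
    using borel_norm_version[OF V_L2[OF z]] by blast
  have \<rho>0: "0 \<le> \<rho> x" "x \<notin> cyl \<Longrightarrow> \<rho> x = 0" for x using \<rho>' by auto
  obtain f where f: "\<And>n::nat. f n \<in> D_sol" "(\<lambda>n. H1_norm (\<lambda>x. f n x - z x)) \<longlonglongrightarrow> 0"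
    using V_approx[OF z] by auto
  have fD: "f n \<in> D_space" and fH: "f n \<in> H1" for n using f by (auto intro: D_space_H1 D_sol_D_space)
  note t = H1_norm_tendsto[OF fH V_H1[OF z] f(2)]
  obtain r where r: "strict_mono r" "AE x in lebesgue_on cyl. (\<lambda>n. f (r n) x) \<longlonglongrightarrow> z x"
    using L2_norm_AE_subseq[OF H1_L2[OF fH] V_L2[OF z] t(3)] by auto
  have "AE x in lborel. x \<in> cyl \<longrightarrow> (\<lambda>n. norm (f (r n) x)) \<longlonglongrightarrow> \<rho> x"
    using ae r(2)[unfolded AE_cyl_iff AE_completion_iff]
    by eventually_elim (auto intro: tendsto_norm dest: tendsto_norm)
  then have conv: "AE c in lborel. AE p in lborel. p \<in> disk \<longrightarrow> 0 < c \<longrightarrow> c < 1 \<longrightarrow> (\<lambda>n. norm (f (r n) (sl c p))) \<longlonglongrightarrow> \<rho> (sl c p)"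
    by (rule eventually_mono[OF AE_slices]) (auto simp: sl_in_cyl elim!: eventually_mono)
  define q where "q n c = slice (\<lambda>x. norm (f (r n) x) ^ 4) c" for n c
  define m where "m n c = slice (\<lambda>x. (norm (f (r n) x))\<^sup>2) c" for n c
  define k where "k n c = slice (\<lambda>x. (norm (jac (f (r n)) x))\<^sup>2) c" for n c
  have mk0: "0 \<le> m n c" "0 \<le> k n c" "0 \<le> q n c" for n c by (auto simp: m_def k_def q_def intro!: slice_nonneg)
  have cm: "cts_disk (\<lambda>x. (norm (f (r n) x))\<^sup>2)" "cts_disk (\<lambda>x. (norm (jac (f (r n)) x))\<^sup>2)" "cts_disk (\<lambda>x. norm (f (r n) x) ^ 4)" for n
    using cts_disk_D_space[OF fD] by auto
  \<comment> \<open>The fourth powers of the approximants need not converge on a slice. Fatou's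
    lemma gives the lower bound by \<open>Z\<close> on almost every slice, and an upper bound for
    \<open>Z\<close> is all that is wanted.\<close>
  have lim: "AE c in lborel. 0 < c \<longrightarrow> c < 1 \<longrightarrow> ennreal Z \<le> liminf (\<lambda>n. ennreal (q n c))"
    using helical_slice_const[OF z h \<rho> \<rho>' ae] conv
  proof eventually_elim
    case (elim c)
    show ?case
    proof (intro impI)
      assume c: "0 < c" "c < 1"
      have "ennreal Z = (\<integral>\<^sup>+p. ennreal (\<rho> (sl c p) ^ 4) \<partial>lborel)" using elim(1) c by (simp add: Z_def)
      also have "\<dots> = (\<integral>\<^sup>+p. liminf (\<lambda>n. ennreal (norm (f (r n) (sl c p)) ^ 4)) \<partial>lborel)"
      proof (rule nn_integral_cong_AE)
        show "AE p in lborel. ennreal (\<rho> (sl c p) ^ 4) = liminf (\<lambda>n. ennreal (norm (f (r n) (sl c p)) ^ 4))"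
          using elim(2)
        proof eventually_elim
          case (elim p)
          have "(\<lambda>n. norm (f (r n) (sl c p))) \<longlonglongrightarrow> \<rho> (sl c p)"
          proof (cases "p \<in> disk")
            case False
            then have "f (r n) (sl c p) = 0" for n by (intro D_space_zero_outside[OF fD]) (simp add: hor_sl)
            moreover have "\<rho> (sl c p) = 0" using False by (intro \<rho>0) (simp add: sl_in_cyl)
            ultimately show ?thesis by simp
          qed (use elim c in auto)
          then have "(\<lambda>n. ennreal (norm (f (r n) (sl c p)) ^ 4)) \<longlonglongrightarrow> ennreal (\<rho> (sl c p) ^ 4)"
            by (intro tendsto_ennrealI tendsto_intros)
          then show ?case by (intro lim_imp_Liminf[symmetric]) auto
        qed
      qed
      also have "\<dots> \<le> liminf (\<lambda>n. \<integral>\<^sup>+p. ennreal (norm (f (r n) (sl c p)) ^ 4) \<partial>lborel)"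
      proof (rule nn_integral_liminf)
        fix n
        have "(\<lambda>p. norm (f (r n) (sl c p)) ^ 4) \<in> borel_measurable lborel"
          using borel_measurable_integrable[OF slice_integrable[OF cm(3)]] .
        then show "(\<lambda>p. ennreal (norm (f (r n) (sl c p)) ^ 4)) \<in> borel_measurable lborel" by simp
      qed
      also have "\<dots> = liminf (\<lambda>n. ennreal (q n c))"
        unfolding q_def by (simp add: nn_integral_slice[OF cm(3)])
      finally show "ennreal Z \<le> liminf (\<lambda>n. ennreal (q n c))" .
    qed
  qed
  have main: "sqrt (2 * Z) \<le> t * (L2_norm z)\<^sup>2 + (L2_norm (wgrad z))\<^sup>2 / t" if t0: "0 < t" for t
  proof -
    define R where "R n c = t * m n c + k n c / t" for n c
    have R0: "0 \<le> R n c" for n c using mk0 t0 by (simp add: R_def)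
    \<comment> \<open>The weights \<open>t\<close> and \<open>1 / t\<close> cancel in the product of
      slice norms, and \<open>4 * a * b \<le> (a + b)\<^sup>2\<close> makes the right-hand side a
      square, whose root is linear in the two norms and can be integrated over the slices.\<close>
    have qR: "2 * q n c \<le> (R n c)\<^sup>2" for n c
    proof -
      have "2 * q n c \<le> 4 * (t * m n c) * (k n c / t)"
        using slice_Ladyzhenskaya[OF fD, of "r n" c] t0 by (simp add: q_def m_def k_def)
      also have "\<dots> \<le> (R n c)\<^sup>2"
        using zero_le_power2[of "t * m n c - k n c / t"] t0 unfolding R_def by (simp add: power2_eq_square algebra_simps)
      finally show ?thesis .
    qed
    have Rint: "integrable lborel (\<lambda>c. indicator {0<..<1} c * R n c)"
      "(\<integral>c. indicator {0<..<1} c * R n c \<partial>lborel) = t * (L2_norm (f (r n)))\<^sup>2 + (L2_norm (wgrad (f (r n))))\<^sup>2 / t" for n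
    proof -
      have e: "indicator {0<..<1} c * R n c = t * (indicator {0<..<1} c * m n c) + (1 / t) * (indicator {0<..<1} c * k n c)" for c
        by (simp add: R_def algebra_simps)
      show "integrable lborel (\<lambda>c. indicator {0<..<1} c * R n c)"
        unfolding e m_def k_def
        by (intro Bochner_Integration.integrable_add integrable_mult_right integral_slices(2)[OF cm(1)] integral_slices(2)[OF cm(2)])
      show "(\<integral>c. indicator {0<..<1} c * R n c \<partial>lborel) = t * (L2_norm (f (r n)))\<^sup>2 + (L2_norm (wgrad (f (r n))))\<^sup>2 / t"
        unfolding e m_def k_def
        by (subst Bochner_Integration.integral_add)
          (simp_all add: integral_slices(2)[OF cm(1)] integral_slices(2)[OF cm(2)] integral_slices(1)[OF cm(1), symmetric]
            integral_slices(1)[OF cm(2), symmetric] L2_norm_sq L2_norm_wgrad_D_space[OF fD])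
    qed
    have Rm: "(\<lambda>c. R n c) \<in> borel_measurable borel" for n
      using slice_measurable[OF cm(1)] slice_measurable[OF cm(2)] unfolding R_def m_def k_def by measurable
    have "ennreal (sqrt (2 * Z)) = (\<integral>\<^sup>+c. ennreal (sqrt (2 * Z)) * indicator {0<..<1::real} c \<partial>lborel)"
      by (simp add: nn_integral_cmult)
    also have "\<dots> \<le> (\<integral>\<^sup>+c. liminf (\<lambda>n. ennreal (indicator {0<..<1} c * R n c)) \<partial>lborel)"
    proof (rule nn_integral_mono_AE)
      show "AE c in lborel. ennreal (sqrt (2 * Z)) * indicator {0<..<1::real} c \<le> liminf (\<lambda>n. ennreal (indicator {0<..<1} c * R n c))"
        using lim
      proof eventually_elim
        case (elim c)
        show ?case
        proof (cases "0 < c \<and> c < 1")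
          case True
          then have L: "ennreal Z \<le> liminf (\<lambda>n. ennreal (q n c))" using elim by simp
          \<comment> \<open>The square root is taken inside the lower limit by means of an arbitrary
            smaller number \<open>y\<close>, whose square is eventually exceeded.\<close>
          have "ennreal (sqrt (2 * Z)) \<le> liminf (\<lambda>n. ennreal (R n c))"
            unfolding le_Liminf_iff
          proof (intro allI impI)
            fix y assume y: "y < ennreal (sqrt (2 * Z))"
            then obtain y' where y': "y = ennreal y'" "0 \<le> y'" by (cases y) auto
            then have "y' < sqrt (2 * Z)" using y by (simp add: ennreal_less_iff)
            then have "y'\<^sup>2 < (sqrt (2 * Z))\<^sup>2" using y' by (intro power_strict_mono) auto
            then have "y'\<^sup>2 / 2 < Z" using Z0 by simp
            then have "ennreal (y'\<^sup>2 / 2) < ennreal Z" by (simp add: ennreal_less_iff)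
            then have "\<forall>\<^sub>F n in sequentially. ennreal (y'\<^sup>2 / 2) < ennreal (q n c)"
              using L unfolding le_Liminf_iff by blast
            then show "\<forall>\<^sub>F n in sequentially. y < ennreal (R n c)"
            proof eventually_elim
              case (elim n)
              then have "y'\<^sup>2 < 2 * q n c" by (simp add: ennreal_less_iff)
              also have "\<dots> \<le> (R n c)\<^sup>2" by (rule qR)
              finally have "y' < R n c" using R0 by (rule power2_less_imp_less)
              then show ?case using y' by (simp add: ennreal_less_iff)
            qed
          qed
          then show ?thesis using True by simp
        qed auto
      qed
    qed
    also have "\<dots> \<le> liminf (\<lambda>n. \<integral>\<^sup>+c. ennreal (indicator {0<..<1} c * R n c) \<partial>lborel)"
      by (rule nn_integral_liminf) (use Rm in measurable)
    also have "\<dots> = liminf (\<lambda>n. ennreal (t * (L2_norm (f (r n)))\<^sup>2 + (L2_norm (wgrad (f (r n))))\<^sup>2 / t))"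
      using R0 by (simp add: nn_integral_eq_integral[OF Rint(1)] Rint(2))
    also have "\<dots> = ennreal (t * (L2_norm z)\<^sup>2 + (L2_norm (wgrad z))\<^sup>2 / t)"
      using LIMSEQ_subseq_LIMSEQ[OF t(2) r(1), unfolded o_def] LIMSEQ_subseq_LIMSEQ[OF t(5) r(1), unfolded o_def] t0
      by (intro lim_imp_Liminf tendsto_ennrealI tendsto_intros) auto
    finally show ?thesis using t0 by (subst (asm) ennreal_le_iff) auto
  qed
  have "(sqrt (2 * Z))\<^sup>2 \<le> 4 * (L2_norm z)\<^sup>2 * (L2_norm (wgrad z))\<^sup>2"
    by (rule real_AM_GM_discriminant[OF main]) (use Z0 in auto)
  then show ?thesis using Z0 by (simp add: Z_def)
qed

text \<open>The inequality of arithmetic and geometric means for the four numbers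
  \<open>P / 3\<close>, \<open>P / 3\<close>, \<open>P / 3\<close>, \<open>R\<close>, whence 4^4 /
  3^3 = 256 / 27. Equality holds at \<open>P = 3 * R\<close>, which is why the difference of the two
  sides has that double root. This is the source of the 27 in the theorem.\<close>

lemma weighted_AM_GM_4:
  fixes P R :: real
  assumes "0 \<le> P" "0 \<le> R"
  shows "256 / 27 * P ^ 3 * R \<le> (P + R) ^ 4"
proof -
  have "(P + R) ^ 4 - 256 / 27 * P ^ 3 * R = (P - 3 * R)\<^sup>2 * (P\<^sup>2 + 14 / 27 * P * R + 1 / 9 * R\<^sup>2)"
    by (simp add: power4_eq_xxxx power3_eq_cube power2_eq_square field_simps)
  moreover have "0 \<le> (P - 3 * R)\<^sup>2 * (P\<^sup>2 + 14 / 27 * P * R + 1 / 9 * R\<^sup>2)"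
    using assms by (intro mult_nonneg_nonneg add_nonneg_nonneg) auto
  ultimately show ?thesis by linarith
qed

text \<open>On a slice with squared norms \<open>n\<close> of the gradient and \<open>m\<close> of
  the field, Holder's inequality with exponents 2, 4, 4 and the Ladyzhenskaya inequality leave the
  fourth root of \<open>2 * Z * m * n ^ 3\<close>. Since \<open>Z\<close> is the same on almost all
  slices, Young's inequality makes this linear in \<open>n\<close> and \<open>m\<close> with fixed
  coefficients, and integration over the slices produces the norms over the cylinder.\<close>

lemma trilinear_slice_bound:
  assumes z: "z \<in> V_space" and h: "helical 1 z" and g: "g \<in> D_sol" and d: "0 < d"
  shows "(LINT x|lebesgue_on cyl. norm (jac g x) * (norm (g x) * norm (z x))) \<le>
    d * (L2_norm (jac g))\<^sup>2 + 27 / (128 * d ^ 3) * (LINT x|lebesgue_on cyl. norm (z x) ^ 4) * (L2_norm g)\<^sup>2"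
proof -
  define Z where "Z = (LINT x|lebesgue_on cyl. norm (z x) ^ 4)"
  have Z0: "0 \<le> Z" by (simp add: Z_def)
  \<comment> \<open>Chosen so that \<open>256 / 27 * d ^ 3 * \<kappa> = 2 * Z\<close>; then
    \<open>weighted_AM_GM_4\<close> applied to \<open>d * n c\<close> and
    \<open>\<kappa> * m c\<close> matches the bound on \<open>i ^ 4\<close> exactly.\<close>
  define \<kappa> where "\<kappa> = 27 / (128 * d ^ 3) * Z"
  have \<kappa>0: "0 \<le> \<kappa>" using Z0 d by (simp add: \<kappa>_def)
  obtain \<rho> where \<rho>[measurable]: "\<rho> \<in> borel_measurable borel" and \<rho>': "\<forall>x. 0 \<le> \<rho> x" "\<forall>x. x \<notin> cyl \<longrightarrow> \<rho> x = 0"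
    and ae: "AE x in lborel. x \<in> cyl \<longrightarrow> norm (z x) = \<rho> x"
    using borel_norm_version[OF V_L2[OF z]] by blast
  have \<rho>0: "0 \<le> \<rho> x" "x \<notin> cyl \<Longrightarrow> \<rho> x = 0" for x using \<rho>' by auto
  note gD = D_sol_D_space[OF g]
  have [measurable]: "jac g \<in> borel_measurable borel" "g \<in> borel_measurable borel"
    by (intro borel_measurable_continuous_onI D_space_continuous[OF gD])+
  define m where "m c = slice (\<lambda>x. (norm (g x))\<^sup>2) c" for c
  define n where "n c = slice (\<lambda>x. (norm (jac g x))\<^sup>2) c" for c
  have mn0: "0 \<le> m c" "0 \<le> n c" for c by (auto simp: m_def n_def intro!: slice_nonneg)
  have cm: "cts_disk (\<lambda>x. (norm (g x))\<^sup>2)" "cts_disk (\<lambda>x. (norm (jac g x))\<^sup>2)" "cts_disk (\<lambda>x. norm (g x) ^ 4)"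
    using cts_disk_D_space[OF gD] by auto
  define I where "I c = (\<integral>\<^sup>+p. ennreal (norm (jac g (sl c p)) * (norm (g (sl c p)) * \<rho> (sl c p))) \<partial>lborel)" for c
  have slm: "(\<lambda>p. F (sl c p)) \<in> borel_measurable lborel" if "F \<in> borel_measurable borel" for F :: "real^3 \<Rightarrow> ennreal" and c
    using sl_measurable_comp[OF that] by simp
  have bound: "I c \<le> ennreal (d * n c + \<kappa> * m c)"
    if c: "(\<integral>\<^sup>+p. ennreal (\<rho> (sl c p) ^ 4) \<partial>lborel) = ennreal Z" for c
  proof -
    \<comment> \<open>Holder's inequality with three factors is obtained by applying the
      Cauchy-Schwarz inequality twice; \<open>J\<close> is the inner integral.\<close>
    define J where "J = (\<integral>\<^sup>+p. ennreal ((norm (g (sl c p)))\<^sup>2) * ennreal ((\<rho> (sl c p))\<^sup>2) \<partial>lborel)"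
    have "J\<^sup>2 \<le> (\<integral>\<^sup>+p. (ennreal ((norm (g (sl c p)))\<^sup>2))\<^sup>2 \<partial>lborel) * (\<integral>\<^sup>+p. (ennreal ((\<rho> (sl c p))\<^sup>2))\<^sup>2 \<partial>lborel)"
      unfolding J_def by (rule Cauchy_Schwarz_nn_integral; rule slm; measurable)
    also have "(\<integral>\<^sup>+p. (ennreal ((norm (g (sl c p)))\<^sup>2))\<^sup>2 \<partial>lborel) = ennreal (slice (\<lambda>x. norm (g x) ^ 4) c)"
      using nn_integral_slice[OF cm(3), of c] by (simp add: ennreal_power flip: power_mult)
    also have "(\<integral>\<^sup>+p. (ennreal ((\<rho> (sl c p))\<^sup>2))\<^sup>2 \<partial>lborel) = ennreal Z"
      using c by (simp add: ennreal_power \<rho>0 flip: power_mult)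
    also have "ennreal (slice (\<lambda>x. norm (g x) ^ 4) c) * ennreal Z \<le> ennreal (2 * m c * n c) * ennreal Z"
      using slice_Ladyzhenskaya[OF gD, of c] by (intro mult_right_mono ennreal_leI) (auto simp: m_def n_def)
    also have "\<dots> = ennreal (2 * m c * n c * Z)" using mn0 Z0 by (simp add: ennreal_mult)
    finally have J2: "J\<^sup>2 \<le> ennreal (2 * m c * n c * Z)" .
    then have "J \<noteq> \<infinity>" by (auto simp: power2_eq_square ennreal_top_mult top_unique)
    then obtain j where j: "J = ennreal j" "0 \<le> j" by (cases J) auto
    have j2: "j\<^sup>2 \<le> 2 * m c * n c * Z"
      using J2 mn0 Z0 unfolding j(1) by (simp add: ennreal_power j ennreal_le_iff)
    have "I c = (\<integral>\<^sup>+p. ennreal (norm (jac g (sl c p))) * ennreal (norm (g (sl c p)) * \<rho> (sl c p)) \<partial>lborel)"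
      unfolding I_def by (simp add: ennreal_mult \<rho>0)
    then have "(I c)\<^sup>2 \<le> (\<integral>\<^sup>+p. (ennreal (norm (jac g (sl c p))))\<^sup>2 \<partial>lborel) * (\<integral>\<^sup>+p. (ennreal (norm (g (sl c p)) * \<rho> (sl c p)))\<^sup>2 \<partial>lborel)"
      by (simp only:) (rule Cauchy_Schwarz_nn_integral; rule slm; measurable)
    also have "(\<integral>\<^sup>+p. (ennreal (norm (jac g (sl c p))))\<^sup>2 \<partial>lborel) = ennreal (n c)"
      using nn_integral_slice[OF cm(2), of c] by (simp add: ennreal_power n_def)
    also have "(\<integral>\<^sup>+p. (ennreal (norm (g (sl c p)) * \<rho> (sl c p)))\<^sup>2 \<partial>lborel) = J"
      unfolding J_def by (simp add: ennreal_power \<rho>0 power_mult_distrib ennreal_mult)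
    also have "ennreal (n c) * J = ennreal (n c * j)" using j mn0 by (simp add: ennreal_mult)
    finally have I2: "(I c)\<^sup>2 \<le> ennreal (n c * j)" .
    then have "I c \<noteq> \<infinity>" by (auto simp: power2_eq_square ennreal_top_mult top_unique)
    then obtain i where i: "I c = ennreal i" "0 \<le> i" by (cases "I c") auto
    have i2: "i\<^sup>2 \<le> n c * j"
      using I2 mn0 j unfolding i(1) by (simp add: ennreal_power i ennreal_le_iff)
    have "i ^ 4 = (i\<^sup>2)\<^sup>2" by (simp flip: power_mult)
    also have "\<dots> \<le> (n c * j)\<^sup>2" by (intro power_mono i2) simp
    also have "\<dots> = (n c)\<^sup>2 * j\<^sup>2" by (simp add: power_mult_distrib)
    also have "\<dots> \<le> (n c)\<^sup>2 * (2 * m c * n c * Z)" by (intro mult_left_mono j2) simp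
    also have "\<dots> = 256 / 27 * (d * n c) ^ 3 * (\<kappa> * m c)"
      using d by (simp add: \<kappa>_def power_mult_distrib power2_eq_square power3_eq_cube)
    also have "\<dots> \<le> (d * n c + \<kappa> * m c) ^ 4"
      using d mn0 \<kappa>0 by (intro weighted_AM_GM_4) auto
    finally have "i \<le> d * n c + \<kappa> * m c"
      using d mn0 \<kappa>0 i by (subst (asm) power_mono_iff) auto
    then show ?thesis unfolding i(1) by (rule ennreal_leI)
  qed
  have gz: "(\<lambda>x. norm (g x)) \<in> L2" "(\<lambda>x. norm (z x)) \<in> L2"
    using L2_norm_fun[OF D_space_L2(1)[OF gD]] L2_norm_fun[OF V_L2[OF z]] by auto
  have int: "integrable (lebesgue_on cyl) (\<lambda>x. norm (jac g x) * (norm (g x) * norm (z x)))"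
    by (intro tri_integrable(1) D_space_L2 gD D_sol_V g z)
  have "ennreal (LINT x|lebesgue_on cyl. norm (jac g x) * (norm (g x) * norm (z x))) =
     (\<integral>\<^sup>+x. ennreal (norm (jac g x) * (norm (g x) * norm (z x))) \<partial>lebesgue_on cyl)"
    by (rule nn_integral_eq_integral[OF int, symmetric]) simp
  also have "\<dots> = (\<integral>\<^sup>+x. ennreal (norm (jac g x) * (norm (g x) * \<rho> x)) \<partial>lebesgue_on cyl)"
    using AE_completion[OF ae] by (intro nn_integral_cong_AE) (auto simp: AE_cyl_iff elim!: eventually_mono)
  also have "\<dots> = (\<integral>\<^sup>+x. ennreal (norm (jac g x) * (norm (g x) * \<rho> x)) * indicator cyl x \<partial>lborel)"
    by (rule nn_integral_cyl_lborel) measurable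
  also have "\<dots> = (\<integral>\<^sup>+c. \<integral>\<^sup>+p. ennreal (norm (jac g (sl c p)) * (norm (g (sl c p)) * \<rho> (sl c p))) * indicator cyl (sl c p) \<partial>lborel \<partial>lborel)"
    by (rule nn_integral_sl) measurable
  also have "\<dots> \<le> (\<integral>\<^sup>+c. ennreal (indicator {0<..<1} c * (d * n c + \<kappa> * m c)) \<partial>lborel)"
  proof (rule nn_integral_mono_AE)
    show "AE c in lborel. (\<integral>\<^sup>+p. ennreal (norm (jac g (sl c p)) * (norm (g (sl c p)) * \<rho> (sl c p))) * indicator cyl (sl c p) \<partial>lborel)
        \<le> ennreal (indicator {0<..<1} c * (d * n c + \<kappa> * m c))"
      using helical_slice_const[OF z h \<rho> \<rho>' ae]
    proof eventually_elim
      case (elim c)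
      show ?case
      proof (cases "0 < c \<and> c < 1")
        case True
        have "(\<integral>\<^sup>+p. ennreal (norm (jac g (sl c p)) * (norm (g (sl c p)) * \<rho> (sl c p))) * indicator cyl (sl c p) \<partial>lborel) \<le> I c"
          unfolding I_def by (intro nn_integral_mono) (auto simp: indicator_def)
        also have "\<dots> \<le> ennreal (d * n c + \<kappa> * m c)" by (rule bound) (use elim True in \<open>simp add: Z_def\<close>)
        finally show ?thesis using True by simp
      next
        case False
        then have "indicator cyl (sl c p) = (0 :: ennreal)" for p by (auto simp: sl_in_cyl)
        then show ?thesis by simp
      qed
    qed
  qed
  also have "\<dots> = ennreal (d * (L2_norm (jac g))\<^sup>2 + \<kappa> * (L2_norm g)\<^sup>2)"
  proof -
    have e: "indicator {0<..<1} c * (d * n c + \<kappa> * m c) = d * (indicator {0<..<1} c * n c) + \<kappa> * (indicator {0<..<1} c * m c)" for c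
      by (simp add: algebra_simps)
    have i: "integrable lborel (\<lambda>c. indicator {0<..<1} c * (d * n c + \<kappa> * m c))"
      unfolding e unfolding m_def n_def
      by (intro Bochner_Integration.integrable_add integrable_mult_right integral_slices(2)[OF cm(1)] integral_slices(2)[OF cm(2)])
    have "(\<integral>c. indicator {0<..<1} c * (d * n c + \<kappa> * m c) \<partial>lborel) = d * (L2_norm (jac g))\<^sup>2 + \<kappa> * (L2_norm g)\<^sup>2"
      unfolding e unfolding m_def n_def
      by (subst Bochner_Integration.integral_add)
        (simp_all add: integral_slices(2)[OF cm(1)] integral_slices(2)[OF cm(2)] integral_slices(1)[OF cm(1), symmetric]
            integral_slices(1)[OF cm(2), symmetric] L2_norm_sq)
    moreover have "0 \<le> indicator {0<..<1} c * (d * n c + \<kappa> * m c)" for c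
      using d \<kappa>0 mn0 by simp
    ultimately show ?thesis using nn_integral_eq_integral[OF i] by simp
  qed
  finally show ?thesis
    using d \<kappa>0 by (subst (asm) ennreal_le_iff) (auto simp: \<kappa>_def Z_def)
qed

text \<open>Antisymmetry moves the derivative from \<open>z\<close> to \<open>a\<close>. Only
  \<open>a\<close> is approximated by smooth fields, as approximants of \<open>z\<close> need not be
  helical. The bound of \<open>Z\<close> in \<open>helical_L4\<close> contributes the factor 2 that
  turns 27/128 into 27/64.\<close>

lemma helical_trilinear:
  assumes z: "z \<in> V_space" and h: "helical 1 z" and a: "a \<in> V_space" and d: "0 < d"
  shows "\<bar>tri (wgrad z) a a\<bar> \<le> d * (L2_norm (wgrad a))\<^sup>2 +
    27 / (64 * d ^ 3) * (L2_norm z)\<^sup>2 * (L2_norm (wgrad z))\<^sup>2 * (L2_norm a)\<^sup>2"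
proof -
  define Z where "Z = (LINT x|lebesgue_on cyl. norm (z x) ^ 4)"
  obtain g where g: "\<And>n::nat. g n \<in> D_sol" "(\<lambda>n. H1_norm (\<lambda>x. g n x - a x)) \<longlonglongrightarrow> 0"
    using V_approx[OF a] by auto
  have gD: "g n \<in> D_space" and gH: "g n \<in> H1" and gV: "g n \<in> V_space" for n
    using g by (auto intro: D_space_H1 D_sol_D_space D_sol_V)
  note t = H1_norm_tendsto[OF gH V_H1[OF a] g(2)]
  have "\<bar>tri (wgrad z) (g n) (g n)\<bar> \<le> d * (L2_norm (wgrad (g n)))\<^sup>2 + 27 / (128 * d ^ 3) * Z * (L2_norm (g n))\<^sup>2" for n
  proof -
    have "\<bar>tri (wgrad z) (g n) (g n)\<bar> = \<bar>tri (jac (g n)) (g n) z\<bar>"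
      using tri_antisym[OF gV[of n] z gV[of n]] tri_jac[OF gD[of n] gV[of n] z] by simp
    also have "\<dots> \<le> (LINT x|lebesgue_on cyl. norm (jac (g n) x) * (norm (g n x) * norm (z x)))"
      by (intro tri_abs_le D_space_L2 gD gV z)
    also have "\<dots> \<le> d * (L2_norm (jac (g n)))\<^sup>2 + 27 / (128 * d ^ 3) * Z * (L2_norm (g n))\<^sup>2"
      unfolding Z_def by (rule trilinear_slice_bound[OF z h g(1) d])
    finally show ?thesis by (simp add: L2_norm_wgrad_D_space[OF gD])
  qed
  moreover have "(\<lambda>n. \<bar>tri (wgrad z) (g n) (g n)\<bar>) \<longlonglongrightarrow> \<bar>tri (wgrad z) a a\<bar>"
    by (intro tendsto_rabs tri_tendsto[of "\<lambda>n. z"] z a gV g V_const_tendsto)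
  moreover have "(\<lambda>n. d * (L2_norm (wgrad (g n)))\<^sup>2 + 27 / (128 * d ^ 3) * Z * (L2_norm (g n))\<^sup>2) \<longlonglongrightarrow>
      d * (L2_norm (wgrad a))\<^sup>2 + 27 / (128 * d ^ 3) * Z * (L2_norm a)\<^sup>2"
    by (intro tendsto_intros t)
  ultimately have "\<bar>tri (wgrad z) a a\<bar> \<le> d * (L2_norm (wgrad a))\<^sup>2 + 27 / (128 * d ^ 3) * Z * (L2_norm a)\<^sup>2"
    by (intro LIMSEQ_le) auto
  also have "27 / (128 * d ^ 3) * Z \<le> 27 / (128 * d ^ 3) * (2 * (L2_norm z)\<^sup>2 * (L2_norm (wgrad z))\<^sup>2)"
    using helical_L4[OF z h] d by (intro mult_left_mono) (auto simp: Z_def)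
  then have "27 / (128 * d ^ 3) * Z * (L2_norm a)\<^sup>2 \<le> 27 / (128 * d ^ 3) * (2 * (L2_norm z)\<^sup>2 * (L2_norm (wgrad z))\<^sup>2) * (L2_norm a)\<^sup>2"
    by (rule mult_right_mono) simp
  finally show ?thesis by (simp add: mult_ac)
qed

text \<open>The companion estimate in which the helical field occupies both undifferentiated places:
  here its \<open>L^4\<close> norm over the cylinder suffices, and \<open>y\<close> may be any field
  in \<open>V_space\<close>.\<close>

lemma helical_trilinear_outer:
  assumes z: "z \<in> V_space" and h: "helical 1 z" and y: "y \<in> V_space" and d: "0 < d"
  shows "\<bar>tri (wgrad y) z z\<bar> \<le> d * (L2_norm (wgrad z))\<^sup>2 + (L2_norm z)\<^sup>2 / (2 * d) * (L2_norm (wgrad y))\<^sup>2"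
proof -
  define B where "B = L2_norm (\<lambda>x. norm (z x) * norm (z x))"
  have "(norm (norm (z x) * norm (z x)))\<^sup>2 = norm (z x) ^ 4" for x
    by (simp add: power4_eq_xxxx power2_eq_square)
  then have "B\<^sup>2 = (LINT x|lebesgue_on cyl. norm (z x) ^ 4)"
    unfolding B_def L2_norm_sq by (simp only:)
  then have B: "B\<^sup>2 \<le> 2 * (L2_norm z)\<^sup>2 * (L2_norm (wgrad z))\<^sup>2" using helical_L4[OF z h] by simp
  define P where "P = d * (L2_norm (wgrad z))\<^sup>2"
  define R where "R = (L2_norm z)\<^sup>2 / (2 * d) * (L2_norm (wgrad y))\<^sup>2"
  have PR: "0 \<le> P" "0 \<le> R" using d by (auto simp: P_def R_def)
  have "\<bar>tri (wgrad y) z z\<bar> \<le> L2_norm (wgrad y) * B"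
    unfolding B_def by (intro tri_abs_le V_wgrad_L2 y z)
  also have "\<dots> \<le> P + R"
  proof (rule power2_le_imp_le)
    have "(L2_norm (wgrad y) * B)\<^sup>2 \<le> (L2_norm (wgrad y))\<^sup>2 * (2 * (L2_norm z)\<^sup>2 * (L2_norm (wgrad z))\<^sup>2)"
      unfolding power_mult_distrib by (intro mult_left_mono B) simp
    also have "\<dots> = 4 * (P * R)" using d by (simp add: P_def R_def)
    also have "\<dots> \<le> (P + R)\<^sup>2"
      using zero_le_power2[of "P - R"] by (simp add: power2_eq_square algebra_simps)
    finally show "(L2_norm (wgrad y) * B)\<^sup>2 \<le> (P + R)\<^sup>2" .
  qed (use PR in simp)
  finally show ?thesis by (simp add: P_def R_def)
qed

text \<open>Needed for increments of \<open>u\<close> in time, so that the trilinear estimates also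
  cover the error made by freezing \<open>u\<close> at one time.\<close>

lemma helical_diff:
  assumes "helical \<sigma> f" "helical \<sigma> g"
  shows "helical \<sigma> (\<lambda>x. f x - g x)"
  unfolding helical_def
proof
  fix \<theta>
  show "AE x in lebesgue. hor x \<in> disk \<longrightarrow>
      z_extend (\<lambda>x. f x - g x) (rot \<theta> *v x + vector [0, 0, \<sigma> / (2 * pi) * \<theta>]) = rot \<theta> *v z_extend (\<lambda>x. f x - g x) x"
    using assms(1)[unfolded helical_def, rule_format, of \<theta>] assms(2)[unfolded helical_def, rule_format, of \<theta>]
    by eventually_elim (simp add: z_extend_def matrix_vector_mult_diff_distrib)
qed

section \<open>Integrals in time and the weak formulation\<close>

text \<open>Over \<open>{0..T}\<close> rather than \<open>{0<..T}\<close>; the value at \<open>0\<close> is irrelevant.\<close>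

definition loc_int :: "(real \<Rightarrow> real) \<Rightarrow> bool" where
  "loc_int F \<longleftrightarrow> (\<forall>T. integrable lebesgue (\<lambda>t. indicator {0..T} t * F t))"

definition time_int :: "(real \<Rightarrow> real) \<Rightarrow> real \<Rightarrow> real \<Rightarrow> real" where
  "time_int F s t = (\<integral>r. indicator {s..t} r * F r \<partial>lebesgue)"

lemma AE_pos_iff: "(AE t in lebesgue_on {0<..}. P t) \<longleftrightarrow> (AE t in lebesgue. (0::real) < t \<longrightarrow> P t)"
  by (simp add: AE_restrict_space_iff)

lemma AE_lebesgue_neq: "AE t in lebesgue. t \<noteq> (c::real)"
  by (rule AE_completion[OF AE_lborel_singleton])

lemma AE_nonneg:
  assumes "AE t in lebesgue. 0 < t \<longrightarrow> P t" shows "AE t in lebesgue. (0::real) \<le> t \<longrightarrow> P t"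
  using assms AE_lebesgue_neq[of 0] by eventually_elim auto

lemma loc_int_interval:
  assumes "loc_int F" "0 \<le> s" shows "integrable lebesgue (\<lambda>r. indicator {s..t} r * F r)"
proof -
  have "integrable lebesgue (\<lambda>r. indicator {s..t} r *\<^sub>R (indicator {0..t} r * F r))"
    by (rule integrable_mult_indicator) (use assms in \<open>auto simp: loc_int_def\<close>)
  also have "(\<lambda>r. indicator {s..t} r *\<^sub>R (indicator {0..t} r * F r)) = (\<lambda>r. indicator {s..t} r * F r)"
    using assms by (auto simp: indicator_def fun_eq_iff)
  finally show ?thesis .
qed

lemma loc_int_const: "loc_int (\<lambda>t. c)"
  unfolding loc_int_def
proof
  fix T :: real
  show "integrable lebesgue (\<lambda>t. indicator {0..T} t * c)"
  proof (rule integrable_mult_left)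
    have "integrable lborel (indicator {0..T} :: real \<Rightarrow> real)" using emeasure_lborel_cbox_finite[of 0 T]
      by (intro integrable_real_indicator) (auto simp: less_top)
    then show "integrable lebesgue (indicator {0..T} :: real \<Rightarrow> real)" by (subst integrable_completion) auto
  qed
qed

lemma loc_int_add: "loc_int F \<Longrightarrow> loc_int G \<Longrightarrow> loc_int (\<lambda>t. F t + G t)"
  by (simp add: loc_int_def distrib_left)

lemma loc_int_diff: "loc_int F \<Longrightarrow> loc_int G \<Longrightarrow> loc_int (\<lambda>t. F t - G t)"
  by (simp add: loc_int_def right_diff_distrib)

lemma loc_int_cmult: "loc_int F \<Longrightarrow> loc_int (\<lambda>t. c * F t)"
  by (simp add: loc_int_def mult.left_commute)

lemma loc_int_of_integrable:
  assumes "integrable (lebesgue_on {0<..}) F" shows "loc_int F"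
  unfolding loc_int_def
proof
  fix T
  have "integrable lebesgue (\<lambda>t. indicator {0<..} t * F t)"
    using assms by (simp add: integrable_restrict_space)
  from integrable_mult_indicator[OF _ this, of "{0..T}"]
  have "integrable lebesgue (\<lambda>t. indicator {0..T} t * (indicator {0<..} t * F t))" by simp
  then have i: "integrable lebesgue (\<lambda>t. indicator {0..T} t * (indicator {0<..} t * F t))" .
  have ae: "AE t in lebesgue. indicator {0..T} t * (indicator {0<..} t * F t) = indicator {0..T} t * F t"
    using AE_lebesgue_neq[of 0] by eventually_elim (auto simp: indicator_def)
  show "integrable lebesgue (\<lambda>t. indicator {0..T} t * F t)"
    by (rule integrable_cong_AE_imp[OF i borel_measurable_AE[OF borel_measurable_integrable[OF i] ae]])
      (use ae in \<open>auto elim: eventually_mono\<close>)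
qed

lemma indicator_measurable:
  assumes "F \<in> borel_measurable (lebesgue_on {0<..})"
  shows "(\<lambda>t::real. indicator {0..T} t * F t :: real) \<in> borel_measurable lebesgue"
proof -
  have m0: "(\<lambda>t. indicator {0<..} t * F t) \<in> borel_measurable lebesgue"
    using assms borel_measurable_restrict_space_iff[of "{0<..}" lebesgue F] by simp
  have m: "(\<lambda>t. indicator {0..T} t * (indicator {0<..} t * F t)) \<in> borel_measurable lebesgue"
    by (rule borel_measurable_times[OF borel_measurable_indicator m0]) auto
  have ae: "AE t in lebesgue. indicator {0..T} t * (indicator {0<..} t * F t) = indicator {0..T} t * F t"
    using AE_lebesgue_neq[of 0] by eventually_elim (auto simp: indicator_def)
  show ?thesis by (rule borel_measurable_AE[OF m ae])
qed

lemma loc_int_bound: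
  assumes "F \<in> borel_measurable (lebesgue_on {0<..})" "loc_int G" "AE t in lebesgue. 0 < t \<longrightarrow> \<bar>F t\<bar> \<le> G t"
  shows "loc_int F"
  unfolding loc_int_def
proof
  fix T
  show "integrable lebesgue (\<lambda>t. indicator {0..T} t * F t)"
  proof (rule Bochner_Integration.integrable_bound)
    show "integrable lebesgue (\<lambda>t. indicator {0..T} t * G t)" using assms by (simp add: loc_int_def)
    show "AE t in lebesgue. norm (indicator {0..T} t * F t) \<le> norm (indicator {0..T} t * G t)"
      using AE_nonneg[OF assms(3)] by eventually_elim (auto simp: indicator_def)
  qed (rule indicator_measurable[OF assms(1)])
qed

lemma time_int_add: "loc_int F \<Longrightarrow> loc_int G \<Longrightarrow> 0 \<le> s \<Longrightarrow> time_int (\<lambda>r. F r + G r) s t = time_int F s t + time_int G s t"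
  unfolding time_int_def distrib_left by (intro Bochner_Integration.integral_add loc_int_interval)

lemma time_int_diff: "loc_int F \<Longrightarrow> loc_int G \<Longrightarrow> 0 \<le> s \<Longrightarrow> time_int (\<lambda>r. F r - G r) s t = time_int F s t - time_int G s t"
  unfolding time_int_def right_diff_distrib by (intro Bochner_Integration.integral_diff loc_int_interval)

lemma time_int_cmult: "time_int (\<lambda>r. c * F r) s t = c * time_int F s t"
  unfolding time_int_def mult.left_commute[of _ c] by simp

lemma time_int_const: "s \<le> t \<Longrightarrow> time_int (\<lambda>r. c) s t = (t - s) * c"
  by (simp add: time_int_def)

lemma time_int_mono_AE:
  assumes "loc_int F" "loc_int G" "0 \<le> s" "AE r in lebesgue. 0 < r \<longrightarrow> s \<le> r \<longrightarrow> r \<le> t \<longrightarrow> F r \<le> G r"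
  shows "time_int F s t \<le> time_int G s t"
  unfolding time_int_def
proof (rule integral_mono_AE)
  show "AE r in lebesgue. indicator {s..t} r * F r \<le> indicator {s..t} r * G r"
    using AE_nonneg[OF assms(4)] by eventually_elim (use assms(3) in \<open>auto simp: indicator_def\<close>)
qed (intro loc_int_interval assms)+

lemma time_int_nonneg: "(\<And>r. 0 \<le> F r) \<Longrightarrow> 0 \<le> time_int F s t"
  unfolding time_int_def by simp

lemma time_int_abs_le:
  assumes "loc_int F" "loc_int G" "0 \<le> s" "AE r in lebesgue. 0 < r \<longrightarrow> s \<le> r \<longrightarrow> r \<le> t \<longrightarrow> \<bar>F r\<bar> \<le> G r"
  shows "\<bar>time_int F s t\<bar> \<le> time_int G s t"
proof -
  have "time_int F s t \<le> time_int G s t"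
    by (rule time_int_mono_AE[OF assms(1-3)]) (use assms(4) in \<open>auto elim!: eventually_mono\<close>)
  moreover have "time_int (\<lambda>r. (-1) * F r) s t \<le> time_int G s t"
    by (rule time_int_mono_AE[OF loc_int_cmult[OF assms(1)] assms(2,3)]) (use assms(4) in \<open>auto elim!: eventually_mono\<close>)
  ultimately show ?thesis unfolding time_int_cmult by linarith
qed

lemma time_int_combine:
  assumes "loc_int F" "0 \<le> a" "a \<le> b" "b \<le> c"
  shows "time_int F a c = time_int F a b + time_int F b c"
proof -
  have "time_int F a c = (\<integral>r. indicator {a..b} r * F r + indicator {b..c} r * F r \<partial>lebesgue)"
    unfolding time_int_def
  proof (rule integral_cong_AE)
    show "AE r in lebesgue. indicator {a..c} r * F r = indicator {a..b} r * F r + indicator {b..c} r * F r"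
      using AE_lebesgue_neq[of b] by eventually_elim (use assms in \<open>auto simp: indicator_def\<close>)
  qed (use loc_int_interval[OF assms(1), of a c] loc_int_interval[OF assms(1), of a b] loc_int_interval[OF assms(1), of b c] assms in auto)
  also have "\<dots> = time_int F a b + time_int F b c"
    unfolding time_int_def by (intro Bochner_Integration.integral_add loc_int_interval) (use assms in auto)
  finally show ?thesis .
qed

lemma time_int_tendsto:
  assumes "loc_int F" "\<And>n. 0 \<le> t n" "t \<longlonglongrightarrow> \<tau>"
  shows "(\<lambda>n::nat. time_int F 0 (t n)) \<longlonglongrightarrow> time_int F 0 \<tau>"
proof -
  obtain T where T: "\<And>n. t n \<le> T"
    using convergent_imp_bounded[OF assms(3)] unfolding bounded_iff by (auto simp: abs_le_iff)
  have "\<tau> \<le> T" using LIMSEQ_le_const2[OF assms(3)] T by blast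
  show ?thesis
    unfolding time_int_def
  proof (rule integral_dominated_convergence)
    show "integrable lebesgue (\<lambda>r. norm (indicator {0..T} r * F r))"
      using assms(1) by (intro integrable_norm) (simp add: loc_int_def)
    show "(\<lambda>r. indicator {0..\<tau>} r * F r) \<in> borel_measurable lebesgue" "(\<lambda>r. indicator {0..t n} r * F r) \<in> borel_measurable lebesgue" for n
      using assms(1) by (auto simp: loc_int_def)
    show "AE r in lebesgue. norm (indicator {0..t n} r * F r) \<le> norm (indicator {0..T} r * F r)" for n
      using T[of n] by (auto simp: indicator_def)
    show "AE r in lebesgue. (\<lambda>n. indicator {0..t n} r * F r) \<longlonglongrightarrow> indicator {0..\<tau>} r * F r"
      using AE_lebesgue_neq[of \<tau>]
    proof eventually_elim
      case (elim r)
      have "\<forall>\<^sub>F n in sequentially. indicator {0..t n} r * F r = indicator {0..\<tau>} r * F r"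
      proof (cases "r < \<tau>")
        case True
        from order_tendstoD(1)[OF assms(3) this] show ?thesis
          by eventually_elim (use True in \<open>auto simp: indicator_def\<close>)
      next
        case False
        then have "\<tau> < r" using elim by simp
        from order_tendstoD(2)[OF assms(3) this] show ?thesis
          by eventually_elim (use \<open>\<tau> < r\<close> in \<open>auto simp: indicator_def\<close>)
      qed
      then show ?case by (rule tendsto_eventually)
    qed
  qed
qed

text \<open>By \<open>flat_DERIV\<close>, \<open>flat 2\<close> is the derivative of
  \<open>flat 0\<close>, which increases from \<open>0\<close> at the origin to \<open>1\<close> at
  infinity.\<close>

lemma flat_2_integral:
  "integrable lborel (flat 2)" "(\<integral>r. flat 2 r \<partial>lborel) = 1"
proof -
  have fm: "flat m \<in> borel_measurable borel" for m
    using Ck_on_flat[of 0 m] by (intro borel_measurable_continuous_onI) simp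
  have "((\<lambda>x::real. exp (- (1 / x))) \<longlongrightarrow> exp (- 0)) at_top"
    by (intro tendsto_intros tendsto_divide_0[OF tendsto_const] filterlim_at_top_imp_at_infinity filterlim_ident)
  moreover have "\<forall>\<^sub>F x::real in at_top. exp (- (1 / x)) = flat 0 x"
    using eventually_gt_at_top[of 0] by eventually_elim (auto simp: flat_def)
  ultimately have lim: "(flat 0 \<longlongrightarrow> 1) at_top" by (auto intro: Lim_transform_eventually)
  have "(\<integral>\<^sup>+x. ennreal (flat 2 x) * indicator {0..} x \<partial>lborel) = ennreal (1 - flat 0 0)"
    by (rule nn_integral_FTC_atLeast[OF fm _ _ lim]) (use flat_DERIV[of 0] in \<open>auto simp: numeral_2_eq_2\<close>)
  moreover have "ennreal (flat 2 x) * indicator {0..} x = ennreal (flat 2 x)" for x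
    by (auto simp: indicator_def)
  ultimately have n: "(\<integral>\<^sup>+x. ennreal (flat 2 x) \<partial>lborel) = ennreal 1" by simp
  show i: "integrable lborel (flat 2)"
    by (rule integrableI_nonneg) (use n fm in auto)
  show "(\<integral>r. flat 2 r \<partial>lborel) = 1"
    using n nn_integral_eq_integral[OF i] by simp
qed

text \<open>The kernel is minus the time derivative of \<open>cutoff\<close>.\<close>

lemma flat_kernel_tendsto:
  assumes g: "continuous_on {0..} g" and \<tau>: "0 < \<tau>"
  shows "(\<lambda>n. \<integral>t. indicator {0..} t * (real (Suc n) * flat 2 (real (Suc n) * (\<tau> - t)) * g t) \<partial>lebesgue) \<longlonglongrightarrow> g \<tau>"
    and "integrable lebesgue (\<lambda>t. indicator {0..} t * (real (Suc n) * flat 2 (real (Suc n) * (\<tau> - t)) * g t))"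
proof -
  \<comment> \<open>Cutting \<open>g\<close> off beyond \<open>\<tau>\<close> changes nothing, as
    the kernel vanishes there, and makes it bounded. After the substitution
    \<open>t = \<tau> - r / real (Suc n)\<close> a multiple of \<open>flat 2\<close>
    dominates.\<close>
  define G where "G t = indicator {0..\<tau>} t * g t" for t
  have "compact (g ` {0..\<tau>})"
    by (intro compact_continuous_image continuous_on_subset[OF g]) auto
  then obtain B where "\<forall>y\<in>g ` {0..\<tau>}. norm y \<le> B"
    using compact_imp_bounded bounded_iff by metis
  then have B: "\<And>t. t \<in> {0..\<tau>} \<Longrightarrow> \<bar>g t\<bar> \<le> B" by auto
  have B0: "0 \<le> B" using B[of 0] \<tau> by auto
  have GB: "\<bar>G t\<bar> \<le> B" for t using B B0 by (auto simp: G_def indicator_def)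
  have fm[measurable]: "flat m \<in> borel_measurable borel" for m
    using Ck_on_flat[of 0 m] by (intro borel_measurable_continuous_onI) simp
  have Gm[measurable]: "G \<in> borel_measurable borel"
    using borel_measurable_continuous_on_indicator[of "{0..\<tau>}" g] continuous_on_subset[OF g, of "{0..\<tau>}"]
    by (simp add: G_def[abs_def])
  define H where "H n t = real (Suc n) * flat 2 (real (Suc n) * (\<tau> - t)) * G t" for n t
  have Hm[measurable]: "H n \<in> borel_measurable borel" for n unfolding H_def[abs_def] by measurable
  have eq: "indicator {0..} t * (real (Suc n) * flat 2 (real (Suc n) * (\<tau> - t)) * g t) = H n t" for n t
  proof (cases "t \<le> \<tau>")
    case False
    then have "real (Suc n) * (\<tau> - t) \<le> 0" by (intro mult_nonneg_nonpos) auto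
    then show ?thesis by (simp add: H_def)
  qed (auto simp: H_def G_def indicator_def)
  have sub: "H n (\<tau> + (- (1 / real (Suc n))) * r) = real (Suc n) * (flat 2 r * G (\<tau> - r / real (Suc n)))" for n r
    by (simp add: H_def del: of_nat_Suc)
  have Hint: "integrable lborel (H n)" for n
  proof -
    have "integrable lborel (\<lambda>r. real (Suc n) * (flat 2 r * G (\<tau> - r / real (Suc n))))"
    proof (rule integrable_mult_right, rule Bochner_Integration.integrable_bound)
      show "integrable lborel (\<lambda>r. flat 2 r * B)" using flat_2_integral by simp
      show "AE x in lborel. norm (flat 2 x * G (\<tau> - x / real (Suc n))) \<le> norm (flat 2 x * B)"
        using GB B0 by (intro AE_I2) (simp add: abs_mult mult_left_mono)
    qed measurable
    then show ?thesis
      using lborel_integrable_real_affine_iff[of "- (1 / real (Suc n))" "H n" \<tau>] unfolding sub by (simp del: of_nat_Suc)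
  qed
  show "integrable lebesgue (\<lambda>t. indicator {0..} t * (real (Suc n) * flat 2 (real (Suc n) * (\<tau> - t)) * g t))"
    unfolding eq using Hint by (simp add: integrable_completion)
  have "(\<integral>t. indicator {0..} t * (real (Suc n) * flat 2 (real (Suc n) * (\<tau> - t)) * g t) \<partial>lebesgue) =
      (\<integral>r. flat 2 r * G (\<tau> - r / real (Suc n)) \<partial>lborel)" for n
  proof -
    have "(\<integral>t. H n t \<partial>lebesgue) = (\<integral>t. H n t \<partial>lborel)" by (simp add: integral_completion)
    also have "\<dots> = \<bar>- (1 / real (Suc n))\<bar> *\<^sub>R (\<integral>r. H n (\<tau> + (- (1 / real (Suc n))) * r) \<partial>lborel)"
      by (rule lborel_integral_real_affine) simp
    also have "\<dots> = (\<integral>r. flat 2 r * G (\<tau> - r / real (Suc n)) \<partial>lborel)"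
      unfolding sub by (simp del: of_nat_Suc)
    finally show ?thesis unfolding eq .
  qed
  moreover have "(\<lambda>n. \<integral>r. flat 2 r * G (\<tau> - r / real (Suc n)) \<partial>lborel) \<longlonglongrightarrow> (\<integral>r. flat 2 r * g \<tau> \<partial>lborel)"
  proof (rule integral_dominated_convergence)
    show "integrable lborel (\<lambda>r. flat 2 r * B)" using flat_2_integral by simp
    show "AE x in lborel. norm (flat 2 x * G (\<tau> - x / real (Suc n))) \<le> flat 2 x * B" for n
      using GB B0 by (intro AE_I2) (simp add: abs_mult mult_left_mono)
    show "AE x in lborel. (\<lambda>n. flat 2 x * G (\<tau> - x / real (Suc n))) \<longlonglongrightarrow> flat 2 x * g \<tau>"
    proof (rule AE_I2)
      fix x :: real
      show "(\<lambda>n. flat 2 x * G (\<tau> - x / real (Suc n))) \<longlonglongrightarrow> flat 2 x * g \<tau>"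
      proof (cases "0 < x")
        case True
        have "(\<lambda>n. \<tau> - x * inverse (real (Suc n))) \<longlonglongrightarrow> \<tau> - x * 0"
          by (intro tendsto_intros LIMSEQ_inverse_real_of_nat)
        then have l: "(\<lambda>n. \<tau> - x / real (Suc n)) \<longlonglongrightarrow> \<tau>" by (simp add: divide_inverse)
        have ev: "\<forall>\<^sub>F n in sequentially. 0 < \<tau> - x / real (Suc n)" using order_tendstoD(1)[OF l \<tau>] .
        have "(\<lambda>n. g (\<tau> - x / real (Suc n))) \<longlonglongrightarrow> g \<tau>"
          by (rule continuous_on_tendsto_compose[OF g l]) (use \<tau> ev in \<open>auto elim: eventually_mono\<close>)
        moreover have "\<forall>\<^sub>F n in sequentially. g (\<tau> - x / real (Suc n)) = G (\<tau> - x / real (Suc n))"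
          using ev by eventually_elim (use True in \<open>auto simp: G_def indicator_def\<close>)
        ultimately have "(\<lambda>n. G (\<tau> - x / real (Suc n))) \<longlonglongrightarrow> g \<tau>" by (rule Lim_transform_eventually)
        then show ?thesis by (intro tendsto_intros)
      qed simp
    qed
  qed measurable
  ultimately show "(\<lambda>n. \<integral>t. indicator {0..} t * (real (Suc n) * flat 2 (real (Suc n) * (\<tau> - t)) * g t) \<partial>lebesgue) \<longlonglongrightarrow> g \<tau>"
    using flat_2_integral(2) by simp
qed

text \<open>A simple function has finitely many values, so its composition with
  \<open>\<Phi>\<close> is measurable whatever \<open>\<Phi>\<close> is. Sequential continuity in
  \<open>H1_norm\<close> carries measurability to the limit, and no measurable structure on
  \<open>V_space\<close> has to be introduced.\<close>

lemma strongly_measurable_comp: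
  fixes \<Phi> :: "(real^3 \<Rightarrow> real^3) \<Rightarrow> (real^3 \<Rightarrow> real^3) \<Rightarrow> real"
  assumes u: "strongly_measurable_on {0<..} V_space H1_norm u"
    and v: "strongly_measurable_on {0<..} V_space H1_norm v"
    and \<Phi>: "\<And>f f' g g'. (\<And>n::nat. f n \<in> V_space) \<Longrightarrow> f' \<in> V_space \<Longrightarrow> (\<lambda>n. H1_norm (\<lambda>x. f n x - f' x)) \<longlonglongrightarrow> 0 \<Longrightarrow>
      (\<And>n::nat. g n \<in> V_space) \<Longrightarrow> g' \<in> V_space \<Longrightarrow> (\<lambda>n. H1_norm (\<lambda>x. g n x - g' x)) \<longlonglongrightarrow> 0 \<Longrightarrow>
      (\<lambda>n. \<Phi> (f n) (g n)) \<longlonglongrightarrow> \<Phi> f' g'"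
  shows "(\<lambda>t. \<Phi> (u t) (v t)) \<in> borel_measurable (lebesgue_on {0<..})"
proof -
  let ?M = "lebesgue_on {0<..} :: real measure"
  obtain s where s: "\<And>n. simple_function ?M (s n)" "\<And>n. s n ` {0<..} \<subseteq> V_space"
    "AE t in ?M. u t \<in> V_space \<and> (\<lambda>n::nat. H1_norm (\<lambda>x. s n t x - u t x)) \<longlonglongrightarrow> 0"
    using u unfolding strongly_measurable_on_def by auto
  obtain r where r: "\<And>n. simple_function ?M (r n)" "\<And>n. r n ` {0<..} \<subseteq> V_space"
    "AE t in ?M. v t \<in> V_space \<and> (\<lambda>n::nat. H1_norm (\<lambda>x. r n t x - v t x)) \<longlonglongrightarrow> 0"
    using v unfolding strongly_measurable_on_def by auto
  have m: "(\<lambda>t. \<Phi> (s n t) (r n t)) \<in> borel_measurable ?M" for n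
    by (rule borel_measurable_simple_function[OF simple_function_compose2[OF s(1) r(1)]])
  have lim: "AE t in ?M. (\<lambda>n. \<Phi> (s n t) (r n t)) \<longlonglongrightarrow> \<Phi> (u t) (v t)"
    using s(3) r(3) AE_space
  proof eventually_elim
    case (elim t)
    then have "s n t \<in> V_space" "r n t \<in> V_space" for n using s(2)[of n] r(2)[of n] by auto
    then show ?case using elim by (intro \<Phi>) auto
  qed
  define L where "L t = lim (\<lambda>n. indicator {0<..} t * \<Phi> (s n t) (r n t))" for t
  have m': "(\<lambda>t. indicator {0<..} t * \<Phi> (s n t) (r n t)) \<in> borel_measurable lebesgue" for n
    using m[of n] borel_measurable_restrict_space_iff[of "{0<..}" lebesgue "\<lambda>t. \<Phi> (s n t) (r n t)"] by simp
  have Lm: "L \<in> borel_measurable lebesgue"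
    unfolding L_def using m' by (rule borel_measurable_lim_metric)
  have "AE t in lebesgue. L t = indicator {0<..} t * \<Phi> (u t) (v t)"
    using lim[unfolded AE_pos_iff]
  proof eventually_elim
    case (elim t)
    have "(\<lambda>n. indicator {0<..} t * \<Phi> (s n t) (r n t)) \<longlonglongrightarrow> indicator {0<..} t * \<Phi> (u t) (v t)"
      by (cases "0 < t") (use elim in auto)
    then show ?case unfolding L_def by (rule limI)
  qed
  from borel_measurable_AE[OF Lm this] show ?thesis
    using borel_measurable_restrict_space_iff[of "{0<..}" lebesgue "\<lambda>t. \<Phi> (u t) (v t)"] by simp
qed

lemma H_L2: "v \<in> H_space \<Longrightarrow> v \<in> L2"
  by (simp add: H_space_def)

lemma C0_HwD:
  assumes "v \<in> C0_Hw"
  shows "0 \<le> t \<Longrightarrow> v t \<in> H_space" "w \<in> L2 \<Longrightarrow> continuous_on {0..} (\<lambda>t. ip (v t) w)"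
proof -
  let ?F = "\<lambda>v. \<lambda>w\<in>L2. LINT x|lebesgue_on cyl. v x \<bullet> w x"
  let ?P = "product_topology (\<lambda>w. euclideanreal) (L2 :: (real^3 \<Rightarrow> real^3) set)"
  have c: "continuous_map (top_of_set {0..}) Hw v" using assms by (simp add: C0_Hw_def)
  have "topspace Hw \<subseteq> H_space" by (auto simp: Hw_def topspace_pullback_topology)
  then show "0 \<le> t \<Longrightarrow> v t \<in> H_space"
    using continuous_map_image_subset_topspace[OF c] by auto
  assume w: "w \<in> L2"
  have "continuous_map Hw ?P ?F"
    using continuous_map_pullback[OF continuous_map_id[of ?P], of H_space ?F] unfolding Hw_def by simp
  from continuous_map_compose[OF c this] have "continuous_map (top_of_set {0..}) ?P (?F \<circ> v)" .
  from continuous_map_compose[OF this continuous_map_product_projection[OF w]]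
  have "continuous_map (top_of_set {0..}) euclideanreal ((\<lambda>x. x w) \<circ> (?F \<circ> v))" .
  then show "continuous_on {0..} (\<lambda>t. ip (v t) w)"
    using w by (simp add: o_def ip_def)
qed

section \<open>The integrated equation of a single flow, applied to both solutions\<close>

locale NS_flow =
  fixes \<nu> :: real and u0 :: "real^3 \<Rightarrow> real^3" and u :: "real \<Rightarrow> real^3 \<Rightarrow> real^3"
  assumes nu: "0 < \<nu>" and u0: "u0 \<in> H_space" and uC: "u \<in> C0_Hw" and uV: "u \<in> L2_V {0<..}"
    and weak: "weak_form \<nu> u0 u" and energy: "energy_inequality \<nu> u0 u"
begin

lemma strong: "strongly_measurable_on {0<..} V_space H1_norm u"
  using uV by (simp add: L2_V_def)

lemma AE_V: "AE t in lebesgue. 0 < t \<longrightarrow> u t \<in> V_space"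
proof -
  have "AE t in lebesgue_on {0<..}. u t \<in> V_space"
    using strong unfolding strongly_measurable_on_def by (auto elim: eventually_mono)
  then show ?thesis by (simp add: AE_pos_iff)
qed

lemma loc_int_H1: "loc_int (\<lambda>t. (H1_norm (u t))\<^sup>2)"
  using uV by (intro loc_int_of_integrable) (simp add: L2_V_def)

lemma u_L2: "0 \<le> t \<Longrightarrow> u t \<in> L2"
  using C0_HwD(1)[OF uC] H_L2 by blast

lemma continuous_ip: "w \<in> L2 \<Longrightarrow> continuous_on {0..} (\<lambda>t. ip (u t) w)"
  by (rule C0_HwD(2)[OF uC])

lemma measurable_wgrad_sq: "(\<lambda>t. (L2_norm (wgrad (u t)))\<^sup>2) \<in> borel_measurable (lebesgue_on {0<..})"
  by (rule strongly_measurable_comp[OF strong strong, of "\<lambda>f g. (L2_norm (wgrad f))\<^sup>2"])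
    (intro tendsto_intros H1_norm_tendsto(5) V_H1)

lemma loc_int_wgrad_sq: "loc_int (\<lambda>t. (L2_norm (wgrad (u t)))\<^sup>2)"
  by (rule loc_int_bound[OF measurable_wgrad_sq loc_int_H1]) (auto intro!: AE_I2 simp: H1_norm_sq)

text \<open>The equation says that \<open>K f\<close> is the derivative of the pairing of \<open>u\<close> with \<open>f\<close>.\<close>

definition K :: "(real^3 \<Rightarrow> real^3) \<Rightarrow> real \<Rightarrow> real" where
  "K f t = tri (wgrad f) (u t) (u t) - \<nu> * ip (wgrad (u t)) (wgrad f)"

lemma ip_wgrad_tendsto:
  assumes "\<And>n::nat. f n \<in> V_space" "f' \<in> V_space" "(\<lambda>n. H1_norm (\<lambda>x. f n x - f' x)) \<longlonglongrightarrow> 0"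
    "\<And>n. g n \<in> V_space" "g' \<in> V_space" "(\<lambda>n. H1_norm (\<lambda>x. g n x - g' x)) \<longlonglongrightarrow> 0"
  shows "(\<lambda>n. ip (wgrad (f n)) (wgrad (g n))) \<longlonglongrightarrow> ip (wgrad f') (wgrad g')"
proof (rule tendsto_of_abs_diff_le)
  let ?e = "\<lambda>n. H1_norm (\<lambda>x. f n x - f' x) * H1_norm (g n) + H1_norm f' * H1_norm (\<lambda>x. g n x - g' x)"
  have "?e \<longlonglongrightarrow> 0 * H1_norm g' + H1_norm f' * 0"
    by (intro tendsto_intros assms H1_norm_tendsto(1) V_H1)
  then show "?e \<longlonglongrightarrow> 0" by simp
  fix n
  note L = V_wgrad_L2[OF assms(1)[of n]] V_wgrad_L2[OF assms(2)] V_wgrad_L2[OF assms(4)[of n]] V_wgrad_L2[OF assms(5)]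
  have "ip (wgrad (f n)) (wgrad (g n)) - ip (wgrad f') (wgrad g') =
     ip (\<lambda>x. wgrad (f n) x - wgrad f' x) (wgrad (g n)) + ip (wgrad f') (\<lambda>x. wgrad (g n) x - wgrad g' x)"
    using L by (simp add: ip_diff_left ip_diff_right)
  moreover have "\<bar>ip (\<lambda>x. wgrad (f n) x - wgrad f' x) (wgrad (g n))\<bar> \<le> H1_norm (\<lambda>x. f n x - f' x) * H1_norm (g n)"
    using L by (intro order.trans[OF ip_Cauchy_Schwarz] mult_mono L2_norm_wgrad_diff_le L2_norm_le_H1 L2_diff V_H1 assms) auto
  moreover have "\<bar>ip (wgrad f') (\<lambda>x. wgrad (g n) x - wgrad g' x)\<bar> \<le> H1_norm f' * H1_norm (\<lambda>x. g n x - g' x)"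
    using L by (intro order.trans[OF ip_Cauchy_Schwarz] mult_mono L2_norm_wgrad_diff_le L2_norm_le_H1 L2_diff V_H1 assms) auto
  ultimately show "\<bar>ip (wgrad (f n)) (wgrad (g n)) - ip (wgrad f') (wgrad g')\<bar> \<le> ?e n" by linarith
qed

lemma measurable_K:
  assumes "f \<in> V_space"
  shows "K f \<in> borel_measurable (lebesgue_on {0<..})"
  unfolding K_def[abs_def]
  by (rule strongly_measurable_comp[OF strong strong, of "\<lambda>p q. tri (wgrad f) p p - \<nu> * ip (wgrad p) (wgrad f)"])
    (intro tendsto_intros tri_tendsto ip_wgrad_tendsto V_const_tendsto assms; assumption)

text \<open>The factor next to \<open>H1_norm f\<close> does not involve \<open>f\<close> and is
  locally integrable in time, so time integrals of \<open>K f\<close> depend continuously on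
  \<open>f\<close>. The summand \<open>\<nu>\<close> comes from bounding a norm by its square plus
  one.\<close>

lemma K_bound:
  assumes "f \<in> V_space" "u t \<in> V_space"
  shows "\<bar>K f t\<bar> \<le> H1_norm f * ((2 + \<nu>) * (H1_norm (u t))\<^sup>2 + \<nu>)"
proof -
  have "\<bar>tri (wgrad f) (u t) (u t)\<bar> \<le> 2 * L2_norm (wgrad f) * H1_norm (u t) * H1_norm (u t)"
    by (intro tri_abs_le V_wgrad_L2 assms)
  also have "\<dots> \<le> 2 * H1_norm f * H1_norm (u t) * H1_norm (u t)"
    by (intro mult_right_mono mult_left_mono L2_norm_le_H1) auto
  finally have 1: "\<bar>tri (wgrad f) (u t) (u t)\<bar> \<le> H1_norm f * (2 * (H1_norm (u t))\<^sup>2)"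
    by (simp add: power2_eq_square mult_ac)
  have "\<bar>ip (wgrad (u t)) (wgrad f)\<bar> \<le> L2_norm (wgrad (u t)) * L2_norm (wgrad f)"
    by (intro ip_Cauchy_Schwarz V_wgrad_L2 assms)
  also have "\<dots> \<le> H1_norm (u t) * H1_norm f" by (intro mult_mono L2_norm_le_H1) auto
  also have "\<dots> \<le> ((H1_norm (u t))\<^sup>2 + 1) * H1_norm f"
  proof (rule mult_right_mono)
    have "2 * H1_norm (u t) * 1 \<le> (H1_norm (u t))\<^sup>2 + 1\<^sup>2" by (rule sum_squares_bound)
    then show "H1_norm (u t) \<le> (H1_norm (u t))\<^sup>2 + 1" using H1_norm_nonneg[of "u t"] unfolding power_one by linarith
  qed simp
  finally have "\<nu> * \<bar>ip (wgrad (u t)) (wgrad f)\<bar> \<le> \<nu> * (((H1_norm (u t))\<^sup>2 + 1) * H1_norm f)"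
    using nu by (intro mult_left_mono) auto
  moreover have "\<bar>K f t\<bar> \<le> \<bar>tri (wgrad f) (u t) (u t)\<bar> + \<nu> * \<bar>ip (wgrad (u t)) (wgrad f)\<bar>"
    unfolding K_def using nu abs_triangle_ineq4[of "tri (wgrad f) (u t) (u t)" "\<nu> * ip (wgrad (u t)) (wgrad f)"]
    by (simp add: abs_mult)
  ultimately show ?thesis using 1 by (simp add: algebra_simps)
qed

lemma loc_int_K_bound: "loc_int (\<lambda>t. c * ((2 + \<nu>) * (H1_norm (u t))\<^sup>2 + \<nu>))"
  by (intro loc_int_cmult loc_int_add loc_int_const loc_int_H1)

lemma loc_int_K:
  assumes "f \<in> V_space" shows "loc_int (K f)"
  by (rule loc_int_bound[OF measurable_K[OF assms] loc_int_K_bound[of "H1_norm f"]])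
    (use AE_V in \<open>auto elim!: eventually_mono intro!: K_bound assms\<close>)

lemma weak_form_cutoff:
  assumes f: "f \<in> D_sol" and \<tau>: "0 < \<tau>"
  shows "(\<integral>t. indicator {0..} t * (real (Suc n) * flat 2 (real (Suc n) * (\<tau> - t)) * ip (u t) f) \<partial>lebesgue)
    - (\<integral>t. cutoff \<tau> (Suc n) t * (indicator {0..\<tau>} t * K f t) \<partial>lebesgue) = cutoff \<tau> (Suc n) 0 * ip u0 f"
proof -
  let ?\<phi> = "\<lambda>t x. cutoff \<tau> (Suc n) t *\<^sub>R f x"
  let ?\<omega> = "\<lambda>t. real (Suc n) * flat 2 (real (Suc n) * (\<tau> - t))"
  let ?in = "\<lambda>t. LINT x|lebesgue_on cyl. - (time_deriv ?\<phi> t x \<bullet> u t x) - (jac (?\<phi> t) x *v u t x) \<bullet> u t x + \<nu> * (wgrad (u t) x \<bullet> jac (?\<phi> t) x)"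
  note fD = D_sol_D_space[OF f] and fV = D_sol_V[OF f]
  have J: "jac (\<lambda>x. c *\<^sub>R f x) x = c *\<^sub>R jac f x" for c x by (rule jac_scaleR[OF D_spaceD(3)[OF fD]])
  have inner: "?in t = ?\<omega> t * ip (u t) f - cutoff \<tau> (Suc n) t * K f t" if t: "0 \<le> t" "u t \<in> V_space" for t
  proof -
    note L = V_L2[OF t(2)] D_space_L2[OF fD] V_wgrad_L2[OF t(2)]
    have Kf: "K f t = tri (jac f) (u t) (u t) - \<nu> * ip (wgrad (u t)) (jac f)"
      unfolding K_def tri_jac[OF fD t(2) t(2)]
      using ip_cong_AE[OF V_wgrad_L2[OF fV] L(3) L(4) wgrad_D_space[OF fD]] by (simp add: ip_commute[of "wgrad (u t)"])
    have "?in t = (LINT x|lebesgue_on cyl. ?\<omega> t * (u t x \<bullet> f x) - cutoff \<tau> (Suc n) t * ((jac f x *v u t x) \<bullet> u t x) +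
        (\<nu> * cutoff \<tau> (Suc n) t) * (wgrad (u t) x \<bullet> jac f x))"
    proof (intro Bochner_Integration.integral_cong refl)
      fix x
      have 1: "time_deriv ?\<phi> t x = (- ?\<omega> t) *\<^sub>R f x"
        using time_deriv_cutoff[OF t(1), of \<tau> "Suc n" f x] by (simp del: of_nat_Suc)
      have 2: "(c *\<^sub>R jac f x) *v w = c *\<^sub>R (jac f x *v w)" for c w
        by (simp add: vec_eq_iff matrix_vector_mult_def sum_distrib_left mult.assoc)
      show "- (time_deriv ?\<phi> t x \<bullet> u t x) - (jac (?\<phi> t) x *v u t x) \<bullet> u t x + \<nu> * (wgrad (u t) x \<bullet> jac (?\<phi> t) x) =
        ?\<omega> t * (u t x \<bullet> f x) - cutoff \<tau> (Suc n) t * ((jac f x *v u t x) \<bullet> u t x) + (\<nu> * cutoff \<tau> (Suc n) t) * (wgrad (u t) x \<bullet> jac f x)"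
        unfolding 1 J 2 by (simp add: inner_commute[of "f x"] mult.assoc del: of_nat_Suc)
    qed
    also have "\<dots> = ?\<omega> t * ip (u t) f - cutoff \<tau> (Suc n) t * tri (jac f) (u t) (u t) + (\<nu> * cutoff \<tau> (Suc n) t) * ip (wgrad (u t)) (jac f)"
      using L2_integrable_inner[OF L(1,2)] L2_integrable_inner[OF L(4,3)] tri_integrable(2)[OF L(3) t(2) t(2)]
      by (simp add: ip_def tri_def del: of_nat_Suc)
    finally show ?thesis by (simp add: Kf algebra_simps)
  qed
  have cut0: "cutoff \<tau> (Suc n) t = 0" if "\<tau> < t" for t
    using that by (simp add: cutoff_def mult_nonneg_nonpos del: of_nat_Suc)
  have i1: "integrable lebesgue (\<lambda>t. indicator {0..} t * (?\<omega> t * ip (u t) f))"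
    by (rule flat_kernel_tendsto(2)[OF continuous_ip[OF D_space_L2(1)[OF fD]] \<tau>])
  have cm: "cutoff \<tau> (Suc n) \<in> borel_measurable lebesgue"
    using Ck_on_cutoff[of 0 \<tau> "Suc n"] by (intro measurable_completion) (simp add: borel_measurable_continuous_onI)
  have i2: "integrable lebesgue (\<lambda>t. cutoff \<tau> (Suc n) t * (indicator {0..\<tau>} t * K f t))"
  proof (rule Bochner_Integration.integrable_bound)
    show i: "integrable lebesgue (\<lambda>t. indicator {0..\<tau>} t * K f t)" using loc_int_K[OF fV] by (simp add: loc_int_def)
    show "(\<lambda>t. cutoff \<tau> (Suc n) t * (indicator {0..\<tau>} t * K f t)) \<in> borel_measurable lebesgue"
      by (rule borel_measurable_times[OF cm borel_measurable_integrable[OF i]])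
    show "AE t in lebesgue. norm (cutoff \<tau> (Suc n) t * (indicator {0..\<tau>} t * K f t)) \<le> norm (indicator {0..\<tau>} t * K f t)"
      by (intro AE_I2) (simp add: abs_mult cutoff_def mult_left_le_one_le)
  qed
  have h1: "(LINT t|lebesgue_on {0..}. ?in t) - (LINT x|lebesgue_on cyl. u0 x \<bullet> ?\<phi> 0 x) = 0"
    using weak cutoff_test_field[OF f, of \<tau> "Suc n"] unfolding weak_form_def by blast
  have h2: "(LINT x|lebesgue_on cyl. u0 x \<bullet> ?\<phi> 0 x) = cutoff \<tau> (Suc n) 0 * ip u0 f" by (simp add: ip_def)
  have h3: "(LINT t|lebesgue_on {0..}. ?in t) = (\<integral>t. indicator {0..} t * ?in t \<partial>lebesgue)"
    by (simp add: integral_restrict_space)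
  have h4: "(\<integral>t. indicator {0..} t * ?in t \<partial>lebesgue) =
     (\<integral>t. indicator {0..} t * (?\<omega> t * ip (u t) f) - cutoff \<tau> (Suc n) t * (indicator {0..\<tau>} t * K f t) \<partial>lebesgue)"
  proof -
    have ae: "AE t in lebesgue. indicator {0..} t * (?\<omega> t * ip (u t) f) - cutoff \<tau> (Suc n) t * (indicator {0..\<tau>} t * K f t) = indicator {0..} t * ?in t"
      using AE_nonneg[OF AE_V]
    proof eventually_elim
      case (elim t)
      show ?case
      proof (cases "0 \<le> t")
        case True
        then have e: "?in t = ?\<omega> t * ip (u t) f - cutoff \<tau> (Suc n) t * K f t" using inner elim by blast
        show ?thesis unfolding e using True cut0[of t] by (cases "t \<le> \<tau>") auto
      qed auto
    qed
    have m: "(\<lambda>t. indicator {0..} t * (?\<omega> t * ip (u t) f) - cutoff \<tau> (Suc n) t * (indicator {0..\<tau>} t * K f t)) \<in> borel_measurable lebesgue"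
      using i1 i2 by simp
    show ?thesis
      by (rule integral_cong_AE[OF borel_measurable_AE[OF m ae] m]) (use ae in \<open>auto elim: eventually_mono\<close>)
  qed
  also have "\<dots> = (\<integral>t. indicator {0..} t * (?\<omega> t * ip (u t) f) \<partial>lebesgue) - (\<integral>t. cutoff \<tau> (Suc n) t * (indicator {0..\<tau>} t * K f t) \<partial>lebesgue)"
    by (rule Bochner_Integration.integral_diff[OF i1 i2])
  finally show ?thesis using h1 unfolding h2 h3 by (simp only: right_minus_eq)
qed

lemma cutoff_tendsto: "t < \<tau> \<Longrightarrow> (\<lambda>n. cutoff \<tau> (Suc n) t) \<longlonglongrightarrow> 1"
  using LIMSEQ_Suc[OF flat_scaled_tendsto[of "\<tau> - t"]] by (simp add: cutoff_def del: of_nat_Suc)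

text \<open>As \<open>n\<close> grows the kernel evaluates the weakly continuous pairing at
  \<open>\<tau>\<close> and the cutoff becomes the indicator of the times before
  \<open>\<tau>\<close>. Weak continuity makes the identity valid at every positive time, not only
  at almost every one.\<close>

lemma ip_D_sol_pos:
  assumes f: "f \<in> D_sol" and \<tau>: "0 < \<tau>"
  shows "ip (u \<tau>) f = ip u0 f + time_int (K f) 0 \<tau>"
proof -
  note fV = D_sol_V[OF f]
  have i: "integrable lebesgue (\<lambda>t. indicator {0..\<tau>} t * K f t)" using loc_int_K[OF fV] by (simp add: loc_int_def)
  have cm: "cutoff \<tau> (Suc n) \<in> borel_measurable lebesgue" for n
    using Ck_on_cutoff[of 0 \<tau> "Suc n"] by (intro measurable_completion) (simp add: borel_measurable_continuous_onI)
  have "(\<lambda>n. \<integral>t. cutoff \<tau> (Suc n) t * (indicator {0..\<tau>} t * K f t) \<partial>lebesgue) \<longlonglongrightarrow> (\<integral>t. indicator {0..\<tau>} t * K f t \<partial>lebesgue)"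
  proof (rule integral_dominated_convergence)
    show "integrable lebesgue (\<lambda>t. norm (indicator {0..\<tau>} t * K f t))" using i by (rule integrable_norm)
    show "(\<lambda>t. indicator {0..\<tau>} t * K f t) \<in> borel_measurable lebesgue" using i by simp
    show "(\<lambda>t. cutoff \<tau> (Suc n) t * (indicator {0..\<tau>} t * K f t)) \<in> borel_measurable lebesgue" for n
      by (rule borel_measurable_times[OF cm borel_measurable_integrable[OF i]])
    show "AE t in lebesgue. norm (cutoff \<tau> (Suc n) t * (indicator {0..\<tau>} t * K f t)) \<le> norm (indicator {0..\<tau>} t * K f t)" for n
      by (intro AE_I2) (simp add: abs_mult cutoff_def mult_left_le_one_le)
    show "AE t in lebesgue. (\<lambda>n. cutoff \<tau> (Suc n) t * (indicator {0..\<tau>} t * K f t)) \<longlonglongrightarrow> indicator {0..\<tau>} t * K f t"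
      using AE_lebesgue_neq[of \<tau>]
    proof eventually_elim
      case (elim t)
      show ?case
      proof (cases "t < \<tau>")
        case True
        from tendsto_mult[OF cutoff_tendsto[OF True] tendsto_const] show ?thesis by simp
      qed (use elim in simp)
    qed
  qed
  then have 1: "(\<lambda>n. \<integral>t. cutoff \<tau> (Suc n) t * (indicator {0..\<tau>} t * K f t) \<partial>lebesgue) \<longlonglongrightarrow> time_int (K f) 0 \<tau>" by (simp add: time_int_def)
  have "(\<lambda>n. cutoff \<tau> (Suc n) 0 * ip u0 f) \<longlonglongrightarrow> ip (u \<tau>) f - time_int (K f) 0 \<tau>"
    unfolding weak_form_cutoff[OF f \<tau>, symmetric]
    by (intro tendsto_diff 1 flat_kernel_tendsto(1)[OF continuous_ip[OF D_space_L2(1)[OF D_sol_D_space[OF f]]] \<tau>])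
  moreover have "(\<lambda>n. cutoff \<tau> (Suc n) 0 * ip u0 f) \<longlonglongrightarrow> 1 * ip u0 f"
    by (intro tendsto_mult cutoff_tendsto tendsto_const \<tau>)
  ultimately show ?thesis using LIMSEQ_unique by fastforce
qed

text \<open>At \<open>t = 0\<close> the cutoff vanishes on the whole time axis and gives no
  information; the identity is recovered there from positive times by weak continuity. This case
  identifies \<open>u 0\<close> with the initial data.\<close>

lemma ip_D_sol:
  assumes f: "f \<in> D_sol" and t: "0 \<le> t"
  shows "ip (u t) f = ip u0 f + time_int (K f) 0 t"
proof (cases "t = 0")
  case True
  have fL: "f \<in> L2" by (rule V_L2[OF D_sol_V[OF f]])
  have l: "(\<lambda>n. inverse (real (Suc n))) \<longlonglongrightarrow> 0" by (rule LIMSEQ_inverse_real_of_nat)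
  have "(\<lambda>n. ip (u (inverse (real (Suc n)))) f) \<longlonglongrightarrow> ip (u 0) f"
    by (rule continuous_on_tendsto_compose[OF continuous_ip[OF fL] l]) auto
  moreover have "(\<lambda>n. ip u0 f + time_int (K f) 0 (inverse (real (Suc n)))) \<longlonglongrightarrow> ip u0 f + time_int (K f) 0 0"
    by (intro tendsto_add tendsto_const time_int_tendsto loc_int_K D_sol_V f l) simp
  moreover have "ip (u (inverse (real (Suc n)))) f = ip u0 f + time_int (K f) 0 (inverse (real (Suc n)))" for n
    by (rule ip_D_sol_pos[OF f]) simp
  ultimately show ?thesis using True LIMSEQ_unique by auto
qed (use t ip_D_sol_pos[OF f] in simp)

end

section \<open>Increments, Gronwall and the initial value\<close>

lemma time_int_refl: "loc_int F \<Longrightarrow> time_int F 0 0 = 0"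
  using time_int_combine[of F 0 0 0] by simp

lemma loc_int_integrable: "integrable lebesgue F \<Longrightarrow> loc_int F"
  unfolding loc_int_def using integrable_mult_indicator[of "{0..T}" lebesgue F for T] by simp

lemma time_int_le_integral:
  assumes "integrable lebesgue F" "\<And>t. 0 \<le> F t" shows "time_int F s t \<le> (\<integral>t. F t \<partial>lebesgue)"
  unfolding time_int_def
  by (rule integral_mono) (use assms integrable_mult_indicator[of "{s..t}" lebesgue F] in \<open>auto simp: indicator_def\<close>)

lemma lebesgue_integral_shift:
  assumes "integrable lebesgue (F :: real \<Rightarrow> real)"
  shows "integrable lebesgue (\<lambda>t. F (t + c))" "(\<integral>t. F (t + c) \<partial>lebesgue) = (\<integral>t. F t \<partial>lebesgue)"
proof -
  show i: "integrable lebesgue (\<lambda>t. F (t + c))"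
    using lebesgue_integrable_real_affine[OF assms, of 1 c] by (simp add: add.commute)
  show "(\<integral>t. F (t + c) \<partial>lebesgue) = (\<integral>t. F t \<partial>lebesgue)"
    using lebesgue_integral_real_affine[of 1 F c] by (simp add: add.commute)
qed

lemma time_int_sum_steps:
  assumes "loc_int k" "0 \<le> t" "0 \<le> h"
  shows "(\<Sum>i<n. time_int k (t + real i * h) (t + real (Suc i) * h)) = time_int k t (t + real n * h)"
proof (induction n)
  case 0
  then show ?case using time_int_combine[OF assms(1,2), of t t] by simp
next
  case (Suc n)
  have "t + real n * h \<le> t + real (Suc n) * h" using assms by (simp add: algebra_simps)
  then show ?case
    using Suc time_int_combine[OF assms(1,2), of "t + real n * h" "t + real (Suc n) * h"] assms by simp
qed

text \<open>The increment over \<open>\<tau>\<close> is a sum of \<open>n\<close> increments of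
  length \<open>h\<close>, each controlled by \<open>k\<close> at its end points and by the integral
  of \<open>k\<close>. At a given \<open>t\<close> the resulting Riemann sum of \<open>k\<close> may
  be large, but averaging over the starting point \<open>t\<close> turns it into at most
  \<open>2 * \<tau>\<close> times the integral of \<open>k\<close>. So the increment is dominated by
  functions with arbitrarily small integrals.\<close>

lemma increments_vanish:
  fixes \<psi> :: "real \<Rightarrow> real"
  assumes \<tau>: "0 < \<tau>"
    and H: "\<And>\<epsilon>. 0 < \<epsilon> \<Longrightarrow> \<exists>\<delta>>0. \<exists>k. (\<forall>t. 0 \<le> k t) \<and> integrable lebesgue k \<and> (\<integral>t. k t \<partial>lebesgue) \<le> \<epsilon> \<and>
      (\<exists>N\<in>null_sets lebesgue. \<forall>t h. 0 < t \<longrightarrow> 0 < h \<longrightarrow> h < \<delta> \<longrightarrow> t + h < \<tau> + 1 \<longrightarrow> t \<notin> N \<longrightarrow> t + h \<notin> N \<longrightarrow>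
        \<bar>\<psi> (t + h) - \<psi> t\<bar> \<le> h * k t + h * k (t + h) + time_int k t (t + h))"
  shows "AE t in lebesgue. 0 < t \<longrightarrow> t < 1 \<longrightarrow> \<psi> (t + \<tau>) = \<psi> t"
proof -
  have "\<exists>g. (\<forall>t. 0 \<le> g t) \<and> integrable lebesgue g \<and> (\<integral>t. g t \<partial>lebesgue) \<le> (4 * \<tau> + 1) * \<epsilon> \<and>
     (AE t in lebesgue. 0 < t \<longrightarrow> t < 1 \<longrightarrow> \<bar>\<psi> (t + \<tau>) - \<psi> t\<bar> \<le> g t)" if \<epsilon>: "0 < \<epsilon>" for \<epsilon>
  proof -
    obtain \<delta> k N where \<delta>: "0 < \<delta>" and k0: "\<forall>t. 0 \<le> k t" and k1: "integrable lebesgue k" "(\<integral>t. k t \<partial>lebesgue) \<le> \<epsilon>"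
      and N: "N \<in> null_sets lebesgue" and B: "\<forall>t h. 0 < t \<longrightarrow> 0 < h \<longrightarrow> h < \<delta> \<longrightarrow> t + h < \<tau> + 1 \<longrightarrow> t \<notin> N \<longrightarrow> t + h \<notin> N \<longrightarrow>
        \<bar>\<psi> (t + h) - \<psi> t\<bar> \<le> h * k t + h * k (t + h) + time_int k t (t + h)"
      using H[OF \<epsilon>] by blast
    note k = k0[rule_format] k1
    obtain n :: nat where n: "\<tau> / \<delta> < real n" using reals_Archimedean2 by blast
    have n0: "0 < real n" using n \<tau> \<delta> by (smt (verit) divide_pos_pos)
    define h where "h = \<tau> / real n"
    have h: "0 < h" "h < \<delta>" "real n * h = \<tau>" using n n0 \<tau> \<delta> by (auto simp: h_def field_simps)
    have hn: "real (Suc n) * h \<le> 2 * \<tau>"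
    proof -
      have "1 \<le> real n" using n0 by simp
      then have "1 * h \<le> real n * h" using h by (intro mult_right_mono) auto
      then have "h \<le> \<tau>" unfolding h(3) by simp
      then show ?thesis unfolding of_nat_Suc distrib_right h(3) by simp
    qed
    \<comment> \<open>Every node bounds at most two neighbouring steps, hence the factor
      \<open>2 * h\<close>; the indicator accounts for the integral of \<open>k\<close>, which is at
      most \<open>\<epsilon>\<close>.\<close>
    define g where "g t = indicator {0<..<1} t * \<epsilon> + 2 * h * (\<Sum>i\<le>n. k (t + real i * h))" for t
    note ks = lebesgue_integral_shift[OF k(2)]
    have ind: "integrable lebesgue (\<lambda>t. indicator {0<..<1::real} t * \<epsilon>)" "(\<integral>t. indicator {0<..<1::real} t * \<epsilon> \<partial>lebesgue) = \<epsilon>"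
    proof -
      have m: "(\<lambda>t. indicator {0<..<1::real} t * \<epsilon>) \<in> borel_measurable lborel" by simp
      have "integrable lborel (\<lambda>t. indicator {0<..<1::real} t * \<epsilon>)" by simp
      then show "integrable lebesgue (\<lambda>t. indicator {0<..<1::real} t * \<epsilon>)" unfolding integrable_completion[OF m] .
      have "(\<integral>t. indicator {0<..<1::real} t * \<epsilon> \<partial>lborel) = \<epsilon>" by (simp add: measure_def)
      then show "(\<integral>t. indicator {0<..<1::real} t * \<epsilon> \<partial>lebesgue) = \<epsilon>" unfolding integral_completion[OF m] .
    qed
    have s: "integrable lebesgue (\<lambda>t. 2 * h * (\<Sum>i\<le>n. k (t + real i * h)))"
      by (intro integrable_mult_right Bochner_Integration.integrable_sum ks)
    have gi: "integrable lebesgue g"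
      unfolding g_def by (rule Bochner_Integration.integrable_add[OF ind(1) s])
    have "(\<integral>t. g t \<partial>lebesgue) = \<epsilon> + 2 * h * (\<Sum>i\<le>n. (\<integral>t. k t \<partial>lebesgue))"
      unfolding g_def by (subst Bochner_Integration.integral_add[OF ind(1) s]) (simp add: ind(2) ks Bochner_Integration.integral_sum)
    also have "\<dots> = \<epsilon> + 2 * (real (Suc n) * h) * (\<integral>t. k t \<partial>lebesgue)" by simp
    also have "\<dots> \<le> \<epsilon> + 2 * (2 * \<tau>) * \<epsilon>"
    proof (rule add_left_mono, rule mult_mono)
      show "0 \<le> (\<integral>t. k t \<partial>lebesgue)" by (simp add: k(1))
    qed (use hn k(3) \<tau> in \<open>auto simp: mult.commute\<close>)
    finally have gI: "(\<integral>t. g t \<partial>lebesgue) \<le> (4 * \<tau> + 1) * \<epsilon>" by (simp add: algebra_simps)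
    \<comment> \<open>For almost every starting point all nodes avoid \<open>N\<close>, as countably
      many translates of a null set form a null set.\<close>
    have "AE t in lebesgue. t + c \<notin> N" for c
      using AE_not_in[OF N] unfolding AE_completion_iff by (rule AE_lborel_shift)
    then have "AE t in lebesgue. \<forall>i::nat. t + real i * h \<notin> N" by (subst AE_all_countable) blast
    then have "AE t in lebesgue. 0 < t \<longrightarrow> t < 1 \<longrightarrow> \<bar>\<psi> (t + \<tau>) - \<psi> t\<bar> \<le> g t"
    proof eventually_elim
      case (elim t)
      show ?case
      proof (intro impI)
        assume t: "0 < t" "t < 1"
        have step: "\<bar>\<psi> (t + real (Suc i) * h) - \<psi> (t + real i * h)\<bar> \<le>
          h * k (t + real i * h) + h * k (t + real (Suc i) * h) + time_int k (t + real i * h) (t + real (Suc i) * h)" if i: "i < n" for i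
        proof -
          have e: "t + real (Suc i) * h = (t + real i * h) + h" by (simp add: algebra_simps)
          have "real (Suc i) * h \<le> real n * h" using i h by (intro mult_right_mono) auto
          then have "(t + real i * h) + h < \<tau> + 1" using h(3) t by (simp add: algebra_simps)
          moreover have "0 < t + real i * h" using t h by (simp add: add_pos_nonneg)
          moreover have "t + real i * h + h \<notin> N" using elim[rule_format, of "Suc i"] unfolding e .
          ultimately show ?thesis unfolding e using B h elim by blast
        qed
        have "\<psi> (t + \<tau>) - \<psi> t = (\<Sum>i<n. \<psi> (t + real (Suc i) * h) - \<psi> (t + real i * h))"
          using h(3) by (subst sum_lessThan_telescope) simp
        then have "\<bar>\<psi> (t + \<tau>) - \<psi> t\<bar> \<le> (\<Sum>i<n. \<bar>\<psi> (t + real (Suc i) * h) - \<psi> (t + real i * h)\<bar>)"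
          by (simp only: sum_abs)
        also have "\<dots> \<le> (\<Sum>i<n. h * k (t + real i * h) + h * k (t + real (Suc i) * h) + time_int k (t + real i * h) (t + real (Suc i) * h))"
          by (intro sum_mono step) simp
        also have "\<dots> = h * (\<Sum>i<n. k (t + real i * h)) + h * (\<Sum>i<n. k (t + real (Suc i) * h)) + time_int k t (t + \<tau>)"
          using time_int_sum_steps[OF loc_int_integrable[OF k(2)], of t h n] t h
          by (simp only: sum.distrib sum_distrib_left)
        also have "(\<Sum>i<n. k (t + real i * h)) \<le> (\<Sum>i\<le>n. k (t + real i * h))"
          by (intro sum_mono2) (auto simp: k)
        also have "(\<Sum>i<n. k (t + real (Suc i) * h)) \<le> (\<Sum>i\<le>n. k (t + real i * h))"
          unfolding lessThan_Suc_atMost[symmetric] by (subst sum.lessThan_Suc_shift) (simp add: k)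
        finally have "\<bar>\<psi> (t + \<tau>) - \<psi> t\<bar> \<le> h * (\<Sum>i\<le>n. k (t + real i * h)) + h * (\<Sum>i\<le>n. k (t + real i * h)) + time_int k t (t + \<tau>)"
          using h by (simp add: mult_left_mono)
        moreover have "time_int k t (t + \<tau>) \<le> \<epsilon>" using time_int_le_integral[OF k(2,1), of t "t + \<tau>"] k(3) by linarith
        ultimately show "\<bar>\<psi> (t + \<tau>) - \<psi> t\<bar> \<le> g t" using t by (simp add: g_def)
      qed
    qed
    then show ?thesis
      using gi gI h k(1) \<epsilon> by (intro exI[of _ g]) (auto simp: g_def intro!: add_nonneg_nonneg mult_nonneg_nonneg sum_nonneg)
  qed
  from this[of "inverse (real (Suc m))" for m]
  have "\<forall>m. \<exists>g. (\<forall>t. 0 \<le> g t) \<and> integrable lebesgue g \<and> (\<integral>t. g t \<partial>lebesgue) \<le> (4 * \<tau> + 1) * inverse (real (Suc m)) \<and>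
     (AE t in lebesgue. 0 < t \<longrightarrow> t < 1 \<longrightarrow> \<bar>\<psi> (t + \<tau>) - \<psi> t\<bar> \<le> g t)" by simp
  then obtain g where g: "\<And>m t. 0 \<le> g m t" "\<And>m. integrable lebesgue (g m)"
    "\<And>m. (\<integral>t. g m t \<partial>lebesgue) \<le> (4 * \<tau> + 1) * inverse (real (Suc m))"
    "\<And>m. AE t in lebesgue. 0 < t \<longrightarrow> t < 1 \<longrightarrow> \<bar>\<psi> (t + \<tau>) - \<psi> t\<bar> \<le> g m t"
    unfolding choice_iff by blast
  have "(\<lambda>m. (4 * \<tau> + 1) * inverse (real (Suc m))) \<longlonglongrightarrow> (4 * \<tau> + 1) * 0"
    by (intro tendsto_intros LIMSEQ_inverse_real_of_nat)
  then have lim: "(\<lambda>m. (4 * \<tau> + 1) * inverse (real (Suc m))) \<longlonglongrightarrow> 0" by simp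
  have nonneg: "0 \<le> (\<integral>t. g m t \<partial>lebesgue)" for m by (simp add: g(1))
  have "(\<integral>t. norm (g m t) \<partial>lebesgue) = (\<integral>t. g m t \<partial>lebesgue)" for m using g(1) by simp
  then have "\<bar>(\<integral>t. norm (g m t) \<partial>lebesgue) - 0\<bar> \<le> (4 * \<tau> + 1) * inverse (real (Suc m))" for m
    using g(3)[of m] nonneg[of m] by simp
  from tendsto_of_abs_diff_le[OF this lim] have "(\<lambda>m. \<integral>t. norm (g m t) \<partial>lebesgue) \<longlonglongrightarrow> 0" .
  from tendsto_L1_AE_subseq[OF g(2) this] obtain r :: "nat \<Rightarrow> nat"
    where r: "AE t in lebesgue. (\<lambda>n. g (r n) t) \<longlonglongrightarrow> 0" by blast
  have "AE t in lebesgue. \<forall>m. 0 < t \<longrightarrow> t < 1 \<longrightarrow> \<bar>\<psi> (t + \<tau>) - \<psi> t\<bar> \<le> g m t"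
    using g(4) by (subst AE_all_countable) blast
  with r show ?thesis
  proof eventually_elim
    case (elim t)
    show ?case
    proof (intro impI)
      assume "0 < t" "t < 1"
      then have "\<bar>\<psi> (t + \<tau>) - \<psi> t\<bar> \<le> g (r n) t" for n using elim(2) by blast
      then have "\<bar>\<psi> (t + \<tau>) - \<psi> t\<bar> \<le> 0" using LIMSEQ_le_const[OF elim(1)] by blast
      then show "\<psi> (t + \<tau>) = \<psi> t" by simp
    qed
  qed
qed

text \<open>Neither \<open>y\<close> nor \<open>\<gamma>\<close> is continuous, so nothing is
  differentiated. The right-hand side \<open>Y\<close> is monotone, and over a time interval on
  which \<open>G\<close> grows by \<open>G T / n\<close> it grows at most by the reciprocal of
  \<open>1 - G T / n\<close>. After \<open>n\<close> such intervals the reciprocal of the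
  \<open>n\<close>-th power remains, which tends to the exponential.\<close>

lemma Gronwall_integral:
  assumes \<gamma>: "loc_int \<gamma>" "\<And>t. 0 \<le> \<gamma> t" and gy: "loc_int (\<lambda>t. \<gamma> t * y t)" and y0: "\<And>t. 0 \<le> y t"
    and le: "\<And>t. 0 \<le> t \<Longrightarrow> y t \<le> c + time_int (\<lambda>r. \<gamma> r * y r) 0 t" and T: "0 \<le> T"
  shows "y T \<le> c * exp (time_int \<gamma> 0 T)"
proof -
  define Y where "Y t = c + time_int (\<lambda>r. \<gamma> r * y r) 0 t" for t
  define G where "G t = time_int \<gamma> 0 t" for t
  have Yd: "Y t - Y s = time_int (\<lambda>r. \<gamma> r * y r) s t" and Gd: "G t - G s = time_int \<gamma> s t" if "0 \<le> s" "s \<le> t" for s t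
    using time_int_combine[OF gy, of 0 s t] time_int_combine[OF \<gamma>(1), of 0 s t] that by (auto simp: Y_def G_def)
  have Ymono: "Y s \<le> Y t" and Gmono: "G s \<le> G t" if "0 \<le> s" "s \<le> t" for s t
    using Yd[OF that] Gd[OF that] time_int_nonneg[of "\<lambda>r. \<gamma> r * y r" s t] time_int_nonneg[of \<gamma> s t] \<gamma> y0 by auto
  have Y0: "0 \<le> Y t" if "0 \<le> t" for t using le[OF that] y0[of t] by (simp add: Y_def)
  have key: "Y t * (1 - (G t - G s)) \<le> Y s" if st: "0 \<le> s" "s \<le> t" for s t
  proof -
    have "time_int (\<lambda>r. \<gamma> r * y r) s t \<le> time_int (\<lambda>r. Y t * \<gamma> r) s t"
    proof (rule time_int_mono_AE[OF gy loc_int_cmult[OF \<gamma>(1)] st(1)], intro AE_I2 impI)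
      fix r assume "s \<le> r" "r \<le> t" "0 < r"
      then have "y r \<le> Y t" using le[of r] Ymono[of r t] by (simp add: Y_def)
      then show "\<gamma> r * y r \<le> Y t * \<gamma> r" using mult_left_mono[OF _ \<gamma>(2), of "y r" "Y t" r] by (simp only: mult.commute)
    qed
    then show ?thesis using Yd[OF st] Gd[OF st] by (simp add: time_int_cmult algebra_simps)
  qed
  have Gcont: "continuous_on {0..} G"
    unfolding continuous_on_sequentially G_def using time_int_tendsto[OF \<gamma>(1)] by (auto simp: o_def)
  have G0: "G 0 = 0" unfolding G_def by (rule time_int_refl[OF \<gamma>(1)])
  have GT: "0 \<le> G T" using Gmono[of 0 T] T G0 by simp
  have bound: "Y T * (1 - G T / real n) ^ n \<le> c" if n: "0 < n" "G T < real n" for n :: nat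
  proof -
    have q: "0 < 1 - G T / real n" using n by simp
    have "\<exists>t. 0 \<le> t \<and> t \<le> T \<and> G t = real i * (G T / real n) \<and> Y t * (1 - G T / real n) ^ i \<le> c" if "i \<le> n" for i
      using that
    proof (induction i)
      case 0
      have "Y 0 = c" unfolding Y_def by (simp add: time_int_refl[OF gy])
      then show ?case using T G0 by (intro exI[of _ 0]) simp
    next
      case (Suc i)
      then obtain s where s: "0 \<le> s" "s \<le> T" "G s = real i * (G T / real n)" "Y s * (1 - G T / real n) ^ i \<le> c" by auto
      have "real (Suc i) * (G T / real n) \<le> real n * (G T / real n)"
        using Suc.prems GT by (intro mult_right_mono) auto
      then have "real (Suc i) * (G T / real n) \<le> G T" using n by simp
      moreover have "G s \<le> real (Suc i) * (G T / real n)"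
        unfolding s(3) using GT by (intro mult_right_mono) auto
      \<comment> \<open>The partition points are taken at equal increments of the continuous
        function \<open>G\<close>, not of time.\<close>
      ultimately obtain t where t: "s \<le> t" "t \<le> T" "G t = real (Suc i) * (G T / real n)"
        using IVT'[of G s "real (Suc i) * (G T / real n)" T] s continuous_on_subset[OF Gcont, of "{s..T}"] by auto
      have "G t - G s = G T / real n" unfolding t(3) s(3) of_nat_Suc distrib_right by linarith
      then have "Y t * (1 - G T / real n) \<le> Y s" using key[OF s(1) t(1)] by simp
      then have "Y t * (1 - G T / real n) * (1 - G T / real n) ^ i \<le> Y s * (1 - G T / real n) ^ i"
        using q by (intro mult_right_mono) auto
      then show ?case using s t by (intro exI[of _ t]) (simp add: mult.assoc)
    qed
    from this[of n] obtain t where t: "0 \<le> t" "t \<le> T" "G t = G T" "Y t * (1 - G T / real n) ^ n \<le> c" using n by auto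
    \<comment> \<open>The last partition point may precede \<open>T\<close>, but \<open>G\<close>
      does not grow in between, and \<open>key\<close> then yields this.\<close>
    then have "Y T \<le> Y t" using key[OF t(1,2)] by simp
    then have "Y T * (1 - G T / real n) ^ n \<le> Y t * (1 - G T / real n) ^ n" using q by (intro mult_right_mono) auto
    then show ?thesis using t by simp
  qed
  have "(\<lambda>n. Y T * (1 + (- G T) / real n) ^ n) \<longlonglongrightarrow> Y T * exp (- G T)"
    by (intro tendsto_mult tendsto_const tendsto_exp_limit_sequentially)
  moreover obtain n0 :: nat where "G T < real n0" using reals_Archimedean2 by blast
  then have "Y T * (1 + (- G T) / real n) ^ n \<le> c" if "Suc n0 \<le> n" for n
    using bound[of n] that by simp
  ultimately have "Y T * exp (- G T) \<le> c" by (intro LIMSEQ_le_const2) auto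
  then have "Y T \<le> c * exp (G T)" by (simp add: exp_minus field_simps)
  then show ?thesis using le[OF T] by (simp add: Y_def G_def)
qed

lemma H_diff_approx:
  assumes "v \<in> H_space" "w \<in> H_space"
  shows "\<exists>h. (\<forall>n::nat. h n \<in> D_sol) \<and> (\<lambda>n. L2_norm (\<lambda>x. (v x - w x) - h n x)) \<longlonglongrightarrow> 0"
proof -
  obtain f where f: "\<And>n. f n \<in> D_sol" "(\<lambda>n::nat. L2_norm (\<lambda>x. f n x - v x)) \<longlonglongrightarrow> 0" using assms(1) by (auto simp: H_space_def)
  obtain g where g: "\<And>n. g n \<in> D_sol" "(\<lambda>n::nat. L2_norm (\<lambda>x. g n x - w x)) \<longlonglongrightarrow> 0" using assms(2) by (auto simp: H_space_def)
  have L: "f n \<in> L2" "g n \<in> L2" for n using f g by (auto intro: D_space_L2 D_sol_D_space)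
  have "(\<lambda>n. L2_norm (\<lambda>x. (v x - w x) - (f n x - g n x))) \<longlonglongrightarrow> 0"
  proof (rule tendsto_of_abs_diff_le)
    show "(\<lambda>n. L2_norm (\<lambda>x. g n x - w x) + L2_norm (\<lambda>x. f n x - v x)) \<longlonglongrightarrow> 0"
      using tendsto_add[OF g(2) f(2)] by simp
    fix n
    have "L2_norm (\<lambda>x. (g n x - w x) + (v x - f n x)) \<le> L2_norm (\<lambda>x. g n x - w x) + L2_norm (\<lambda>x. v x - f n x)"
      by (intro L2_norm_triangle L2_diff L H_L2 assms)
    then show "\<bar>L2_norm (\<lambda>x. (v x - w x) - (f n x - g n x)) - 0\<bar> \<le> L2_norm (\<lambda>x. g n x - w x) + L2_norm (\<lambda>x. f n x - v x)"
      by (simp add: algebra_simps L2_norm_minus_commute[of v])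
  qed
  then show ?thesis using D_sol_diff[OF f(1) g(1)] by (intro exI[of _ "\<lambda>n x. f n x - g n x"]) auto
qed

section \<open>Initial value and increments of a single flow\<close>

context NS_flow
begin

lemma init: "L2_norm (\<lambda>x. u 0 x - u0 x) = 0"
proof -
  define w where "w x = u 0 x - u0 x" for x
  have uH: "u 0 \<in> H_space" using C0_HwD(1)[OF uC] by simp
  have wL: "w \<in> L2" unfolding w_def by (intro L2_diff H_L2 uH u0)
  obtain h where h: "\<And>n::nat. h n \<in> D_sol" "(\<lambda>n. L2_norm (\<lambda>x. w x - h n x)) \<longlonglongrightarrow> 0"
    using H_diff_approx[OF uH u0] by (auto simp: w_def)
  have hL: "h n \<in> L2" for n using h by (auto intro: D_space_L2 D_sol_D_space)
  have z: "ip w (h n) = 0" for n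
    unfolding w_def using ip_D_sol[OF h(1), of 0 n] hL by (simp add: ip_diff_left H_L2 uH u0 time_int_refl loc_int_K D_sol_V h)
  have "(\<lambda>n. L2_norm w * L2_norm (\<lambda>x. w x - h n x)) \<longlonglongrightarrow> L2_norm w * 0"
    by (intro tendsto_intros h)
  moreover have "ip w w \<le> L2_norm w * L2_norm (\<lambda>x. w x - h n x)" for n
  proof -
    have "ip w w = ip w (\<lambda>x. w x - h n x)" using z hL wL by (simp add: ip_diff_right)
    also have "\<dots> \<le> L2_norm w * L2_norm (\<lambda>x. w x - h n x)"
      using ip_Cauchy_Schwarz[OF wL L2_diff[OF wL hL], of n] by linarith
    finally show ?thesis .
  qed
  ultimately have "ip w w \<le> 0" using LIMSEQ_le_const[of _ 0 "ip w w"] by auto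
  then show ?thesis unfolding L2_norm_sq_ip[symmetric] w_def[symmetric] by simp
qed

lemma energy_II:
  assumes "0 < t"
  shows "(L2_norm (u t))\<^sup>2 + 2 * \<nu> * time_int (\<lambda>s. (L2_norm (wgrad (u s)))\<^sup>2) 0 t \<le> (L2_norm u0)\<^sup>2"
  using energy assms by (simp add: energy_inequality_def time_int_def integral_restrict_space)

lemma norm_le: "0 \<le> t \<Longrightarrow> L2_norm (u t) \<le> L2_norm u0"
proof (cases "t = 0")
  case True
  then show ?thesis using L2_norm_triangle_diff[OF u_L2 H_L2[OF u0], of 0] init by simp
next
  case False
  assume "0 \<le> t"
  then have "(L2_norm (u t))\<^sup>2 + 2 * \<nu> * time_int (\<lambda>s. (L2_norm (wgrad (u s)))\<^sup>2) 0 t \<le> (L2_norm u0)\<^sup>2"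
    using False by (intro energy_II) simp
  moreover have "0 \<le> 2 * \<nu> * time_int (\<lambda>s. (L2_norm (wgrad (u s)))\<^sup>2) 0 t"
    using nu time_int_nonneg[of "\<lambda>s. (L2_norm (wgrad (u s)))\<^sup>2"] by simp
  ultimately have "(L2_norm (u t))\<^sup>2 \<le> (L2_norm u0)\<^sup>2" by linarith
  then show ?thesis by (rule power2_le_imp_le) simp
qed

lemma ip_init: "w \<in> L2 \<Longrightarrow> ip (u 0) w = ip u0 w"
proof -
  assume w: "w \<in> L2"
  have "\<bar>ip (\<lambda>x. u 0 x - u0 x) w\<bar> \<le> 0"
    using ip_Cauchy_Schwarz[OF L2_diff[OF u_L2 H_L2[OF u0]] w, of 0] init by simp
  then show ?thesis using w by (simp add: ip_diff_left u_L2 H_L2 u0)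
qed

lemma K_diff:
  assumes "f \<in> V_space" "g \<in> V_space" "u t \<in> V_space"
  shows "K (\<lambda>x. f x - g x) t = K f t - K g t"
proof -
  have "ip (wgrad (u t)) (wgrad (\<lambda>x. f x - g x)) = ip (wgrad (u t)) (\<lambda>x. wgrad f x - wgrad g x)"
    unfolding ip_commute[of "wgrad (u t)"]
    by (intro ip_cong_AE V_wgrad_L2 V_diff L2_diff assms wgrad_diff V_H1)
  also have "\<dots> = ip (wgrad (u t)) (wgrad f) - ip (wgrad (u t)) (wgrad g)"
    by (intro ip_diff_right V_wgrad_L2 assms)
  finally show ?thesis
    unfolding K_def tri_wgrad_diff[OF assms(1,2,3,3)] by (simp only: right_diff_distrib)
qed

text \<open>By density the test field may be any fixed element of \<open>V_space\<close>, in
  particular the other solution frozen at one time.\<close>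

lemma ip_increment:
  assumes f: "f \<in> V_space" and st: "0 \<le> s" "s \<le> t"
  shows "ip (\<lambda>x. u t x - u s x) f = time_int (K f) s t"
proof -
  obtain g where g: "\<And>n::nat. g n \<in> D_sol" "(\<lambda>n. H1_norm (\<lambda>x. g n x - f x)) \<longlonglongrightarrow> 0"
    using V_approx[OF f] by auto
  have gV: "g n \<in> V_space" for n using g by (auto intro: D_sol_V)
  have wL: "(\<lambda>x. u t x - u s x) \<in> L2" using st by (intro L2_diff u_L2) auto
  have 1: "ip (\<lambda>x. u t x - u s x) (g n) = time_int (K (g n)) s t" for n
    using ip_D_sol[OF g(1), of t n] ip_D_sol[OF g(1), of s n] time_int_combine[OF loc_int_K[OF gV], of 0 s t n] st
    by (simp add: ip_diff_left u_L2 V_L2 gV)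
  define C where "C = time_int (\<lambda>t. (2 + \<nu>) * (H1_norm (u t))\<^sup>2 + \<nu>) s t"
  have "(\<lambda>n. ip (\<lambda>x. u t x - u s x) (g n)) \<longlonglongrightarrow> ip (\<lambda>x. u t x - u s x) f"
  proof (rule tendsto_of_abs_diff_le)
    have "(\<lambda>n. L2_norm (\<lambda>x. u t x - u s x) * H1_norm (\<lambda>x. g n x - f x)) \<longlonglongrightarrow> L2_norm (\<lambda>x. u t x - u s x) * 0"
      by (intro tendsto_intros g)
    then show "(\<lambda>n. L2_norm (\<lambda>x. u t x - u s x) * H1_norm (\<lambda>x. g n x - f x)) \<longlonglongrightarrow> 0" by simp
    fix n
    have "\<bar>ip (\<lambda>x. u t x - u s x) (\<lambda>x. g n x - f x)\<bar> \<le> L2_norm (\<lambda>x. u t x - u s x) * L2_norm (\<lambda>x. g n x - f x)"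
      by (intro ip_Cauchy_Schwarz wL L2_diff V_L2 gV f)
    also have "\<dots> \<le> L2_norm (\<lambda>x. u t x - u s x) * H1_norm (\<lambda>x. g n x - f x)"
      by (intro mult_left_mono L2_norm_le_H1) simp
    finally show "\<bar>ip (\<lambda>x. u t x - u s x) (g n) - ip (\<lambda>x. u t x - u s x) f\<bar> \<le> L2_norm (\<lambda>x. u t x - u s x) * H1_norm (\<lambda>x. g n x - f x)"
      using wL by (simp add: ip_diff_right V_L2 gV f)
  qed
  moreover have "(\<lambda>n. time_int (K (g n)) s t) \<longlonglongrightarrow> time_int (K f) s t"
  proof (rule tendsto_of_abs_diff_le)
    have "(\<lambda>n. H1_norm (\<lambda>x. g n x - f x) * C) \<longlonglongrightarrow> 0 * C" by (intro tendsto_intros g)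
    then show "(\<lambda>n. H1_norm (\<lambda>x. g n x - f x) * C) \<longlonglongrightarrow> 0" by simp
    fix n
    have "\<bar>time_int (\<lambda>r. K (g n) r - K f r) s t\<bar> \<le> time_int (\<lambda>r. H1_norm (\<lambda>x. g n x - f x) * ((2 + \<nu>) * (H1_norm (u r))\<^sup>2 + \<nu>)) s t"
    proof (rule time_int_abs_le)
      show "AE r in lebesgue. 0 < r \<longrightarrow> s \<le> r \<longrightarrow> r \<le> t \<longrightarrow> \<bar>K (g n) r - K f r\<bar> \<le> H1_norm (\<lambda>x. g n x - f x) * ((2 + \<nu>) * (H1_norm (u r))\<^sup>2 + \<nu>)"
        using AE_V
      proof eventually_elim
        case (elim r)
        show ?case using K_diff[OF gV f, of r n] K_bound[OF V_diff[OF gV f], of r n] elim by auto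
      qed
    qed (intro loc_int_diff loc_int_K gV f loc_int_K_bound st)+
    then show "\<bar>time_int (K (g n)) s t - time_int (K f) s t\<bar> \<le> H1_norm (\<lambda>x. g n x - f x) * C"
      using st by (simp add: time_int_cmult time_int_diff loc_int_K gV f C_def)
  qed
  ultimately show ?thesis unfolding 1 using LIMSEQ_unique by blast
qed

end

section \<open>Uniform continuity in time with values in V, off a small set\<close>

lemma H1_norm_diff_le: "f \<in> H1 \<Longrightarrow> g \<in> H1 \<Longrightarrow> H1_norm (\<lambda>x. f x - g x) \<le> H1_norm f + H1_norm g"
  using H1_triangle[OF _ zero_H1, of f g] H1_norm_minus_commute[OF zero_H1, of g] by simp

lemma H1_norm_diff_sq_le:
  assumes "f \<in> H1" "g \<in> H1"
  shows "(H1_norm (\<lambda>x. f x - g x))\<^sup>2 \<le> 2 * (H1_norm f)\<^sup>2 + 2 * (H1_norm g)\<^sup>2"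
proof -
  have "(H1_norm (\<lambda>x. f x - g x))\<^sup>2 \<le> (H1_norm f + H1_norm g)\<^sup>2"
    by (intro power_mono H1_norm_diff_le assms) simp
  also have "\<dots> \<le> 2 * (H1_norm f)\<^sup>2 + 2 * (H1_norm g)\<^sup>2"
    using sum_squares_bound[of "H1_norm f" "H1_norm g"] by (simp add: power2_sum)
  finally show ?thesis .
qed

lemma H1_dist_tendsto:
  assumes f: "\<And>n::nat. f n \<in> V_space" "f' \<in> V_space" "(\<lambda>n. H1_norm (\<lambda>x. f n x - f' x)) \<longlonglongrightarrow> 0"
    and g: "\<And>n. g n \<in> V_space" "g' \<in> V_space" "(\<lambda>n. H1_norm (\<lambda>x. g n x - g' x)) \<longlonglongrightarrow> 0"
  shows "(\<lambda>n. H1_norm (\<lambda>x. f n x - g n x)) \<longlonglongrightarrow> H1_norm (\<lambda>x. f' x - g' x)"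
proof (rule tendsto_of_abs_diff_le)
  show "(\<lambda>n. H1_norm (\<lambda>x. f n x - f' x) + H1_norm (\<lambda>x. g n x - g' x)) \<longlonglongrightarrow> 0"
    using tendsto_add[OF f(3) g(3)] by simp
  fix n
  note H = V_H1[OF f(1)[of n]] V_H1[OF f(2)] V_H1[OF g(1)[of n]] V_H1[OF g(2)]
  show "\<bar>H1_norm (\<lambda>x. f n x - g n x) - H1_norm (\<lambda>x. f' x - g' x)\<bar> \<le> H1_norm (\<lambda>x. f n x - f' x) + H1_norm (\<lambda>x. g n x - g' x)"
    using H1_triangle[OF H(1,2,3)] H1_triangle[OF H(2,4,3)] H1_triangle[OF H(2,1,4)] H1_triangle[OF H(1,3,4)]
      H1_norm_minus_commute[OF H(1,2)] H1_norm_minus_commute[OF H(3,4)] by linarith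
qed

lemma separated_closed_family:
  fixes K :: "'i \<Rightarrow> real set"
  assumes "finite R" "\<And>x. x \<in> R \<Longrightarrow> compact (K x)" "\<And>x y. x \<in> R \<Longrightarrow> y \<in> R \<Longrightarrow> x \<noteq> y \<Longrightarrow> K x \<inter> K y = {}"
  shows "\<exists>\<delta>>0. \<forall>x\<in>R. \<forall>y\<in>R. x \<noteq> y \<longrightarrow> (\<forall>a\<in>K x. \<forall>b\<in>K y. \<delta> \<le> dist a b)"
proof -
  have "\<exists>d>0. x \<noteq> y \<longrightarrow> (\<forall>a\<in>K x. \<forall>b\<in>K y. d \<le> dist a b)" if "x \<in> R" "y \<in> R" for x y
    using separate_compact_closed[OF assms(2)[OF that(1)] compact_imp_closed[OF assms(2)[OF that(2)]]] assms(3)[OF that]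
    by (cases "x = y") (auto intro: exI[of _ 1])
  then obtain d where d: "\<And>x y. x \<in> R \<Longrightarrow> y \<in> R \<Longrightarrow> 0 < d x y"
    "\<And>x y a b. x \<in> R \<Longrightarrow> y \<in> R \<Longrightarrow> x \<noteq> y \<Longrightarrow> a \<in> K x \<Longrightarrow> b \<in> K y \<Longrightarrow> d x y \<le> dist a b" by metis
  \<comment> \<open>The element \<open>1\<close> keeps the minimum meaningful when \<open>R\<close>
    is empty.\<close>
  define \<delta> where "\<delta> = Min (insert 1 ((\<lambda>(x, y). d x y) ` (R \<times> R)))"
  have fin: "finite (insert 1 ((\<lambda>(x, y). d x y) ` (R \<times> R)))" using assms(1) by simp
  have "0 < \<delta>" unfolding \<delta>_def using d(1) fin by (subst Min_gr_iff) auto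
  moreover have "\<delta> \<le> d x y" if "x \<in> R" "y \<in> R" for x y
    unfolding \<delta>_def using that fin by (intro Min_le) auto
  ultimately show ?thesis using d(2) by (intro exI[of _ \<delta>]) (meson order.trans)
qed

lemma bounded_Ioo: "bounded {a<..<b::real}"
  by (rule bounded_subset[OF bounded_closed_interval[of a b]]) auto

lemma integrable_indicator_lebesgue:
  assumes "A \<in> sets lebesgue" "A \<subseteq> {0<..<T}"
  shows "integrable lebesgue (indicator A :: real \<Rightarrow> real)" "A \<in> lmeasurable"
proof -
  show "A \<in> lmeasurable"
    by (rule bounded_set_imp_lmeasurable) (use assms bounded_subset[OF bounded_Ioo] in auto)
  then show "integrable lebesgue (indicator A :: real \<Rightarrow> real)"
    by (intro integrable_real_indicator) (auto simp only: fmeasurable_def mem_Collect_eq infinity_ennreal_def)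
qed

context NS_flow
begin

text \<open>Off a set of small measure \<open>u\<close> is uniformly close to a simple function, which is constant near
  each point of a union of disjoint compact sets; \<open>e\<close> is supported in the exceptional set.\<close>

lemma modulus:
  assumes T: "0 < T" and \<epsilon>: "0 < \<epsilon>"
  shows "\<exists>\<delta>>0. \<exists>e N. (\<forall>t. 0 \<le> e t) \<and> integrable lebesgue e \<and> (\<integral>t. e t \<partial>lebesgue) \<le> \<epsilon> \<and> N \<in> null_sets lebesgue \<and>
    (\<forall>t. 0 < t \<longrightarrow> t \<notin> N \<longrightarrow> u t \<in> V_space) \<and>
    (\<forall>t\<in>{0<..<T} - N. \<forall>r\<in>{0<..<T} - N. \<bar>t - r\<bar> < \<delta> \<longrightarrow> (H1_norm (\<lambda>x. u t x - u r x))\<^sup>2 \<le> \<epsilon> + e t + e r)"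
proof -
  let ?I = "{0<..<T}"
  define h where "h t = indicator ?I t * (H1_norm (u t))\<^sup>2" for t
  have h0: "0 \<le> h t" for t by (simp add: h_def)
  have hint: "integrable lebesgue h"
  proof -
    have "integrable lebesgue (\<lambda>t. indicator {0..T} t * (H1_norm (u t))\<^sup>2)" using loc_int_H1 by (simp add: loc_int_def)
    from integrable_mult_indicator[OF _ this, of ?I]
    have "integrable lebesgue (\<lambda>t. indicator ?I t * (indicator {0..T} t * (H1_norm (u t))\<^sup>2))" by simp
    also have "(\<lambda>t. indicator ?I t * (indicator {0..T} t * (H1_norm (u t))\<^sup>2)) = h"
      by (auto simp: h_def indicator_def fun_eq_iff)
    finally show ?thesis .
  qed
  have hm: "h \<in> borel_measurable lebesgue" using hint by auto
  have Aset: "{t. c < h t} \<in> sets lebesgue" for c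
    using measurable_sets[OF hm, of "{c<..}"] by (simp add: vimage_def)
  \<comment> \<open>Times at which the squared norm exceeds a high level contribute little to its
    integral. This fixes the level \<open>M\<close>, after which the other exceptional sets need
    small measure only.\<close>
  have "(\<lambda>n. \<integral>t. indicator {t. real n < h t} t * h t \<partial>lebesgue) \<longlonglongrightarrow> (\<integral>t. 0 \<partial>(lebesgue :: real measure))"
  proof (rule integral_dominated_convergence[OF _ _ hint])
    show "AE t in lebesgue. (\<lambda>n. indicator {t. real n < h t} t * h t) \<longlonglongrightarrow> 0"
    proof (rule AE_I2)
      fix t
      obtain n0 :: nat where "h t < real n0" using reals_Archimedean2 by blast
      then have "\<forall>\<^sub>F n in sequentially. indicator {t. real n < h t} t * h t = 0"
        unfolding eventually_sequentially by (intro exI[of _ n0]) (auto simp: indicator_def)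
      then show "(\<lambda>n. indicator {t. real n < h t} t * h t) \<longlonglongrightarrow> 0" by (rule tendsto_eventually)
    qed
    show "(\<lambda>t. indicator {t. real n < h t} t * h t) \<in> borel_measurable lebesgue" for n
      by (rule borel_measurable_times[OF borel_measurable_indicator[OF Aset] hm])
    show "AE t in lebesgue. norm (indicator {t. real n < h t} t * h t) \<le> h t" for n
      using h0 by (intro AE_I2) (auto simp: indicator_def)
  qed simp
  then have "\<forall>\<^sub>F n in sequentially. (\<integral>t. indicator {t. real n < h t} t * h t \<partial>lebesgue) < \<epsilon> / 8"
    using \<epsilon> by (intro order_tendstoD(2)[of _ 0]) auto
  then obtain n0 :: nat where n0: "(\<integral>t. indicator {t. real n0 < h t} t * h t \<partial>lebesgue) < \<epsilon> / 8"
    by (auto simp: eventually_sequentially)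
  define M where "M = real n0"
  define A where "A = {t. M < h t}"
  have M0: "0 \<le> M" by (simp add: M_def)
  \<comment> \<open>The integral of \<open>e\<close> will be at most
    \<open>\<epsilon> / 2 + 8 * M * \<mu>\<close>; dividing by \<open>M + 1\<close> covers
    \<open>M = 0\<close>.\<close>
  define \<mu> where "\<mu> = \<epsilon> / (16 * (M + 1))"
  have \<mu>: "0 < \<mu>" using \<epsilon> M0 by (simp add: \<mu>_def)
  have M\<mu>: "16 * (M * \<mu>) \<le> \<epsilon>"
  proof -
    have "16 * (M * \<mu>) = M * \<epsilon> / (M + 1)" using M0 by (simp add: \<mu>_def field_simps)
    also have "\<dots> \<le> \<epsilon>" using M0 \<epsilon> by (simp add: field_simps)
    finally show ?thesis .
  qed
  \<comment> \<open>Two approximation errors of size \<open>\<eta>\<close> enter the triangle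
    inequality, and \<open>(2 * \<eta>)\<^sup>2 = \<epsilon>\<close>.\<close>
  define \<eta> where "\<eta> = sqrt \<epsilon> / 2"
  have \<eta>: "0 < \<eta>" "(2 * \<eta>)\<^sup>2 = \<epsilon>" using \<epsilon> by (auto simp: \<eta>_def)
  obtain s where s: "\<And>n. simple_function (lebesgue_on {0<..}) (s n)" "\<And>n. s n ` {0<..} \<subseteq> V_space"
    "AE t in lebesgue_on {0<..}. u t \<in> V_space \<and> (\<lambda>n::nat. H1_norm (\<lambda>x. s n t x - u t x)) \<longlonglongrightarrow> 0"
    using strong unfolding strongly_measurable_on_def by auto
  have sV: "0 < t \<Longrightarrow> s n t \<in> V_space" for n t using s(2)[of n] by auto
  define D where "D n t = H1_norm (\<lambda>x. s n t x - u t x)" for n t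
  have Dm: "D n \<in> borel_measurable (lebesgue_on {0<..})" for n
  proof -
    have "strongly_measurable_on {0<..} V_space H1_norm (s n)"
      unfolding strongly_measurable_on_def
      by (intro exI[of _ "\<lambda>_. s n"] conjI allI s AE_I2) (auto simp: H1_norm_zero sV)
    from strongly_measurable_comp[OF this strong, of "\<lambda>f g. H1_norm (\<lambda>x. f x - g x)"] H1_dist_tendsto
    show ?thesis unfolding D_def by blast
  qed
  define bad where "bad n = {t \<in> ?I. \<eta> < D n t}" for n
  have badset: "bad n \<in> sets lebesgue" for n
  proof -
    have m: "(\<lambda>t. indicator {0..T} t * D n t) \<in> borel_measurable lebesgue" by (rule indicator_measurable[OF Dm])
    have "bad n = ((\<lambda>t. indicator {0..T} t * D n t) -` {\<eta><..} \<inter> space lebesgue) \<inter> ?I"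
      by (auto simp: bad_def)
    also have "\<dots> \<in> sets lebesgue" by (intro sets.Int measurable_sets[OF m]) auto
    finally show ?thesis .
  qed
  have badI: "bad n \<subseteq> ?I" for n by (auto simp: bad_def)
  have Iset: "?I \<in> sets lebesgue" by simp
  have "(\<lambda>n. \<integral>t. (indicator (bad n) t :: real) \<partial>lebesgue) \<longlonglongrightarrow> (\<integral>t. 0 \<partial>(lebesgue :: real measure))"
  proof (rule integral_dominated_convergence[OF _ _ integrable_indicator_lebesgue(1)[OF Iset order_refl]])
    show "AE t in lebesgue. (\<lambda>n. indicator (bad n) t :: real) \<longlonglongrightarrow> 0"
      using s(3)[unfolded AE_pos_iff]
    proof eventually_elim
      case (elim t)
      show ?case
      proof (cases "0 < t")
        case True
        then have "(\<lambda>n. D n t) \<longlonglongrightarrow> 0" using elim by (simp add: D_def)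
        from order_tendstoD(2)[OF this \<eta>(1)]
        have "\<forall>\<^sub>F n in sequentially. indicator (bad n) t = (0::real)" by eventually_elim (auto simp: bad_def)
        then show ?thesis by (rule tendsto_eventually)
      qed (auto simp: bad_def)
    qed
    show "AE t in lebesgue. norm (indicator (bad n) t :: real) \<le> indicator ?I t" for n
      using badI[of n] by (intro AE_I2) (auto simp: indicator_def)
  qed (use badset in auto)
  then have "(\<lambda>n. measure lebesgue (bad n)) \<longlonglongrightarrow> 0" by simp
  from order_tendstoD(2)[OF this \<mu>] obtain n where n: "measure lebesgue (bad n) < \<mu>"
    by (auto simp: eventually_sequentially)
  define R where "R = s n ` ?I"
  have "finite (s n ` {0<..})" using simple_functionD(1)[OF s(1), of n] by simp
  then have fR: "finite R" by (rule finite_subset[rotated]) (auto simp: R_def)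
  define E where "E x = {t \<in> ?I. s n t = x}" for x
  have Eset: "E x \<in> sets lebesgue" for x
  proof -
    have "s n -` {x} \<inter> space (lebesgue_on {0<..}) \<in> sets (lebesgue_on {0<..})" by (rule simple_functionD(2)[OF s(1)])
    then have "s n -` {x} \<inter> {0<..} \<in> sets lebesgue" by (simp add: sets_restrict_space_iff)
    from sets.Int[OF this Iset] have "(s n -` {x} \<inter> {0<..}) \<inter> ?I \<in> sets lebesgue" .
    also have "(s n -` {x} \<inter> {0<..}) \<inter> ?I = E x" by (auto simp: E_def)
    finally show ?thesis .
  qed
  define \<mu>' where "\<mu>' = \<mu> / (real (card R) + 1)"
  have \<mu>': "0 < \<mu>'" using \<mu> by (simp add: \<mu>'_def add_nonneg_pos)
  have "\<exists>K. closed K \<and> K \<subseteq> E x \<and> emeasure lebesgue (E x - K) < ennreal \<mu>'" for x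
    using sets_lebesgue_inner_closed[OF Eset \<mu>'] by metis
  then obtain K where K: "\<And>x. closed (K x)" "\<And>x. K x \<subseteq> E x" "\<And>x. emeasure lebesgue (E x - K x) < ennreal \<mu>'" by metis
  define F where "F = (\<Union>x\<in>R. E x - K x)"
  have FI: "F \<subseteq> ?I" by (auto simp: F_def E_def)
  have EK: "E x - K x \<in> sets lebesgue" for x using Eset K(1) by auto
  have Fset: "F \<in> sets lebesgue" unfolding F_def using fR EK by (intro sets.finite_UN) auto
  have Fm: "measure lebesgue F \<le> \<mu>"
  proof -
    have lm: "E x - K x \<in> lmeasurable" for x
      by (rule integrable_indicator_lebesgue(2)[OF EK, of _ T]) (auto simp: E_def)
    have "measure lebesgue F \<le> (\<Sum>x\<in>R. measure lebesgue (E x - K x))"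
      unfolding F_def by (rule measure_UNION_le[OF fR EK])
    also have "\<dots> \<le> (\<Sum>x\<in>R. \<mu>')"
      using K(3) lm \<mu>' by (intro sum_mono) (metis emeasure_eq_measure2 ennreal_less_iff less_imp_le measure_nonneg)
    also have "\<dots> \<le> \<mu>" using \<mu> by (simp add: \<mu>'_def field_simps)
    finally show ?thesis .
  qed
  have "compact (K x)" for x
  proof -
    have "K x \<subseteq> ?I" using K(2)[of x] by (auto simp: E_def)
    then have "bounded (K x)" by (rule bounded_subset[OF bounded_Ioo])
    then show ?thesis using K(1) by (simp add: compact_eq_bounded_closed)
  qed
  moreover have "K x \<inter> K y = {}" if "x \<noteq> y" for x y using K(2)[of x] K(2)[of y] that by (auto simp: E_def)
  ultimately obtain \<delta> where \<delta>: "0 < \<delta>" "\<And>x y a b. x \<in> R \<Longrightarrow> y \<in> R \<Longrightarrow> x \<noteq> y \<Longrightarrow> a \<in> K x \<Longrightarrow> b \<in> K y \<Longrightarrow> \<delta> \<le> dist a b"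
    using separated_closed_family[OF fR, of K] by metis
  \<comment> \<open>The increment is always bounded by \<open>2 * h t + 2 * h r\<close>. If only
    \<open>t\<close> is exceptional then \<open>h r \<le> M\<close>, so \<open>e t\<close> must
    dominate \<open>2 * h t + 2 * M\<close>: on \<open>A\<close> because \<open>h t\<close> exceeds
    \<open>M\<close>, on the other two sets off \<open>A\<close> because \<open>h t\<close> is at
    most \<open>M\<close>. This explains the factors 4.\<close>
  define e where "e t = 4 * (indicator A t * h t) + 4 * M * indicator (bad n) t + 4 * M * indicator F t" for t
  have iA: "integrable lebesgue (\<lambda>t. indicator A t * h t)"
    using integrable_mult_indicator[OF Aset[of M] hint] by (simp add: A_def)
  note ib = integrable_indicator_lebesgue(1)[OF badset badI] integrable_indicator_lebesgue(1)[OF Fset FI]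
  have ei: "integrable lebesgue e"
    unfolding e_def by (intro Bochner_Integration.integrable_add integrable_mult_right iA ib)
  have "(\<integral>t. e t \<partial>lebesgue) = 4 * (\<integral>t. indicator A t * h t \<partial>lebesgue) + 4 * M * measure lebesgue (bad n) + 4 * M * measure lebesgue F"
    unfolding e_def
    using iA ib by (simp add: Bochner_Integration.integral_add Bochner_Integration.integrable_add integrable_mult_right)
  also have "\<dots> \<le> 4 * (\<epsilon> / 8) + 4 * M * \<mu> + 4 * M * \<mu>"
    using n0 n Fm M0 by (intro add_mono mult_left_mono) (auto simp: A_def M_def)
  also have "\<dots> \<le> \<epsilon>" using M\<mu> by simp
  finally have eI: "(\<integral>t. e t \<partial>lebesgue) \<le> \<epsilon>" .
  have e0: "0 \<le> e t" for t using h0 M0 by (simp add: e_def)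
  obtain N where N: "{t. \<not> (0 < t \<longrightarrow> u t \<in> V_space)} \<subseteq> N" "N \<in> null_sets lebesgue"
    using AE_V unfolding eventually_ae_filter by auto
  have NV: "u t \<in> V_space" if "0 < t" "t \<notin> N" for t using N that by auto
  have eB: "2 * h t + 2 * M \<le> e t" if "t \<in> A \<union> bad n \<union> F" for t
    using that M0 h0[of t] unfolding e_def A_def by (auto simp: indicator_def not_less)
  have main: "(H1_norm (\<lambda>x. u t x - u r x))\<^sup>2 \<le> \<epsilon> + e t + e r"
    if t: "t \<in> ?I - N" and r: "r \<in> ?I - N" and d: "\<bar>t - r\<bar> < \<delta>" for t r
  proof -
    have tV: "u t \<in> V_space" "u r \<in> V_space" using NV t r by auto
    have ht: "h t = (H1_norm (u t))\<^sup>2" "h r = (H1_norm (u r))\<^sup>2" using t r by (auto simp: h_def)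
    have sq: "(H1_norm (\<lambda>x. u t x - u r x))\<^sup>2 \<le> 2 * h t + 2 * h r"
      unfolding ht by (intro H1_norm_diff_sq_le V_H1 tV)
    show ?thesis
    proof (cases "t \<in> A \<union> bad n \<union> F \<or> r \<in> A \<union> bad n \<union> F")
      case True
      moreover have "h z \<le> M" if "z \<notin> A \<union> bad n \<union> F" for z using that by (simp add: A_def not_less)
      ultimately show ?thesis using sq eB[of t] eB[of r] e0[of t] e0[of r] \<epsilon> M0
        by (cases "t \<in> A \<union> bad n \<union> F"; cases "r \<in> A \<union> bad n \<union> F") (smt (verit))+
    next
      case False
      \<comment> \<open>Two times closer than \<open>\<delta>\<close> cannot lie in different
        compact sets, so the simple function has the same value at both.\<close>
      have "t \<in> K (s n t)" "r \<in> K (s n r)" using False t r by (auto simp: F_def R_def E_def)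
      moreover have "s n t \<in> R" "s n r \<in> R" using t r by (auto simp: R_def)
      ultimately have eq: "s n t = s n r" using \<delta>(2)[of "s n t" "s n r" t r] d by (auto simp: dist_real_def)
      have D: "D n t \<le> \<eta>" "D n r \<le> \<eta>" using False t r by (auto simp: bad_def not_less)
      have sH: "s n t \<in> H1" using sV t by (auto intro: V_H1)
      have "H1_norm (\<lambda>x. u t x - u r x) \<le> H1_norm (\<lambda>x. u t x - s n t x) + H1_norm (\<lambda>x. s n t x - u r x)"
        by (rule H1_triangle[OF V_H1[OF tV(1)] sH V_H1[OF tV(2)]])
      also have "H1_norm (\<lambda>x. u t x - s n t x) = D n t" unfolding D_def by (rule H1_norm_minus_commute[OF V_H1[OF tV(1)] sH])
      also have "H1_norm (\<lambda>x. s n t x - u r x) = D n r" unfolding D_def eq ..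
      finally have "H1_norm (\<lambda>x. u t x - u r x) \<le> 2 * \<eta>" using D by linarith
      then have "(H1_norm (\<lambda>x. u t x - u r x))\<^sup>2 \<le> (2 * \<eta>)\<^sup>2" by (intro power_mono) auto
      then show ?thesis using e0[of t] e0[of r] \<eta>(2) by linarith
    qed
  qed
  show ?thesis
    by (intro exI[of _ \<delta>] conjI exI[of _ e] exI[of _ N] allI ballI impI \<delta>(1) e0 ei eI N(2) NV main)
qed

end

section \<open>Comparison of the two solutions\<close>

lemma Young_weighted:
  fixes a b \<eta> :: real
  assumes "0 < \<eta>"
  shows "\<nu> * (a * b) \<le> \<eta> * a\<^sup>2 + \<nu>\<^sup>2 / (4 * \<eta>) * b\<^sup>2"
proof -
  have "0 \<le> \<eta> * (a - \<nu> * b / (2 * \<eta>))\<^sup>2" using assms by simp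
  also have "\<dots> = \<eta> * a\<^sup>2 + \<nu>\<^sup>2 / (4 * \<eta>) * b\<^sup>2 - \<nu> * (a * b)"
    using assms by (simp add: power2_eq_square field_simps)
  finally show ?thesis by simp
qed

lemma AE_exists_small:
  assumes "AE t in lebesgue. 0 < t \<longrightarrow> t < 1 \<longrightarrow> P t" "0 < (a::real)" "a \<le> 1"
  shows "\<exists>t. 0 < t \<and> t < a \<and> P t"
proof (rule ccontr)
  assume "\<not> ?thesis"
  with assms have "AE t in lborel. t \<notin> {0<..<a}"
    unfolding AE_completion_iff by (auto elim!: eventually_mono)
  then have "emeasure lborel {t::real. \<not> t \<notin> {0<..<a}} = 0" by (subst (asm) AE_iff_measurable[OF _ refl]) auto
  moreover have "{t::real. \<not> t \<notin> {0<..<a}} = {0<..<a}" by auto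
  ultimately show False using assms by simp
qed

locale flow_pair = U: NS_flow \<nu> u0 u + V: NS_flow \<nu> v0 v for \<nu> u0 u v0 v +
  assumes helical: "\<And>t. 0 \<le> t \<Longrightarrow> helical 1 (u t)"
begin

section \<open>The identity for the inner product of the two solutions\<close>

definition coupling :: "real \<Rightarrow> real" where
  "coupling r = V.K (u r) r + U.K (v r) r"

text \<open>Formally \<open>coupling\<close> is the time derivative of the inner product of \<open>u\<close> and \<open>v\<close>, so that the
  following quantity is constant.\<close>

definition defect :: "real \<Rightarrow> real" where
  "defect t = ip (u t) (v t) - time_int coupling 0 t"

lemma AE_both: "AE t in lebesgue. 0 < t \<longrightarrow> u t \<in> V_space \<and> v t \<in> V_space"
  using U.AE_V V.AE_V by eventually_elim auto

text \<open>The free parameter \<open>\<eta>\<close> can be made small in front of the dissipation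
  of \<open>v\<close>, at the price of a large constant in front of the gradient of
  \<open>z\<close>, which is harmless when \<open>z\<close> is a small increment of
  \<open>u\<close>. The bound \<open>B\<close> is kept general because \<open>z\<close> will be
  either \<open>u\<close> itself or such an increment.\<close>

lemma V_K_bound:
  assumes z: "z \<in> V_space" "helical 1 z" "L2_norm z \<le> B" and r: "0 \<le> r" "v r \<in> V_space" and \<eta>: "0 < \<eta>"
  shows "\<bar>V.K z r\<bar> \<le> 2 * \<eta> * (L2_norm (wgrad (v r)))\<^sup>2 +
    (27 / (64 * \<eta> ^ 3) * B\<^sup>2 * (L2_norm v0)\<^sup>2 + \<nu>\<^sup>2 / (4 * \<eta>)) * (L2_norm (wgrad z))\<^sup>2"
proof -
  have "\<bar>tri (wgrad z) (v r) (v r)\<bar> \<le> \<eta> * (L2_norm (wgrad (v r)))\<^sup>2 +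
      27 / (64 * \<eta> ^ 3) * (L2_norm z)\<^sup>2 * (L2_norm (wgrad z))\<^sup>2 * (L2_norm (v r))\<^sup>2"
    by (rule helical_trilinear[OF z(1,2) r(2) \<eta>])
  also have "27 / (64 * \<eta> ^ 3) * (L2_norm z)\<^sup>2 * (L2_norm (wgrad z))\<^sup>2 * (L2_norm (v r))\<^sup>2 \<le>
      27 / (64 * \<eta> ^ 3) * B\<^sup>2 * (L2_norm (wgrad z))\<^sup>2 * (L2_norm v0)\<^sup>2"
    using \<eta> z(3) V.norm_le[OF r(1)] by (intro mult_mono power_mono) auto
  finally have 1: "\<bar>tri (wgrad z) (v r) (v r)\<bar> \<le> \<eta> * (L2_norm (wgrad (v r)))\<^sup>2 +
      27 / (64 * \<eta> ^ 3) * B\<^sup>2 * (L2_norm (wgrad z))\<^sup>2 * (L2_norm v0)\<^sup>2" by simp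
  have "\<nu> * \<bar>ip (wgrad (v r)) (wgrad z)\<bar> \<le> \<nu> * (L2_norm (wgrad (v r)) * L2_norm (wgrad z))"
    using V.nu by (intro mult_left_mono ip_Cauchy_Schwarz V_wgrad_L2 z r) simp
  also have "\<dots> \<le> \<eta> * (L2_norm (wgrad (v r)))\<^sup>2 + \<nu>\<^sup>2 / (4 * \<eta>) * (L2_norm (wgrad z))\<^sup>2"
    by (rule Young_weighted[OF \<eta>])
  finally have 2: "\<nu> * \<bar>ip (wgrad (v r)) (wgrad z)\<bar> \<le> \<eta> * (L2_norm (wgrad (v r)))\<^sup>2 + \<nu>\<^sup>2 / (4 * \<eta>) * (L2_norm (wgrad z))\<^sup>2" .
  have "\<bar>V.K z r\<bar> \<le> \<bar>tri (wgrad z) (v r) (v r)\<bar> + \<nu> * \<bar>ip (wgrad (v r)) (wgrad z)\<bar>"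
    unfolding V.K_def using V.nu abs_triangle_ineq4[of "tri (wgrad z) (v r) (v r)" "\<nu> * ip (wgrad (v r)) (wgrad z)"]
    by (simp add: abs_mult)
  then show ?thesis using 1 2 by (simp add: algebra_simps)
qed

text \<open>The counterpart with a general test field: here the transporting field \<open>u\<close>
  is the helical one, so \<open>y\<close> may be an increment of \<open>v\<close>.\<close>

lemma U_K_bound:
  assumes y: "y \<in> V_space" and r: "0 \<le> r" "u r \<in> V_space" and \<eta>: "0 < \<eta>"
  shows "\<bar>U.K y r\<bar> \<le> 2 * \<eta> * (L2_norm (wgrad (u r)))\<^sup>2 +
    ((L2_norm u0)\<^sup>2 / (2 * \<eta>) + \<nu>\<^sup>2 / (4 * \<eta>)) * (L2_norm (wgrad y))\<^sup>2"
proof -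
  have "\<bar>tri (wgrad y) (u r) (u r)\<bar> \<le> \<eta> * (L2_norm (wgrad (u r)))\<^sup>2 + (L2_norm (u r))\<^sup>2 / (2 * \<eta>) * (L2_norm (wgrad y))\<^sup>2"
    by (rule helical_trilinear_outer[OF r(2) helical[OF r(1)] y \<eta>])
  also have "(L2_norm (u r))\<^sup>2 / (2 * \<eta>) * (L2_norm (wgrad y))\<^sup>2 \<le> (L2_norm u0)\<^sup>2 / (2 * \<eta>) * (L2_norm (wgrad y))\<^sup>2"
    using \<eta> U.norm_le[OF r(1)] by (intro mult_right_mono divide_right_mono power_mono) auto
  finally have 1: "\<bar>tri (wgrad y) (u r) (u r)\<bar> \<le> \<eta> * (L2_norm (wgrad (u r)))\<^sup>2 + (L2_norm u0)\<^sup>2 / (2 * \<eta>) * (L2_norm (wgrad y))\<^sup>2" by simp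
  have "\<nu> * \<bar>ip (wgrad (u r)) (wgrad y)\<bar> \<le> \<nu> * (L2_norm (wgrad (u r)) * L2_norm (wgrad y))"
    using U.nu by (intro mult_left_mono ip_Cauchy_Schwarz V_wgrad_L2 y r) simp
  also have "\<dots> \<le> \<eta> * (L2_norm (wgrad (u r)))\<^sup>2 + \<nu>\<^sup>2 / (4 * \<eta>) * (L2_norm (wgrad y))\<^sup>2"
    by (rule Young_weighted[OF \<eta>])
  finally have 2: "\<nu> * \<bar>ip (wgrad (u r)) (wgrad y)\<bar> \<le> \<eta> * (L2_norm (wgrad (u r)))\<^sup>2 + \<nu>\<^sup>2 / (4 * \<eta>) * (L2_norm (wgrad y))\<^sup>2" .
  have "\<bar>U.K y r\<bar> \<le> \<bar>tri (wgrad y) (u r) (u r)\<bar> + \<nu> * \<bar>ip (wgrad (u r)) (wgrad y)\<bar>"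
    unfolding U.K_def using U.nu abs_triangle_ineq4[of "tri (wgrad y) (u r) (u r)" "\<nu> * ip (wgrad (u r)) (wgrad y)"]
    by (simp add: abs_mult)
  then show ?thesis using 1 2 by (simp add: algebra_simps)
qed

text \<open>\<open>tri_abs_le\<close> alone would leave a product of three norms, too many for
  square integrability in time. The helical bounds, with \<open>\<eta> = 1\<close>, leave only
  squares of gradients with constant coefficients.\<close>

lemma loc_int_coupling: "loc_int coupling"
proof (rule loc_int_bound)
  have "(\<lambda>t. (\<lambda>f g. (tri (wgrad f) g g - \<nu> * ip (wgrad g) (wgrad f)) + (tri (wgrad g) f f - \<nu> * ip (wgrad f) (wgrad g))) (u t) (v t))
    \<in> borel_measurable (lebesgue_on {0<..})"
    by (rule strongly_measurable_comp[OF U.strong V.strong])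
      (intro tendsto_intros tri_tendsto U.ip_wgrad_tendsto; assumption)
  then show "coupling \<in> borel_measurable (lebesgue_on {0<..})"
    by (simp add: coupling_def[abs_def] V.K_def U.K_def)
  let ?C = "27 / (64 * 1 ^ 3) * (L2_norm u0)\<^sup>2 * (L2_norm v0)\<^sup>2 + \<nu>\<^sup>2 / (4 * 1)"
  let ?C' = "(L2_norm u0)\<^sup>2 / (2 * 1) + \<nu>\<^sup>2 / (4 * 1)"
  let ?G = "\<lambda>r. (2 * 1 * (L2_norm (wgrad (v r)))\<^sup>2 + ?C * (L2_norm (wgrad (u r)))\<^sup>2) + (2 * 1 * (L2_norm (wgrad (u r)))\<^sup>2 + ?C' * (L2_norm (wgrad (v r)))\<^sup>2)"
  show "loc_int ?G" by (intro loc_int_add loc_int_cmult U.loc_int_wgrad_sq V.loc_int_wgrad_sq)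
  show "AE r in lebesgue. 0 < r \<longrightarrow> \<bar>coupling r\<bar> \<le> ?G r"
    using AE_both
  proof eventually_elim
    case (elim r)
    show ?case
    proof
      assume r: "0 < r"
      then have "\<bar>V.K (u r) r\<bar> \<le> 2 * 1 * (L2_norm (wgrad (v r)))\<^sup>2 + ?C * (L2_norm (wgrad (u r)))\<^sup>2"
        using elim by (intro V_K_bound helical U.norm_le) auto
      moreover have "\<bar>U.K (v r) r\<bar> \<le> 2 * 1 * (L2_norm (wgrad (u r)))\<^sup>2 + ?C' * (L2_norm (wgrad (v r)))\<^sup>2"
        using elim r by (intro U_K_bound) auto
      ultimately show "\<bar>coupling r\<bar> \<le> ?G r" unfolding coupling_def by (intro order.trans[OF abs_triangle_ineq] add_mono)
    qed
  qed
qed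

text \<open>The product rule for differences is exact when one factor is frozen at the end and the
  other at the start of the interval, which dictates the times \<open>t + h\<close> for
  \<open>u\<close> and \<open>t\<close> for \<open>v\<close>.\<close>

lemma defect_increment:
  assumes t: "0 < t" "0 < h" and V: "u (t + h) \<in> V_space" "v t \<in> V_space"
  shows "defect (t + h) - defect t = time_int (\<lambda>r. (V.K (u (t + h)) r + U.K (v t) r) - coupling r) t (t + h)"
proof -
  have L: "u t \<in> L2" "u (t + h) \<in> L2" "v t \<in> L2" "v (t + h) \<in> L2" using t by (auto intro: U.u_L2 V.u_L2)
  have "ip (u (t + h)) (v (t + h)) - ip (u t) (v t) = ip (\<lambda>x. v (t + h) x - v t x) (u (t + h)) + ip (\<lambda>x. u (t + h) x - u t x) (v t)"
    using L by (simp add: ip_diff_left ip_commute[of "v (t + h)"] ip_commute[of "v t" "u (t + h)"])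
  also have "\<dots> = time_int (V.K (u (t + h))) t (t + h) + time_int (U.K (v t)) t (t + h)"
    using t by (simp add: V.ip_increment[OF V(1)] U.ip_increment[OF V(2)])
  finally show ?thesis
    using time_int_combine[OF loc_int_coupling, of 0 t "t + h"] t V
    by (simp add: defect_def time_int_diff time_int_add loc_int_add U.loc_int_K V.loc_int_K loc_int_coupling)
qed

text \<open>By linearity of \<open>K\<close> in the test field, the error of freezing is
  \<open>V.K z r + U.K y r\<close> with increments \<open>z\<close> of \<open>u\<close> and
  \<open>y\<close> of \<open>v\<close>. The parameters depend on each other in this order:
  \<open>\<eta>\<close> is small relative to the total dissipation, \<open>C\<close> is determined
  by \<open>\<eta>\<close>, and the modulus of continuity \<open>\<epsilon>\<close> is small
  relative to \<open>C\<close>.\<close>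

lemma defect_small_increments:
  assumes T: "0 < T" and \<epsilon>0: "0 < \<epsilon>0"
  shows "\<exists>\<delta>>0. \<exists>k. (\<forall>t. 0 \<le> k t) \<and> integrable lebesgue k \<and> (\<integral>t. k t \<partial>lebesgue) \<le> \<epsilon>0 \<and>
      (\<exists>N\<in>null_sets lebesgue. \<forall>t h. 0 < t \<longrightarrow> 0 < h \<longrightarrow> h < \<delta> \<longrightarrow> t + h < T \<longrightarrow> t \<notin> N \<longrightarrow> t + h \<notin> N \<longrightarrow>
        \<bar>defect (t + h) - defect t\<bar> \<le> h * k t + h * k (t + h) + time_int k t (t + h))"
proof -
  define D where "D r = (H1_norm (u r))\<^sup>2 + (H1_norm (v r))\<^sup>2" for r
  have D0: "0 \<le> D r" for r by (simp add: D_def)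
  have lD: "loc_int D" unfolding D_def by (intro loc_int_add U.loc_int_H1 V.loc_int_H1)
  define I where "I = time_int D 0 T"
  have I0: "0 \<le> I" unfolding I_def by (rule time_int_nonneg) (rule D0)
  \<comment> \<open>Half of \<open>\<epsilon>0\<close> is reserved for the dissipation terms; the
    summand \<open>1\<close> guards against \<open>I = 0\<close>.\<close>
  define \<eta> where "\<eta> = \<epsilon>0 / (4 * (I + 1))"
  have \<eta>: "0 < \<eta>" "2 * \<eta> * I \<le> \<epsilon>0 / 2"
  proof -
    show "0 < \<eta>" using \<epsilon>0 I0 by (simp add: \<eta>_def)
    have "2 * \<eta> * I = \<epsilon>0 / 2 * (I / (I + 1))" using I0 by (simp add: \<eta>_def field_simps)
    also have "\<dots> \<le> \<epsilon>0 / 2 * 1" using \<epsilon>0 I0 by (intro mult_left_mono) auto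
    finally show "2 * \<eta> * I \<le> \<epsilon>0 / 2" by simp
  qed
  define C1 where "C1 = 27 / (64 * \<eta> ^ 3) * (2 * L2_norm u0)\<^sup>2 * (L2_norm v0)\<^sup>2 + \<nu>\<^sup>2 / (4 * \<eta>)"
  define C2 where "C2 = (L2_norm u0)\<^sup>2 / (2 * \<eta>) + \<nu>\<^sup>2 / (4 * \<eta>)"
  have C12: "0 \<le> C1" "0 \<le> C2" using \<eta> by (auto simp: C1_def C2_def)
  define C where "C = C1 + C2"
  have C: "0 \<le> C" "C1 \<le> C" "C2 \<le> C" using C12 by (auto simp: C_def)
  \<comment> \<open>The other half pays for \<open>C\<close> times the two constants
    \<open>\<epsilon>\<close> integrated over the length \<open>T\<close> and the two functions
    \<open>eu\<close> and \<open>ev\<close> with integral at most \<open>\<epsilon>\<close>, hence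
    \<open>2 * T + 2\<close>.\<close>
  define \<epsilon> where "\<epsilon> = \<epsilon>0 / (2 * (C + 1) * (2 * T + 2))"
  have \<epsilon>: "0 < \<epsilon>" "C * (\<epsilon> * (2 * T + 2)) \<le> \<epsilon>0 / 2"
  proof -
    show "0 < \<epsilon>" using \<epsilon>0 C T by (simp add: \<epsilon>_def)
    have "(C + 1) * (\<epsilon> * (2 * T + 2)) = \<epsilon>0 / 2"
    proof -
      have "C + 1 \<noteq> 0" "2 * T + 2 \<noteq> 0" using C T by auto
      then show ?thesis unfolding \<epsilon>_def by (simp add: divide_simps)
    qed
    moreover have "0 \<le> \<epsilon> * (2 * T + 2)" using \<open>0 < \<epsilon>\<close> T by simp
    ultimately show "C * (\<epsilon> * (2 * T + 2)) \<le> \<epsilon>0 / 2" by (simp add: distrib_right)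
  qed
  obtain \<delta>u eu Nu where \<delta>u: "0 < \<delta>u" and eu: "\<forall>t. 0 \<le> eu t" "integrable lebesgue eu" "(\<integral>t. eu t \<partial>lebesgue) \<le> \<epsilon>"
    and Nu: "Nu \<in> null_sets lebesgue" "\<forall>t. 0 < t \<longrightarrow> t \<notin> Nu \<longrightarrow> u t \<in> V_space"
    and mu: "\<forall>t\<in>{0<..<T} - Nu. \<forall>r\<in>{0<..<T} - Nu. \<bar>t - r\<bar> < \<delta>u \<longrightarrow> (H1_norm (\<lambda>x. u t x - u r x))\<^sup>2 \<le> \<epsilon> + eu t + eu r"
    using U.modulus[OF T \<epsilon>(1)] by blast
  obtain \<delta>v ev Nv where \<delta>v: "0 < \<delta>v" and ev: "\<forall>t. 0 \<le> ev t" "integrable lebesgue ev" "(\<integral>t. ev t \<partial>lebesgue) \<le> \<epsilon>"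
    and Nv: "Nv \<in> null_sets lebesgue" "\<forall>t. 0 < t \<longrightarrow> t \<notin> Nv \<longrightarrow> v t \<in> V_space"
    and mv: "\<forall>t\<in>{0<..<T} - Nv. \<forall>r\<in>{0<..<T} - Nv. \<bar>t - r\<bar> < \<delta>v \<longrightarrow> (H1_norm (\<lambda>x. v t x - v r x))\<^sup>2 \<le> \<epsilon> + ev t + ev r"
    using V.modulus[OF T \<epsilon>(1)] by blast
  define N where "N = Nu \<union> Nv"
  define k where "k r = 2 * \<eta> * (indicator {0..T} r * D r) + indicator {0..T} r * (2 * C * \<epsilon>) + C * eu r + C * ev r" for r
  have k0: "0 \<le> k r" for r
    using \<eta> D0 C \<epsilon> eu(1) ev(1) by (auto simp: k_def intro!: add_nonneg_nonneg)
  have iD: "integrable lebesgue (\<lambda>r. indicator {0..T} r * D r)" using lD by (simp add: loc_int_def)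
  have iC: "integrable lebesgue (\<lambda>r. indicator {0..T} r * (2 * C * \<epsilon>))" using loc_int_const[of "2 * C * \<epsilon>"] unfolding loc_int_def by blast
  have ik: "integrable lebesgue k"
    unfolding k_def by (intro Bochner_Integration.integrable_add integrable_mult_right iD iC eu ev)
  have "(\<integral>r. k r \<partial>lebesgue) = 2 * \<eta> * I + time_int (\<lambda>r. 2 * C * \<epsilon>) 0 T + C * (\<integral>r. eu r \<partial>lebesgue) + C * (\<integral>r. ev r \<partial>lebesgue)"
    unfolding k_def I_def time_int_def using iD iC eu ev
    by (simp add: Bochner_Integration.integral_add Bochner_Integration.integrable_add integrable_mult_right)
  also have "\<dots> \<le> 2 * \<eta> * I + T * (2 * C * \<epsilon>) + C * \<epsilon> + C * \<epsilon>"
    using mult_left_mono[OF eu(3) C(1)] mult_left_mono[OF ev(3) C(1)] T by (simp add: time_int_const)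
  also have "\<dots> = 2 * \<eta> * I + C * (\<epsilon> * (2 * T + 2))" by (simp add: algebra_simps)
  also have "\<dots> \<le> \<epsilon>0" using \<eta>(2) \<epsilon>(2) by linarith
  finally have kI: "(\<integral>r. k r \<partial>lebesgue) \<le> \<epsilon>0" .
  have N: "N \<in> null_sets lebesgue" using Nu(1) Nv(1) by (simp add: N_def null_sets.Un)
  have main: "\<bar>defect (t + h) - defect t\<bar> \<le> h * k t + h * k (t + h) + time_int k t (t + h)"
    if t: "0 < t" "0 < h" "h < min \<delta>u \<delta>v" "t + h < T" "t \<notin> N" "t + h \<notin> N" for t h
  proof -
    have VV: "u t \<in> V_space" "u (t + h) \<in> V_space" "v t \<in> V_space"
      using Nu(2) Nv(2) t by (auto simp: N_def)
    define c where "c = C * (eu (t + h) + ev t)"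
    have "\<bar>time_int (\<lambda>r. (V.K (u (t + h)) r + U.K (v t) r) - coupling r) t (t + h)\<bar> \<le> time_int (\<lambda>r. k r + c) t (t + h)"
    proof (rule time_int_abs_le)
      show "loc_int (\<lambda>r. V.K (u (t + h)) r + U.K (v t) r - coupling r)"
        by (intro loc_int_diff loc_int_add U.loc_int_K V.loc_int_K loc_int_coupling VV)
      show "loc_int (\<lambda>r. k r + c)" by (intro loc_int_add loc_int_const loc_int_integrable ik)
      show "AE r in lebesgue. 0 < r \<longrightarrow> t \<le> r \<longrightarrow> r \<le> t + h \<longrightarrow> \<bar>V.K (u (t + h)) r + U.K (v t) r - coupling r\<bar> \<le> k r + c"
        using AE_not_in[OF N]
      proof eventually_elim
        case (elim r)
        show ?case
        proof (intro impI)
          assume r: "0 < r" "t \<le> r" "r \<le> t + h"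
          have rV: "u r \<in> V_space" "v r \<in> V_space" using Nu(2) Nv(2) elim r by (auto simp: N_def)
          define z where "z x = u (t + h) x - u r x" for x
          define y where "y x = v t x - v r x" for x
          have zy: "z \<in> V_space" "y \<in> V_space" unfolding z_def y_def by (intro V_diff VV rV)+
          have eq: "V.K (u (t + h)) r + U.K (v t) r - coupling r = V.K z r + U.K y r"
            unfolding z_def y_def coupling_def
            using V.K_diff[OF VV(2) rV(1) rV(2)] U.K_diff[OF VV(3) rV(2) rV(1)] by simp
          have zh: "helical 1 z" unfolding z_def using t r by (intro helical_diff helical) auto
          have "L2_norm (\<lambda>x. u (t + h) x - u r x) \<le> L2_norm (u (t + h)) + L2_norm (u r)"
            using L2_norm_diff_triangle[OF V_L2[OF VV(2)] L2_const[of 0] V_L2[OF rV(1)]]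
              L2_norm_minus_commute[of "\<lambda>x. 0" "u r"] by simp
          then have zB: "L2_norm z \<le> 2 * L2_norm u0"
            using U.norm_le[of "t + h"] U.norm_le[of r] t r unfolding z_def by simp
          have dz: "(L2_norm (wgrad z))\<^sup>2 \<le> \<epsilon> + eu (t + h) + eu r"
          proof -
            have "(H1_norm z)\<^sup>2 \<le> \<epsilon> + eu (t + h) + eu r"
              unfolding z_def using mu t r elim by (auto simp: N_def)
            moreover have "(L2_norm (wgrad z))\<^sup>2 \<le> (H1_norm z)\<^sup>2" by (intro power_mono L2_norm_le_H1) simp
            ultimately show ?thesis by linarith
          qed
          have dy: "(L2_norm (wgrad y))\<^sup>2 \<le> \<epsilon> + ev t + ev r"
          proof -
            have "(H1_norm y)\<^sup>2 \<le> \<epsilon> + ev t + ev r"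
              unfolding y_def using mv t r elim by (auto simp: N_def)
            moreover have "(L2_norm (wgrad y))\<^sup>2 \<le> (H1_norm y)\<^sup>2" by (intro power_mono L2_norm_le_H1) simp
            ultimately show ?thesis by linarith
          qed
          have "\<bar>V.K z r\<bar> \<le> 2 * \<eta> * (L2_norm (wgrad (v r)))\<^sup>2 + C1 * (L2_norm (wgrad z))\<^sup>2"
            unfolding C1_def by (rule V_K_bound[OF zy(1) zh zB _ rV(2) \<eta>(1)]) (use r in simp)
          also have "\<dots> \<le> 2 * \<eta> * (H1_norm (v r))\<^sup>2 + C * (\<epsilon> + eu (t + h) + eu r)"
            using \<eta> C C12 dz by (intro add_mono mult_left_mono mult_mono power_mono L2_norm_le_H1) auto
          finally have a1: "\<bar>V.K z r\<bar> \<le> 2 * \<eta> * (H1_norm (v r))\<^sup>2 + C * (\<epsilon> + eu (t + h) + eu r)" .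
          have "\<bar>U.K y r\<bar> \<le> 2 * \<eta> * (L2_norm (wgrad (u r)))\<^sup>2 + C2 * (L2_norm (wgrad y))\<^sup>2"
            unfolding C2_def by (rule U_K_bound[OF zy(2) _ rV(1) \<eta>(1)]) (use r in simp)
          also have "\<dots> \<le> 2 * \<eta> * (H1_norm (u r))\<^sup>2 + C * (\<epsilon> + ev t + ev r)"
            using \<eta> C C12 dy by (intro add_mono mult_left_mono mult_mono power_mono L2_norm_le_H1) auto
          finally have a2: "\<bar>U.K y r\<bar> \<le> 2 * \<eta> * (H1_norm (u r))\<^sup>2 + C * (\<epsilon> + ev t + ev r)" .
          have "k r + c = (2 * \<eta> * (H1_norm (v r))\<^sup>2 + C * (\<epsilon> + eu (t + h) + eu r)) + (2 * \<eta> * (H1_norm (u r))\<^sup>2 + C * (\<epsilon> + ev t + ev r))"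
            using r t by (simp add: k_def c_def D_def algebra_simps)
          then show "\<bar>V.K (u (t + h)) r + U.K (v t) r - coupling r\<bar> \<le> k r + c"
            unfolding eq using a1 a2 abs_triangle_ineq[of "V.K z r" "U.K y r"] by linarith
        qed
      qed
    qed (use t in simp)
    also have "time_int (\<lambda>r. k r + c) t (t + h) = time_int k t (t + h) + h * c"
      using t by (simp add: time_int_add loc_int_const loc_int_integrable[OF ik] time_int_const)
    also have "c \<le> k t + k (t + h)"
    proof -
      have "C * eu (t + h) \<le> k (t + h)" "C * ev t \<le> k t"
        using \<eta> D0 C \<epsilon> eu(1) ev(1) by (auto simp: k_def intro!: add_nonneg_nonneg)
      then show ?thesis by (simp add: c_def distrib_left)
    qed
    finally show ?thesis
      unfolding defect_increment[OF t(1,2) VV(2,3)] using t by (simp add: mult_left_mono distrib_left)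
  qed
  show ?thesis
    using main by (intro exI[of _ "min \<delta>u \<delta>v"] conjI exI[of _ k] bexI[OF _ N] allI impI k0 ik kI) (use \<delta>u \<delta>v in auto)
qed

lemma defect_periodic:
  assumes "0 < \<tau>"
  shows "AE t in lebesgue. 0 < t \<longrightarrow> t < 1 \<longrightarrow> defect (t + \<tau>) = defect t"
  by (rule increments_vanish[OF assms defect_small_increments]) (use assms in auto)

text \<open>Weak convergence of both factors would not suffice. The energy bound
  \<open>L2_norm (v t) \<le> L2_norm v0\<close> upgrades that of \<open>v\<close> to strong
  convergence, and for \<open>u\<close> weak convergence is then enough.\<close>

lemma ip_tendsto_init:
  assumes t: "\<And>n. 0 < t n" "t \<longlonglongrightarrow> 0"
  shows "(\<lambda>n::nat. ip (u (t n)) (v (t n))) \<longlonglongrightarrow> ip u0 v0"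
proof -
  have L: "u0 \<in> L2" "v0 \<in> L2" using U.u0 V.u0 H_L2 by auto
  have Lt: "u (t n) \<in> L2" "v (t n) \<in> L2" for n using t(1)[of n] by (auto intro: U.u_L2 V.u_L2)
  have lu: "(\<lambda>n. ip (u (t n)) v0) \<longlonglongrightarrow> ip u0 v0"
    using continuous_on_tendsto_compose[OF U.continuous_ip[OF L(2)] t(2)] t(1) by (simp add: less_imp_le U.ip_init[OF L(2)])
  have lv: "(\<lambda>n. ip (v (t n)) v0) \<longlonglongrightarrow> ip v0 v0"
    using continuous_on_tendsto_compose[OF V.continuous_ip[OF L(2)] t(2)] t(1) by (simp add: less_imp_le V.ip_init[OF L(2)])
  have bnd: "\<bar>ip (u (t n)) (v (t n)) - ip (u (t n)) v0\<bar> \<le> L2_norm u0 * sqrt (2 * ip v0 v0 - 2 * ip (v (t n)) v0)" for n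
  proof -
    have "(L2_norm (\<lambda>x. v (t n) x - v0 x))\<^sup>2 = (L2_norm (v (t n)))\<^sup>2 - 2 * ip (v (t n)) v0 + (L2_norm v0)\<^sup>2"
      by (rule L2_norm_sq_diff[OF Lt(2) L(2)])
    also have "(L2_norm (v (t n)))\<^sup>2 \<le> (L2_norm v0)\<^sup>2" using V.norm_le[of "t n"] t(1)[of n] by (intro power_mono) auto
    finally have "(L2_norm (\<lambda>x. v (t n) x - v0 x))\<^sup>2 \<le> 2 * ip v0 v0 - 2 * ip (v (t n)) v0" by (simp add: L2_norm_sq_ip)
    then have d: "L2_norm (\<lambda>x. v (t n) x - v0 x) \<le> sqrt (2 * ip v0 v0 - 2 * ip (v (t n)) v0)" by (rule real_le_rsqrt)
    have "ip (u (t n)) (v (t n)) - ip (u (t n)) v0 = ip (u (t n)) (\<lambda>x. v (t n) x - v0 x)"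
      using Lt L by (simp add: ip_diff_right)
    then have "\<bar>ip (u (t n)) (v (t n)) - ip (u (t n)) v0\<bar> \<le> L2_norm (u (t n)) * L2_norm (\<lambda>x. v (t n) x - v0 x)"
      using ip_Cauchy_Schwarz[OF Lt(1) L2_diff[OF Lt(2) L(2)], of n n] by simp
    also have "\<dots> \<le> L2_norm u0 * sqrt (2 * ip v0 v0 - 2 * ip (v (t n)) v0)"
      using U.norm_le[of "t n"] t(1)[of n] d by (intro mult_mono) auto
    finally show ?thesis .
  qed
  have "(\<lambda>n. L2_norm u0 * sqrt (2 * ip v0 v0 - 2 * ip (v (t n)) v0)) \<longlonglongrightarrow> L2_norm u0 * sqrt (2 * ip v0 v0 - 2 * ip v0 v0)"
    by (intro tendsto_intros lv)
  then have "(\<lambda>n. L2_norm u0 * sqrt (2 * ip v0 v0 - 2 * ip (v (t n)) v0)) \<longlonglongrightarrow> 0" by simp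
  from tendsto_of_abs_diff_le[of "\<lambda>n. ip (u (t n)) (v (t n)) - ip (u (t n)) v0" 0, OF _ this] bnd
  have "(\<lambda>n. ip (u (t n)) (v (t n)) - ip (u (t n)) v0) \<longlonglongrightarrow> 0" by simp
  from tendsto_add[OF this lu] show ?thesis by simp
qed

section \<open>The Gronwall argument for the difference\<close>

definition dist_sq :: "real \<Rightarrow> real" where
  "dist_sq t = (L2_norm (\<lambda>x. v t x - u t x))\<^sup>2"

lemma dist_nonneg: "0 \<le> dist_sq t"
  by (simp add: dist_sq_def)

definition rate :: "real \<Rightarrow> real" where
  "rate t = 27 / (32 * \<nu> ^ 3) * (L2_norm u0)\<^sup>2 * (L2_norm (wgrad (u t)))\<^sup>2"

text \<open>For fields in \<open>V_space\<close> this is 2 \<nu> |grad w|^2 + 2 b(w, u, w) with w =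
  v - u, as computed in \<open>loss_lower_bound\<close>; the present form is the one in which it
  comes out of the two energy inequalities and the defect.\<close>

definition loss :: "real \<Rightarrow> real" where
  "loss r = 2 * \<nu> * ((L2_norm (wgrad (u r)))\<^sup>2 + (L2_norm (wgrad (v r)))\<^sup>2) + 2 * coupling r"

lemma loc_int_loss: "loc_int loss"
  unfolding loss_def by (intro loc_int_add loc_int_cmult U.loc_int_wgrad_sq V.loc_int_wgrad_sq loc_int_coupling)

lemma energy_difference:
  assumes T: "0 < T"
  shows "dist_sq T \<le> (L2_norm (\<lambda>x. v0 x - u0 x))\<^sup>2 - time_int loss 0 T"
proof -
  have L: "u0 \<in> L2" "v0 \<in> L2" using U.u0 V.u0 H_L2 by auto
  \<comment> \<open>For fixed \<open>T\<close> equality of the defects is known only for almost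
    every starting time, so admissible starting times are chosen that tend to zero; the energy
    inequalities are then used at \<open>t n + T\<close> instead of \<open>T\<close>.\<close>
  have "\<forall>n. \<exists>t. 0 < t \<and> t < inverse (real (Suc n)) \<and> defect (t + T) = defect t"
    by (intro allI AE_exists_small[OF defect_periodic[OF T]]) (auto simp: field_simps)
  then obtain t where t: "\<And>n. 0 < t n" "\<And>n. t n < inverse (real (Suc n))" "\<And>n. defect (t n + T) = defect (t n)"
    by metis
  have t0: "t \<longlonglongrightarrow> 0"
    by (rule tendsto_of_abs_diff_le[OF _ LIMSEQ_inverse_real_of_nat]) (use t(1,2) in \<open>auto simp: less_imp_le abs_of_pos\<close>)
  have tT: "(\<lambda>n. t n + T) \<longlonglongrightarrow> T" using tendsto_add[OF t0 tendsto_const[of T]] by simp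
  have pos: "0 < t n + T" for n using t(1)[of n] T by simp
  define w where "w x = v T x - u T x" for x
  have wL: "w \<in> L2" unfolding w_def using T by (intro L2_diff U.u_L2 V.u_L2) auto
  define R where "R n = (L2_norm u0)\<^sup>2 + (L2_norm v0)\<^sup>2 - 2 * defect (t n) - time_int loss 0 (t n + T)" for n
  have Lt: "u (t n + T) \<in> L2" "v (t n + T) \<in> L2" for n using pos[of n] by (auto intro: U.u_L2 V.u_L2)
  have distR: "(L2_norm (\<lambda>x. v (t n + T) x - u (t n + T) x))\<^sup>2 \<le> R n" for n
  proof -
    let ?s = "t n + T"
    have "(L2_norm (\<lambda>x. v ?s x - u ?s x))\<^sup>2 = (L2_norm (v ?s))\<^sup>2 - 2 * ip (u ?s) (v ?s) + (L2_norm (u ?s))\<^sup>2"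
      using L2_norm_sq_diff[OF Lt(2) Lt(1), of n n] by (simp add: ip_commute[of "v ?s"])
    moreover have "ip (u ?s) (v ?s) = defect (t n) + time_int coupling 0 ?s" using t(3)[of n] by (simp add: defect_def)
    moreover have "time_int loss 0 ?s = 2 * \<nu> * time_int (\<lambda>s. (L2_norm (wgrad (u s)))\<^sup>2) 0 ?s + 2 * \<nu> * time_int (\<lambda>s. (L2_norm (wgrad (v s)))\<^sup>2) 0 ?s + 2 * time_int coupling 0 ?s"
      unfolding loss_def distrib_left
      by (simp add: time_int_add time_int_cmult loc_int_add loc_int_cmult U.loc_int_wgrad_sq V.loc_int_wgrad_sq loc_int_coupling)
    ultimately show ?thesis
      using U.energy_II[OF pos[of n]] V.energy_II[OF pos[of n]] unfolding R_def by linarith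
  qed
  have dl: "(\<lambda>n. defect (t n)) \<longlonglongrightarrow> ip u0 v0 - time_int coupling 0 0"
    unfolding defect_def by (intro tendsto_diff ip_tendsto_init t(1) t0 time_int_tendsto loc_int_coupling less_imp_le)
  have Rl: "R \<longlonglongrightarrow> (L2_norm u0)\<^sup>2 + (L2_norm v0)\<^sup>2 - 2 * (ip u0 v0 - time_int coupling 0 0) - time_int loss 0 T"
    unfolding R_def by (intro tendsto_intros dl time_int_tendsto loc_int_loss tT less_imp_le pos)
  also have "(L2_norm u0)\<^sup>2 + (L2_norm v0)\<^sup>2 - 2 * (ip u0 v0 - time_int coupling 0 0) - time_int loss 0 T = (L2_norm (\<lambda>x. v0 x - u0 x))\<^sup>2 - time_int loss 0 T"
    using L2_norm_sq_diff[OF L(2,1)] by (simp add: time_int_refl[OF loc_int_coupling] ip_commute[of v0])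
  finally have Rlim: "R \<longlonglongrightarrow> (L2_norm (\<lambda>x. v0 x - u0 x))\<^sup>2 - time_int loss 0 T" (is "_ \<longlonglongrightarrow> ?R") .
  have R0: "0 \<le> R n" for n using distR[of n] zero_le_power2 order.trans by blast
  have RL0: "0 \<le> ?R" using LIMSEQ_le_const[OF Rlim] R0 by blast
  \<comment> \<open>Weak lower semicontinuity, by pairing with the limit \<open>w\<close> itself:
    the pairings converge to its squared norm, while each is at most
    \<open>sqrt (R n) * L2_norm w\<close>.\<close>
  have "(\<lambda>n. ip (v (t n + T)) w - ip (u (t n + T)) w) \<longlonglongrightarrow> ip (v T) w - ip (u T) w"
    by (intro tendsto_diff continuous_on_tendsto_compose[OF U.continuous_ip[OF wL] tT] continuous_on_tendsto_compose[OF V.continuous_ip[OF wL] tT])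
      (use T pos in \<open>auto simp: less_imp_le\<close>)
  moreover have "ip (v T) w - ip (u T) w = ip w w"
    using T unfolding w_def by (subst ip_diff_left) (auto intro!: U.u_L2 V.u_L2 L2_diff)
  moreover have "ip (v (t n + T)) w - ip (u (t n + T)) w = ip (\<lambda>x. v (t n + T) x - u (t n + T) x) w" for n
    using Lt wL by (simp add: ip_diff_left)
  ultimately have "(\<lambda>n. ip (\<lambda>x. v (t n + T) x - u (t n + T) x) w) \<longlonglongrightarrow> ip w w" by simp
  moreover have "(\<lambda>n. sqrt (R n) * L2_norm w) \<longlonglongrightarrow> sqrt ?R * L2_norm w" by (intro tendsto_intros Rlim)
  moreover have "ip (\<lambda>x. v (t n + T) x - u (t n + T) x) w \<le> sqrt (R n) * L2_norm w" for n
  proof -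
    have "ip (\<lambda>x. v (t n + T) x - u (t n + T) x) w \<le> L2_norm (\<lambda>x. v (t n + T) x - u (t n + T) x) * L2_norm w"
      using ip_Cauchy_Schwarz[OF L2_diff[OF Lt(2) Lt(1)] wL, of n n] by linarith
    also have "\<dots> \<le> sqrt (R n) * L2_norm w" by (intro mult_right_mono real_le_rsqrt distR) simp
    finally show ?thesis .
  qed
  ultimately have "ip w w \<le> sqrt ?R * L2_norm w" by (intro LIMSEQ_le) auto
  then have "L2_norm w * L2_norm w \<le> sqrt ?R * L2_norm w" by (simp add: L2_norm_sq_ip[symmetric] power2_eq_square)
  then have "L2_norm w \<le> sqrt ?R"
    using L2_norm_nonneg[of w] RL0 by (cases "L2_norm w = 0") (auto simp: mult_le_cancel_right)
  then have "(L2_norm w)\<^sup>2 \<le> (sqrt ?R)\<^sup>2" by (intro power_mono) auto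
  then show ?thesis using RL0 by (simp add: dist_sq_def w_def[abs_def])
qed

lemma loss_lower_bound:
  assumes r: "0 \<le> r" and uV: "u r \<in> V_space" and vV: "v r \<in> V_space"
  shows "- (rate r * dist_sq r) \<le> loss r"
proof -
  define w where "w x = v r x - u r x" for x
  have wV: "w \<in> V_space" unfolding w_def by (intro V_diff vV uV)
  note G = V_wgrad_L2[OF uV] V_wgrad_L2[OF vV]
  \<comment> \<open>Of the four terms of the expansion, the two with last argument
    \<open>u r\<close> vanish by antisymmetry, and the mixed one turns into
    \<open>tri (wgrad (v r)) (u r) (u r)\<close>. The result is the trilinear part of
    \<open>coupling\<close>.\<close>
  have "tri (wgrad (u r)) w w = tri (wgrad (u r)) (v r) w - tri (wgrad (u r)) (u r) w"
    using tri_diff(2)[OF G(1) G(1) vV uV wV wV] by (simp add: w_def[abs_def])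
  also have "\<dots> = tri (wgrad (u r)) (v r) (v r) - tri (wgrad (u r)) (v r) (u r) - (tri (wgrad (u r)) (u r) (v r) - tri (wgrad (u r)) (u r) (u r))"
    using tri_diff(3)[OF G(1) G(1) vV vV vV uV] tri_diff(3)[OF G(1) G(1) uV uV vV uV] by (simp add: w_def[abs_def])
  also have "\<dots> = tri (wgrad (u r)) (v r) (v r) + tri (wgrad (v r)) (u r) (u r)"
    using tri_antisym[OF uV uV vV] by (simp add: tri_self uV vV)
  finally have tw: "tri (wgrad (u r)) w w = tri (wgrad (u r)) (v r) (v r) + tri (wgrad (v r)) (u r) (u r)" .
  have "L2_norm (wgrad w) = L2_norm (\<lambda>x. wgrad (v r) x - wgrad (u r) x)"
    unfolding w_def by (intro L2_norm_wgrad_diff V_H1 uV vV)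
  then have gw: "(L2_norm (wgrad w))\<^sup>2 = (L2_norm (wgrad (v r)))\<^sup>2 - 2 * ip (wgrad (u r)) (wgrad (v r)) + (L2_norm (wgrad (u r)))\<^sup>2"
    using L2_norm_sq_diff[OF G(2,1)] by (simp add: ip_commute[of "wgrad (v r)"])
  have loss: "loss r = 2 * \<nu> * (L2_norm (wgrad w))\<^sup>2 + 2 * tri (wgrad (u r)) w w"
    unfolding loss_def coupling_def V.K_def U.K_def tw gw ip_commute[of "wgrad (v r)" "wgrad (u r)"]
    by (simp add: algebra_simps)
  \<comment> \<open>The choice \<open>d = \<nu>\<close> spends the whole dissipation of
    \<open>w\<close> on the gradient term.\<close>
  have "\<bar>tri (wgrad (u r)) w w\<bar> \<le> \<nu> * (L2_norm (wgrad w))\<^sup>2 + 27 / (64 * \<nu> ^ 3) * (L2_norm (u r))\<^sup>2 * (L2_norm (wgrad (u r)))\<^sup>2 * (L2_norm w)\<^sup>2"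
    by (rule helical_trilinear[OF uV helical[OF r] wV U.nu])
  also have "27 / (64 * \<nu> ^ 3) * (L2_norm (u r))\<^sup>2 * (L2_norm (wgrad (u r)))\<^sup>2 * (L2_norm w)\<^sup>2 \<le>
      27 / (64 * \<nu> ^ 3) * (L2_norm u0)\<^sup>2 * (L2_norm (wgrad (u r)))\<^sup>2 * (L2_norm w)\<^sup>2"
    using U.nu U.norm_le[OF r] by (intro mult_right_mono mult_left_mono power_mono) auto
  finally have "\<bar>tri (wgrad (u r)) w w\<bar> \<le> \<nu> * (L2_norm (wgrad w))\<^sup>2 + rate r * dist_sq r / 2"
    by (simp add: rate_def dist_sq_def w_def[abs_def])
  then show ?thesis unfolding loss by (simp add: abs_le_iff)
qed

lemma loc_int_rate: "loc_int rate"
  unfolding rate_def by (intro loc_int_cmult U.loc_int_wgrad_sq)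

lemma rate_nonneg: "0 \<le> rate t"
  using U.nu by (simp add: rate_def)

lemma loc_int_rate_dist: "loc_int (\<lambda>r. rate r * dist_sq r)"
proof (rule loc_int_bound)
  have "(\<lambda>t. (\<lambda>f g. 27 / (32 * \<nu> ^ 3) * (L2_norm u0)\<^sup>2 * (L2_norm (wgrad f))\<^sup>2 * (L2_norm (\<lambda>x. g x - f x))\<^sup>2) (u t) (v t))
    \<in> borel_measurable (lebesgue_on {0<..})"
  proof (rule strongly_measurable_comp[OF U.strong V.strong])
    fix f g :: "nat \<Rightarrow> real^3 \<Rightarrow> real^3" and f' g'
    assume f: "\<And>n. f n \<in> V_space" "f' \<in> V_space" "(\<lambda>n. H1_norm (\<lambda>x. f n x - f' x)) \<longlonglongrightarrow> 0"
      and g: "\<And>n. g n \<in> V_space" "g' \<in> V_space" "(\<lambda>n. H1_norm (\<lambda>x. g n x - g' x)) \<longlonglongrightarrow> 0"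
    have "(\<lambda>n. L2_norm (\<lambda>x. g n x - f n x)) \<longlonglongrightarrow> L2_norm (\<lambda>x. g' x - f' x)"
    proof (rule tendsto_of_abs_diff_le)
      show "(\<lambda>n. H1_norm (\<lambda>x. g n x - g' x) + H1_norm (\<lambda>x. f n x - f' x)) \<longlonglongrightarrow> 0"
        using tendsto_add[OF g(3) f(3)] by simp
      fix n
      note L = V_L2[OF g(1)[of n]] V_L2[OF g(2)] V_L2[OF f(1)[of n]] V_L2[OF f(2)]
      show "\<bar>L2_norm (\<lambda>x. g n x - f n x) - L2_norm (\<lambda>x. g' x - f' x)\<bar> \<le> H1_norm (\<lambda>x. g n x - g' x) + H1_norm (\<lambda>x. f n x - f' x)"
        using L2_norm_diff_triangle[OF L(1,2,3)] L2_norm_diff_triangle[OF L(2,4,3)] L2_norm_diff_triangle[OF L(2,1,4)] L2_norm_diff_triangle[OF L(1,3,4)]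
          L2_norm_minus_commute[of "g n" g'] L2_norm_minus_commute[of "f n" f'] L2_norm_le_H1(1)[of "\<lambda>x. g n x - g' x"] L2_norm_le_H1(1)[of "\<lambda>x. f n x - f' x"]
        by linarith
    qed
    then show "(\<lambda>n. 27 / (32 * \<nu> ^ 3) * (L2_norm u0)\<^sup>2 * (L2_norm (wgrad (f n)))\<^sup>2 * (L2_norm (\<lambda>x. g n x - f n x))\<^sup>2) \<longlonglongrightarrow>
        27 / (32 * \<nu> ^ 3) * (L2_norm u0)\<^sup>2 * (L2_norm (wgrad f'))\<^sup>2 * (L2_norm (\<lambda>x. g' x - f' x))\<^sup>2"
      by (intro tendsto_mult tendsto_power tendsto_const H1_norm_tendsto(5) V_H1 f)
  qed
  then show "(\<lambda>r. rate r * dist_sq r) \<in> borel_measurable (lebesgue_on {0<..})" by (simp add: rate_def dist_sq_def)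
  show "loc_int (\<lambda>r. (L2_norm v0 + L2_norm u0)\<^sup>2 * rate r)" by (intro loc_int_cmult loc_int_rate)
  show "AE r in lebesgue. 0 < r \<longrightarrow> \<bar>rate r * dist_sq r\<bar> \<le> (L2_norm v0 + L2_norm u0)\<^sup>2 * rate r"
  proof (intro AE_I2 impI)
    fix r :: real assume r: "0 < r"
    then have L: "u r \<in> L2" "v r \<in> L2" by (auto intro: U.u_L2 V.u_L2)
    have "L2_norm (\<lambda>x. v r x - u r x) \<le> L2_norm (v r) + L2_norm (u r)"
      using L2_norm_diff_triangle[OF L(2) L2_const[of 0] L(1)] L2_norm_minus_commute[of "\<lambda>x. 0" "u r"] by simp
    also have "\<dots> \<le> L2_norm v0 + L2_norm u0" using U.norm_le[of r] V.norm_le[of r] r by simp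
    finally have "dist_sq r \<le> (L2_norm v0 + L2_norm u0)\<^sup>2" unfolding dist_sq_def by (intro power_mono) auto
    then show "\<bar>rate r * dist_sq r\<bar> \<le> (L2_norm v0 + L2_norm u0)\<^sup>2 * rate r"
      using mult_left_mono[OF _ rate_nonneg, of "dist_sq r" "(L2_norm v0 + L2_norm u0)\<^sup>2" r] rate_nonneg[of r]
      by (simp add: abs_mult mult.commute dist_nonneg)
  qed
qed

lemma integral_inequality:
  assumes T: "0 \<le> T"
  shows "dist_sq T \<le> (L2_norm (\<lambda>x. v0 x - u0 x))\<^sup>2 + time_int (\<lambda>r. rate r * dist_sq r) 0 T"
proof (cases "T = 0")
  case True
  have L: "u0 \<in> L2" "v0 \<in> L2" "u 0 \<in> L2" "v 0 \<in> L2" using U.u0 V.u0 H_L2 U.u_L2 V.u_L2 by auto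
  \<comment> \<open>The energy comparison covers positive times only; at time zero the fields agree
    with the data up to norm zero.\<close>
  have "L2_norm (\<lambda>x. v 0 x - u 0 x) \<le> L2_norm (\<lambda>x. v 0 x - v0 x) + (L2_norm (\<lambda>x. v0 x - u0 x) + L2_norm (\<lambda>x. u0 x - u 0 x))"
    using L2_norm_diff_triangle[OF L(4,2,3)] L2_norm_diff_triangle[OF L(2,1,3)] by linarith
  then have "L2_norm (\<lambda>x. v 0 x - u 0 x) \<le> L2_norm (\<lambda>x. v0 x - u0 x)"
    using U.init V.init L2_norm_minus_commute[of u0 "u 0"] by simp
  then show ?thesis unfolding True time_int_refl[OF loc_int_rate_dist] by (simp add: dist_sq_def power_mono)
next
  case False
  have "time_int (\<lambda>r. (-1) * (rate r * dist_sq r)) 0 T \<le> time_int loss 0 T"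
    by (rule time_int_mono_AE[OF loc_int_cmult[OF loc_int_rate_dist] loc_int_loss order_refl])
      (use AE_both in \<open>auto elim!: eventually_mono intro!: loss_lower_bound\<close>)
  then show ?thesis using energy_difference[of T] T False by (simp only: time_int_cmult) linarith
qed

lemma stability:
  assumes t: "0 \<le> t"
  shows "(L2_norm (\<lambda>x. v t x - u t x))\<^sup>2 \<le> (L2_norm (\<lambda>x. v0 x - u0 x))\<^sup>2 * exp (27 / (64 * \<nu> ^ 4) * (L2_norm u0) ^ 4)"
proof -
  have "dist_sq t \<le> (L2_norm (\<lambda>x. v0 x - u0 x))\<^sup>2 * exp (time_int rate 0 t)"
    by (rule Gronwall_integral[OF loc_int_rate rate_nonneg loc_int_rate_dist _ integral_inequality t]) (auto simp: dist_sq_def)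
  also have "\<dots> \<le> (L2_norm (\<lambda>x. v0 x - u0 x))\<^sup>2 * exp (27 / (64 * \<nu> ^ 4) * (L2_norm u0) ^ 4)"
  proof (intro mult_left_mono, simp only: exp_le_cancel_iff)
    show "time_int rate 0 t \<le> 27 / (64 * \<nu> ^ 4) * (L2_norm u0) ^ 4"
    proof (cases "t = 0")
      case True
      then show ?thesis by (simp add: time_int_refl[OF loc_int_rate])
    next
      case False
      define J where "J = time_int (\<lambda>s. (L2_norm (wgrad (u s)))\<^sup>2) 0 t"
      have "(L2_norm (u t))\<^sup>2 + 2 * \<nu> * J \<le> (L2_norm u0)\<^sup>2"
        using U.energy_II[of t] t False by (simp add: J_def)
      then have "2 * \<nu> * J \<le> (L2_norm u0)\<^sup>2" using zero_le_power2[of "L2_norm (u t)"] by linarith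
      then have J: "J \<le> (L2_norm u0)\<^sup>2 / (2 * \<nu>)" using U.nu by (simp add: field_simps)
      \<comment> \<open>The dissipation budget of \<open>u\<close> supplies the factor
        \<open>1 / (2 * \<nu>)\<close>, which turns 27/32 with the third power of \<nu> into 27/64
        with the fourth.\<close>
      have "time_int rate 0 t = 27 / (32 * \<nu> ^ 3) * (L2_norm u0)\<^sup>2 * J" unfolding rate_def J_def by (rule time_int_cmult)
      also have "\<dots> \<le> 27 / (32 * \<nu> ^ 3) * (L2_norm u0)\<^sup>2 * ((L2_norm u0)\<^sup>2 / (2 * \<nu>))"
        using J U.nu by (intro mult_left_mono) auto
      also have "\<dots> = 27 / (64 * \<nu> ^ 4) * (L2_norm u0) ^ 4"
        by (simp add: power4_eq_xxxx power3_eq_cube power2_eq_square)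
      finally show ?thesis .
    qed
  qed simp
  finally show ?thesis by (simp add: dist_sq_def)
qed

end

theorem theorem3p2:
  fixes \<nu> :: real
    and u\<^sub>0 v\<^sub>0 :: "real^3 \<Rightarrow> real^3"
    and u v :: "real \<Rightarrow> real^3 \<Rightarrow> real^3"
  assumes "\<nu> > 0"
    and "u\<^sub>0 \<in> H_space" and "helical 1 u\<^sub>0"
    and "helical_weak_solution \<nu> 1 u\<^sub>0 u"
    and "v\<^sub>0 \<in> H_space"
    and "leray_hopf \<nu> v\<^sub>0 v" and "v \<in> L2_V {0<..}"
  shows "\<forall>t\<ge>0. (L2_norm (\<lambda>x. v t x - u t x))\<^sup>2
           \<le> (L2_norm (\<lambda>x. v\<^sub>0 x - u\<^sub>0 x))\<^sup>2 * exp (27 / (64 * \<nu> ^ 4) * (L2_norm u\<^sub>0) ^ 4)"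
proof -
  interpret flow_pair \<nu> u\<^sub>0 u v\<^sub>0 v
    by unfold_locales (use assms in \<open>auto simp: helical_weak_solution_def leray_hopf_def\<close>)
  show ?thesis using stability by blast
qed

end
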